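(* Assume that $(B,L_B)$ is a $C^*$-algebraic compact quantum metric space with $L_B$ lower semi-continuous on its domain $V_B$, and that $\{\beta_t\}_{t \in T}$ is a family of $*$-automorphisms of $B$ parametrized by a compact Hausdorff space $T$. Suppose moreover that the map $t \mapsto \beta_t(b)$ is continuous (in the $C^*$-norm) for all $b \in B$ and that the $*$-automorphisms $\beta_t \colon B \to B$ satisfy $\beta_t(V_B) = V_B$ and are Lip-isometric in the sense that $L_B(\beta_t(b)) = L_B(b)$ for all $b \in V_B$ and all $t \in T$. Then for any choice of order preserving norm $|||\cdot|||$ on $C_c(\mathbb{Z})$, the semi-norm $L_t \colon C_c(\mathbb{Z},V_B)\to[0,\infty)$ given by \[ L_t(x) := \max\Big\{ \Big\| \sum_n n\,x(n)U^n\Big\|_{C_r^*(\mathbb{Z},B,\beta_t)},\ |||L_B\circ x|||,\ |||L_B\circ x^*||| \Big\} \] turns $C_r^*(\mathbb{Z},B,\beta_t)$ into a compact quantum metric space for every $t\in T$, and the family $\{(C_r^*(\mathbb{Z},B,\beta_t),L_t)\}_{t \in T}$ varies continuously in the quantum Gromov-Hausdorff distance, i.e. for every $t_0 \in T$, \[ \lim_{t\to t_0} \mathrm{dist}_q\big( (C_r^*(\mathbb{Z},B,\beta_t),L_t), (C_r^*(\mathbb{Z},B,\beta_{t_0}),L_{t_0})\big) = 0 . \]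
   Context: **Compact quantum metric spaces.** Let $A$ be a unital $C^*$-algebra and $V\subseteq A$ a (not necessarily dense) complex subspace with $1\in V$, $V^*=V$. $V^{\mathrm{sa}}=\{\xi\in V\mid \xi=\xi^*\}$ is an order unit space with the order and unit of $A$; its state space $S(V^{\mathrm{sa}})$ is the set of positive $\mathbb{R}$-linear $\mu\colon V^{\mathrm{sa}}\to\mathbb{R}$ with $\mu(1)=1$, with the weak $*$-topology. For a semi-norm $L^{\mathrm{sa}}$ on $V^{\mathrm{sa}}$ with $L^{\mathrm{sa}}(1)=0$ put $\rho_{L^{\mathrm{sa}}}(\mu,\nu)=\sup\{|\mu(\xi)-\nu(\xi)| \mid \xi\in V^{\mathrm{sa}}, L^{\mathrm{sa}}(\xi)\le 1\}$. $(V^{\mathrm{sa}},L^{\mathrm{sa}})$ is an order unit compact quantum metric space if $\rho_{L^{\mathrm{sa}}}$ metrizes the weak $*$-topology on $S(V^{\mathrm{sa}})$. If $V$ is norm-dense and $L\colon V\to[0,\infty)$ is a semi-norm with $L(1)=0$, $L(\xi^* )=L(\xi)$, then $(A,L)$ is a ($C^*$-algebraic) compact quantum metric space if $\rho_L(\mu,\nu)=\sup\{|\mu(\xi)-\nu(\xi)|\mid \xi\in V, L(\xi)\le1\}$ metrizes the weak $*$-topology on the state space $S(A)$. Lower semi-continuity is with respect to the $C^*$-norm topology on $V$. **Quantum Gromov-Hausdorff distance.** For order unit compact quantum metric spaces $(V_j^{\mathrm{sa}},L_j^{\mathrm{sa}})$, $j=1,2$, a semi-norm $L^{\mathrm{sa}}$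 on $V_1^{\mathrm{sa}}\oplus V_2^{\mathrm{sa}}$ vanishing on the unit is admissible if $(V_1^{\mathrm{sa}}\oplus V_2^{\mathrm{sa}},L^{\mathrm{sa}})$ is an order unit compact quantum metric space and $L_j^{\mathrm{sa}}$ is the quotient semi-norm of $L^{\mathrm{sa}}$ under the projection onto $V_j^{\mathrm{sa}}$, $j=1,2$. Then $\mathrm{dist}_q(V_1^{\mathrm{sa}},V_2^{\mathrm{sa}})$ is the infimum over admissible $L^{\mathrm{sa}}$ of the Hausdorff distance, with respect to $\rho_{L^{\mathrm{sa}}}$, between $S(V_1^{\mathrm{sa}})$ and $S(V_2^{\mathrm{sa}})$ viewed (via the projections) as subsets of $S(V_1^{\mathrm{sa}}\oplus V_2^{\mathrm{sa}})$. For $C^*$-algebraic compact quantum metric spaces, $\mathrm{dist}_q((A_1,L_1),(A_2,L_2)):=\mathrm{dist}_q(V_1^{\mathrm{sa}},V_2^{\mathrm{sa}})$, where $V_j$ is the domain of $L_j$. **Crossed products.** $C_r^*(\mathbb{Z},B,\beta)$ is the reduced crossed product of $B$ by the $\mathbb{Z}$-action generated by $\beta$, generated by $B$ and a unitary $U$ with $UbU^*=\beta(b)$. $C_c(\mathbb{Z})$ is the space of finitely supported complex functions on $\mathbb{Z}$; a finitely supported $x\colon\mathbb{Z}\to V_B$ is identified with $\sum_n x(n)U^n$, and these form the dense subspace $C_c(\mathbb{Z},V_B)$. $x^*$ is the adjoint in the crossed product, $x^*(n)=\beta^n(x(-n)^* )$ (with $\beta=\beta_t$ in $C_r^*(\mathbb{Z},B,\beta_t)$),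 and $L_B\circ x\in C_c(\mathbb{Z})$ is $n\mapsto L_B(x(n))$. A norm $|||\cdot|||$ on $C_c(\mathbb{Z})$ is order preserving if $|||h|||\le|||k|||$ whenever $0\le h(n)\le k(n)$ for all $n\in\mathbb{Z}$. *)

theory Defs
  imports "HOL-Analysis.Analysis" "HOL-Algebra.Ring"
begin

section \<open>Unital \<open>C\<^sup>*\<close>-algebras\<close>

text \<open>
  The coefficient algebra is a type of class \<open>cstar_algebra\<close>.  The crossed products depend on a
  parameter \<open>t\<close>, so they cannot be types; they are records satisfying the locale
  \<open>unital_cstar\<close>, and \<open>cstar_of_type\<close> turns the type into such a record.
  The class excludes the zero algebra.
\<close>

class cstar_algebra = banach + real_normed_algebra_1 +
  fixes scaleC :: "complex \<Rightarrow> 'a \<Rightarrow> 'a"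
    and adj :: "'a \<Rightarrow> 'a"
  assumes scaleC_of_real: "scaleC (complex_of_real r) x = r *\<^sub>R x"
    and scaleC_add_right: "scaleC c (x + y) = scaleC c x + scaleC c y"
    and scaleC_add_left: "scaleC (c + d) x = scaleC c x + scaleC d x"
    and scaleC_scaleC: "scaleC c (scaleC d x) = scaleC (c * d) x"
    and mult_scaleC_left: "scaleC c x * y = scaleC c (x * y)"
    and mult_scaleC_right: "x * scaleC c y = scaleC c (x * y)"
    and norm_scaleC: "norm (scaleC c x) = cmod c * norm x"
    and adj_adj: "adj (adj x) = x"
    and adj_add: "adj (x + y) = adj x + adj y"
    and adj_scaleC: "adj (scaleC c x) = scaleC (cnj c) (adj x)"
    and adj_mult: "adj (x * y) = adj y * adj x"
    and cstar_identity: "norm (adj x * x) = (norm x)\<^sup>2"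

record 'a cstar = "'a ring" +
  cscale :: "complex \<Rightarrow> 'a \<Rightarrow> 'a"
  star :: "'a \<Rightarrow> 'a"
  nrm :: "'a \<Rightarrow> real"

locale unital_cstar = ring A for A (structure) +
  assumes cscale_closed: "x \<in> carrier A \<Longrightarrow> cscale A c x \<in> carrier A"
    and cscale_one: "x \<in> carrier A \<Longrightarrow> cscale A 1 x = x"
    and cscale_cscale: "x \<in> carrier A \<Longrightarrow> cscale A c (cscale A d x) = cscale A (c * d) x"
    and cscale_add_right: "\<lbrakk>x \<in> carrier A; y \<in> carrier A\<rbrakk>
          \<Longrightarrow> cscale A c (x \<oplus> y) = cscale A c x \<oplus> cscale A c y"
    and cscale_add_left: "x \<in> carrier A \<Longrightarrow> cscale A (c + d) x = cscale A c x \<oplus> cscale A d x"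
    and mult_cscale_left: "\<lbrakk>x \<in> carrier A; y \<in> carrier A\<rbrakk>
          \<Longrightarrow> cscale A c x \<otimes> y = cscale A c (x \<otimes> y)"
    and mult_cscale_right: "\<lbrakk>x \<in> carrier A; y \<in> carrier A\<rbrakk>
          \<Longrightarrow> x \<otimes> cscale A c y = cscale A c (x \<otimes> y)"
    and star_closed: "x \<in> carrier A \<Longrightarrow> star A x \<in> carrier A"
    and star_star: "x \<in> carrier A \<Longrightarrow> star A (star A x) = x"
    and star_add: "\<lbrakk>x \<in> carrier A; y \<in> carrier A\<rbrakk> \<Longrightarrow> star A (x \<oplus> y) = star A x \<oplus> star A y"
    and star_cscale: "x \<in> carrier A \<Longrightarrow> star A (cscale A c x) = cscale A (cnj c) (star A x)"
    and star_mult: "\<lbrakk>x \<in> carrier A; y \<in> carrier A\<rbrakk> \<Longrightarrow> star A (x \<otimes> y) = star A y \<otimes> star A x"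
    and nrm_nonneg: "x \<in> carrier A \<Longrightarrow> 0 \<le> nrm A x"
    and nrm_eq_zero: "x \<in> carrier A \<Longrightarrow> nrm A x = 0 \<longleftrightarrow> x = \<zero>"
    and nrm_triangle: "\<lbrakk>x \<in> carrier A; y \<in> carrier A\<rbrakk> \<Longrightarrow> nrm A (x \<oplus> y) \<le> nrm A x + nrm A y"
    and nrm_cscale: "x \<in> carrier A \<Longrightarrow> nrm A (cscale A c x) = cmod c * nrm A x"
    and nrm_mult: "\<lbrakk>x \<in> carrier A; y \<in> carrier A\<rbrakk> \<Longrightarrow> nrm A (x \<otimes> y) \<le> nrm A x * nrm A y"
    and nrm_star_mult: "x \<in> carrier A \<Longrightarrow> nrm A (star A x \<otimes> x) = (nrm A x)\<^sup>2"
    and nrm_complete: "\<lbrakk>\<And>n::nat. s n \<in> carrier A;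
            \<And>e. 0 < e \<Longrightarrow> \<exists>N. \<forall>m\<ge>N. \<forall>n\<ge>N. nrm A (s m \<ominus> s n) < e\<rbrakk>
          \<Longrightarrow> \<exists>a\<in>carrier A. (\<lambda>n. nrm A (s n \<ominus> a)) \<longlonglongrightarrow> 0"

definition cstar_of_type :: "'b::cstar_algebra cstar" where
  "cstar_of_type = \<lparr>carrier = UNIV, mult = (*), one = 1, zero = 0, add = (+),
     cscale = scaleC, star = adj, nrm = norm\<rparr>"

lemma ring_cstar_of_type: "Ring.ring (cstar_of_type :: 'b::cstar_algebra cstar)"
  by unfold_locales
    (auto simp: cstar_of_type_def algebra_simps Units_def intro!: exI[of _ "- _"])

lemma a_minus_cstar_of_type: "x \<ominus>\<^bsub>cstar_of_type\<^esub> y = x - (y :: 'b::cstar_algebra)"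
proof -
  interpret Ring.ring "cstar_of_type :: 'b cstar"
    by (rule ring_cstar_of_type)
  have "\<ominus>\<^bsub>cstar_of_type\<^esub> y = - y"
    by (rule minus_equality) (simp_all add: cstar_of_type_def)
  then show ?thesis
    by (simp add: a_minus_def) (simp add: cstar_of_type_def)
qed

lemma unital_cstar_of_type: "unital_cstar (cstar_of_type :: 'b::cstar_algebra cstar)"
proof -
  interpret Ring.ring "cstar_of_type :: 'b cstar"
    by (rule ring_cstar_of_type)
  show ?thesis
  proof
    fix x :: 'b
    show "cscale cstar_of_type 1 x = x"
      using scaleC_of_real[of 1 x] by (simp add: cstar_of_type_def)
  next
    fix s :: "nat \<Rightarrow> 'b"
    assume "\<And>e. 0 < e \<Longrightarrow>
      \<exists>N. \<forall>m\<ge>N. \<forall>n\<ge>N. nrm cstar_of_type (s m \<ominus>\<^bsub>cstar_of_type\<^esub> s n) < e"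
    then have "Cauchy s"
      unfolding Cauchy_def a_minus_cstar_of_type by (simp add: cstar_of_type_def dist_norm)
    then obtain a where "s \<longlonglongrightarrow> a"
      using Cauchy_convergent convergent_def by blast
    then have "(\<lambda>n. norm (s n - a)) \<longlonglongrightarrow> 0"
      using LIM_zero tendsto_norm_zero by blast
    then show "\<exists>a\<in>carrier cstar_of_type.
        (\<lambda>n. nrm cstar_of_type (s n \<ominus>\<^bsub>cstar_of_type\<^esub> a)) \<longlonglongrightarrow> 0"
      unfolding a_minus_cstar_of_type by (auto simp: cstar_of_type_def)
  qed (auto simp: cstar_of_type_def scaleC_add_right scaleC_add_left scaleC_scaleC
      mult_scaleC_left mult_scaleC_right norm_scaleC adj_adj adj_add adj_scaleC adj_mult
      cstar_identity norm_triangle_ineq norm_mult_ineq)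
qed

definition dsum :: "'a cstar \<Rightarrow> 'b cstar \<Rightarrow> ('a \<times> 'b) cstar" where
  "dsum A B = \<lparr>carrier = carrier A \<times> carrier B,
     mult = (\<lambda>x y. (fst x \<otimes>\<^bsub>A\<^esub> fst y, snd x \<otimes>\<^bsub>B\<^esub> snd y)),
     one = (\<one>\<^bsub>A\<^esub>, \<one>\<^bsub>B\<^esub>), zero = (\<zero>\<^bsub>A\<^esub>, \<zero>\<^bsub>B\<^esub>),
     add = (\<lambda>x y. (fst x \<oplus>\<^bsub>A\<^esub> fst y, snd x \<oplus>\<^bsub>B\<^esub> snd y)),
     cscale = (\<lambda>c x. (cscale A c (fst x), cscale B c (snd x))),
     star = (\<lambda>x. (star A (fst x), star B (snd x))),
     nrm = (\<lambda>x. max (nrm A (fst x)) (nrm B (snd x)))\<rparr>"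

definition positive :: "'a cstar \<Rightarrow> 'a \<Rightarrow> bool" where
  "positive A x \<longleftrightarrow> (\<exists>y\<in>carrier A. x = star A y \<otimes>\<^bsub>A\<^esub> y)"

definition norm_closure :: "'a cstar \<Rightarrow> 'a set \<Rightarrow> 'a set" where
  "norm_closure A W = {a \<in> carrier A. \<forall>e>0. \<exists>w\<in>W. nrm A (a \<ominus>\<^bsub>A\<^esub> w) < e}"


section \<open>Compact quantum metric spaces\<close>

definition unital_star_subspace :: "'a cstar \<Rightarrow> 'a set \<Rightarrow> bool" where
  "unital_star_subspace A V \<longleftrightarrow> V \<subseteq> carrier A \<and> \<one>\<^bsub>A\<^esub> \<in> V \<and>
     (\<forall>x\<in>V. \<forall>y\<in>V. x \<oplus>\<^bsub>A\<^esub> y \<in> V) \<and> (\<forall>c. \<forall>x\<in>V. cscale A c x \<in> V) \<and> (\<forall>x\<in>V. star A x \<in> V)"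

definition sa_part :: "'a cstar \<Rightarrow> 'a set \<Rightarrow> 'a set" where
  "sa_part A V = {x \<in> V. star A x = x}"

text \<open>
  \<open>F\<close> is the set of scalars: \<open>UNIV\<close> for a complex, \<open>\<real>\<close> for a real semi-norm.
\<close>

definition seminorm_over :: "complex set \<Rightarrow> 'a cstar \<Rightarrow> 'a set \<Rightarrow> ('a \<Rightarrow> real) \<Rightarrow> bool" where
  "seminorm_over F A W L \<longleftrightarrow> (\<forall>x\<in>W. 0 \<le> L x) \<and>
     (\<forall>x\<in>W. \<forall>y\<in>W. L (x \<oplus>\<^bsub>A\<^esub> y) \<le> L x + L y) \<and>
     (\<forall>c\<in>F. \<forall>x\<in>W. L (cscale A c x) = cmod c * L x)"

text \<open>
  Functionals on a set are extensional functions, as required by \<^const>\<open>product_topology\<close>.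
\<close>

definition ou_states :: "'a cstar \<Rightarrow> 'a set \<Rightarrow> ('a \<Rightarrow> real) set" where
  "ou_states A V = {\<mu> \<in> extensional (sa_part A V).
     (\<forall>x\<in>sa_part A V. \<forall>y\<in>sa_part A V. \<mu> (x \<oplus>\<^bsub>A\<^esub> y) = \<mu> x + \<mu> y) \<and>
     (\<forall>r. \<forall>x\<in>sa_part A V. \<mu> (cscale A (complex_of_real r) x) = r * \<mu> x) \<and>
     (\<forall>x\<in>sa_part A V. positive A x \<longrightarrow> 0 \<le> \<mu> x) \<and> \<mu> \<one>\<^bsub>A\<^esub> = 1}"

definition states :: "'a cstar \<Rightarrow> ('a \<Rightarrow> complex) set" where
  "states A = {\<mu> \<in> extensional (carrier A).
     (\<forall>x\<in>carrier A. \<forall>y\<in>carrier A. \<mu> (x \<oplus>\<^bsub>A\<^esub> y) = \<mu> x + \<mu> y) \<and>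
     (\<forall>c. \<forall>x\<in>carrier A. \<mu> (cscale A c x) = c * \<mu> x) \<and>
     (\<forall>x\<in>carrier A. positive A x \<longrightarrow> \<mu> x \<in> \<real>\<^sub>\<ge>\<^sub>0) \<and> \<mu> \<one>\<^bsub>A\<^esub> = 1}"

definition weak_star :: "'a set \<Rightarrow> ('a \<Rightarrow> 'f::topological_space) set \<Rightarrow> ('a \<Rightarrow> 'f) topology" where
  "weak_star W S = subtopology (product_topology (\<lambda>_. euclidean) W) S"

text \<open>
  The supremum may be infinite, so it is taken in \<^typ>\<open>ennreal\<close>; that it is finite is
  part of \<open>metrizes\<close>.
\<close>

definition state_dist ::
  "'a set \<Rightarrow> ('a \<Rightarrow> real) \<Rightarrow> ('a \<Rightarrow> 'f::real_normed_vector) \<Rightarrow> ('a \<Rightarrow> 'f) \<Rightarrow> ennreal" where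
  "state_dist W L \<mu> \<nu> = (SUP x\<in>{x\<in>W. L x \<le> 1}. ennreal (norm (\<mu> x - \<nu> x)))"

definition metrizes :: "('s \<Rightarrow> 's \<Rightarrow> ennreal) \<Rightarrow> 's topology \<Rightarrow> bool" where
  "metrizes \<rho> X \<longleftrightarrow> (\<forall>x\<in>topspace X. \<forall>y\<in>topspace X. \<rho> x y < \<infinity>) \<and>
     Metric_space (topspace X) (\<lambda>x y. enn2real (\<rho> x y)) \<and>
     Metric_space.mtopology (topspace X) (\<lambda>x y. enn2real (\<rho> x y)) = X"

definition ou_cqms :: "'a cstar \<Rightarrow> 'a set \<Rightarrow> ('a \<Rightarrow> real) \<Rightarrow> bool" where
  "ou_cqms A V L \<longleftrightarrow> unital_cstar A \<and> unital_star_subspace A V \<and>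
     seminorm_over \<real> A (sa_part A V) L \<and> L \<one>\<^bsub>A\<^esub> = 0 \<and>
     metrizes (state_dist (sa_part A V) L) (weak_star (sa_part A V) (ou_states A V))"

definition cqms :: "'a cstar \<Rightarrow> 'a set \<Rightarrow> ('a \<Rightarrow> real) \<Rightarrow> bool" where
  "cqms A V L \<longleftrightarrow> unital_cstar A \<and> unital_star_subspace A V \<and> norm_closure A V = carrier A \<and>
     seminorm_over UNIV A V L \<and> L \<one>\<^bsub>A\<^esub> = 0 \<and> (\<forall>x\<in>V. L (star A x) = L x) \<and>
     metrizes (state_dist V L) (weak_star (carrier A) (states A))"

definition lower_semicontinuous_on :: "'b::topological_space set \<Rightarrow> ('b \<Rightarrow> real) \<Rightarrow> bool" where
  "lower_semicontinuous_on V L \<longleftrightarrow>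
     (\<forall>x\<in>V. \<forall>c. c < L x \<longrightarrow> (\<forall>\<^sub>F y in at x within V. c < L y))"


section \<open>Quantum Gromov-Hausdorff distance\<close>

definition hausdorff_dist :: "('s \<Rightarrow> 's \<Rightarrow> ennreal) \<Rightarrow> 's set \<Rightarrow> 's set \<Rightarrow> ennreal" where
  "hausdorff_dist \<rho> X Y = max (SUP x\<in>X. INF y\<in>Y. \<rho> x y) (SUP y\<in>Y. INF x\<in>X. \<rho> x y)"

definition admissible ::
  "'a cstar \<Rightarrow> 'a set \<Rightarrow> ('a \<Rightarrow> real) \<Rightarrow> 'b cstar \<Rightarrow> 'b set \<Rightarrow> ('b \<Rightarrow> real) \<Rightarrow> ('a \<times> 'b \<Rightarrow> real) \<Rightarrow> bool"
where
  "admissible A1 V1 L1 A2 V2 L2 L \<longleftrightarrow> ou_cqms (dsum A1 A2) (V1 \<times> V2) L \<and>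
     (\<forall>x\<in>sa_part A1 V1. L1 x = (INF y\<in>sa_part A2 V2. L (x, y))) \<and>
     (\<forall>y\<in>sa_part A2 V2. L2 y = (INF x\<in>sa_part A1 V1. L (x, y)))"

definition dist_q ::
  "'a cstar \<Rightarrow> 'a set \<Rightarrow> ('a \<Rightarrow> real) \<Rightarrow> 'b cstar \<Rightarrow> 'b set \<Rightarrow> ('b \<Rightarrow> real) \<Rightarrow> ennreal"
where
  "dist_q A1 V1 L1 A2 V2 L2 =
     (let W = sa_part (dsum A1 A2) (V1 \<times> V2) in
      INF L\<in>{L. admissible A1 V1 L1 A2 V2 L2 L}.
        hausdorff_dist (state_dist W L)
          ((\<lambda>\<mu>. restrict (\<mu> \<circ> fst) W) ` ou_states A1 V1)
          ((\<lambda>\<mu>. restrict (\<mu> \<circ> snd) W) ` ou_states A2 V2))"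


section \<open>Reduced crossed products by the integers\<close>

definition star_automorphism :: "('b::cstar_algebra \<Rightarrow> 'b) \<Rightarrow> bool" where
  "star_automorphism \<beta> \<longleftrightarrow> bij \<beta> \<and> (\<forall>x y. \<beta> (x + y) = \<beta> x + \<beta> y) \<and>
     (\<forall>c x. \<beta> (scaleC c x) = scaleC c (\<beta> x)) \<and> (\<forall>x y. \<beta> (x * y) = \<beta> x * \<beta> y) \<and>
     (\<forall>x. \<beta> (adj x) = adj (\<beta> x))"

definition int_iter :: "('b \<Rightarrow> 'b) \<Rightarrow> int \<Rightarrow> 'b \<Rightarrow> 'b" where
  "int_iter \<beta> n = (if 0 \<le> n then \<beta> ^^ nat n else inv_into UNIV \<beta> ^^ nat (- n))"

text \<open>
  The right Hilbert \<open>B\<close>-module \<open>\<ell>\<^sup>2(\<int>, B)\<close>, with inner product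
  \<open>\<langle>\<xi>, \<eta>\<rangle> = \<Sum>n. \<xi>(n)\<^sup>* \<eta>(n)\<close>, and the \<open>C\<^sup>*\<close>-algebra of its adjointable operators.
  Boundedness is automatic for adjointable operators and only recorded for convenience.
\<close>

definition l2 :: "(int \<Rightarrow> 'b::cstar_algebra) set" where
  "l2 = {\<xi>. (\<lambda>n. adj (\<xi> n) * \<xi> n) summable_on UNIV}"

definition l2_inner :: "(int \<Rightarrow> 'b::cstar_algebra) \<Rightarrow> (int \<Rightarrow> 'b) \<Rightarrow> 'b" where
  "l2_inner \<xi> \<eta> = infsum (\<lambda>n. adj (\<xi> n) * \<eta> n) UNIV"

definition l2_norm :: "(int \<Rightarrow> 'b::cstar_algebra) \<Rightarrow> real" where
  "l2_norm \<xi> = sqrt (norm (l2_inner \<xi> \<xi>))"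

type_synonym 'b l2_op = "(int \<Rightarrow> 'b) \<Rightarrow> int \<Rightarrow> 'b"

definition is_adjoint :: "'b::cstar_algebra l2_op \<Rightarrow> 'b l2_op \<Rightarrow> bool" where
  "is_adjoint S T \<longleftrightarrow> S \<in> l2 \<rightarrow>\<^sub>E l2 \<and> (\<forall>\<xi>\<in>l2. \<forall>\<eta>\<in>l2. l2_inner (S \<xi>) \<eta> = l2_inner \<xi> (T \<eta>))"

definition adjointable_ops :: "'b::cstar_algebra l2_op cstar" where
  "adjointable_ops = \<lparr>
     carrier = {T \<in> l2 \<rightarrow>\<^sub>E l2. (\<exists>K. \<forall>\<xi>\<in>l2. l2_norm (T \<xi>) \<le> K * l2_norm \<xi>) \<and> (\<exists>S. is_adjoint S T)},
     mult = (\<lambda>S T. compose l2 S T),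
     one = restrict (\<lambda>\<xi>. \<xi>) l2,
     zero = restrict (\<lambda>\<xi> n. 0) l2,
     add = (\<lambda>S T. restrict (\<lambda>\<xi> n. S \<xi> n + T \<xi> n) l2),
     cscale = (\<lambda>c T. restrict (\<lambda>\<xi> n. scaleC c (T \<xi> n)) l2),
     star = (\<lambda>T. THE S. is_adjoint S T),
     nrm = (\<lambda>T. SUP \<xi>\<in>{\<xi>\<in>l2. l2_norm \<xi> \<le> 1}. l2_norm (T \<xi>))\<rparr>"

definition fin_supp :: "'b::zero set \<Rightarrow> (int \<Rightarrow> 'b) set" where
  "fin_supp V = {x. finite {n. x n \<noteq> 0} \<and> (\<forall>n. x n \<in> V)}"

text \<open>
  The regular representation on \<open>\<ell>\<^sup>2(\<int>, B)\<close>: \<open>b\<close> acts by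
  \<open>(b\<xi>)(m) = \<beta>\<^sup>-\<^sup>m(b) \<xi>(m)\<close> and \<open>shift n\<close> is \<open>U\<^sup>n\<close>.  For a faithful representation of \<open>B\<close> on a
  Hilbert space \<open>H\<close>, tensoring with \<open>H\<close> over \<open>B\<close> gives the usual regular representation on
  \<open>\<ell>\<^sup>2(\<int>, H)\<close>, with the same operator norms.
\<close>

definition coeff_op :: "('b::cstar_algebra \<Rightarrow> 'b) \<Rightarrow> 'b \<Rightarrow> 'b l2_op" where
  "coeff_op \<beta> b \<xi> = (\<lambda>m. int_iter \<beta> (- m) b * \<xi> m)"

definition shift :: "int \<Rightarrow> (int \<Rightarrow> 'b) \<Rightarrow> int \<Rightarrow> 'b" where
  "shift n \<xi> = (\<lambda>m. \<xi> (m - n))"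

lemma coeff_op_covariant:
  assumes "bij \<beta>"
  shows "shift 1 (coeff_op \<beta> b (shift (- 1) \<xi>)) = coeff_op \<beta> (\<beta> b) \<xi>"
proof
  fix m
  have inv_left: "inv_into UNIV \<beta> (\<beta> c) = c" for c
    using assms by (simp add: bij_is_inj)
  have "int_iter \<beta> (1 - m) b = int_iter \<beta> (- m) (\<beta> b)"
  proof (cases "m \<le> 0")
    case True
    then have "nat (1 - m) = Suc (nat (- m))" by simp
    with True show ?thesis by (simp add: int_iter_def funpow_swap1)
  next
    case False
    then have "nat m = Suc (nat (m - 1))" by simp
    then have "(inv_into UNIV \<beta> ^^ nat m) (\<beta> b) = (inv_into UNIV \<beta> ^^ nat (m - 1)) b"
      by (simp add: funpow_swap1 inv_left)
    with False show ?thesis by (auto simp: int_iter_def)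
  qed
  then show "shift 1 (coeff_op \<beta> b (shift (- 1) \<xi>)) m = coeff_op \<beta> (\<beta> b) \<xi> m"
    by (simp add: shift_def coeff_op_def)
qed

definition reg_rep :: "('b::cstar_algebra \<Rightarrow> 'b) \<Rightarrow> (int \<Rightarrow> 'b) \<Rightarrow> 'b l2_op" where
  "reg_rep \<beta> x = restrict (\<lambda>\<xi> m. \<Sum>n | x n \<noteq> 0. coeff_op \<beta> (x n) (shift n \<xi>) m) l2"

definition crossed_product :: "('b::cstar_algebra \<Rightarrow> 'b) \<Rightarrow> 'b l2_op cstar" where
  "crossed_product \<beta> =
     adjointable_ops\<lparr>carrier := norm_closure adjointable_ops (reg_rep \<beta> ` fin_supp UNIV)\<rparr>"

definition cp_adj :: "('b::cstar_algebra \<Rightarrow> 'b) \<Rightarrow> (int \<Rightarrow> 'b) \<Rightarrow> int \<Rightarrow> 'b" where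
  "cp_adj \<beta> x = (\<lambda>n. int_iter \<beta> n (adj (x (- n))))"

definition order_preserving_norm :: "((int \<Rightarrow> complex) \<Rightarrow> real) \<Rightarrow> bool" where
  "order_preserving_norm N \<longleftrightarrow>
     (\<forall>h\<in>fin_supp UNIV. 0 \<le> N h \<and> (N h = 0 \<longleftrightarrow> h = (\<lambda>n. 0))) \<and>
     (\<forall>h\<in>fin_supp UNIV. \<forall>k\<in>fin_supp UNIV. N (\<lambda>n. h n + k n) \<le> N h + N k) \<and>
     (\<forall>c. \<forall>h\<in>fin_supp UNIV. N (\<lambda>n. c * h n) = cmod c * N h) \<and>
     (\<forall>h\<in>fin_supp UNIV. \<forall>k\<in>fin_supp UNIV. (\<forall>n. 0 \<le> h n \<and> h n \<le> k n) \<longrightarrow>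
        N (\<lambda>n. complex_of_real (h n)) \<le> N (\<lambda>n. complex_of_real (k n)))"

definition cp_seminorm_coeff ::
  "('b::cstar_algebra \<Rightarrow> real) \<Rightarrow> ((int \<Rightarrow> complex) \<Rightarrow> real) \<Rightarrow> ('b \<Rightarrow> 'b) \<Rightarrow> (int \<Rightarrow> 'b) \<Rightarrow> real"
where
  "cp_seminorm_coeff LB N \<beta> x =
     Max {nrm (crossed_product \<beta>) (reg_rep \<beta> (\<lambda>n. of_int n * x n)),
          N (\<lambda>n. complex_of_real (LB (x n))),
          N (\<lambda>n. complex_of_real (LB (cp_adj \<beta> x n)))}"

definition cp_domain :: "'b::cstar_algebra set \<Rightarrow> ('b \<Rightarrow> 'b) \<Rightarrow> 'b l2_op set" where
  "cp_domain VB \<beta> = reg_rep \<beta> ` fin_supp VB"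

lemma int_iter_inj:
  assumes "bij \<beta>"
  shows "inj (int_iter \<beta> n)"
  using assms bij_imp_bij_inv[OF assms]
  by (auto simp: int_iter_def intro!: inj_fn bij_is_inj)

lemma inj_on_reg_rep:
  assumes "star_automorphism \<beta>"
  shows "inj_on (reg_rep \<beta>) (fin_supp V)"
proof (rule inj_onI)
  fix x y :: "int \<Rightarrow> 'a"
  assume x: "x \<in> fin_supp V" and y: "y \<in> fin_supp V" and eq: "reg_rep \<beta> x = reg_rep \<beta> y"
  define \<delta> :: "int \<Rightarrow> 'a" where "\<delta> = (\<lambda>n. if n = 0 then 1 else 0)"
  have \<beta>: "bij \<beta>" "\<And>u v. \<beta> (u + v) = \<beta> u + \<beta> v"
    using assms by (auto simp: star_automorphism_def)
  have \<beta>0: "\<beta> 0 = 0"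
    using \<beta>(2)[of 0 0] by simp
  have inv0: "inv_into UNIV \<beta> 0 = 0"
    using \<beta>(1) \<beta>0 by (metis bij_is_inj inv_f_f)
  have pow0: "(f ^^ n) 0 = 0" if "f 0 = 0" for f :: "'a \<Rightarrow> 'a" and n
    using that by (induction n) auto
  have iter0: "int_iter \<beta> n 0 = 0" for n
    by (simp add: int_iter_def pow0 \<beta>0 inv0)
  have "(\<lambda>n. adj (\<delta> n) * \<delta> n) summable_on UNIV"
  proof (rule finite_nonzero_values_imp_summable_on)
    have "{n \<in> UNIV. adj (\<delta> n) * \<delta> n \<noteq> 0} \<subseteq> {0}"
      by (auto simp: \<delta>_def)
    then show "finite {n \<in> UNIV. adj (\<delta> n) * \<delta> n \<noteq> 0}"
      using finite_subset by blast
  qed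
  then have \<delta>: "\<delta> \<in> l2"
    by (simp add: l2_def)
  have val: "reg_rep \<beta> z \<delta> m = int_iter \<beta> (- m) (z m)" if z: "z \<in> fin_supp V" for z m
  proof -
    have "reg_rep \<beta> z \<delta> m = (\<Sum>n | z n \<noteq> 0. int_iter \<beta> (- m) (z n) * \<delta> (m - n))"
      using \<delta> by (simp add: reg_rep_def coeff_op_def shift_def)
    also have "\<dots> = (\<Sum>n | z n \<noteq> 0. if n = m then int_iter \<beta> (- m) (z m) else 0)"
      by (intro sum.cong) (auto simp: \<delta>_def)
    also have "\<dots> = int_iter \<beta> (- m) (z m)"
      using z by (auto simp: fin_supp_def iter0 sum.delta)
    finally show ?thesis .
  qed
  show "x = y"
  proof
    fix m
    have "int_iter \<beta> (- m) (x m) = int_iter \<beta> (- m) (y m)"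
      using val[OF x, of m] val[OF y, of m] eq by simp
    then show "x m = y m"
      using int_iter_inj[OF \<beta>(1)] by (meson injD)
  qed
qed

definition cp_seminorm ::
  "'b::cstar_algebra set \<Rightarrow> ('b \<Rightarrow> real) \<Rightarrow> ((int \<Rightarrow> complex) \<Rightarrow> real) \<Rightarrow> ('b \<Rightarrow> 'b) \<Rightarrow> 'b l2_op \<Rightarrow> real"
where
  "cp_seminorm VB LB N \<beta> T = cp_seminorm_coeff LB N \<beta> (the_inv_into (fin_supp VB) (reg_rep \<beta>) T)"

end

(* Compressing the regular representation over t to {0..<R}, reading the compressed matrix over t0
   and averaging the matrix along the diagonals gives a map Phi from finitely supported sequences
   over t to such sequences over t0: it averages the automorphisms b |-> beta_t0^m (beta_t^-m b) over
   m.  Phi is unital, a contraction for the C*-norms and for the Lipschitz semi-norms, and it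
   commutes with the derivation x(n) |-> n x(n).  The Fourier multiplier with the square summable
   symbol 1/n, |n| > M, bounds the part of an element with |n| > M by its derivation, uniformly in t.
   The finitely many remaining coefficients lie in totally bounded sets (Rieffel's criterion for B),
   which gives total boundedness of the Lipschitz balls and, for t close to t0, makes both
   composites of the two transfer maps close to the identity on them.  The bridge semi-norms
   max (L1 x) (max (L2 y) (|y - Phi x| / e)) then bound the quantum Gromov-Hausdorff distance. *)

theory Submission
  imports Defs "HOL-Real_Asymp.Real_Asymp"
begin

text \<open>The unitaries of two crossed products implement different automorphisms, so there is no
  natural homomorphism between the algebras. A window of length \<open>R\<close> involves only
  powers below \<open>R\<close>, and these depend continuously on t, uniformly over a Lipschitz
  ball. The price is a Fejer weight \<open>1 - |n| / R\<close> on the n-th coefficient, harmless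
  because the derivation bounds \<open>|n| * norm (x n)\<close>. No representation of B on a Hilbert
  space is used. A real state \<open>f\<close> turns a module element into the scalar sequence
  \<open>f (adj (\<xi> n) * \<xi> n)\<close>; estimates are made for finite sums of such scalars,
  and the norm of a self-adjoint element is a supremum over \<open>f\<close>. This requires enough
  states, hence that \<open>adj y * y\<close> is positive in a sense expressed by norms, which is
  derived without spectra from an iteration for square roots. Constants must be sharp in the
  transfer map: it has to be exactly contractive in order to pull back states, and must not increase
  the semi-norm, so that the bridge has the right quotients. Elsewhere a factor 2 from splitting
  into real and imaginary parts does no harm.\<close>

context unital_cstar
begin

section \<open>Elementary algebra and norm estimates in a unital C*-algebra\<close>

declare cscale_closed [simp, intro] star_closed [simp, intro]

lemma cscale_zero_right [simp]: "cscale A c \<zero> = \<zero>"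
proof -
  have "cscale A c \<zero> = cscale A c \<zero> \<oplus> cscale A c \<zero>"
    using cscale_add_right[of \<zero> \<zero> c] by simp
  then show ?thesis
    by (metis add.r_cancel_one' cscale_closed zero_closed)
qed

lemma cscale_zero_left [simp]: "x \<in> carrier A \<Longrightarrow> cscale A 0 x = \<zero>"
proof -
  assume x: "x \<in> carrier A"
  then have "cscale A 0 x = cscale A 0 x \<oplus> cscale A 0 x"
    using cscale_add_left[of x 0 0] by simp
  then show ?thesis
    by (metis add.r_cancel_one' cscale_closed x)
qed

lemma a_inv_eq_cscale: "x \<in> carrier A \<Longrightarrow> \<ominus> x = cscale A (-1) x"
proof -
  assume x: "x \<in> carrier A"
  have "cscale A (-1) x \<oplus> x = cscale A (-1 + 1) x"
    using x by (simp only: cscale_add_left cscale_one)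
  then have "cscale A (-1) x \<oplus> x = \<zero>"
    using x by simp
  then show ?thesis
    using x by (simp add: minus_equality)
qed

lemma cscale_minus: "x \<in> carrier A \<Longrightarrow> \<ominus> cscale A c x = cscale A (- c) x"
  by (simp add: a_inv_eq_cscale cscale_cscale)

lemma cscale_a_inv: "x \<in> carrier A \<Longrightarrow> cscale A c (\<ominus> x) = cscale A (- c) x"
  by (simp add: a_inv_eq_cscale cscale_cscale)

lemma cscale_diff:
  "\<lbrakk>x \<in> carrier A; y \<in> carrier A\<rbrakk> \<Longrightarrow> cscale A c (x \<ominus> y) = cscale A c x \<ominus> cscale A c y"
  by (simp add: minus_eq cscale_add_right cscale_a_inv cscale_minus)

lemma cscale_two: "x \<in> carrier A \<Longrightarrow> cscale A 2 x = x \<oplus> x"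
  using cscale_add_left[of x 1 1] by (simp add: cscale_one)

lemma star_one [simp]: "star A \<one> = \<one>"
proof -
  have "star A \<one> = star A (star A \<one>) "
    by (metis l_one one_closed r_one star_closed star_mult star_star)
  then show ?thesis
    by (simp add: star_star)
qed

lemma star_zero [simp]: "star A \<zero> = \<zero>"
  using star_cscale[of \<zero> 0] by simp

lemma star_a_inv: "x \<in> carrier A \<Longrightarrow> star A (\<ominus> x) = \<ominus> star A x"
  by (simp add: a_inv_eq_cscale star_cscale)

lemma star_diff:
  "\<lbrakk>x \<in> carrier A; y \<in> carrier A\<rbrakk> \<Longrightarrow> star A (x \<ominus> y) = star A x \<ominus> star A y"
  by (simp add: minus_eq star_add star_a_inv)

lemma nrm_zero [simp]: "nrm A \<zero> = 0"
  using nrm_eq_zero by simp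

lemma nrm_a_inv [simp]: "x \<in> carrier A \<Longrightarrow> nrm A (\<ominus> x) = nrm A x"
  by (simp add: a_inv_eq_cscale nrm_cscale)

lemma nrm_diff_commute:
  "\<lbrakk>x \<in> carrier A; y \<in> carrier A\<rbrakk> \<Longrightarrow> nrm A (x \<ominus> y) = nrm A (y \<ominus> x)"
  using nrm_a_inv[of "x \<ominus> y"] by (simp add: minus_eq minus_add a_comm)

lemma nrm_diff_le:
  "\<lbrakk>x \<in> carrier A; y \<in> carrier A\<rbrakk> \<Longrightarrow> nrm A (x \<ominus> y) \<le> nrm A x + nrm A y"
  using nrm_triangle[of x "\<ominus> y"] by (simp add: minus_eq)

lemma nrm_diff_triangle:
  assumes "x \<in> carrier A" "y \<in> carrier A" "z \<in> carrier A"
  shows "nrm A (x \<ominus> z) \<le> nrm A (x \<ominus> y) + nrm A (y \<ominus> z)"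
proof -
  have "x \<ominus> z = (x \<ominus> y) \<oplus> (y \<ominus> z)"
    using assms by algebra
  then show ?thesis
    using nrm_triangle[of "x \<ominus> y" "y \<ominus> z"] assms by simp
qed

lemma diff_eq_zero: "\<lbrakk>x \<in> carrier A; y \<in> carrier A; x \<ominus> y = \<zero>\<rbrakk> \<Longrightarrow> x = y"
  by (metis (no_types, opaque_lifting) a_minus_def add.inv_equality minus_minus a_comm a_inv_closed minus_equality)

text \<open>Cancelling \<open>nrm A y\<close> in \<open>(nrm A y)^2 = nrm A (star A y \<otimes> y)
  \<le> nrm A (star A y) * nrm A y\<close> gives one inequality; the same for
  \<open>star A y\<close> gives the other.\<close>

lemma nrm_star [simp]:
  assumes "x \<in> carrier A"
  shows "nrm A (star A x) = nrm A x"
proof -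
  have le: "nrm A y \<le> nrm A (star A y)" if y: "y \<in> carrier A" for y
  proof (cases "nrm A y = 0")
    case True
    then show ?thesis using nrm_nonneg[of "star A y"] y by simp
  next
    case False
    have "(nrm A y)\<^sup>2 \<le> nrm A (star A y) * nrm A y"
      using nrm_mult[of "star A y" y] nrm_star_mult[of y] y by simp
    then show ?thesis
      using False nrm_nonneg[OF y] by (simp add: power2_eq_square)
  qed
  show ?thesis
    using le[of x] le[of "star A x"] assms by (simp add: star_star)
qed

lemma nrm_square_sa: "\<lbrakk>x \<in> carrier A; star A x = x\<rbrakk> \<Longrightarrow> nrm A (x \<otimes> x) = (nrm A x)\<^sup>2"
  using nrm_star_mult[of x] by simp

text \<open>Only an inequality, because the locale admits the zero algebra, whose unit has norm 0;
  otherwise the value is 1, the unit being a self-adjoint idempotent.\<close>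

lemma nrm_one_le: "nrm A \<one> \<le> 1"
proof -
  have "nrm A \<one> = (nrm A \<one>)\<^sup>2"
    using nrm_square_sa[of \<one>] by simp
  then have "nrm A \<one> = 0 \<or> nrm A \<one> = 1"
    by (simp add: power2_eq_square)
  then show ?thesis by auto
qed

lemma nrm_cscale_one_le: "nrm A (cscale A c \<one>) \<le> cmod c"
  using nrm_cscale[of \<one> c] nrm_one_le by (simp add: mult_left_le)

section \<open>Norm convergence of sequences\<close>

definition converges_to :: "(nat \<Rightarrow> 'a) \<Rightarrow> 'a \<Rightarrow> bool" where
  "converges_to s a \<longleftrightarrow> (\<forall>n. s n \<in> carrier A) \<and> a \<in> carrier A \<and> (\<lambda>n. nrm A (s n \<ominus> a)) \<longlonglongrightarrow> 0"

lemma converges_toD: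
  assumes "converges_to s a"
  shows "s n \<in> carrier A" "a \<in> carrier A" "(\<lambda>n. nrm A (s n \<ominus> a)) \<longlonglongrightarrow> 0"
  using assms by (auto simp: converges_to_def)

lemma converges_toI:
  assumes "\<And>n. s n \<in> carrier A" "a \<in> carrier A" "\<And>n. nrm A (s n \<ominus> a) \<le> r n" "r \<longlonglongrightarrow> 0"
  shows "converges_to s a"
  unfolding converges_to_def using assms nrm_nonneg
  by (auto intro!: tendsto_sandwich[OF always_eventually always_eventually tendsto_const assms(4)])

lemma converges_to_const: "a \<in> carrier A \<Longrightarrow> converges_to (\<lambda>_. a) a"
  by (simp add: converges_to_def r_neg minus_eq)

lemma converges_to_unique:
  assumes "converges_to s a" "converges_to s b"
  shows "a = b"
proof -
  note c = converges_toD[OF assms(1)] converges_toD[OF assms(2)]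
  have "nrm A (a \<ominus> b) \<le> nrm A (s n \<ominus> a) + nrm A (s n \<ominus> b)" for n
    using nrm_diff_triangle[of a "s n" b] nrm_diff_commute[of a "s n"] c by simp
  moreover have "(\<lambda>n. nrm A (s n \<ominus> a) + nrm A (s n \<ominus> b)) \<longlonglongrightarrow> 0 + 0"
    by (intro tendsto_add c)
  ultimately have "nrm A (a \<ominus> b) \<le> 0"
    by (intro tendsto_lowerbound[of "\<lambda>n. nrm A (s n \<ominus> a) + nrm A (s n \<ominus> b)" _ sequentially]) auto
  then have "a \<ominus> b = \<zero>"
    using nrm_eq_zero[of "a \<ominus> b"] nrm_nonneg[of "a \<ominus> b"] c by auto
  then show ?thesis using c diff_eq_zero by blast
qed

lemma converges_to_add:
  assumes "converges_to s a" "converges_to t b"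
  shows "converges_to (\<lambda>n. s n \<oplus> t n) (a \<oplus> b)"
proof (rule converges_toI[where r = "\<lambda>n. nrm A (s n \<ominus> a) + nrm A (t n \<ominus> b)"])
  note c = converges_toD[OF assms(1)] converges_toD[OF assms(2)]
  fix n
  have "(s n \<oplus> t n) \<ominus> (a \<oplus> b) = (s n \<ominus> a) \<oplus> (t n \<ominus> b)"
    using c(1)[of n] c(4)[of n] c(2,5) by algebra
  then show "nrm A ((s n \<oplus> t n) \<ominus> (a \<oplus> b)) \<le> nrm A (s n \<ominus> a) + nrm A (t n \<ominus> b)"
    using nrm_triangle[of "s n \<ominus> a" "t n \<ominus> b"] c by simp
qed (use converges_toD[OF assms(1)] converges_toD[OF assms(2)] in \<open>auto intro!: tendsto_eq_intros\<close>)

lemma converges_to_cscale: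
  assumes "converges_to s a"
  shows "converges_to (\<lambda>n. cscale A c (s n)) (cscale A c a)"
proof (rule converges_toI[where r = "\<lambda>n. cmod c * nrm A (s n \<ominus> a)"])
  note c = converges_toD[OF assms(1)]
  show "nrm A (cscale A c (s n) \<ominus> cscale A c a) \<le> cmod c * nrm A (s n \<ominus> a)" for n
    using c by (simp flip: cscale_diff add: nrm_cscale)
qed (use converges_toD[OF assms(1)] in \<open>auto intro!: tendsto_eq_intros\<close>)

lemma converges_to_star:
  assumes "converges_to s a"
  shows "converges_to (\<lambda>n. star A (s n)) (star A a)"
proof (rule converges_toI[where r = "\<lambda>n. nrm A (s n \<ominus> a)"])
  note c = converges_toD[OF assms(1)]
  show "nrm A (star A (s n) \<ominus> star A a) \<le> nrm A (s n \<ominus> a)" for n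
    using c by (simp flip: star_diff)
qed (use converges_toD[OF assms(1)] in auto)

lemma converges_to_nrm:
  assumes "converges_to s a"
  shows "(\<lambda>n. nrm A (s n)) \<longlonglongrightarrow> nrm A a"
proof -
  note c = converges_toD[OF assms(1)]
  have "\<bar>nrm A (s n) - nrm A a\<bar> \<le> nrm A (s n \<ominus> a)" for n
  proof -
    have "s n = (s n \<ominus> a) \<oplus> a" "a = (a \<ominus> s n) \<oplus> s n"
      using c(1)[of n] c(2) by algebra+
    then have "nrm A (s n) \<le> nrm A (s n \<ominus> a) + nrm A a" "nrm A a \<le> nrm A (a \<ominus> s n) + nrm A (s n)"
      using c(1)[of n] c(2) nrm_triangle[of "s n \<ominus> a" a] nrm_triangle[of "a \<ominus> s n" "s n"] by auto
    then show ?thesis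
      using nrm_diff_commute[of a "s n"] c by simp
  qed
  then have "(\<lambda>n. nrm A (s n) - nrm A a) \<longlonglongrightarrow> 0"
    by (intro Lim_null_comparison[OF always_eventually c(3)]) simp
  then show ?thesis by (simp add: LIM_zero_iff)
qed

lemma converges_to_mult:
  assumes "converges_to s a" "converges_to t b"
  shows "converges_to (\<lambda>n. s n \<otimes> t n) (a \<otimes> b)"
proof (rule converges_toI[where r = "\<lambda>n. nrm A (s n \<ominus> a) * nrm A (t n) + nrm A a * nrm A (t n \<ominus> b)"])
  note c = converges_toD[OF assms(1)] converges_toD[OF assms(2)]
  fix n
  have "s n \<otimes> t n \<ominus> a \<otimes> b = (s n \<ominus> a) \<otimes> t n \<oplus> a \<otimes> (t n \<ominus> b)"
    using c(1)[of n] c(4)[of n] c(2,5) by algebra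
  then show "nrm A (s n \<otimes> t n \<ominus> a \<otimes> b)
      \<le> nrm A (s n \<ominus> a) * nrm A (t n) + nrm A a * nrm A (t n \<ominus> b)"
    using nrm_triangle[of "(s n \<ominus> a) \<otimes> t n" "a \<otimes> (t n \<ominus> b)"]
      nrm_mult[of "s n \<ominus> a" "t n"] nrm_mult[of a "t n \<ominus> b"] c by simp
next
  note c = converges_toD[OF assms(1)] converges_toD[OF assms(2)]
  show "(\<lambda>n. nrm A (s n \<ominus> a) * nrm A (t n) + nrm A a * nrm A (t n \<ominus> b)) \<longlonglongrightarrow> 0"
    using tendsto_add[OF tendsto_mult[OF c(3) converges_to_nrm[OF assms(2)]]
        tendsto_mult[OF tendsto_const[of "nrm A a"] c(6)]] by simp
qed (use converges_toD[OF assms(1)] converges_toD[OF assms(2)] in auto)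

lemma converges_to_Suc: "converges_to s a \<Longrightarrow> converges_to (\<lambda>n. s (Suc n)) a"
  by (auto simp: converges_to_def dest: LIMSEQ_Suc)

lemma mult_commute_diff_squares:
  assumes "a \<in> carrier A" "b \<in> carrier A" "a \<otimes> b = b \<otimes> a"
  shows "(a \<ominus> b) \<otimes> (a \<oplus> b) = a \<otimes> a \<ominus> b \<otimes> b"
proof -
  have "(a \<ominus> b) \<otimes> (a \<oplus> b) = (a \<otimes> a \<ominus> b \<otimes> b) \<oplus> (a \<otimes> b \<ominus> b \<otimes> a)"
    using assms(1,2) by algebra
  then show ?thesis using assms by (simp add: minus_eq r_neg)
qed

end

section \<open>Square roots by a fixed point iteration\<close>

fun sqrt_iter :: "('a, 'm) cstar_scheme \<Rightarrow> 'a \<Rightarrow> nat \<Rightarrow> 'a" where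
  "sqrt_iter A x 0 = \<zero>\<^bsub>A\<^esub>"
| "sqrt_iter A x (Suc n) = cscale A (1/2) (x \<oplus>\<^bsub>A\<^esub> sqrt_iter A x n \<otimes>\<^bsub>A\<^esub> sqrt_iter A x n)"

fun sqrt_bound :: "nat \<Rightarrow> real" where
  "sqrt_bound 0 = 0"
| "sqrt_bound (Suc n) = (1 + (sqrt_bound n)\<^sup>2) / 2"

lemma sqrt_bound_range: "0 \<le> sqrt_bound n \<and> sqrt_bound n \<le> 1"
proof (induction n)
  case (Suc n)
  then have "(sqrt_bound n)\<^sup>2 \<le> 1"
    by (simp add: power_le_one)
  then show ?case by simp
qed simp

lemma sqrt_bound_mono: "incseq sqrt_bound"
proof (rule incseq_SucI)
  fix n
  have "0 \<le> (1 - sqrt_bound n)\<^sup>2" by simp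
  then show "sqrt_bound n \<le> sqrt_bound (Suc n)"
    by (simp add: power2_eq_square algebra_simps)
qed

text \<open>The scalar iteration converges too slowly for a geometric bound, so the Cauchy property
  comes from monotonicity and boundedness.\<close>

lemma sqrt_bound_Cauchy: "Cauchy sqrt_bound"
  using sqrt_bound_mono sqrt_bound_range
  by (metis incseq_convergent convergent_Cauchy convergent_def)

context unital_cstar
begin

text \<open>With \<open>y = 1 - s\<close>, the equation \<open>s\<^sup>2 = 1 - x\<close> is the fixed point equation
  \<open>y = (x + y\<^sup>2) / 2\<close>. The scalar iteration for \<open>x = 1\<close> dominates the steps.\<close>

lemma sqrt_one_minus:
  assumes x: "x \<in> carrier A" and sa: "star A x = x" and x1: "nrm A x \<le> 1"
  obtains s where "s \<in> carrier A" "star A s = s" "s \<otimes> s = \<one> \<ominus> x" "nrm A (\<one> \<ominus> s) \<le> 1"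
    "\<And>z. z \<in> carrier A \<Longrightarrow> z \<otimes> x = x \<otimes> z \<Longrightarrow> z \<otimes> s = s \<otimes> z"
proof -
  define y where "y = sqrt_iter A x"
  have y0: "y 0 = \<zero>" and ySuc: "y (Suc n) = cscale A (1/2) (x \<oplus> y n \<otimes> y n)" for n
    by (simp_all add: y_def)
  have yc [simp]: "y n \<in> carrier A" for n
    by (induction n) (use x in \<open>auto simp: y0 ySuc\<close>)
  have ys: "star A (y n) = y n" for n
    by (induction n) (use x sa in \<open>auto simp: y0 ySuc star_cscale star_add star_mult\<close>)
  have ycomm: "z \<otimes> y n = y n \<otimes> z" if z: "z \<in> carrier A" "z \<otimes> x = x \<otimes> z" for z n
  proof (induction n)
    case (Suc n)
    have "z \<otimes> (y n \<otimes> y n) = (y n \<otimes> y n) \<otimes> z"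
      using Suc z by (metis m_assoc yc)
    then show ?case
      using x z by (simp add: ySuc mult_cscale_left mult_cscale_right r_distr l_distr)
  qed (use z in \<open>simp add: y0\<close>)
  \<comment> \<open>Taking \<open>z = x\<close> shows that \<open>x\<close> commutes with every
    iterate; then \<open>z = y m\<close> is allowed, and the iterates commute with each other. This
    lets the difference of two squares factor below.\<close>
  have yy: "y m \<otimes> y n = y n \<otimes> y m" for m n
    using ycomm[of "y m" n] ycomm[of x m] x by simp
  have ynorm: "nrm A (y n) \<le> sqrt_bound n" for n
  proof (induction n)
    case (Suc n)
    have "nrm A (y (Suc n)) \<le> (nrm A x + nrm A (y n \<otimes> y n)) / 2"
      using nrm_triangle[of x "y n \<otimes> y n"] x by (simp add: ySuc nrm_cscale)
    also have "nrm A (y n \<otimes> y n) \<le> (sqrt_bound n)\<^sup>2"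
      using Suc nrm_square_sa[of "y n"] ys[of n] by (simp add: nrm_nonneg power_mono)
    finally show ?case using x1 by simp
  qed (simp add: y0)
  have ystep: "nrm A (y (Suc n) \<ominus> y n) \<le> sqrt_bound (Suc n) - sqrt_bound n" for n
  proof (induction n)
    case 0
    have "nrm A (y (Suc 0)) \<le> 1 / 2"
      using x x1 by (simp add: ySuc y0 nrm_cscale)
    then show ?case by (simp add: y0 minus_eq)
  next
    case (Suc n)
    have "y (Suc (Suc n)) \<ominus> y (Suc n)
        = cscale A (1/2) ((x \<oplus> y (Suc n) \<otimes> y (Suc n)) \<ominus> (x \<oplus> y n \<otimes> y n))"
      using x by (subst ySuc, subst (2) ySuc) (simp add: cscale_diff)
    also have "(x \<oplus> y (Suc n) \<otimes> y (Suc n)) \<ominus> (x \<oplus> y n \<otimes> y n)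
        = y (Suc n) \<otimes> y (Suc n) \<ominus> y n \<otimes> y n"
      using x yc[of n] yc[of "Suc n"] by algebra
    also have "\<dots> = (y (Suc n) \<ominus> y n) \<otimes> (y (Suc n) \<oplus> y n)"
      using mult_commute_diff_squares[of "y (Suc n)" "y n"] yy by simp
    finally have "nrm A (y (Suc (Suc n)) \<ominus> y (Suc n))
        = nrm A ((y (Suc n) \<ominus> y n) \<otimes> (y (Suc n) \<oplus> y n)) / 2"
      by (simp add: nrm_cscale)
    also have "\<dots> \<le> nrm A (y (Suc n) \<ominus> y n) * nrm A (y (Suc n) \<oplus> y n) / 2"
      using nrm_mult by simp
    also have "\<dots> \<le> (sqrt_bound (Suc n) - sqrt_bound n) * (sqrt_bound (Suc n) + sqrt_bound n) / 2"
    proof -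
      have "nrm A (y (Suc n) \<oplus> y n) \<le> sqrt_bound (Suc n) + sqrt_bound n"
        using nrm_triangle[OF yc yc, of "Suc n" n] ynorm[of n] ynorm[of "Suc n"] by linarith
      then show ?thesis
        using Suc nrm_nonneg[of "y (Suc n) \<oplus> y n"] nrm_nonneg[of "y (Suc n) \<ominus> y n"]
        by (simp add: mult_mono del: sqrt_bound.simps)
    qed
    \<comment> \<open>The scalar recursion satisfies the same difference identity with equality, so
      the induction closes.\<close>
    also have "\<dots> = sqrt_bound (Suc (Suc n)) - sqrt_bound (Suc n)"
      unfolding sqrt_bound.simps(2)[of "Suc n"] sqrt_bound.simps(2)[of n, symmetric]
      by (subst sqrt_bound.simps(2)) (simp add: power2_eq_square field_simps)
    finally show ?case .
  qed
  have ydist: "nrm A (y (n + k) \<ominus> y n) \<le> sqrt_bound (n + k) - sqrt_bound n" for n k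
  proof (induction k)
    case (Suc k)
    then show ?case
      using nrm_diff_triangle[of "y (n + Suc k)" "y (n + k)" "y n"] ystep[of "n + k"]
      by (simp del: sqrt_bound.simps)
  qed (simp add: minus_eq r_neg)
  have "\<exists>a\<in>carrier A. (\<lambda>n. nrm A (y n \<ominus> a)) \<longlonglongrightarrow> 0"
  proof (rule nrm_complete)
    fix e :: real assume "0 < e"
    then obtain M where M: "\<And>m n. m \<ge> M \<Longrightarrow> n \<ge> M \<Longrightarrow> \<bar>sqrt_bound m - sqrt_bound n\<bar> < e"
      using sqrt_bound_Cauchy unfolding Cauchy_def dist_real_def by meson
    have "nrm A (y m \<ominus> y n) < e" if "m \<ge> M" "n \<ge> M" for m n
      using M[OF that] ydist[of n "m - n"] ydist[of m "n - m"] nrm_diff_commute[of "y m" "y n"]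
      by (cases "n \<le> m") auto
    then show "\<exists>N. \<forall>m\<ge>N. \<forall>n\<ge>N. nrm A (y m \<ominus> y n) < e" by blast
  qed simp
  then obtain a where a: "converges_to y a"
    by (auto simp: converges_to_def)
  note ac = converges_toD(2)[OF a]
  have fix_a: "a = cscale A (1/2) (x \<oplus> a \<otimes> a)"
  proof (rule converges_to_unique[OF converges_to_Suc[OF a]])
    show "converges_to (\<lambda>n. y (Suc n)) (cscale A (1/2) (x \<oplus> a \<otimes> a))"
      unfolding ySuc by (intro converges_to_cscale converges_to_add converges_to_const converges_to_mult x a)
  qed
  have sa_a: "star A a = a"
    using converges_to_unique[OF a converges_to_star[OF a, unfolded ys]] by (rule sym)
  have norm_a: "nrm A a \<le> 1"
    by (rule tendsto_upperbound[OF converges_to_nrm[OF a]])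
      (auto intro!: always_eventually order_trans[OF ynorm] simp: sqrt_bound_range)
  have comm_a: "z \<otimes> a = a \<otimes> z" if z: "z \<in> carrier A" "z \<otimes> x = x \<otimes> z" for z
    using converges_to_unique[OF converges_to_mult[OF converges_to_const[OF z(1)] a]]
      converges_to_mult[OF a converges_to_const[OF z(1)]] unfolding ycomm[OF z] by blast
  have two_a: "a \<oplus> a = x \<oplus> a \<otimes> a"
  proof -
    have "cscale A 2 a = cscale A 2 (cscale A (1/2) (x \<oplus> a \<otimes> a))"
      using fix_a by simp
    then show ?thesis
      using ac x by (simp add: cscale_two cscale_cscale cscale_one)
  qed
  have "(\<one> \<ominus> a) \<otimes> (\<one> \<ominus> a) = (\<one> \<oplus> a \<otimes> a) \<ominus> (a \<oplus> a)"
    using ac by (simp add: minus_eq r_distr l_distr r_minus l_minus minus_add a_assoc a_lcomm a_comm)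
  also have "\<dots> = \<one> \<ominus> x"
    unfolding two_a using ac x by algebra
  finally have sq: "(\<one> \<ominus> a) \<otimes> (\<one> \<ominus> a) = \<one> \<ominus> x" .
  show thesis
  proof (rule that[OF _ _ sq])
    show "star A (\<one> \<ominus> a) = \<one> \<ominus> a"
      using ac sa_a by (simp add: star_diff)
    have "\<one> \<ominus> (\<one> \<ominus> a) = a"
      using ac by algebra
    then show "nrm A (\<one> \<ominus> (\<one> \<ominus> a)) \<le> 1"
      using norm_a by simp
    show "z \<otimes> (\<one> \<ominus> a) = (\<one> \<ominus> a) \<otimes> z" if "z \<in> carrier A" "z \<otimes> x = x \<otimes> z" for z
      using comm_a[OF that] that ac by (simp add: minus_eq r_distr l_distr r_minus l_minus)
  qed (use ac in auto)
qed

text \<open>The element \<open>u = s + i t\<close> satisfies \<open>star A u \<otimes> u = s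
  \<otimes> s \<oplus> t \<otimes> t = \<one>\<close>, so its norm is at most 1, and
  \<open>s\<close> is its real part.\<close>

lemma norm_le_one_of_sum_squares:
  assumes "s \<in> carrier A" "star A s = s" "t \<in> carrier A" "star A t = t" "s \<otimes> t = t \<otimes> s"
    and sum: "s \<otimes> s \<oplus> t \<otimes> t = \<one>"
  shows "nrm A s \<le> 1"
proof -
  define w u where "w = cscale A \<i> t" and "u = s \<oplus> w"
  have c [simp]: "w \<in> carrier A" "u \<in> carrier A"
    using assms by (auto simp: w_def u_def)
  have ww: "w \<otimes> w = \<ominus> (t \<otimes> t)"
    using assms by (simp add: w_def mult_cscale_left mult_cscale_right cscale_cscale a_inv_eq_cscale)
  have sw: "s \<otimes> w = w \<otimes> s"
    using assms by (simp add: w_def mult_cscale_left mult_cscale_right)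
  have star_w: "star A w = \<ominus> w"
    using assms by (simp add: w_def star_cscale a_inv_eq_cscale cscale_cscale)
  then have star_u: "star A u = s \<ominus> w"
    using assms by (simp add: u_def star_add minus_eq)
  have "star A u \<otimes> u = \<one>"
    using mult_commute_diff_squares[OF assms(1) c(1) sw] assms
    by (simp add: star_u ww) (simp add: u_def minus_eq)
  then have "(nrm A u)\<^sup>2 \<le> 1"
    using nrm_star_mult[of u] nrm_one_le by simp
  then have nu: "nrm A u \<le> 1"
    using power2_le_imp_le[of "nrm A u" 1] by simp
  have "star A u \<oplus> u = s \<oplus> s"
    unfolding star_u unfolding u_def using assms(1) c(1) by algebra
  then have "2 * nrm A s \<le> nrm A (star A u) + nrm A u"
    using nrm_triangle[of "star A u" u] nrm_cscale[of s 2] assms by (simp add: cscale_two)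
  then show ?thesis using nu by simp
qed

text \<open>A self-adjoint root \<open>c\<close> of \<open>\<one> \<ominus> h \<otimes> h\<close>
  commutes with \<open>h\<close>, and the squares of \<open>c\<close> and \<open>h\<close> add up to
  the unit. Hence \<open>nrm A c \<le> 1\<close>, and the C*-identity passes this on to
  \<open>c \<otimes> c\<close>.\<close>

lemma norm_one_minus_square:
  assumes h: "h \<in> carrier A" "star A h = h" "nrm A h \<le> 1"
  shows "nrm A (\<one> \<ominus> h \<otimes> h) \<le> 1"
proof -
  have hh: "nrm A (h \<otimes> h) \<le> 1"
    using nrm_square_sa[of h] nrm_nonneg[of h] h by (simp add: power_le_one)
  obtain c where c: "c \<in> carrier A" "star A c = c" "c \<otimes> c = \<one> \<ominus> h \<otimes> h"
    and comm: "\<And>z. z \<in> carrier A \<Longrightarrow> z \<otimes> (h \<otimes> h) = (h \<otimes> h) \<otimes> z \<Longrightarrow> z \<otimes> c = c \<otimes> z"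
    using sqrt_one_minus[OF _ _ hh] h by (metis m_closed star_mult)
  have "c \<otimes> c \<oplus> h \<otimes> h = \<one>"
    unfolding c(3) using h(1) by algebra
  moreover have "c \<otimes> h = h \<otimes> c"
    using comm[of h] h by (simp add: m_assoc)
  ultimately have "nrm A c \<le> 1"
    using norm_le_one_of_sum_squares[of c h] c h by simp
  then have "nrm A (c \<otimes> c) \<le> 1"
    using nrm_square_sa[of c] nrm_nonneg[of c] c by (simp add: power_le_one)
  then show ?thesis using c by simp
qed

section \<open>Positive elements described by norms\<close>

abbreviation scal :: "real \<Rightarrow> 'a" where "scal r \<equiv> cscale A (complex_of_real r) \<one>"

lemma scal_add: "scal (r + q) = scal r \<oplus> scal q"
  by (simp add: cscale_add_left)

lemma star_scal [simp]: "star A (scal r) = scal r"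
  by (simp add: star_cscale)

lemma scal_one: "scal 1 = \<one>"
  by (simp add: cscale_one)

text \<open>Spectrum-free positivity: a self-adjoint \<open>a\<close> has spectrum in \<open>[0, 2r]\<close> iff
  \<open>\<parallel>r - a\<parallel> \<le> r\<close>.\<close>

definition pos :: "'a \<Rightarrow> bool" where
  "pos a \<longleftrightarrow> a \<in> carrier A \<and> star A a = a \<and> (\<exists>r\<ge>0. nrm A (scal r \<ominus> a) \<le> r)"

lemma posD: "pos a \<Longrightarrow> a \<in> carrier A" "pos a \<Longrightarrow> star A a = a"
  by (auto simp: pos_def)

text \<open>An admissible radius may be enlarged, here by 1, so that later scalings can divide by
  it.\<close>

lemma posE:
  assumes "pos a"
  obtains r where "r > 0" "nrm A (scal r \<ominus> a) \<le> r"
proof -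
  obtain r where r: "r \<ge> 0" "nrm A (scal r \<ominus> a) \<le> r"
    using assms by (auto simp: pos_def)
  have "scal (r + 1) \<ominus> a = \<one> \<oplus> (scal r \<ominus> a)"
    using posD(1)[OF assms] cscale_closed[OF one_closed, of "complex_of_real r"]
    unfolding scal_add scal_one by algebra
  then have "nrm A (scal (r + 1) \<ominus> a) \<le> 1 + r"
    using nrm_triangle[of \<one> "scal r \<ominus> a"] nrm_one_le r posD(1)[OF assms] by simp
  then show thesis
    using r that[of "r + 1"] by simp
qed

lemma posI: "\<lbrakk>a \<in> carrier A; star A a = a; r \<ge> 0; nrm A (scal r \<ominus> a) \<le> r\<rbrakk> \<Longrightarrow> pos a"
  by (auto simp: pos_def)

lemma pos_add:
  assumes "pos a" "pos b"
  shows "pos (a \<oplus> b)"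
proof -
  note c = posD[OF assms(1)] posD[OF assms(2)]
  obtain r q where r: "r > 0" "nrm A (scal r \<ominus> a) \<le> r" "q > 0" "nrm A (scal q \<ominus> b) \<le> q"
    using assms by (meson posE)
  have "scal (r + q) \<ominus> (a \<oplus> b) = (scal r \<ominus> a) \<oplus> (scal q \<ominus> b)"
    using c(1,3) cscale_closed[OF one_closed, of "complex_of_real r"]
      cscale_closed[OF one_closed, of "complex_of_real q"] unfolding scal_add by algebra
  then have "nrm A (scal (r + q) \<ominus> (a \<oplus> b)) \<le> r + q"
    using nrm_triangle[of "scal r \<ominus> a" "scal q \<ominus> b"] r c by simp
  then show ?thesis
    using r c by (intro posI[of _ "r + q"]) (auto simp: star_add)
qed

lemma pos_cscale:
  assumes a: "pos a" and k: "k \<ge> 0"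
  shows "pos (cscale A (complex_of_real k) a)"
proof -
  note c = posD[OF a]
  obtain r where r: "r > 0" "nrm A (scal r \<ominus> a) \<le> r"
    using a by (meson posE)
  have "scal (k * r) \<ominus> cscale A k a = cscale A k (scal r \<ominus> a)"
    using c by (simp add: cscale_diff cscale_cscale)
  then have "nrm A (scal (k * r) \<ominus> cscale A k a) \<le> k * r"
    using k r c by (simp add: nrm_cscale mult_left_mono)
  then show ?thesis
    using r k c by (intro posI[of _ "k * r"]) (auto simp: star_cscale)
qed

text \<open>For \<open>h\<close> scaled to norm at most 1, \<open>norm_one_minus_square\<close> says
  that 1 is an admissible radius for the square. The extra 1 in \<open>r\<close> permits the scaling
  even for \<open>h = \<zero>\<close>.\<close>

lemma pos_square:
  assumes h: "h \<in> carrier A" "star A h = h"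
  shows "pos (h \<otimes> h)"
proof -
  define r where "r = nrm A h + 1"
  have r: "r > 0" using nrm_nonneg[OF h(1)] by (simp add: r_def)
  define k where "k = cscale A (complex_of_real (1 / r)) h"
  have k: "k \<in> carrier A" "star A k = k"
    using h by (auto simp: k_def star_cscale)
  have "nrm A k \<le> 1"
    using r nrm_nonneg[OF h(1)] h by (simp add: k_def nrm_cscale norm_divide r_def)
  then have "nrm A (\<one> \<ominus> k \<otimes> k) \<le> 1"
    using norm_one_minus_square k by blast
  moreover have "scal (r\<^sup>2) \<ominus> h \<otimes> h = cscale A (complex_of_real (r\<^sup>2)) (\<one> \<ominus> k \<otimes> k)"
    using k h r unfolding k_def
    by (simp add: cscale_diff mult_cscale_left mult_cscale_right cscale_cscale power2_eq_square cscale_one)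
  ultimately have "nrm A (scal (r\<^sup>2) \<ominus> h \<otimes> h) \<le> r\<^sup>2"
    using k by (simp add: nrm_cscale norm_power mult_left_le)
  then show ?thesis
    using h by (intro posI[of _ "r\<^sup>2"]) (auto simp: star_mult)
qed

lemma pos_one: "pos \<one>"
  using pos_square[of \<one>] by simp

text \<open>A root of \<open>a / r\<close> comes from \<open>sqrt_one_minus\<close> applied to
  \<open>\<one> - a / r\<close>, and the bound on \<open>\<one> \<ominus> s\<close> there is
  positivity of the root with radius 1. The commutation clause is kept because later arguments
  multiply the roots of two commuting elements.\<close>

lemma pos_sqrt:
  assumes a: "pos a"
  obtains s where "pos s" "s \<otimes> s = a"
    "\<And>z. z \<in> carrier A \<Longrightarrow> z \<otimes> a = a \<otimes> z \<Longrightarrow> z \<otimes> s = s \<otimes> z"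
proof -
  note c = posD[OF a]
  obtain r where r: "r > 0" "nrm A (scal r \<ominus> a) \<le> r"
    using a by (meson posE)
  define x where "x = cscale A (complex_of_real (1 / r)) (scal r \<ominus> a)"
  have x: "x \<in> carrier A" "star A x = x" "nrm A x \<le> 1"
    using c r by (auto simp: x_def star_cscale star_diff nrm_cscale norm_divide)
  have x_eq: "x = \<one> \<ominus> cscale A (complex_of_real (1 / r)) a"
    using c r by (simp add: x_def cscale_diff cscale_cscale cscale_one)
  obtain s where s: "s \<in> carrier A" "star A s = s" "s \<otimes> s = \<one> \<ominus> x" "nrm A (\<one> \<ominus> s) \<le> 1"
    and comm: "\<And>z. z \<in> carrier A \<Longrightarrow> z \<otimes> x = x \<otimes> z \<Longrightarrow> z \<otimes> s = s \<otimes> z"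
    using sqrt_one_minus[OF x] by metis
  define t where "t = cscale A (complex_of_real (sqrt r)) s"
  have ss: "s \<otimes> s = cscale A (complex_of_real (1 / r)) a"
    unfolding s(3) x_eq using c(1) cscale_closed[OF c(1)] by algebra
  show thesis
  proof (rule that[of t])
    have "scal (sqrt r) \<ominus> t = cscale A (complex_of_real (sqrt r)) (\<one> \<ominus> s)"
      using s by (simp add: t_def cscale_diff)
    then have "nrm A (scal (sqrt r) \<ominus> t) \<le> sqrt r"
      using s r by (simp add: nrm_cscale mult_left_le)
    then show "pos t"
      using s r by (intro posI[of _ "sqrt r"]) (auto simp: t_def star_cscale)
    have "complex_of_real (sqrt r) * (complex_of_real (sqrt r) * complex_of_real (1 / r)) = 1"
      using r by (simp flip: of_real_mult)
    then show "t \<otimes> t = a"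
      using s(1) c(1) by (simp add: t_def mult_cscale_left mult_cscale_right cscale_cscale ss cscale_one mult.assoc del: of_real_divide)
    show "z \<otimes> t = t \<otimes> z" if z: "z \<in> carrier A" "z \<otimes> a = a \<otimes> z" for z
    proof -
      have "z \<otimes> x = x \<otimes> z"
        using z c by (simp add: x_eq minus_eq r_distr l_distr r_minus l_minus mult_cscale_left mult_cscale_right)
      then show ?thesis
        using comm[of z] z s by (simp add: t_def mult_cscale_left mult_cscale_right)
    qed
  qed
qed

lemma pos_scal_diff:
  assumes "a \<in> carrier A" "star A a = a" "nrm A a \<le> r"
  shows "pos (scal r \<ominus> a)"
proof (rule posI[of _ r])
  have "scal r \<ominus> (scal r \<ominus> a) = a"
    using assms(1) cscale_closed[OF one_closed, of "complex_of_real r"] by algebra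
  then show "nrm A (scal r \<ominus> (scal r \<ominus> a)) \<le> r"
    using assms by simp
qed (use assms nrm_nonneg[of a] in \<open>auto simp: star_diff\<close>)

text \<open>For \<open>q > r\<close> the elements \<open>a\<close> and \<open>q - a\<close> have
  commuting roots \<open>t\<close> and \<open>s\<close>. Divided by \<open>sqrt q\<close>, their
  squares add up to the unit, so \<open>norm_le_one_of_sum_squares\<close> bounds \<open>t\<close>.
  Passing through \<open>q > r\<close> avoids a division by \<open>r = 0\<close>.\<close>

lemma pos_bound:
  assumes a: "pos a" and b: "pos (scal r \<ominus> a)" and r: "r \<ge> 0"
  shows "nrm A a \<le> r"
proof -
  have "nrm A a \<le> q" if q: "q > r" for q
  proof -
    have q0: "q > 0" using q r by simp
    note c = posD[OF a]
    have "pos (scal (q - r) \<oplus> (scal r \<ominus> a))"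
      using pos_add[OF pos_cscale[OF pos_one, of "q - r"] b] q by simp
    moreover have "scal (q - r) \<oplus> (scal r \<ominus> a) = scal q \<ominus> a"
      using scal_add[of "q - r" r] c by (simp add: minus_eq a_assoc)
    ultimately have p: "pos (scal q \<ominus> a)" by simp
    obtain t where t: "pos t" "t \<otimes> t = a"
      "\<And>z. z \<in> carrier A \<Longrightarrow> z \<otimes> a = a \<otimes> z \<Longrightarrow> z \<otimes> t = t \<otimes> z"
      using pos_sqrt[OF a] by metis
    obtain s where s: "pos s" "s \<otimes> s = scal q \<ominus> a"
      "\<And>z. z \<in> carrier A \<Longrightarrow> z \<otimes> (scal q \<ominus> a) = (scal q \<ominus> a) \<otimes> z \<Longrightarrow> z \<otimes> s = s \<otimes> z"
      using pos_sqrt[OF p] by metis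
    note st = posD[OF t(1)] posD[OF s(1)]
    have ta: "t \<otimes> a = a \<otimes> t"
      using t(2) st(1) by (metis m_assoc)
    then have "t \<otimes> (scal q \<ominus> a) = (scal q \<ominus> a) \<otimes> t"
      using st c by (simp add: minus_eq r_distr l_distr r_minus l_minus mult_cscale_left mult_cscale_right)
    then have ts: "t \<otimes> s = s \<otimes> t"
      using s(3) st by blast
    define k where "k = complex_of_real (1 / sqrt q)"
    have kk: "k * k = complex_of_real (1 / q)"
      using q0 by (simp add: k_def flip: of_real_mult)
    have "cscale A k t \<otimes> cscale A k t \<oplus> cscale A k s \<otimes> cscale A k s
        = cscale A (complex_of_real (1 / q)) (a \<oplus> (scal q \<ominus> a))"
      using st c by (simp add: mult_cscale_left mult_cscale_right cscale_cscale kk t(2) s(2) cscale_add_right)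
    also have "a \<oplus> (scal q \<ominus> a) = scal q"
      using c(1) cscale_closed[OF one_closed, of "complex_of_real q"] by algebra
    also have "cscale A (complex_of_real (1 / q)) (scal q) = \<one>"
      using q0 by (simp add: cscale_cscale cscale_one)
    finally have "nrm A (cscale A k t) \<le> 1"
      using norm_le_one_of_sum_squares[of "cscale A k t" "cscale A k s"] st ts
      by (simp add: star_cscale mult_cscale_left mult_cscale_right k_def)
    then have "nrm A t \<le> sqrt q"
      using st q0 by (simp add: nrm_cscale k_def norm_divide field_simps)
    then have "(nrm A t)\<^sup>2 \<le> q"
      using power_mono[of "nrm A t" "sqrt q" 2] q0 nrm_nonneg[of t] st by simp
    then show ?thesis
      using nrm_square_sa[of t] st t(2) by simp
  qed
  then show ?thesis
    by (rule dense_ge)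
qed

lemma pos_antisym:
  assumes "pos a" "pos (\<ominus> a)"
  shows "a = \<zero>"
proof -
  have "scal 0 \<ominus> a = \<ominus> a"
    using posD[OF assms(1)] by (simp add: minus_eq)
  then have "nrm A a \<le> 0"
    using pos_bound[of a 0] assms by simp
  then show ?thesis
    using nrm_eq_zero[of a] nrm_nonneg[of a] posD[OF assms(1)] by simp
qed

text \<open>Replaces \<open>sp (z\<^sup>* z) \<union> {0} = sp (z z\<^sup>*) \<union> {0}\<close>: with \<open>\<parallel>1 - z z\<^sup>*\<parallel> \<le> 1\<close>, the powers of
  \<open>1 - z\<^sup>* z\<close> are \<open>1 - z\<^sup>* g z\<close> with \<open>g\<close> a geometric sum in \<open>1 - z z\<^sup>*\<close>; they grow at most
  linearly, while the norms of the powers of exponent \<open>2\<^sup>k\<close> of a self-adjoint element grow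
  geometrically.\<close>

lemma pos_swap:
  assumes z: "z \<in> carrier A" and p: "pos (z \<otimes> star A z)"
  shows "pos (star A z \<otimes> z)"
proof -
  have main: "nrm A (\<one> \<ominus> star A w \<otimes> w) \<le> 1"
    if w: "w \<in> carrier A" "nrm A w \<le> 1" "pos (w \<otimes> star A w)" for w
  proof -
    define e e' where "e = \<one> \<ominus> star A w \<otimes> w" and "e' = \<one> \<ominus> w \<otimes> star A w"
    have ec [simp]: "e \<in> carrier A" "e' \<in> carrier A"
      using w by (auto simp: e_def e'_def)
    \<comment> \<open>The root serves to write \<open>e'\<close> as the unit minus a square, whence
      \<open>nrm A e' \<le> 1\<close>.\<close>
    obtain s where s: "pos s" "s \<otimes> s = w \<otimes> star A w"
      using pos_sqrt[OF w(3)] by metis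
    note sc = posD[OF s(1)]
    have "(nrm A s)\<^sup>2 \<le> 1\<^sup>2"
      using nrm_square_sa[OF sc] s(2) nrm_mult[of w "star A w"] w(1,2) nrm_nonneg[OF w(1)]
        mult_mono[of "nrm A w" 1 "nrm A w" 1] by simp
    then have "nrm A s \<le> 1"
      by (rule power2_le_imp_le) simp
    then have e'1: "nrm A e' \<le> 1"
      using norm_one_minus_square[OF sc] s(2) by (simp add: e'_def)
    define g where "g = rec_nat \<zero> (\<lambda>_ g. \<one> \<oplus> g \<otimes> e')"
    have g0: "g 0 = \<zero>" and gSuc: "g (Suc n) = \<one> \<oplus> g n \<otimes> e'" for n
      by (simp_all add: g_def)
    have gc [simp]: "g n \<in> carrier A" for n
      by (induction n) (auto simp: g0 gSuc)
    have gn: "nrm A (g n) \<le> real n" for n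
    proof (induction n)
      case (Suc n)
      have "nrm A (g n \<otimes> e') \<le> real n"
        using nrm_mult[of "g n" e'] Suc e'1 nrm_nonneg[of "g n"] nrm_nonneg[of e']
          mult_mono[of "nrm A (g n)" "real n" "nrm A e'" 1] by simp
      then show ?case
        using nrm_triangle[of \<one> "g n \<otimes> e'"] nrm_one_le by (simp add: gSuc)
    qed (simp add: g0)
    have pw: "e [^] n = \<one> \<ominus> star A w \<otimes> g n \<otimes> w" for n :: nat
    proof (induction n)
      case (Suc n)
      have "e [^] Suc n = (\<one> \<ominus> star A w \<otimes> g n \<otimes> w) \<otimes> e"
        using Suc by simp
      also have "\<dots> = \<one> \<ominus> star A w \<otimes> g (Suc n) \<otimes> w"
        unfolding gSuc e_def e'_def using w(1)
        by (simp add: minus_eq r_distr l_distr r_minus l_minus minus_add m_assoc a_assoc a_lcomm a_comm)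
      finally show ?case .
    qed (use w in \<open>simp add: g0 minus_eq\<close>)
    have bound: "nrm A (e [^] n) \<le> 1 + real n" for n :: nat
    proof -
      have "nrm A (star A w \<otimes> g n \<otimes> w) \<le> nrm A (star A w \<otimes> g n) * nrm A w"
        using w by (intro nrm_mult) auto
      also have "\<dots> \<le> (nrm A w * nrm A (g n)) * nrm A w"
        using nrm_mult[of "star A w" "g n"] w nrm_nonneg[of w] by (simp add: mult_right_mono)
      also have "\<dots> \<le> (1 * real n) * 1"
        using w gn[of n] nrm_nonneg[of w] nrm_nonneg[of "g n"] by (intro mult_mono) auto
      finally show ?thesis
        unfolding pw using nrm_diff_le[of \<one> "star A w \<otimes> g n \<otimes> w"] nrm_one_le w by simp
    qed
    have star_e: "star A e = e"
      using w by (simp add: e_def star_diff star_mult star_star)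
    have star_pow: "star A (e [^] n) = e [^] n" for n :: nat
    proof (induction n)
      case (Suc n)
      have "star A (e [^] Suc n) = e \<otimes> e [^] n"
        using Suc by (simp add: star_mult star_e)
      then show ?case
        using nat_pow_Suc2[OF ec(1)] by metis
    qed simp
    have "nrm A (e [^] (2 ^ k :: nat)) = nrm A e ^ 2 ^ k" for k
    proof (induction k)
      case (Suc k)
      have "e [^] (2 ^ Suc k :: nat) = e [^] (2 ^ k :: nat) \<otimes> e [^] (2 ^ k :: nat)"
        by (simp add: nat_pow_mult mult_2)
      then show ?case
        using nrm_square_sa[of "e [^] (2 ^ k :: nat)"] star_pow Suc
        by (simp add: power2_eq_square mult_2 power_add)
    qed simp
    then have growth: "nrm A e ^ 2 ^ k \<le> 1 + real (2 ^ k)" for k :: nat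
      using bound[of "2 ^ k"] by simp
    show ?thesis
    proof (rule ccontr)
      assume "\<not> nrm A (\<one> \<ominus> star A w \<otimes> w) \<le> 1"
      then have gt: "nrm A e > 1" by (simp add: e_def)
      have "filterlim (\<lambda>n. nrm A e ^ n - (1 + real n)) at_top at_top"
        using gt by real_asymp
      then have "\<forall>\<^sub>F n in at_top. nrm A e ^ n - (1 + real n) > 0"
        by (rule filterlim_at_top_dense[THEN iffD1, rule_format])
      moreover have "filterlim (\<lambda>k. 2 ^ k :: nat) at_top at_top"
        by (rule filterlim_subseq) (simp add: strict_mono_def)
      ultimately have "\<forall>\<^sub>F k in at_top. nrm A e ^ 2 ^ k - (1 + real (2 ^ k)) > 0"
        by (rule eventually_compose_filterlim)
      then show False
        using growth by (auto simp: eventually_at_top_linorder not_less[symmetric] dest!: spec)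
    qed
  qed
  define r where "r = nrm A z + 1"
  have r: "r > 0" using nrm_nonneg[OF z] by (simp add: r_def)
  define w where "w = cscale A (complex_of_real (1 / r)) z"
  have w: "w \<in> carrier A" "nrm A w \<le> 1"
    using z r nrm_nonneg[OF z] by (auto simp: w_def nrm_cscale norm_divide r_def)
  have ww: "w \<otimes> star A w = cscale A (complex_of_real (1 / r\<^sup>2)) (z \<otimes> star A z)"
    using z by (simp add: w_def star_cscale mult_cscale_left mult_cscale_right cscale_cscale power2_eq_square)
  have wp: "pos (w \<otimes> star A w)"
    unfolding ww by (rule pos_cscale[OF p]) simp
  have "pos (star A w \<otimes> w)"
    by (rule posI[of _ 1]) (use main[OF w wp] w in \<open>auto simp: star_mult star_star cscale_one\<close>)
  then have "pos (cscale A (complex_of_real (r\<^sup>2)) (star A w \<otimes> w))"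
    by (rule pos_cscale) simp
  moreover have "cscale A (complex_of_real (r\<^sup>2)) (star A w \<otimes> w) = star A z \<otimes> z"
    using z r by (simp add: w_def star_cscale mult_cscale_left mult_cscale_right cscale_cscale
        power2_eq_square cscale_one)
  ultimately show ?thesis by simp
qed

lemma Re_Im_decomposition:
  assumes "z \<in> carrier A"
  obtains a b where "a \<in> carrier A" "star A a = a" "nrm A a \<le> nrm A z"
    "b \<in> carrier A" "star A b = b" "nrm A b \<le> nrm A z"
    "z = a \<oplus> cscale A \<i> b" "star A z = a \<ominus> cscale A \<i> b"
    "a = cscale A (1/2) (z \<oplus> star A z)" "b = cscale A (1/2) (cscale A (-\<i>) z \<oplus> star A (cscale A (-\<i>) z))"
proof (rule that[of "cscale A (1/2) (z \<oplus> star A z)"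
      "cscale A (1/2) (cscale A (-\<i>) z \<oplus> star A (cscale A (-\<i>) z))"])
  note c = assms
  let ?a = "cscale A (1/2) (z \<oplus> star A z)"
  let ?b = "cscale A (1/2) (cscale A (-\<i>) z \<oplus> star A (cscale A (-\<i>) z))"
  show "?a \<in> carrier A" "?b \<in> carrier A"
    using c by auto
  show "star A ?a = ?a" "star A ?b = ?b"
    using c by (auto simp: star_cscale star_add star_star a_comm)
  show "nrm A ?a \<le> nrm A z"
    using nrm_triangle[of z "star A z"] c by (simp add: nrm_cscale)
  show "nrm A ?b \<le> nrm A z"
    using nrm_triangle[of "cscale A (-\<i>) z" "star A (cscale A (-\<i>) z)"] c by (simp add: nrm_cscale)
  have ib: "cscale A \<i> ?b = cscale A (1/2) z \<ominus> cscale A (1/2) (star A z)"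
    using c by (simp add: cscale_add_right star_cscale cscale_cscale minus_eq cscale_minus)
  have half: "cscale A (1/2) x \<oplus> cscale A (1/2) x = x" if "x \<in> carrier A" for x
    using cscale_add_left[OF that, of "1/2" "1/2"] that by (simp add: cscale_one)
  define p q where "p = cscale A (1/2) z" and "q = cscale A (1/2) (star A z)"
  have pq: "p \<in> carrier A" "q \<in> carrier A" "p \<oplus> p = z" "q \<oplus> q = star A z"
    using c half by (auto simp: p_def q_def)
  have eqs: "(p \<oplus> q) \<oplus> (p \<ominus> q) = p \<oplus> p" "(p \<oplus> q) \<ominus> (p \<ominus> q) = q \<oplus> q"
    using pq(1,2) by algebra+
  have a_eq: "?a = p \<oplus> q"
    using c by (simp add: cscale_add_right p_def q_def)
  have b_eq: "cscale A \<i> ?b = p \<ominus> q"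
    unfolding ib p_def q_def ..
  show "z = ?a \<oplus> cscale A \<i> ?b"
    unfolding a_eq b_eq by (rule trans[OF pq(3)[symmetric] eqs(1)[symmetric]])
  show "star A z = ?a \<ominus> cscale A \<i> ?b"
    unfolding a_eq b_eq by (rule trans[OF pq(4)[symmetric] eqs(2)[symmetric]])
qed (rule refl)+

text \<open>Kaplansky's argument. With \<open>h = y\<^sup>* y\<close>, \<open>k = \<bar>h\<bar>\<close> and \<open>f = k - h\<close>, the element \<open>z = y f\<close>
  has \<open>z\<^sup>* z = f h f = - k f\<^sup>2 \<le> 0\<close>, hence also \<open>z z\<^sup>* \<ge> 0\<close>, hence \<open>z\<^sup>* z \<ge> 0\<close> and \<open>z = 0\<close>,
  which forces \<open>f = 0\<close>.\<close>

theorem pos_star_mult: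
  assumes y: "y \<in> carrier A"
  shows "pos (star A y \<otimes> y)"
proof -
  define h where "h = star A y \<otimes> y"
  have h: "h \<in> carrier A" "star A h = h"
    using y by (auto simp: h_def star_mult star_star)
  obtain k where k: "pos k" "k \<otimes> k = h \<otimes> h"
    and kcomm: "\<And>z. z \<in> carrier A \<Longrightarrow> z \<otimes> (h \<otimes> h) = (h \<otimes> h) \<otimes> z \<Longrightarrow> z \<otimes> k = k \<otimes> z"
    using pos_sqrt[OF pos_square[OF h]] by metis
  note kc = posD[OF k(1)]
  have hk: "h \<otimes> k = k \<otimes> h"
    using kcomm[of h] h by (simp add: m_assoc)
  obtain c where c: "pos c" "c \<otimes> c = k"
    and ccomm: "\<And>z. z \<in> carrier A \<Longrightarrow> z \<otimes> k = k \<otimes> z \<Longrightarrow> z \<otimes> c = c \<otimes> z"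
    using pos_sqrt[OF k(1)] by metis
  note cc = posD[OF c(1)]
  \<comment> \<open>With \<open>k\<close> the absolute value of \<open>h\<close>, this is twice the
    negative part of \<open>h\<close>; the aim is to show that it vanishes.\<close>
  define f where "f = k \<ominus> h"
  have f: "f \<in> carrier A" "star A f = f"
    using h kc by (auto simp: f_def star_diff)
  \<comment> \<open>Uses \<open>k \<otimes> k = h \<otimes> h\<close> and commutation. At the end it
    turns \<open>f \<otimes> (k \<otimes> f) = \<zero>\<close> into the vanishing of the cube of
    \<open>f\<close>.\<close>
  have ff: "f \<otimes> f = k \<otimes> f \<oplus> k \<otimes> f"
  proof -
    have "f \<otimes> f = (k \<otimes> k \<oplus> h \<otimes> h) \<ominus> (k \<otimes> h \<oplus> h \<otimes> k)"
      unfolding f_def using h(1) kc(1) by algebra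
    also have "\<dots> = (k \<otimes> k \<oplus> k \<otimes> k) \<ominus> (k \<otimes> h \<oplus> k \<otimes> h)"
      using k(2) hk by simp
    also have "\<dots> = k \<otimes> f \<oplus> k \<otimes> f"
      unfolding f_def using h(1) kc(1) by algebra
    finally show ?thesis .
  qed
  have hf: "h \<otimes> f = \<ominus> (k \<otimes> f)"
  proof -
    have "h \<otimes> f = h \<otimes> k \<ominus> h \<otimes> h"
      unfolding f_def using h(1) kc(1) by algebra
    also have "\<dots> = k \<otimes> h \<ominus> k \<otimes> k"
      using k(2) hk by simp
    also have "\<dots> = \<ominus> (k \<otimes> f)"
      unfolding f_def using h(1) kc(1) by algebra
    finally show ?thesis .
  qed
  have kf: "k \<otimes> f = f \<otimes> k"
    using hk h(1) kc(1) by (simp add: f_def minus_eq r_distr l_distr r_minus l_minus)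
  have cf: "c \<otimes> f = f \<otimes> c"
    using ccomm[of f] kf f by simp
  \<comment> \<open>A self-adjoint element with square \<open>f \<otimes> (k \<otimes> f)\<close>,
    which exhibits that product as positive.\<close>
  define d where "d = c \<otimes> f"
  have d: "d \<in> carrier A" "star A d = d"
    using cc f cf by (auto simp: d_def star_mult)
  have dd: "d \<otimes> d = f \<otimes> (k \<otimes> f)"
  proof -
    have "d \<otimes> d = f \<otimes> (c \<otimes> c \<otimes> f)"
      unfolding d_def using cf cc(1) f(1) by (metis m_assoc m_closed)
    then show ?thesis using c(2) by simp
  qed
  define z where "z = y \<otimes> f"
  have z: "z \<in> carrier A" using y f by (simp add: z_def)
  have zz: "star A z \<otimes> z = \<ominus> (d \<otimes> d)"
  proof -
    have "star A z \<otimes> z = f \<otimes> (h \<otimes> f)"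
      using y f by (simp add: z_def star_mult h_def m_assoc)
    then show ?thesis
      unfolding hf dd using f kc by (simp add: r_minus)
  qed
  have neg: "pos (\<ominus> (star A z \<otimes> z))"
    unfolding zz using pos_square[OF d] d by simp
  obtain a b where ab: "a \<in> carrier A" "star A a = a" "b \<in> carrier A" "star A b = b"
    "z = a \<oplus> cscale A \<i> b" "star A z = a \<ominus> cscale A \<i> b"
    using Re_Im_decomposition[OF z] by metis
  \<comment> \<open>The sum is twice the sum of the squares of real and imaginary part, hence
    positive. Adding the positive element \<open>\<ominus> (star A z \<otimes> z)\<close> then
    isolates \<open>z \<otimes> star A z\<close>.\<close>
  have sum: "z \<otimes> star A z \<oplus> star A z \<otimes> z = (a \<otimes> a \<oplus> a \<otimes> a) \<oplus> (b \<otimes> b \<oplus> b \<otimes> b)"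
  proof -
    define w where "w = cscale A \<i> b"
    have w: "w \<in> carrier A" "w \<otimes> w = \<ominus> (b \<otimes> b)"
      using ab by (auto simp: w_def mult_cscale_left mult_cscale_right cscale_cscale a_inv_eq_cscale)
    have "z \<otimes> star A z \<oplus> star A z \<otimes> z = (a \<otimes> a \<oplus> a \<otimes> a) \<ominus> (w \<otimes> w \<oplus> w \<otimes> w)"
      unfolding ab(6) unfolding ab(5) w_def[symmetric] using ab(1) w(1) by algebra
    also have "\<dots> = (a \<otimes> a \<oplus> a \<otimes> a) \<oplus> (b \<otimes> b \<oplus> b \<otimes> b)"
      unfolding w(2) using ab(1,3) by algebra
    finally show ?thesis .
  qed
  have "pos (z \<otimes> star A z \<oplus> star A z \<otimes> z)"
    unfolding sum using pos_square ab by (intro pos_add) auto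
  then have "pos ((z \<otimes> star A z \<oplus> star A z \<otimes> z) \<oplus> \<ominus> (star A z \<otimes> z))"
    using neg by (rule pos_add)
  moreover have "(z \<otimes> star A z \<oplus> star A z \<otimes> z) \<oplus> \<ominus> (star A z \<otimes> z) = z \<otimes> star A z"
    using z star_closed[OF z] by algebra
  ultimately have "pos (z \<otimes> star A z)" by simp
  then have "pos (star A z \<otimes> z)"
    using pos_swap z by blast
  then have "star A z \<otimes> z = \<zero>"
    using neg pos_antisym by blast
  then have "f \<otimes> (k \<otimes> f) = \<zero>"
    unfolding zz dd using f kc by (metis m_closed minus_minus minus_zero)
  then have "f \<otimes> (f \<otimes> f) = \<zero>"
    unfolding ff using f kc by (simp add: r_distr)
  then have "(f \<otimes> f) \<otimes> (f \<otimes> f) = \<zero>"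
    using f by (simp add: m_assoc)
  then have "nrm A f ^ 4 = 0"
    using nrm_square_sa[of "f \<otimes> f"] nrm_square_sa[of f] f by (simp add: star_mult)
  then have "f = \<zero>"
    using nrm_eq_zero f by simp
  then have "k = h"
    using diff_eq_zero kc(1) h(1) by (simp add: f_def)
  then show ?thesis
    using k(1) by (simp add: h_def)
qed

text \<open>The roots of \<open>r - a\<close> and \<open>r + a\<close> commute, so
  \<open>r^2 - a^2\<close> is the square of their product and therefore positive; now
  \<open>pos_bound\<close> applies to \<open>a \<otimes> a\<close>.\<close>

lemma norm_le_of_pos_both:
  assumes a: "a \<in> carrier A" "star A a = a" and r: "r \<ge> 0"
    and p: "pos (scal r \<ominus> a)" and q: "pos (scal r \<oplus> a)"
  shows "nrm A a \<le> r"
proof -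
  obtain s where s: "pos s" "s \<otimes> s = scal r \<ominus> a"
    "\<And>z. z \<in> carrier A \<Longrightarrow> z \<otimes> (scal r \<ominus> a) = (scal r \<ominus> a) \<otimes> z \<Longrightarrow> z \<otimes> s = s \<otimes> z"
    using pos_sqrt[OF p] by metis
  obtain t where t: "pos t" "t \<otimes> t = scal r \<oplus> a"
    "\<And>z. z \<in> carrier A \<Longrightarrow> z \<otimes> (scal r \<oplus> a) = (scal r \<oplus> a) \<otimes> z \<Longrightarrow> z \<otimes> t = t \<otimes> z"
    using pos_sqrt[OF q] by metis
  note c = posD[OF s(1)] posD[OF t(1)]
  have as: "a \<otimes> s = s \<otimes> a"
    using s(3)[OF a(1)] a(1)
    by (simp add: minus_eq r_distr l_distr r_minus l_minus mult_cscale_left mult_cscale_right)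
  have "s \<otimes> (scal r \<oplus> a) = (scal r \<oplus> a) \<otimes> s"
    using as a(1) c by (simp add: r_distr l_distr mult_cscale_left mult_cscale_right)
  then have st: "s \<otimes> t = t \<otimes> s"
    using t(3) c by blast
  have "(s \<otimes> t) \<otimes> (s \<otimes> t) = (s \<otimes> s) \<otimes> (t \<otimes> t)"
    using st c(1,3) by (metis m_assoc m_closed)
  also have "\<dots> = (scal r \<ominus> a) \<otimes> (scal r \<oplus> a)"
    by (simp only: s(2) t(2))
  also have "\<dots> = scal r \<otimes> scal r \<ominus> a \<otimes> a"
    using a(1) by (intro mult_commute_diff_squares) (simp_all add: mult_cscale_left mult_cscale_right)
  also have "scal r \<otimes> scal r = scal (r\<^sup>2)"
    by (simp add: mult_cscale_left cscale_cscale power2_eq_square)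
  finally have "pos (scal (r\<^sup>2) \<ominus> a \<otimes> a)"
    using pos_square[of "s \<otimes> t"] c st by (simp add: star_mult)
  then have "(nrm A a)\<^sup>2 \<le> r\<^sup>2"
    using pos_bound[OF pos_square[OF a]] nrm_square_sa[OF a] by simp
  then show ?thesis
    using r by (rule power2_le_imp_le)
qed

end

text \<open>One direction is Kaplansky's theorem \<open>pos_star_mult\<close>, the other the
  self-adjoint root from \<open>pos_sqrt\<close>.\<close>

lemma positive_iff_pos:
  assumes "unital_cstar (A :: 'a cstar)"
  shows "positive A x \<longleftrightarrow> unital_cstar.pos A x"
proof -
  interpret unital_cstar A by fact
  show ?thesis
    using pos_star_mult pos_sqrt posD unfolding positive_def by metis
qed

section \<open>Sublinear functionals\<close>

definition sublinear :: "('a::real_vector \<Rightarrow> real) \<Rightarrow> bool" where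
  "sublinear p \<longleftrightarrow> (\<forall>x y. p (x + y) \<le> p x + p y) \<and> (\<forall>t x. 0 \<le> t \<longrightarrow> p (t *\<^sub>R x) = t * p x)"

lemma sublinearD:
  assumes "sublinear p"
  shows "p (x + y) \<le> p x + p y" "0 \<le> t \<Longrightarrow> p (t *\<^sub>R x) = t * p x" "p 0 = 0" "- p (- x) \<le> p x"
proof -
  show add: "p (x + y) \<le> p x + p y" and "0 \<le> t \<Longrightarrow> p (t *\<^sub>R x) = t * p x" for x y
    using assms by (auto simp: sublinear_def)
  have "p (0 *\<^sub>R 0) = 0 * p 0"
    using assms unfolding sublinear_def by (metis order_refl)
  then show p0: "p 0 = 0" by simp
  show "- p (- x) \<le> p x"
    using add[of x "- x"] p0 by simp
qed

lemma sublinearI: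
  assumes "\<And>x y. p (x + y) \<le> p x + p y" "p 0 = 0" "\<And>t x. 0 < t \<Longrightarrow> p (t *\<^sub>R x) \<le> t * p x"
  shows "sublinear p"
  unfolding sublinear_def
proof (intro conjI allI impI assms(1))
  fix t :: real and x assume t: "0 \<le> t"
  show "p (t *\<^sub>R x) = t * p x"
  proof (cases "t = 0")
    case False
    then have "p ((1 / t) *\<^sub>R (t *\<^sub>R x)) \<le> (1 / t) * p (t *\<^sub>R x)"
      using t by (intro assms(3)) auto
    then have "t * p x \<le> p (t *\<^sub>R x)"
      using t False by (simp add: field_simps)
    then show ?thesis
      using assms(3)[of t x] t False by simp
  qed (simp add: assms(2))
qed

text \<open>At \<open>x = - y\<close> the value is at most \<open>- p y\<close>. Hence every linear
  functional below \<open>reduce_along p y\<close> is at least \<open>p y\<close> at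
  \<open>y\<close>.\<close>

definition reduce_along :: "('a::real_vector \<Rightarrow> real) \<Rightarrow> 'a \<Rightarrow> 'a \<Rightarrow> real" where
  "reduce_along p y x = (INF t\<in>{0..}. p (x + t *\<^sub>R y) - t * p y)"

lemma reduce_along:
  assumes p: "sublinear p"
  shows "sublinear (reduce_along p y)"
    and "reduce_along p y x \<le> p x" and "reduce_along p y x \<le> p (x + y) - p y"
proof -
  let ?q = "reduce_along p y"
  have lower: "- p (- x) \<le> p (x + t *\<^sub>R y) - t * p y" if "t \<ge> 0" for x t
    using sublinearD(1)[OF p, of "x + t *\<^sub>R y" "- x"] sublinearD(2)[OF p that, of y] by simp
  have bdd: "bdd_below ((\<lambda>t. p (x + t *\<^sub>R y) - t * p y) ` {0..})" for x
    by (rule bdd_belowI[where m = "- p (- x)"]) (use lower in auto)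
  have le: "?q x \<le> p (x + t *\<^sub>R y) - t * p y" if "t \<ge> 0" for x t
    unfolding reduce_along_def using that by (intro cINF_lower[OF bdd]) auto
  have ge: "m \<le> ?q x" if "\<And>t. t \<ge> 0 \<Longrightarrow> m \<le> p (x + t *\<^sub>R y) - t * p y" for m x
    unfolding reduce_along_def using that by (intro cINF_greatest) auto
  show "?q x \<le> p x" "?q x \<le> p (x + y) - p y"
    using le[of 0 x] le[of 1 x] by simp_all
  show "sublinear ?q"
  proof (rule sublinearI)
    fix x x'
    have "?q (x + x') - ?q x \<le> p (x' + t' *\<^sub>R y) - t' * p y" if t': "t' \<ge> 0" for t'
    proof -
      have "?q (x + x') - (p (x' + t' *\<^sub>R y) - t' * p y) \<le> p (x + t *\<^sub>R y) - t * p y" if t: "t \<ge> 0" for t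
        using le[of "t + t'" "x + x'"] t t' sublinearD(1)[OF p, of "x + t *\<^sub>R y" "x' + t' *\<^sub>R y"]
        by (simp add: algebra_simps)
      then have "?q (x + x') - (p (x' + t' *\<^sub>R y) - t' * p y) \<le> ?q x"
        by (rule ge)
      then show ?thesis by simp
    qed
    then have "?q (x + x') - ?q x \<le> ?q x'"
      by (rule ge)
    then show "?q (x + x') \<le> ?q x + ?q x'" by simp
  next
    show "?q 0 = 0"
      using le[of 0 0] ge[of 0 0] sublinearD(2,3)[OF p] by simp
  next
    fix s :: real and x assume s: "0 < s"
    have "?q (s *\<^sub>R x) / s \<le> p (x + t *\<^sub>R y) - t * p y" if t: "t \<ge> 0" for t
    proof -
      have "?q (s *\<^sub>R x) \<le> p (s *\<^sub>R (x + t *\<^sub>R y)) - s * t * p y"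
        using le[of "s * t" "s *\<^sub>R x"] s t by (simp add: algebra_simps)
      also have "p (s *\<^sub>R (x + t *\<^sub>R y)) = s * p (x + t *\<^sub>R y)"
        using sublinearD(2)[OF p, of s] s by simp
      finally show ?thesis using s by (simp add: field_simps)
    qed
    then have "?q (s *\<^sub>R x) / s \<le> ?q x"
      by (rule ge)
    then show "?q (s *\<^sub>R x) \<le> s * ?q x"
      using s by (simp add: field_simps)
  qed
qed

text \<open>Subadditivity rests on the chain condition: given \<open>g\<close> for \<open>x\<close>
  and \<open>h\<close> for \<open>y\<close>, the smaller of the two serves both. The common lower
  bound \<open>- q (- x)\<close> keeps the infimum finite.\<close>

lemma chain_infimum_sublinear:
  assumes ne: "C \<noteq> {}" and sub: "\<And>g. g \<in> C \<Longrightarrow> sublinear g \<and> (\<forall>x. g x \<le> q x)"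
    and chain: "\<And>g h. g \<in> C \<Longrightarrow> h \<in> C \<Longrightarrow> (\<forall>x. g x \<le> h x) \<or> (\<forall>x. h x \<le> g x)"
  shows "sublinear (\<lambda>x. INF g\<in>C. g x)" "\<And>g x. g \<in> C \<Longrightarrow> (INF g\<in>C. g x) \<le> g x"
proof -
  let ?i = "\<lambda>x. INF g\<in>C. g x"
  have lower: "- q (- x) \<le> g x" if "g \<in> C" for g x
    using sublinearD(4)[of g x] sub[OF that] by (meson neg_le_iff_le order_trans)
  show le: "?i x \<le> g x" if "g \<in> C" for g x
    using that by (intro cINF_lower bdd_belowI[where m = "- q (- x)"]) (auto intro: lower)
  have ge: "m \<le> ?i x" if "\<And>g. g \<in> C \<Longrightarrow> m \<le> g x" for m x
    using ne that by (intro cINF_greatest) auto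
  show "sublinear ?i"
  proof (rule sublinearI)
    fix x y
    have "?i (x + y) - ?i x \<le> h y" if h: "h \<in> C" for h
    proof -
      have "?i (x + y) - h y \<le> g x" if g: "g \<in> C" for g
      proof (cases "\<forall>x. g x \<le> h x")
        case True
        then show ?thesis
          using le[OF g, of "x + y"] sublinearD(1)[OF conjunct1[OF sub[OF g]], of x y] spec[OF True, of y]
          by linarith
      next
        case False
        then have "h x \<le> g x" using chain[OF g h] by blast
        then show ?thesis
          using le[OF h, of "x + y"] sublinearD(1)[OF conjunct1[OF sub[OF h]], of x y] by linarith
      qed
      then have "?i (x + y) - h y \<le> ?i x" by (rule ge)
      then show ?thesis by simp
    qed
    then have "?i (x + y) - ?i x \<le> ?i y" by (rule ge)
    then show "?i (x + y) \<le> ?i x + ?i y" by simp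
  next
    have "g 0 = 0" if "g \<in> C" for g
      using sublinearD(3) sub[OF that] by blast
    then have "(\<lambda>g. g 0) ` C = {0}"
      using ne by force
    then show "?i 0 = 0" by simp
  next
    fix t :: real and x assume t: "0 < t"
    have "?i (t *\<^sub>R x) / t \<le> g x" if "g \<in> C" for g
      using le[OF that, of "t *\<^sub>R x"] sublinearD(2)[of g t x] sub[OF that] t by (simp add: field_simps)
    then have "?i (t *\<^sub>R x) / t \<le> ?i x" by (rule ge)
    then show "?i (t *\<^sub>R x) \<le> t * ?i x" using t by (simp add: field_simps)
  qed
qed

text \<open>A minimal sublinear functional \<open>p\<close> satisfies \<open>p = reduce_along p y\<close> for all \<open>y\<close>, which
  makes it additive.\<close>

lemma sublinear_dominates_linear:
  fixes p :: "'a::real_vector \<Rightarrow> real"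
  assumes p: "sublinear p"
  obtains f where "linear f" "\<And>x. f x \<le> p x" "f a = p a"
proof -
  \<comment> \<open>Searching below \<open>q\<close> instead of \<open>p\<close> forces the value of
    the resulting functional at \<open>a\<close>.\<close>
  define q where "q = reduce_along p a"
  define S where "S = {g. sublinear g \<and> (\<forall>x. g x \<le> q x)}"
  \<comment> \<open>The order is reversed: Zorn's lemma delivers maximal elements, and a minimal
    functional is wanted.\<close>
  define P :: "('a \<Rightarrow> real) \<Rightarrow> ('a \<Rightarrow> real) \<Rightarrow> bool" where "P g h \<longleftrightarrow> (\<forall>x. h x \<le> g x)" for g h
  have q: "sublinear q" "\<And>x. q x \<le> p x" "q (- a) \<le> - p a"
    using reduce_along[OF p, of a] sublinearD(3)[OF p] unfolding q_def
    by (auto, metis add.left_inverse diff_0)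
  have "\<exists>m\<in>S. \<forall>g\<in>S. P m g \<longrightarrow> g = m"
  proof (rule predicate_Zorn)
    show "partial_order_on S (relation_of P S)"
    proof (rule partial_order_on_relation_ofI)
      show "P g h \<Longrightarrow> P h k \<Longrightarrow> P g k" for g h k
        unfolding P_def by (meson order_trans)
      show "P g h \<Longrightarrow> P h g \<Longrightarrow> g = h" for g h
        unfolding P_def by (intro ext antisym) auto
    qed (simp add: P_def)
    fix C assume C: "C \<in> Chains (relation_of P S)"
    then have CS: "C \<subseteq> S" and chain: "\<And>g h. g \<in> C \<Longrightarrow> h \<in> C \<Longrightarrow> P g h \<or> P h g"
      by (auto simp: Chains_def relation_of_def)
    show "\<exists>u\<in>S. \<forall>g\<in>C. P g u"
    proof (cases "C = {}")
      case True
      then show ?thesis using q by (auto simp: S_def)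
    next
      case False
      have sub: "\<And>g. g \<in> C \<Longrightarrow> sublinear g \<and> (\<forall>x. g x \<le> q x)"
        using CS by (auto simp: S_def)
      have chain': "\<And>g h. g \<in> C \<Longrightarrow> h \<in> C \<Longrightarrow> (\<forall>x. g x \<le> h x) \<or> (\<forall>x. h x \<le> g x)"
        using chain unfolding P_def by blast
      have inf: "sublinear (\<lambda>x. INF g\<in>C. g x)" "\<And>g x. g \<in> C \<Longrightarrow> (INF g\<in>C. g x) \<le> g x"
        by (rule chain_infimum_sublinear[OF False], use sub chain' in auto)+
      obtain g where g: "g \<in> C" using False by blast
      have "(INF g\<in>C. g x) \<le> q x" for x
        using inf(2)[OF g, of x] sub[OF g] order_trans by blast
      then have "(\<lambda>x. INF g\<in>C. g x) \<in> S"
        using inf(1) by (simp add: S_def)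
      moreover have "\<forall>g\<in>C. P g (\<lambda>x. INF g\<in>C. g x)"
        using inf(2) by (simp add: P_def)
      ultimately show ?thesis by blast
    qed
  qed
  then obtain m where m: "sublinear m" "\<And>x. m x \<le> q x"
    and min: "\<And>g. sublinear g \<Longrightarrow> (\<And>x. g x \<le> m x) \<Longrightarrow> g = m"
  proof -
    from \<open>\<exists>m\<in>S. \<forall>g\<in>S. P m g \<longrightarrow> g = m\<close> obtain m where m: "m \<in> S" "\<And>g. g \<in> S \<Longrightarrow> P m g \<Longrightarrow> g = m"
      by blast
    have "g = m" if "sublinear g" "\<And>x. g x \<le> m x" for g
      using that m order_trans[OF that(2)] by (intro m(2)) (auto simp: S_def P_def)
    then show thesis
      using m(1) that by (auto simp: S_def)
  qed
  have add: "m (x + y) = m x + m y" for x y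
  proof -
    have "reduce_along m y = m"
      using reduce_along[OF m(1)] by (intro min) auto
    then have "m x \<le> m (x + y) - m y"
      using reduce_along(3)[OF m(1), of y x] by simp
    then show ?thesis
      using sublinearD(1)[OF m(1), of x y] by simp
  qed
  have neg: "m (- x) = - m x" for x
    using add[of x "- x"] sublinearD(3)[OF m(1)] by simp
  have "linear m"
  proof (rule linearI[OF add])
    fix t x
    show "m (t *\<^sub>R x) = t *\<^sub>R m x"
      using sublinearD(2)[OF m(1), of t x] sublinearD(2)[OF m(1), of "- t" x] neg[of "t *\<^sub>R x"]
      by (cases "t \<ge> 0") auto
  qed
  moreover have "m x \<le> p x" for x
    using m(2)[of x] q(2)[of x] by simp
  moreover have "m a = p a"
    using m(2)[of "- a"] q(3) neg[of a] calculation(2)[of a] by simp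
  ultimately show thesis by (rule that)
qed

section \<open>States of the coefficient algebra\<close>

interpretation cst: unital_cstar "cstar_of_type :: 'b::cstar_algebra cstar"
  by (rule unital_cstar_of_type)

lemma scaleC_one [simp]: "scaleC 1 x = (x :: 'b::cstar_algebra)"
  using scaleC_of_real[of 1 x] by simp

lemma scaleC_zero_left [simp]: "scaleC 0 x = (0 :: 'b::cstar_algebra)"
  using scaleC_of_real[of 0 x] by simp

lemma linear_scaleC: "linear (scaleC c :: 'b::cstar_algebra \<Rightarrow> 'b)"
  by (rule linearI) (simp_all add: scaleC_add_right scaleC_scaleC mult.commute flip: scaleC_of_real)

lemma scaleC_minus_left: "scaleC (- c) x = - scaleC c (x :: 'b::cstar_algebra)"
  using scaleC_add_left[of c "- c" x] by (simp add: eq_neg_iff_add_eq_0 add.commute)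

lemma adj_scaleR: "adj (r *\<^sub>R x) = r *\<^sub>R adj (x :: 'b::cstar_algebra)"
  by (simp flip: scaleC_of_real add: adj_scaleC)

lemma linear_adj: "linear (adj :: 'b::cstar_algebra \<Rightarrow> 'b)"
  by (rule linearI) (simp_all add: adj_add adj_scaleR)

lemmas adj_zero [simp] = linear_0[OF linear_adj]
  and adj_minus = linear_neg[OF linear_adj]
  and adj_diff = linear_diff[OF linear_adj]
  and adj_sum = linear_sum[OF linear_adj]

lemma adj_one [simp]: "adj 1 = (1 :: 'b::cstar_algebra)"
  by (metis adj_adj adj_mult mult_1 mult.right_neutral)

lemma norm_adj [simp]: "norm (adj x) = norm (x :: 'b::cstar_algebra)"
  using cst.nrm_star[of x] by (simp add: cstar_of_type_def)

lemma bounded_linear_adj: "bounded_linear (adj :: 'b::cstar_algebra \<Rightarrow> 'b)"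
  using linear_adj by (auto simp: bounded_linear_def bounded_linear_axioms_def intro!: exI[of _ 1])

definition psd :: "'b::cstar_algebra \<Rightarrow> bool" where
  "psd a \<longleftrightarrow> (\<exists>y. a = adj y * y)"

lemma psd_iff_pos: "psd a \<longleftrightarrow> cst.pos (a :: 'b::cstar_algebra)"
  using positive_iff_pos[OF unital_cstar_of_type, of a]
  by (simp add: positive_def psd_def cstar_of_type_def)

lemma psd_star_mult [simp]: "psd (adj y * y)"
  by (auto simp: psd_def)

lemma psd_adj: "psd a \<Longrightarrow> adj a = a"
  by (auto simp: psd_def adj_mult adj_adj)

lemma psd_add: "psd a \<Longrightarrow> psd b \<Longrightarrow> psd (a + b)"
  using cst.pos_add[of a b] by (simp add: psd_iff_pos) (simp add: cstar_of_type_def)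

lemma psd_scaleR: "psd a \<Longrightarrow> 0 \<le> k \<Longrightarrow> psd (k *\<^sub>R a)"
  using cst.pos_cscale[of a k] by (simp add: psd_iff_pos) (simp add: cstar_of_type_def scaleC_of_real)

lemma psd_antisym: "psd a \<Longrightarrow> psd (- a) \<Longrightarrow> a = 0"
proof -
  assume a: "psd a" "psd (- a)"
  have "\<ominus>\<^bsub>cstar_of_type\<^esub> a = - a"
    using a_minus_cstar_of_type[of 0 a] by (simp add: a_minus_def) (simp add: cstar_of_type_def)
  then show ?thesis
    using cst.pos_antisym[of a] a by (simp add: psd_iff_pos) (simp add: cstar_of_type_def)
qed

lemma psd_norm_diff: "adj a = a \<Longrightarrow> norm a \<le> r \<Longrightarrow> psd (r *\<^sub>R 1 - a)"
  using cst.pos_scal_diff[of a r]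
  by (simp add: psd_iff_pos a_minus_cstar_of_type) (simp add: cstar_of_type_def scaleC_of_real)

lemma norm_le_of_psd:
  assumes "adj a = a" "0 \<le> r" "psd (r *\<^sub>R 1 - a)" "psd (r *\<^sub>R 1 + a)"
  shows "norm a \<le> r"
  using cst.norm_le_of_pos_both[of a r] assms
  by (simp add: psd_iff_pos a_minus_cstar_of_type) (simp add: cstar_of_type_def scaleC_of_real)

text \<open>Real parts of states: a state \<open>\<mu>\<close> is recovered from \<open>f = Re \<mu>\<close> as
  \<open>\<mu> x = f x + \<i> f (- \<i> x)\<close>.\<close>

definition real_states :: "('b::cstar_algebra \<Rightarrow> real) set" where
  "real_states = {f. linear f \<and> f 1 = 1 \<and> (\<forall>y. 0 \<le> f (adj y * y)) \<and> (\<forall>x. f (adj x) = f x)}"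

text \<open>The maximum of the spectrum of the real part of \<open>x\<close>. Linear functionals
  dominated by it turn out to be the real parts of states, which makes it the right bound for a
  Hahn-Banach argument.\<close>

definition upper_bound :: "'b::cstar_algebra \<Rightarrow> real" where
  "upper_bound x = Inf {r. psd (r *\<^sub>R 1 - (1/2) *\<^sub>R (x + adj x))}"

text \<open>Boundedness below and nonemptiness give the infimum in \<open>upper_bound\<close> its
  meaning. An \<open>r\<close> below \<open>- norm a\<close> would make a negative multiple of 1
  positive, which \<open>psd_antisym\<close> excludes since \<open>1 \<noteq> 0\<close> in the
  class.\<close>

lemma upper_bound_aux:
  fixes x :: "'b::cstar_algebra"
  shows "bdd_below {r. psd (r *\<^sub>R 1 - (1/2) *\<^sub>R (x + adj x))}" (is "bdd_below ?S")
    and "psd (norm ((1/2) *\<^sub>R (x + adj x)) *\<^sub>R 1 - (1/2) *\<^sub>R (x + adj x))"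
proof -
  define a where "a = (1/2) *\<^sub>R (x + adj x)"
  have a: "adj a = a" by (simp add: a_def adj_scaleR adj_add adj_adj add.commute)
  show "psd (norm ((1/2) *\<^sub>R (x + adj x)) *\<^sub>R 1 - (1/2) *\<^sub>R (x + adj x))"
    using psd_norm_diff[OF a order_refl] by (simp add: a_def)
  have "- norm a \<le> r" if r: "psd (r *\<^sub>R 1 - a)" for r
  proof (rule ccontr)
    assume "\<not> - norm a \<le> r"
    then have d: "r + norm a < 0" by simp
    have "psd (norm a *\<^sub>R 1 + a)"
      using psd_norm_diff[of "- a" "norm a"] a by (simp add: adj_minus)
    then have "psd ((r + norm a) *\<^sub>R (1 :: 'b))"
      using psd_add[OF r, of "norm a *\<^sub>R 1 + a"] by (simp add: algebra_simps)
    moreover have "psd (- ((r + norm a) *\<^sub>R (1 :: 'b)))"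
      using psd_scaleR[of "1 :: 'b" "- (r + norm a)"] psd_star_mult[of "1 :: 'b"] d
      by (simp add: algebra_simps)
    ultimately have "(r + norm a) *\<^sub>R (1 :: 'b) = 0"
      by (rule psd_antisym)
    then show False using d by simp
  qed
  then show "bdd_below ?S"
    by (intro bdd_belowI[where m = "- norm a"]) (auto simp: a_def)
qed

lemma upper_bound_le:
  "psd (r *\<^sub>R 1 - (1/2) *\<^sub>R (x + adj x)) \<Longrightarrow> upper_bound x \<le> r"
  unfolding upper_bound_def by (intro cInf_lower upper_bound_aux) simp

text \<open>The admissible \<open>r\<close> form an upward closed set, so everything strictly above
  the infimum is admissible and no attainment has to be shown.\<close>

lemma upper_bound_less:
  assumes "upper_bound x < r"
  shows "psd (r *\<^sub>R 1 - (1/2) *\<^sub>R (x + adj x))"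
proof -
  have "{r. psd (r *\<^sub>R 1 - (1/2) *\<^sub>R (x + adj x))} \<noteq> {}"
    using upper_bound_aux(2)[of x] by blast
  from cInf_lessD[OF this assms[unfolded upper_bound_def]]
  obtain q where q: "psd (q *\<^sub>R 1 - (1/2) *\<^sub>R (x + adj x))" "q < r"
    by auto
  have "psd ((r - q) *\<^sub>R 1)"
    using psd_scaleR[of 1 "r - q"] psd_star_mult[of 1] q by simp
  from psd_add[OF this q(1)] show ?thesis
    by (simp add: algebra_simps)
qed

lemma sublinear_upper_bound: "sublinear (upper_bound :: 'b::cstar_algebra \<Rightarrow> real)"
proof (rule sublinearI)
  fix x y :: 'b
  show "upper_bound (x + y) \<le> upper_bound x + upper_bound y"
  proof (rule field_le_epsilon)
    fix e :: real assume "0 < e"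
    then have "psd ((upper_bound x + e/2) *\<^sub>R 1 - (1/2) *\<^sub>R (x + adj x))"
      "psd ((upper_bound y + e/2) *\<^sub>R 1 - (1/2) *\<^sub>R (y + adj y))"
      by (auto intro: upper_bound_less)
    from psd_add[OF this] show "upper_bound (x + y) \<le> upper_bound x + upper_bound y + e"
      by (intro upper_bound_le) (simp add: algebra_simps adj_add flip: scaleR_add_left)
  qed
next
  have "upper_bound (0::'b) \<le> 0"
    using psd_star_mult[of "0::'b"] by (intro upper_bound_le) simp
  moreover have "\<not> upper_bound (0::'b) < 0"
  proof
    assume neg: "upper_bound (0::'b) < 0"
    obtain r where r: "upper_bound (0::'b) < r" "r < 0"
      using dense[OF neg] by blast
    then have "psd (r *\<^sub>R (1::'b))" using upper_bound_less[of "0::'b" r] by simp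
    moreover have "psd (- (r *\<^sub>R (1 :: 'b)))"
      using psd_scaleR[of "1 :: 'b" "- r"] psd_star_mult[of "1 :: 'b"] r by simp
    ultimately have "r *\<^sub>R (1 :: 'b) = 0" by (rule psd_antisym)
    then show False using r by simp
  qed
  ultimately show "upper_bound (0::'b) = 0" by simp
next
  fix t :: real and x :: 'b assume t: "0 < t"
  show "upper_bound (t *\<^sub>R x) \<le> t * upper_bound x"
  proof (rule field_le_epsilon)
    fix e :: real assume "0 < e"
    then have "psd ((upper_bound x + e/t) *\<^sub>R 1 - (1/2) *\<^sub>R (x + adj x))"
      using t by (intro upper_bound_less) auto
    from psd_scaleR[OF this, of t] t show "upper_bound (t *\<^sub>R x) \<le> t * upper_bound x + e"
      by (intro upper_bound_le) (simp add: algebra_simps adj_scaleR)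
  qed
qed

text \<open>Domination is tested on few elements: 1 and -1 fix \<open>f 1\<close>,
  \<open>- (adj y * y)\<close> gives positivity, and \<open>x - adj x\<close>, whose real part is 0,
  gives invariance under \<open>adj\<close>.\<close>

lemma dominated_real_state:
  fixes f :: "'b::cstar_algebra \<Rightarrow> real"
  assumes f: "linear f" "\<And>x. f x \<le> upper_bound x"
  shows "f \<in> real_states"
proof -
  have "psd (0::'b)"
    using psd_star_mult[of "0::'b"] by simp
  then have "upper_bound (1::'b) \<le> 1" "upper_bound (- 1 :: 'b) \<le> - 1"
    by (auto intro!: upper_bound_le simp only: adj_minus adj_one scaleR_half_double) simp_all
  then have one: "f 1 = 1"
    using f(2)[of 1] f(2)[of "- 1"] linear_neg[OF f(1), of 1] by simp
  have pos: "0 \<le> f (adj y * y)" for y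
  proof -
    have "upper_bound (- (adj y * y)) \<le> 0"
    proof (rule upper_bound_le)
      have "(1/2) *\<^sub>R (- (adj y * y) + adj (- (adj y * y))) = - (adj y * y)"
        by (simp only: adj_minus adj_mult adj_adj scaleR_half_double)
      then show "psd (0 *\<^sub>R 1 - (1/2) *\<^sub>R (- (adj y * y) + adj (- (adj y * y))))"
        by (simp only:) simp
    qed
    then show ?thesis
      using f(2)[of "- (adj y * y)"] linear_neg[OF f(1), of "adj y * y"] by linarith
  qed
  have skew: "f (x - adj x) \<le> 0" for x
  proof -
    have "upper_bound (x - adj x) \<le> 0"
      by (rule upper_bound_le) (use psd_star_mult[of 0] in \<open>simp add: adj_diff adj_adj\<close>)
    then show ?thesis using f(2)[of "x - adj x"] by linarith
  qed
  have "f (adj x) = f x" for x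
    using skew[of x] skew[of "adj x"] linear_diff[OF f(1)] by (simp add: adj_adj)
  then show ?thesis
    using f(1) one pos by (simp add: real_states_def)
qed

text \<open>If \<open>upper_bound a\<close> and \<open>upper_bound (- a)\<close> were both below
  \<open>norm a\<close>, some \<open>r < norm a\<close> would bound \<open>a\<close> from both
  sides, contradicting \<open>norm_le_of_psd\<close>. A linear functional that touches
  \<open>upper_bound\<close> at \<open>a\<close> or at \<open>- a\<close> is the state
  sought.\<close>

lemma norming_real_state:
  fixes a :: "'b::cstar_algebra"
  assumes a: "adj a = a"
  obtains f where "f \<in> real_states" "\<bar>f a\<bar> = norm a"
proof -
  have half: "(1/2) *\<^sub>R (a + adj a) = a"
    using a by (simp flip: scaleR_2)
  have le: "upper_bound a \<le> norm a" "upper_bound (- a) \<le> norm a"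
    using psd_norm_diff[of a "norm a"] psd_norm_diff[of "- a" "norm a"] a half
    by (auto intro!: upper_bound_le simp: adj_minus simp flip: scaleR_2)
  have "upper_bound a = norm a \<or> upper_bound (- a) = norm a"
  proof (rule ccontr)
    assume "\<not> ?thesis"
    then have "upper_bound a < norm a" "upper_bound (- a) < norm a"
      using le by auto
    then obtain r where r: "upper_bound a < r" "upper_bound (- a) < r" "r < norm a"
      using dense[of "max (upper_bound a) (upper_bound (- a))" "norm a"] by auto
    have "0 = upper_bound (a + - a)"
      using sublinearD(3)[OF sublinear_upper_bound] by simp
    also have "\<dots> < 2 * r"
      using sublinearD(1)[OF sublinear_upper_bound, of a "- a"] r by simp
    finally have "0 \<le> r" by simp
    have "psd (r *\<^sub>R 1 - a)" "psd (r *\<^sub>R 1 + a)"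
      using upper_bound_less[OF r(1)] upper_bound_less[OF r(2)] half a
      by (simp_all add: adj_minus flip: scaleR_2)
    then have "norm a \<le> r"
      using norm_le_of_psd[OF a \<open>0 \<le> r\<close>] by simp
    then show False using r by simp
  qed
  then obtain b where b: "b = a \<or> b = - a" "upper_bound b = norm a"
    by blast
  obtain f where f: "linear f" "\<And>x. f x \<le> upper_bound x" "f b = upper_bound b"
    using sublinear_dominates_linear[OF sublinear_upper_bound, of b] by metis
  have "\<bar>f a\<bar> = norm a"
    using b f(3) linear_neg[OF f(1), of a] by (metis abs_minus_cancel abs_norm_cancel)
  then show thesis
    using dominated_real_state[OF f(1,2)] that by blast
qed

lemma real_stateD:
  assumes "f \<in> real_states"
  shows "linear f" "f 1 = 1" "0 \<le> f (adj y * y)" "f (adj x) = f x"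
  using assms by (auto simp: real_states_def)

lemma real_state_psd: "f \<in> real_states \<Longrightarrow> psd a \<Longrightarrow> 0 \<le> f a"
  by (auto simp: psd_def real_stateD)

lemma real_state_le_norm:
  assumes f: "f \<in> real_states"
  shows "\<bar>f x\<bar> \<le> norm x"
proof -
  note l = real_stateD(1)[OF f]
  define a where "a = (1/2) *\<^sub>R (x + adj x)"
  have a: "adj a = a" by (simp add: a_def adj_scaleR adj_add adj_adj add.commute)
  have "norm a \<le> norm x"
    using norm_triangle_ineq[of x "adj x"] by (simp add: a_def)
  moreover have "f a = f x"
    using real_stateD(4)[OF f, of x] by (simp add: a_def linear_scale[OF l] linear_add[OF l])
  moreover have "0 \<le> f (norm a *\<^sub>R 1 - a)" "0 \<le> f (norm a *\<^sub>R 1 - (- a))"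
    using a by (intro real_state_psd[OF f] psd_norm_diff; simp add: adj_minus)+
  then have "\<bar>f a\<bar> \<le> norm a"
    using real_stateD(2)[OF f] by (simp add: linear_scale[OF l] linear_add[OF l] linear_diff[OF l])
  ultimately show ?thesis by simp
qed

lemma bounded_linear_real_state: "f \<in> real_states \<Longrightarrow> bounded_linear f"
  using real_stateD(1)[of f] real_state_le_norm[of f]
  by (auto simp: bounded_linear_def bounded_linear_axioms_def intro!: exI[of _ 1])

section \<open>Quadratic estimates tested on states\<close>

definition sq :: "'b::cstar_algebra \<Rightarrow> 'b" where
  "sq a = adj a * a"

lemma adj_sq [simp]: "adj (sq a) = sq a"
  by (simp add: sq_def adj_mult adj_adj)

lemma norm_sq: "norm (sq a) = (norm a)\<^sup>2"
  by (simp add: sq_def cstar_identity)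

lemma sq_scaleC: "sq (scaleC c a) = (cmod c)\<^sup>2 *\<^sub>R sq a"
  unfolding scaleC_of_real[symmetric] complex_norm_square
  by (simp add: sq_def adj_scaleC mult_scaleC_left mult_scaleC_right scaleC_scaleC)

lemma sq_zero [simp]: "sq 0 = 0"
  by (simp add: sq_def)

lemma sq_minus [simp]: "sq (- a) = sq a"
  by (simp add: sq_def adj_minus)

lemma real_state_sq_nonneg [simp]: "f \<in> real_states \<Longrightarrow> 0 \<le> f (sq a)"
  by (simp add: sq_def real_stateD)

lemma real_state_sq_diff:
  assumes "f \<in> real_states"
  shows "f (sq (a - b)) = f (sq a) + f (sq b) - 2 * f (adj a * b)"
proof -
  note l = real_stateD(1)[OF assms]
  have "f (adj b * a) = f (adj a * b)"
    using real_stateD(4)[OF assms, of "adj a * b"] by (simp add: adj_mult adj_adj)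
  then show ?thesis
    by (simp add: sq_def adj_diff algebra_simps linear_add[OF l] linear_diff[OF l])
qed

text \<open>Cauchy-Schwarz, from the nonnegative double sum of \<open>f (sq (v m - v k))\<close>.
  The constant \<open>card M\<close> is sharp, and the contractivity of the transfer map depends on
  that.\<close>

lemma real_state_sq_sum_le:
  assumes f: "f \<in> real_states"
  shows "f (sq (\<Sum>m\<in>M. v m)) \<le> real (card M) * (\<Sum>m\<in>M. f (sq (v m)))"
proof -
  note l = real_stateD(1)[OF f]
  have "0 \<le> (\<Sum>m\<in>M. \<Sum>k\<in>M. f (sq (v m - v k)))"
    using f by (intro sum_nonneg) simp
  also have "\<dots> = 2 * real (card M) * (\<Sum>m\<in>M. f (sq (v m))) - 2 * (\<Sum>m\<in>M. \<Sum>k\<in>M. f (adj (v m) * v k))"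
    by (simp add: real_state_sq_diff[OF f] sum.distrib sum_subtractf sum_distrib_left mult.assoc)
  also have "(\<Sum>m\<in>M. \<Sum>k\<in>M. f (adj (v m) * v k)) = f (sq (\<Sum>m\<in>M. v m))"
    by (simp add: sq_def adj_sum sum_product linear_sum[OF l])
  finally show ?thesis by simp
qed

lemma real_state_sq_add_le:
  assumes f: "f \<in> real_states"
  shows "f (sq (a + b)) \<le> 2 * f (sq a) + 2 * f (sq b)"
  using real_state_sq_sum_le[OF f, of "\<lambda>m. if m then a else b" UNIV] by (simp add: UNIV_bool add.commute)

text \<open>The element \<open>norm b - b\<close> is positive, hence of the form
  \<open>adj s * s\<close>, and conjugation by \<open>c\<close> keeps this form.\<close>

lemma real_state_conj_le:
  assumes f: "f \<in> real_states" and b: "adj b = b"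
  shows "f (adj c * b * c) \<le> norm b * f (sq c)"
proof -
  note l = real_stateD(1)[OF f]
  obtain s where s: "norm b *\<^sub>R 1 - b = adj s * s"
    using psd_norm_diff[OF b order_refl] by (auto simp: psd_def)
  have "0 \<le> f (adj (s * c) * (s * c))"
    by (rule real_stateD(3)[OF f])
  also have "adj (s * c) * (s * c) = adj c * (norm b *\<^sub>R 1 - b) * c"
    by (simp add: s adj_mult mult.assoc)
  also have "\<dots> = norm b *\<^sub>R sq c - adj c * b * c"
    by (simp add: sq_def algebra_simps)
  finally show ?thesis
    by (simp add: linear_diff[OF l] linear_scale[OF l])
qed

lemma real_state_sq_mult_le:
  assumes f: "f \<in> real_states"
  shows "f (sq (b * c)) \<le> (norm b)\<^sup>2 * f (sq c)"
  using real_state_conj_le[OF f, of "sq b" c] by (simp add: norm_sq) (simp add: sq_def adj_mult mult.assoc)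

lemma norm_le_of_real_states:
  assumes "adj a = a" "\<And>f. f \<in> real_states \<Longrightarrow> \<bar>f a\<bar> \<le> r"
  shows "norm a \<le> r"
  using norming_real_state[OF assms(1)] assms(2) by metis

text \<open>Real states see only the real part of an element; testing \<open>- i a\<close> as well
  covers the imaginary part. The factor 2 does no harm where only smallness is at stake.\<close>

lemma norm_le_2_of_real_states:
  assumes "\<And>f. f \<in> real_states \<Longrightarrow> \<bar>f a\<bar> \<le> r" "\<And>f. f \<in> real_states \<Longrightarrow> \<bar>f (scaleC (- \<i>) a)\<bar> \<le> r"
  shows "norm a \<le> 2 * r"
proof -
  have re: "norm ((1/2) *\<^sub>R (b + adj b)) \<le> r" if "\<And>f. f \<in> real_states \<Longrightarrow> \<bar>f b\<bar> \<le> r" for b :: 'a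
  proof (rule norm_le_of_real_states)
    fix f :: "'a \<Rightarrow> real" assume f: "f \<in> real_states"
    show "\<bar>f ((1/2) *\<^sub>R (b + adj b))\<bar> \<le> r"
      using that[OF f] real_stateD(4)[OF f, of b]
      by (simp add: linear_scale[OF real_stateD(1)[OF f]] linear_add[OF real_stateD(1)[OF f]])
  qed (simp add: adj_scaleR adj_add adj_adj add.commute)
  define b where "b = scaleC (- \<i>) a"
  have "scaleC \<i> ((1/2) *\<^sub>R (b + adj b)) = (1/2) *\<^sub>R (a - adj a)"
    by (simp add: b_def adj_scaleC linear_scale[OF linear_scaleC] scaleC_add_right scaleC_scaleC scaleC_minus_left
        adj_minus linear_diff[OF linear_scaleC] linear_neg[OF linear_scaleC])
  then have "a = (1/2) *\<^sub>R (a + adj a) + scaleC \<i> ((1/2) *\<^sub>R (b + adj b))"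
    by (simp add: algebra_simps flip: scaleR_add_left)
  then have "norm a \<le> norm ((1/2) *\<^sub>R (a + adj a)) + norm (scaleC \<i> ((1/2) *\<^sub>R (b + adj b)))"
    by (metis norm_triangle_ineq)
  also have "\<dots> \<le> r + r"
    using re[of a] re[of b] assms by (intro add_mono) (auto simp: norm_scaleC b_def)
  finally show ?thesis by simp
qed

section \<open>Automorphisms\<close>

lemma star_automorphismD:
  assumes "star_automorphism \<beta>"
  shows "bij \<beta>" "\<beta> (x + y) = \<beta> x + \<beta> y" "\<beta> (scaleC c x) = scaleC c (\<beta> x)" "\<beta> (x * y) = \<beta> x * \<beta> y"
    "\<beta> (adj x) = adj (\<beta> x)" "\<beta> 1 = 1" "linear \<beta>"
proof -
  show *: "bij \<beta>" "\<And>x y. \<beta> (x + y) = \<beta> x + \<beta> y" "\<And>c x. \<beta> (scaleC c x) = scaleC c (\<beta> x)"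
    "\<And>x y. \<beta> (x * y) = \<beta> x * \<beta> y" "\<And>x. \<beta> (adj x) = adj (\<beta> x)"
    using assms by (auto simp: star_automorphism_def)
  obtain e where "\<beta> e = 1" using *(1) by (metis bij_pointE)
  then show "\<beta> 1 = 1" using *(4)[of e 1] by simp
  show "linear \<beta>"
    by (rule linearI) (use * in \<open>simp_all flip: scaleC_of_real\<close>)
qed

text \<open>Continuity is automatic: positivity is preserved, and applied to
  \<open>norm (adj x * x)\<close> minus and plus \<open>adj x * x\<close> this bounds the image of
  \<open>adj x * x\<close>. The C*-identity does the rest.\<close>

lemma star_automorphism_norm_le:
  assumes \<beta>: "star_automorphism \<beta>"
  shows "norm (\<beta> x) \<le> norm x"
proof -
  note l = star_automorphismD(7)[OF \<beta>]
  note d = star_automorphismD(1-6)[OF \<beta>]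
  have psd: "psd (\<beta> a)" if "psd a" for a
    using that by (auto simp: psd_def d)
  have "norm (\<beta> (adj x * x)) \<le> norm (adj x * x)"
  proof (rule norm_le_of_psd)
    have "psd (\<beta> (norm (adj x * x) *\<^sub>R 1 - adj x * x))" "psd (\<beta> (norm (adj x * x) *\<^sub>R 1 - (- (adj x * x))))"
      by (intro psd psd_norm_diff; simp add: adj_mult adj_adj adj_minus)+
    then show "psd (norm (adj x * x) *\<^sub>R 1 - \<beta> (adj x * x))" "psd (norm (adj x * x) *\<^sub>R 1 + \<beta> (adj x * x))"
      by (simp_all add: linear_diff[OF l] linear_add[OF l] linear_scale[OF l] d(6))
  qed (auto simp: d adj_mult adj_adj)
  then have "(norm (\<beta> x))\<^sup>2 \<le> (norm x)\<^sup>2"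
    by (simp add: d cstar_identity)
  then show ?thesis by (rule power2_le_imp_le) simp
qed

lemma star_automorphism_inv:
  assumes "star_automorphism \<beta>"
  shows "star_automorphism (inv_into UNIV \<beta>)"
proof -
  note d = star_automorphismD[OF assms]
  note i = inv_f_f[OF bij_is_inj[OF d(1)]] and s = surj_f_inv_f[OF bij_is_surj[OF d(1)]]
  have eqI: "inv_into UNIV \<beta> u = v" if "u = \<beta> v" for u v
    using that i by simp
  show ?thesis
    unfolding star_automorphism_def using bij_imp_bij_inv[OF d(1)]
    by (auto intro!: eqI simp: d(2-5) s)
qed

lemma star_automorphism_norm [simp]:
  assumes "star_automorphism \<beta>"
  shows "norm (\<beta> x) = norm x"
  using star_automorphism_norm_le[OF assms, of x]
    star_automorphism_norm_le[OF star_automorphism_inv[OF assms], of "\<beta> x"]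
    inv_f_f[OF bij_is_inj[OF star_automorphismD(1)[OF assms]], of x]
  by simp

lemma star_automorphism_comp:
  "star_automorphism \<beta> \<Longrightarrow> star_automorphism \<gamma> \<Longrightarrow> star_automorphism (\<lambda>x. \<beta> (\<gamma> x))"
  using bij_comp[of \<gamma> \<beta>] by (auto simp: star_automorphism_def o_def)

lemma star_automorphism_funpow: "star_automorphism \<beta> \<Longrightarrow> star_automorphism (\<beta> ^^ n)"
proof (induction n)
  case 0
  then show ?case by (simp add: star_automorphism_def id_def[symmetric])
next
  case (Suc n)
  then show ?case using star_automorphism_comp[of \<beta> "\<beta> ^^ n"] by (simp add: o_def)
qed

lemma star_automorphism_int_iter: "star_automorphism \<beta> \<Longrightarrow> star_automorphism (int_iter \<beta> n)"
  by (simp add: int_iter_def star_automorphism_funpow star_automorphism_inv)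

lemma int_iter_0 [simp]: "int_iter \<beta> 0 x = x"
  by (simp add: int_iter_def)

lemma int_iter_Suc:
  assumes "bij \<beta>"
  shows "int_iter \<beta> (n + 1) x = \<beta> (int_iter \<beta> n x)"
proof (cases "n \<ge> 0")
  case True
  then have "nat (n + 1) = Suc (nat n)" by simp
  with True show ?thesis by (simp add: int_iter_def)
next
  case False
  then have n: "nat (- n) = Suc (nat (- (n + 1)))" by simp
  have "int_iter \<beta> n x = inv_into UNIV \<beta> ((inv_into UNIV \<beta> ^^ nat (- (n + 1))) x)"
    using False n by (simp add: int_iter_def)
  moreover have "int_iter \<beta> (n + 1) x = (inv_into UNIV \<beta> ^^ nat (- (n + 1))) x"
    using False by (cases "n = -1") (auto simp: int_iter_def)
  ultimately show ?thesis
    using surj_f_inv_f[OF bij_is_surj[OF assms]] by simp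
qed

lemma int_iter_add:
  assumes "bij \<beta>"
  shows "int_iter \<beta> (m + n) x = int_iter \<beta> m (int_iter \<beta> n x)"
proof (induction m rule: int_induct[of _ 0])
  case (step1 i)
  then show ?case
    using int_iter_Suc[OF assms, of "i + n" x] int_iter_Suc[OF assms, of i "int_iter \<beta> n x"]
    by (simp add: algebra_simps)
next
  case (step2 i)
  then show ?case
    using int_iter_Suc[OF assms, of "i - 1 + n" x] int_iter_Suc[OF assms, of "i - 1" "int_iter \<beta> n x"]
      bij_is_inj[OF assms] by (simp add: inj_eq algebra_simps)
qed simp

lemma int_iter_cancel [simp]:
  assumes "bij \<beta>"
  shows "int_iter \<beta> n (int_iter \<beta> (- n) x) = x" "int_iter \<beta> (- n) (int_iter \<beta> n x) = x"
  using int_iter_add[OF assms, of n "- n" x] int_iter_add[OF assms, of "- n" n x] by simp_all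

section \<open>The Hilbert module \<open>\<ell>\<^sup>2(\<int>, B)\<close>\<close>

text \<open>Series in the module converge unconditionally but in general not absolutely. Comparison
  therefore goes through the norms of finite blocks that avoid a finite set.\<close>

lemma summable_on_iff_Cauchy:
  fixes f :: "'i \<Rightarrow> 'a::banach"
  shows "f summable_on UNIV \<longleftrightarrow>
    (\<forall>e>0. \<exists>F. finite F \<and> (\<forall>G. finite G \<and> G \<inter> F = {} \<longrightarrow> norm (sum f G) < e))"
    (is "_ \<longleftrightarrow> ?R")
proof
  assume "f summable_on UNIV"
  then have lim: "(sum f \<longlongrightarrow> infsum f UNIV) (finite_subsets_at_top UNIV)"
    by (simp flip: has_sum_def)
  show ?R
  proof (intro allI impI)
    fix e :: real assume "e > 0"
    then have "\<forall>\<^sub>F F in finite_subsets_at_top UNIV. dist (sum f F) (infsum f UNIV) < e / 2"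
      using lim by (intro tendstoD) auto
    then obtain F where F: "finite F" and close: "\<And>Y. finite Y \<Longrightarrow> F \<subseteq> Y \<Longrightarrow> dist (sum f Y) (infsum f UNIV) < e / 2"
      by (auto simp: eventually_finite_subsets_at_top)
    have "norm (sum f G) < e" if "finite G" "G \<inter> F = {}" for G
    proof -
      have "sum f (F \<union> G) = sum f F + sum f G"
        using that F by (intro sum.union_disjoint) auto
      then have "norm (sum f G) = dist (sum f (F \<union> G)) (sum f F)"
        by (simp add: dist_norm)
      also have "\<dots> \<le> dist (sum f (F \<union> G)) (infsum f UNIV) + dist (sum f F) (infsum f UNIV)"
        by (rule dist_triangle2)
      also have "\<dots> < e"
        using close[of "F \<union> G"] close[of F] that F by simp
      finally show ?thesis .
    qed
    then show "\<exists>F. finite F \<and> (\<forall>G. finite G \<and> G \<inter> F = {} \<longrightarrow> norm (sum f G) < e)"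
      using F by blast
  qed
next
  assume R: ?R
  have "\<exists>P. eventually P (finite_subsets_at_top UNIV) \<and> (\<forall>F F'. P F \<and> P F' \<longrightarrow> dist (sum f F) (sum f F') < e)"
    if e: "e > 0" for e
  proof -
    obtain F where F: "finite F" "\<And>G. finite G \<Longrightarrow> G \<inter> F = {} \<Longrightarrow> norm (sum f G) < e / 2"
      using R[rule_format, of "e/2"] e by auto
    have "dist (sum f Y) (sum f F) < e / 2" if "finite Y" "F \<subseteq> Y" for Y
      using F(2)[of "Y - F"] that sum_diff[OF that, of f] by (auto simp: dist_norm)
    then have "dist (sum f Y) (sum f Z) < e" if "finite Y \<and> F \<subseteq> Y" "finite Z \<and> F \<subseteq> Z" for Y Z
      using that dist_triangle_half_l[of "sum f Y" "sum f F" e "sum f Z"] by blast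
    then show ?thesis
      using F(1) by (intro exI[of _ "\<lambda>Y. finite Y \<and> F \<subseteq> Y"]) (auto simp: eventually_finite_subsets_at_top)
  qed
  then have "cauchy_filter (filtermap (sum f) (finite_subsets_at_top UNIV))"
    by (simp add: cauchy_filter_metric_filtermap)
  moreover have "complete (UNIV :: 'a set)"
    by (meson Cauchy_convergent UNIV_I complete_def convergent_def)
  ultimately obtain L where "(sum f \<longlongrightarrow> L) (finite_subsets_at_top UNIV)"
    using complete_uniform[where S = UNIV] by (force simp: filterlim_def)
  then show "f summable_on UNIV"
    using summable_on_def has_sum_def by blast
qed

lemma infsum_bounded_linear:
  "bounded_linear h \<Longrightarrow> f summable_on A \<Longrightarrow> infsum (\<lambda>x. h (f x)) A = h (infsum f A)"
  by (metis has_sum_bounded_linear has_sum_infsum infsumI)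

lemma l2_iff_summable: "\<xi> \<in> l2 \<longleftrightarrow> (\<lambda>n. sq (\<xi> n)) summable_on UNIV"
  by (simp add: l2_def sq_def)

lemma real_state_sum: "f \<in> real_states \<Longrightarrow> f (\<Sum>n\<in>G. v n) = (\<Sum>n\<in>G. f (v n))"
  using linear_sum[OF real_stateD(1)] .

lemma adj_sum_sq [simp]: "adj (\<Sum>n\<in>G. sq (v n)) = (\<Sum>n\<in>G. sq (v n))"
  by (simp add: adj_sum)

lemma norm_sum_sq_le:
  assumes "\<And>f. f \<in> real_states \<Longrightarrow> (\<Sum>n\<in>G. f (sq (v n))) \<le> r"
  shows "norm (\<Sum>n\<in>G. sq (v n)) \<le> r"
  by (rule norm_le_of_real_states) (use assms in \<open>auto simp: real_state_sum abs_of_nonneg sum_nonneg\<close>)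

lemma real_state_sum_sq_le:
  "f \<in> real_states \<Longrightarrow> (\<Sum>n\<in>G. f (sq (v n))) \<le> norm (\<Sum>n\<in>G. sq (v n))"
  using real_state_le_norm[of f "\<Sum>n\<in>G. sq (v n)"] by (simp add: real_state_sum)

lemma l2_tail:
  assumes "\<xi> \<in> l2" "e > 0"
  obtains F where "finite F" "\<And>G. finite G \<Longrightarrow> G \<inter> F = {} \<Longrightarrow> norm (\<Sum>n\<in>G. sq (\<xi> n)) < e"
  using assms unfolding l2_iff_summable summable_on_iff_Cauchy by metis

text \<open>A comparison test in which the order of the algebra is replaced by inequalities under
  every real state. Two dominating vectors are allowed so that sums of vectors are covered.\<close>

lemma l2_dominated:
  assumes \<xi>: "\<xi> \<in> l2" and \<eta>: "\<eta> \<in> l2" and C: "C \<ge> 0"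
    and dom: "\<And>f n. f \<in> real_states \<Longrightarrow> f (sq (\<zeta> n)) \<le> C * (f (sq (\<xi> n)) + f (sq (\<eta> n)))"
  shows "\<zeta> \<in> l2"
  unfolding l2_iff_summable summable_on_iff_Cauchy
proof (intro allI impI)
  fix e :: real assume e: "e > 0"
  \<comment> \<open>The summand 1 makes the final inequality strict and covers
    \<open>C = 0\<close>.\<close>
  define d where "d = e / (2 * C + 1)"
  have d: "d > 0" using e C by (simp add: d_def)
  obtain F where F: "finite F" "\<And>G. finite G \<Longrightarrow> G \<inter> F = {} \<Longrightarrow> norm (\<Sum>n\<in>G. sq (\<xi> n)) < d"
    using l2_tail[OF \<xi> d] by blast
  obtain F' where F': "finite F'" "\<And>G. finite G \<Longrightarrow> G \<inter> F' = {} \<Longrightarrow> norm (\<Sum>n\<in>G. sq (\<eta> n)) < d"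
    using l2_tail[OF \<eta> d] by blast
  have "norm (\<Sum>n\<in>G. sq (\<zeta> n)) < e" if G: "finite G" "G \<inter> (F \<union> F') = {}" for G
  proof -
    have "norm (\<Sum>n\<in>G. sq (\<zeta> n)) \<le> C * (d + d)"
    proof (rule norm_sum_sq_le)
      fix f :: "'a \<Rightarrow> real" assume f: "f \<in> real_states"
      have "(\<Sum>n\<in>G. f (sq (\<zeta> n))) \<le> (\<Sum>n\<in>G. C * (f (sq (\<xi> n)) + f (sq (\<eta> n))))"
        by (intro sum_mono dom f)
      also have "\<dots> = C * ((\<Sum>n\<in>G. f (sq (\<xi> n))) + (\<Sum>n\<in>G. f (sq (\<eta> n))))"
        by (simp flip: sum_distrib_left add: sum.distrib)
      also have "\<dots> \<le> C * (d + d)"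
      proof -
        have "G \<inter> F = {}" "G \<inter> F' = {}" using G by auto
        then show ?thesis
          using C F(2)[OF G(1)] F'(2)[OF G(1)]
            real_state_sum_sq_le[OF f, of \<xi> G] real_state_sum_sq_le[OF f, of \<eta> G]
          by (intro mult_left_mono add_mono) auto
      qed
      finally show "(\<Sum>n\<in>G. f (sq (\<zeta> n))) \<le> C * (d + d)" .
    qed
    also have "\<dots> < (2 * C + 1) * d"
      using d by (simp add: algebra_simps)
    also have "\<dots> = e"
      using C by (simp add: d_def)
    finally show ?thesis .
  qed
  then show "\<exists>F. finite F \<and> (\<forall>G. finite G \<and> G \<inter> F = {} \<longrightarrow> norm (\<Sum>n\<in>G. sq (\<zeta> n)) < e)"
    using F(1) F'(1) by (intro exI[of _ "F \<union> F'"]) auto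
qed

lemma l2_dominated1:
  assumes "\<xi> \<in> l2" "C \<ge> 0" "\<And>f n. f \<in> real_states \<Longrightarrow> f (sq (\<zeta> n)) \<le> C * f (sq (\<xi> n))"
  shows "\<zeta> \<in> l2"
proof (rule l2_dominated[OF assms(1,1,2)])
  fix f :: "'a \<Rightarrow> real" and n assume f: "f \<in> real_states"
  show "f (sq (\<zeta> n)) \<le> C * (f (sq (\<xi> n)) + f (sq (\<xi> n)))"
    using assms(3)[OF f, of n] mult_nonneg_nonneg[OF assms(2) real_state_sq_nonneg[OF f, of "\<xi> n"]]
    by (simp add: distrib_left)
qed

lemma l2_finite_support: "finite {n. \<xi> n \<noteq> 0} \<Longrightarrow> \<xi> \<in> l2"
  unfolding l2_iff_summable
  by (rule finite_nonzero_values_imp_summable_on) (auto elim!: finite_subset[rotated])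

lemma l2_zero [simp]: "(\<lambda>n. 0) \<in> l2"
  by (rule l2_finite_support) simp

lemma l2_add [simp]: "\<xi> \<in> l2 \<Longrightarrow> \<eta> \<in> l2 \<Longrightarrow> (\<lambda>n. \<xi> n + \<eta> n) \<in> l2"
  by (rule l2_dominated[of \<xi> \<eta> 2]) (auto simp: distrib_left real_state_sq_add_le)

lemma l2_mult_bounded:
  assumes "\<xi> \<in> l2" and b: "\<And>n. norm (b n) \<le> C"
  shows "(\<lambda>n. b n * \<xi> n) \<in> l2"
proof (rule l2_dominated1[OF assms(1), of "C\<^sup>2"])
  fix f :: "'a \<Rightarrow> real" and n assume f: "f \<in> real_states"
  show "f (sq (b n * \<xi> n)) \<le> C\<^sup>2 * f (sq (\<xi> n))"
    using real_state_sq_mult_le[OF f, of "b n" "\<xi> n"] b[of n] f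
    by (meson mult_right_mono norm_ge_zero order_trans power_mono real_state_sq_nonneg)
qed simp

lemma l2_scaleC [simp]: "\<xi> \<in> l2 \<Longrightarrow> (\<lambda>n. scaleC c (\<xi> n)) \<in> l2"
  using l2_mult_bounded[of \<xi> "\<lambda>_. scaleC c 1" "cmod c"] by (simp add: mult_scaleC_left norm_scaleC)

lemma l2_minus [simp]: "\<xi> \<in> l2 \<Longrightarrow> (\<lambda>n. - \<xi> n) \<in> l2"
  using l2_scaleC[of \<xi> "-1"] by (simp add: scaleC_minus_left)

lemma l2_diff [simp]: "\<xi> \<in> l2 \<Longrightarrow> \<eta> \<in> l2 \<Longrightarrow> (\<lambda>n. \<xi> n - \<eta> n) \<in> l2"
  using l2_add[OF _ l2_minus, of \<xi> \<eta>] by simp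

lemma l2_sum [simp]: "(\<And>k. k \<in> K \<Longrightarrow> \<xi> k \<in> l2) \<Longrightarrow> (\<lambda>n. \<Sum>k\<in>K. \<xi> k n) \<in> l2"
  by (induction K rule: infinite_finite_induct) auto

lemma bij_shift: "bij (\<lambda>m. m - n :: int)"
  by (rule o_bij[of "\<lambda>m. m + n"]) auto

lemma l2_shift [simp]: "\<xi> \<in> l2 \<Longrightarrow> shift n \<xi> \<in> l2"
  using summable_on_reindex_bij_betw[OF bij_shift, of "\<lambda>m. sq (\<xi> m)" n]
  by (simp add: l2_iff_summable shift_def)

lemma abs_real_state_adj_mult_le:
  assumes f: "f \<in> real_states"
  shows "\<bar>f (adj a * b)\<bar> \<le> (f (sq a) + f (sq b)) / 2"
  using real_state_sq_diff[OF f, of a b] real_state_sq_diff[OF f, of a "- b"]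
    real_state_sq_nonneg[OF f, of "a - b"] real_state_sq_nonneg[OF f, of "a - - b"]
    linear_neg[OF real_stateD(1)[OF f], of "adj a * b"] by simp

lemma l2_inner_summable:
  assumes \<xi>: "\<xi> \<in> l2" and \<eta>: "\<eta> \<in> l2"
  shows "(\<lambda>n. adj (\<xi> n) * \<eta> n) summable_on UNIV"
  unfolding summable_on_iff_Cauchy
proof (intro allI impI)
  fix e :: real assume e: "e > 0"
  then have d: "e / 2 > 0" by simp
  obtain F where F: "finite F" "\<And>G. finite G \<Longrightarrow> G \<inter> F = {} \<Longrightarrow> norm (\<Sum>n\<in>G. sq (\<xi> n)) < e / 2"
    using l2_tail[OF \<xi> d] by blast
  obtain F' where F': "finite F'" "\<And>G. finite G \<Longrightarrow> G \<inter> F' = {} \<Longrightarrow> norm (\<Sum>n\<in>G. sq (\<eta> n)) < e / 2"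
    using l2_tail[OF \<eta> d] by blast
  have "norm (\<Sum>n\<in>G. adj (\<xi> n) * \<eta> n) < e" if G: "finite G" "G \<inter> (F \<union> F') = {}" for G
  proof -
    \<comment> \<open>Stated for all \<open>\<eta>'\<close> with the same squares as
      \<open>\<eta>\<close>, so that \<open>\<eta>\<close> and its multiple by - i are treated at
      once.\<close>
    have le: "\<bar>f (\<Sum>n\<in>G. adj (\<xi> n) * \<eta>' n)\<bar> \<le> (norm (\<Sum>n\<in>G. sq (\<xi> n)) + norm (\<Sum>n\<in>G. sq (\<eta> n))) / 2"
      if f: "f \<in> real_states" and \<eta>': "\<And>n. sq (\<eta>' n) = sq (\<eta> n)" for f \<eta>'
    proof -
      have "\<bar>f (\<Sum>n\<in>G. adj (\<xi> n) * \<eta>' n)\<bar> \<le> (\<Sum>n\<in>G. \<bar>f (adj (\<xi> n) * \<eta>' n)\<bar>)"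
        unfolding real_state_sum[OF f] by (rule sum_abs)
      also have "\<dots> \<le> (\<Sum>n\<in>G. (f (sq (\<xi> n)) + f (sq (\<eta>' n))) / 2)"
        by (intro sum_mono abs_real_state_adj_mult_le f)
      also have "\<dots> = ((\<Sum>n\<in>G. f (sq (\<xi> n))) + (\<Sum>n\<in>G. f (sq (\<eta> n)))) / 2"
        by (simp add: \<eta>' sum.distrib flip: sum_divide_distrib)
      finally show ?thesis
        using real_state_sum_sq_le[OF f, of \<xi> G] real_state_sum_sq_le[OF f, of \<eta> G] by simp
    qed
    have "norm (\<Sum>n\<in>G. adj (\<xi> n) * \<eta> n) \<le> 2 * ((norm (\<Sum>n\<in>G. sq (\<xi> n)) + norm (\<Sum>n\<in>G. sq (\<eta> n))) / 2)"
      using le[of _ \<eta>] le[of _ "\<lambda>n. scaleC (- \<i>) (\<eta> n)"]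
      by (intro norm_le_2_of_real_states)
        (auto simp: sq_scaleC linear_sum[OF linear_scaleC] mult_scaleC_right)
    moreover have "G \<inter> F = {}" "G \<inter> F' = {}" using G by auto
    ultimately show ?thesis
      using F(2)[OF G(1)] F'(2)[OF G(1)] by simp
  qed
  then show "\<exists>F. finite F \<and> (\<forall>G. finite G \<and> G \<inter> F = {} \<longrightarrow> norm (\<Sum>n\<in>G. adj (\<xi> n) * \<eta> n) < e)"
    using F(1) F'(1) by (intro exI[of _ "F \<union> F'"]) auto
qed

lemma bounded_linear_scaleC: "bounded_linear (scaleC c :: 'b::cstar_algebra \<Rightarrow> 'b)"
  using linear_scaleC[of c] by (auto simp: bounded_linear_def bounded_linear_axioms_def norm_scaleC mult.commute intro!: exI[of _ "cmod c"])

lemma l2_inner_adj: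
  assumes "\<xi> \<in> l2" "\<eta> \<in> l2"
  shows "adj (l2_inner \<xi> \<eta>) = l2_inner \<eta> \<xi>"
  using infsum_bounded_linear[OF bounded_linear_adj l2_inner_summable[OF assms]]
  by (simp add: l2_inner_def adj_mult adj_adj o_def)

lemma l2_inner_add_right:
  assumes "\<xi> \<in> l2" "\<eta> \<in> l2" "\<zeta> \<in> l2"
  shows "l2_inner \<xi> (\<lambda>n. \<eta> n + \<zeta> n) = l2_inner \<xi> \<eta> + l2_inner \<xi> \<zeta>"
  using infsum_add[OF l2_inner_summable[OF assms(1,2)] l2_inner_summable[OF assms(1,3)]]
  by (simp add: l2_inner_def distrib_left)

lemma l2_inner_scaleC_right:
  assumes "\<xi> \<in> l2" "\<eta> \<in> l2"
  shows "l2_inner \<xi> (\<lambda>n. scaleC c (\<eta> n)) = scaleC c (l2_inner \<xi> \<eta>)"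
  using infsum_bounded_linear[OF bounded_linear_scaleC l2_inner_summable[OF assms], of c]
  by (simp add: l2_inner_def mult_scaleC_right o_def)

lemma l2_inner_minus_right:
  "\<lbrakk>\<xi> \<in> l2; \<eta> \<in> l2\<rbrakk> \<Longrightarrow> l2_inner \<xi> (\<lambda>n. - \<eta> n) = - l2_inner \<xi> \<eta>"
  using l2_inner_scaleC_right[of \<xi> \<eta> "-1"] by (simp add: scaleC_minus_left)

lemma l2_inner_diff_right:
  "\<lbrakk>\<xi> \<in> l2; \<eta> \<in> l2; \<zeta> \<in> l2\<rbrakk> \<Longrightarrow> l2_inner \<xi> (\<lambda>n. \<eta> n - \<zeta> n) = l2_inner \<xi> \<eta> - l2_inner \<xi> \<zeta>"
  using l2_inner_add_right[of \<xi> \<eta> "\<lambda>n. - \<zeta> n"] by (simp add: l2_inner_minus_right)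

lemma l2_inner_add_left:
  "\<lbrakk>\<xi> \<in> l2; \<eta> \<in> l2; \<zeta> \<in> l2\<rbrakk> \<Longrightarrow> l2_inner (\<lambda>n. \<eta> n + \<zeta> n) \<xi> = l2_inner \<eta> \<xi> + l2_inner \<zeta> \<xi>"
  using l2_inner_adj[of \<xi> "\<lambda>n. \<eta> n + \<zeta> n"] l2_inner_adj[of \<xi> \<eta>] l2_inner_adj[of \<xi> \<zeta>]
  by (simp add: l2_inner_add_right adj_add)

lemma l2_inner_scaleC_left:
  "\<lbrakk>\<xi> \<in> l2; \<eta> \<in> l2\<rbrakk> \<Longrightarrow> l2_inner (\<lambda>n. scaleC c (\<eta> n)) \<xi> = scaleC (cnj c) (l2_inner \<eta> \<xi>)"
  using l2_inner_adj[of \<xi> "\<lambda>n. scaleC c (\<eta> n)"] l2_inner_adj[of \<xi> \<eta>]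
  by (simp add: l2_inner_scaleC_right adj_scaleC)

lemma l2_inner_diff_left:
  "\<lbrakk>\<xi> \<in> l2; \<eta> \<in> l2; \<zeta> \<in> l2\<rbrakk> \<Longrightarrow> l2_inner (\<lambda>n. \<eta> n - \<zeta> n) \<xi> = l2_inner \<eta> \<xi> - l2_inner \<zeta> \<xi>"
  using l2_inner_adj[of \<xi> "\<lambda>n. \<eta> n - \<zeta> n"] l2_inner_adj[of \<xi> \<eta>] l2_inner_adj[of \<xi> \<zeta>]
  by (simp add: l2_inner_diff_right adj_diff)

lemma l2_inner_zero_right [simp]: "l2_inner \<xi> (\<lambda>n. 0) = 0"
  by (simp add: l2_inner_def)

lemma real_state_inner:
  assumes "f \<in> real_states" "\<xi> \<in> l2" "\<eta> \<in> l2"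
  shows "(\<lambda>n. f (adj (\<xi> n) * \<eta> n)) summable_on UNIV" (is ?A)
    and "f (l2_inner \<xi> \<eta>) = infsum (\<lambda>n. f (adj (\<xi> n) * \<eta> n)) UNIV" (is ?B)
proof -
  note bl = bounded_linear_real_state[OF assms(1)] and s = l2_inner_summable[OF assms(2,3)]
  show ?A using summable_on_bounded_linear[OF bl s] by (simp add: o_def)
  show ?B using infsum_bounded_linear[OF bl s] by (simp add: l2_inner_def o_def)
qed

lemma real_state_inner_self_nonneg:
  "f \<in> real_states \<Longrightarrow> \<xi> \<in> l2 \<Longrightarrow> 0 \<le> f (l2_inner \<xi> \<xi>)"
  by (simp add: real_state_inner infsum_nonneg real_stateD)

lemma sum_real_state_sq_le:
  assumes "f \<in> real_states" "\<xi> \<in> l2" "finite G"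
  shows "(\<Sum>n\<in>G. f (sq (\<xi> n))) \<le> f (l2_inner \<xi> \<xi>)"
  using real_state_inner[OF assms(1,2,2)] assms real_stateD(3)[OF assms(1)] unfolding sq_def
  by (simp add: finite_sum_le_infsum)

lemma real_state_inner_self_le:
  assumes f: "f \<in> real_states" and \<xi>: "\<xi> \<in> l2"
    and le: "\<And>G. finite G \<Longrightarrow> (\<Sum>n\<in>G. f (sq (\<xi> n))) \<le> r"
  shows "f (l2_inner \<xi> \<xi>) \<le> r"
  using real_state_inner[OF f \<xi> \<xi>] le by (simp add: sq_def infsum_le_finite_sums)

lemma l2_norm_nonneg [simp]: "0 \<le> l2_norm \<xi>"
  by (simp add: l2_norm_def)

lemma l2_norm_square: "(l2_norm \<xi>)\<^sup>2 = norm (l2_inner \<xi> \<xi>)"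
  by (simp add: l2_norm_def)

lemma real_state_inner_self_le_norm:
  "f \<in> real_states \<Longrightarrow> f (l2_inner \<xi> \<xi>) \<le> (l2_norm \<xi>)\<^sup>2"
  using real_state_le_norm[of f "l2_inner \<xi> \<xi>"] by (simp add: l2_norm_square)

lemma l2_norm_leI:
  assumes \<xi>: "\<xi> \<in> l2" and r: "r \<ge> 0" and le: "\<And>f. f \<in> real_states \<Longrightarrow> f (l2_inner \<xi> \<xi>) \<le> r\<^sup>2"
  shows "l2_norm \<xi> \<le> r"
proof -
  have "norm (l2_inner \<xi> \<xi>) \<le> r\<^sup>2"
    using le real_state_inner_self_nonneg[OF _ \<xi>] \<xi>
    by (intro norm_le_of_real_states) (simp_all add: l2_inner_adj abs_of_nonneg)
  then have "(l2_norm \<xi>)\<^sup>2 \<le> r\<^sup>2" by (simp add: l2_norm_square)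
  then show ?thesis using r by (rule power2_le_imp_le)
qed

text \<open>The form in which vectors are estimated later: only finite sums of scalars occur, one
  real state at a time.\<close>

lemma l2_norm_leI_finite:
  assumes "\<xi> \<in> l2" "r \<ge> 0"
    and "\<And>f G. f \<in> real_states \<Longrightarrow> finite G \<Longrightarrow> (\<Sum>n\<in>G. f (sq (\<xi> n))) \<le> r\<^sup>2"
  shows "l2_norm \<xi> \<le> r"
  by (rule l2_norm_leI[OF assms(1,2)], rule real_state_inner_self_le) (use assms in auto)

lemma discriminant_le:
  fixes a b c :: real
  assumes "\<And>r. 0 \<le> a - 2 * r * b + r\<^sup>2 * c" "0 \<le> a" "0 \<le> c"
  shows "b\<^sup>2 \<le> a * c"
proof (cases "c = 0")
  case True
  have "b = 0"
  proof (rule ccontr)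
    assume "b \<noteq> 0"
    \<comment> \<open>With \<open>c = 0\<close>, this choice of \<open>r\<close> gives the quadratic
      the value -1.\<close>
    then show False
      using assms(1)[of "(a + 1) / (2 * b)"] True by (simp add: field_simps)
  qed
  then show ?thesis using assms by simp
next
  case False
  then show ?thesis
    using assms(1)[of "b / c"] assms(3) by (simp add: field_simps power2_eq_square)
qed

text \<open>Cauchy-Schwarz for the scalar semi-inner product induced by \<open>f\<close>; the
  polynomial in \<open>r\<close> is its value on \<open>\<xi> - r \<eta>\<close>.\<close>

lemma real_state_inner_square_le:
  assumes f: "f \<in> real_states" and \<xi>: "\<xi> \<in> l2" and \<eta>: "\<eta> \<in> l2"
  shows "(f (l2_inner \<xi> \<eta>))\<^sup>2 \<le> f (l2_inner \<xi> \<xi>) * f (l2_inner \<eta> \<eta>)"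
proof (rule discriminant_le)
  note l = real_stateD(1)[OF f]
  fix r :: real
  define \<zeta> where "\<zeta> = (\<lambda>n. r *\<^sub>R \<eta> n)"
  have \<zeta>: "\<zeta> \<in> l2" using l2_scaleC[OF \<eta>, of "complex_of_real r"] by (simp add: \<zeta>_def scaleC_of_real)
  have scale: "l2_inner \<kappa> \<zeta> = r *\<^sub>R l2_inner \<kappa> \<eta>" "l2_inner \<zeta> \<kappa> = r *\<^sub>R l2_inner \<eta> \<kappa>" if "\<kappa> \<in> l2" for \<kappa>
    using l2_inner_scaleC_right[OF that \<eta>, of "complex_of_real r"]
      l2_inner_scaleC_left[OF that \<eta>, of "complex_of_real r"]
    by (simp_all add: \<zeta>_def scaleC_of_real)
  have sym: "f (l2_inner \<eta> \<xi>) = f (l2_inner \<xi> \<eta>)"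
    using real_stateD(4)[OF f, of "l2_inner \<xi> \<eta>"] \<xi> \<eta> by (simp add: l2_inner_adj)
  have "0 \<le> f (l2_inner (\<lambda>n. \<xi> n - \<zeta> n) (\<lambda>n. \<xi> n - \<zeta> n))"
    using \<xi> \<zeta> f by (intro real_state_inner_self_nonneg) auto
  also have "\<dots> = f (l2_inner \<xi> \<xi>) - 2 * r * f (l2_inner \<xi> \<eta>) + r\<^sup>2 * f (l2_inner \<eta> \<eta>)"
    using \<xi> \<eta> \<zeta> sym
    by (simp add: l2_inner_diff_right l2_inner_diff_left linear_diff[OF l] power2_eq_square
      scale linear_scale[OF l])
  finally show "0 \<le> f (l2_inner \<xi> \<xi>) - 2 * r * f (l2_inner \<xi> \<eta>) + r\<^sup>2 * f (l2_inner \<eta> \<eta>)" .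
qed (use real_state_inner_self_nonneg f \<xi> \<eta> in auto)

lemma abs_real_state_inner_le:
  assumes f: "f \<in> real_states" and \<xi>: "\<xi> \<in> l2" and \<eta>: "\<eta> \<in> l2"
  shows "\<bar>f (l2_inner \<xi> \<eta>)\<bar> \<le> l2_norm \<xi> * l2_norm \<eta>"
proof -
  have "(f (l2_inner \<xi> \<eta>))\<^sup>2 \<le> (l2_norm \<xi>)\<^sup>2 * (l2_norm \<eta>)\<^sup>2"
    using real_state_inner_square_le[OF assms] real_state_inner_self_le_norm[OF f]
      real_state_inner_self_nonneg[OF f] \<xi> \<eta> by (meson mult_mono order_trans zero_le_power2)
  then have "\<bar>f (l2_inner \<xi> \<eta>)\<bar>\<^sup>2 \<le> (l2_norm \<xi> * l2_norm \<eta>)\<^sup>2"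
    by (simp add: power_mult_distrib)
  then show ?thesis by (rule power2_le_imp_le) simp
qed

lemma l2_norm_scaleC:
  assumes "\<xi> \<in> l2"
  shows "l2_norm (\<lambda>n. scaleC c (\<xi> n)) = cmod c * l2_norm \<xi>"
  using assms by (simp add: l2_norm_def l2_inner_scaleC_right l2_inner_scaleC_left norm_scaleC
      real_sqrt_mult)

text \<open>The factor 2 is not sharp; the bound serves for the continuity of inner
  products.\<close>

lemma norm_l2_inner_le:
  assumes \<xi>: "\<xi> \<in> l2" and \<eta>: "\<eta> \<in> l2"
  shows "norm (l2_inner \<xi> \<eta>) \<le> 2 * (l2_norm \<xi> * l2_norm \<eta>)"
proof (rule norm_le_2_of_real_states)
  fix f :: "'a \<Rightarrow> real" assume f: "f \<in> real_states"
  show "\<bar>f (l2_inner \<xi> \<eta>)\<bar> \<le> l2_norm \<xi> * l2_norm \<eta>"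
    by (rule abs_real_state_inner_le[OF f \<xi> \<eta>])
  have "\<bar>f (l2_inner \<xi> (\<lambda>n. scaleC (- \<i>) (\<eta> n)))\<bar> \<le> l2_norm \<xi> * l2_norm (\<lambda>n. scaleC (- \<i>) (\<eta> n))"
    using \<eta> by (intro abs_real_state_inner_le[OF f \<xi>]) simp
  then show "\<bar>f (scaleC (- \<i>) (l2_inner \<xi> \<eta>))\<bar> \<le> l2_norm \<xi> * l2_norm \<eta>"
    by (simp only: l2_inner_scaleC_right[OF \<xi> \<eta>] l2_norm_scaleC[OF \<eta>]) simp
qed

lemma l2_norm_triangle:
  assumes \<xi>: "\<xi> \<in> l2" and \<eta>: "\<eta> \<in> l2"
  shows "l2_norm (\<lambda>n. \<xi> n + \<eta> n) \<le> l2_norm \<xi> + l2_norm \<eta>"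
proof (rule l2_norm_leI)
  fix f :: "'a \<Rightarrow> real" assume f: "f \<in> real_states"
  note l = real_stateD(1)[OF f]
  have sym: "f (l2_inner \<eta> \<xi>) = f (l2_inner \<xi> \<eta>)"
    using real_stateD(4)[OF f, of "l2_inner \<xi> \<eta>"] \<xi> \<eta> by (simp add: l2_inner_adj)
  have "f (l2_inner (\<lambda>n. \<xi> n + \<eta> n) (\<lambda>n. \<xi> n + \<eta> n))
      = f (l2_inner \<xi> \<xi>) + 2 * f (l2_inner \<xi> \<eta>) + f (l2_inner \<eta> \<eta>)"
    using \<xi> \<eta> sym by (simp add: l2_inner_add_right l2_inner_add_left linear_add[OF l])
  also have "\<dots> \<le> (l2_norm \<xi>)\<^sup>2 + 2 * (l2_norm \<xi> * l2_norm \<eta>) + (l2_norm \<eta>)\<^sup>2"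
    using abs_real_state_inner_le[OF f \<xi> \<eta>] real_state_inner_self_le_norm[OF f, of \<xi>]
      real_state_inner_self_le_norm[OF f, of \<eta>] by linarith
  also have "\<dots> = (l2_norm \<xi> + l2_norm \<eta>)\<^sup>2"
    by (simp add: power2_sum)
  finally show "f (l2_inner (\<lambda>n. \<xi> n + \<eta> n) (\<lambda>n. \<xi> n + \<eta> n)) \<le> (l2_norm \<xi> + l2_norm \<eta>)\<^sup>2" .
qed (use \<xi> \<eta> in auto)

lemma l2_norm_zero [simp]: "l2_norm (\<lambda>n. 0) = 0"
  by (simp add: l2_norm_def)

lemma l2_norm_minus: "\<xi> \<in> l2 \<Longrightarrow> l2_norm (\<lambda>n. - \<xi> n) = l2_norm \<xi>"
  using l2_norm_scaleC[of \<xi> "-1"] by (simp add: scaleC_minus_left)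

lemma l2_norm_diff_commute:
  "\<xi> \<in> l2 \<Longrightarrow> \<eta> \<in> l2 \<Longrightarrow> l2_norm (\<lambda>n. \<xi> n - \<eta> n) = l2_norm (\<lambda>n. \<eta> n - \<xi> n)"
  using l2_norm_minus[of "\<lambda>n. \<xi> n - \<eta> n"] by simp

lemma l2_norm_diff_triangle:
  assumes "\<xi> \<in> l2" "\<eta> \<in> l2" "\<zeta> \<in> l2"
  shows "l2_norm (\<lambda>n. \<xi> n - \<zeta> n) \<le> l2_norm (\<lambda>n. \<xi> n - \<eta> n) + l2_norm (\<lambda>n. \<eta> n - \<zeta> n)"
  using l2_norm_triangle[of "\<lambda>n. \<xi> n - \<eta> n" "\<lambda>n. \<eta> n - \<zeta> n"] assms by simp

lemma norm_component_le:
  assumes "\<xi> \<in> l2"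
  shows "norm (\<xi> n) \<le> l2_norm \<xi>"
proof -
  have "norm (sq (\<xi> n)) \<le> (l2_norm \<xi>)\<^sup>2"
  proof (rule norm_le_of_real_states)
    fix f :: "'a \<Rightarrow> real" assume f: "f \<in> real_states"
    show "\<bar>f (sq (\<xi> n))\<bar> \<le> (l2_norm \<xi>)\<^sup>2"
      using sum_real_state_sq_le[OF f assms, of "{n}"] real_state_inner_self_le_norm[OF f, of \<xi>] f by simp
  qed simp
  then have "(norm (\<xi> n))\<^sup>2 \<le> (l2_norm \<xi>)\<^sup>2" by (simp add: norm_sq)
  then show ?thesis by (rule power2_le_imp_le) simp
qed

lemma l2_norm_eq_zero:
  assumes "\<xi> \<in> l2" "l2_norm \<xi> = 0"
  shows "\<xi> = (\<lambda>n. 0)"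
  using norm_component_le[OF assms(1)] assms(2) by auto

lemma l2_eqI_inner:
  assumes \<xi>: "\<xi> \<in> l2" and \<eta>: "\<eta> \<in> l2" and eq: "\<And>\<zeta>. \<zeta> \<in> l2 \<Longrightarrow> l2_inner \<zeta> \<xi> = l2_inner \<zeta> \<eta>"
  shows "\<xi> = \<eta>"
proof -
  let ?d = "\<lambda>n. \<xi> n - \<eta> n"
  have "l2_inner ?d ?d = 0"
    using \<xi> \<eta> by (simp add: l2_inner_diff_right eq)
  then have "?d = (\<lambda>n. 0)"
    using \<xi> \<eta> by (intro l2_norm_eq_zero) (auto simp: l2_norm_def)
  then show ?thesis by (simp add: fun_eq_iff)
qed

lemma l2_complete:
  assumes \<xi>: "\<And>k::nat. \<xi> k \<in> l2"
    and Cauchy: "\<And>e. 0 < e \<Longrightarrow> \<exists>K. \<forall>i\<ge>K. \<forall>j\<ge>K. l2_norm (\<lambda>n. \<xi> i n - \<xi> j n) < e"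
  obtains \<eta> where "\<eta> \<in> l2" "(\<lambda>k. l2_norm (\<lambda>n. \<xi> k n - \<eta> n)) \<longlonglongrightarrow> 0"
proof -
  have "convergent (\<lambda>k. \<xi> k n)" for n
  proof (rule Cauchy_convergent, rule CauchyI)
    fix e :: real assume "0 < e"
    then obtain K where "\<forall>i\<ge>K. \<forall>j\<ge>K. l2_norm (\<lambda>n. \<xi> i n - \<xi> j n) < e"
      using Cauchy by blast
    then show "\<exists>M. \<forall>m\<ge>M. \<forall>k\<ge>M. norm (\<xi> m n - \<xi> k n) < e"
      using norm_component_le[OF l2_diff[OF \<xi> \<xi>]] by (meson le_less_trans)
  qed
  then obtain \<eta> where lim: "\<And>n. (\<lambda>k. \<xi> k n) \<longlonglongrightarrow> \<eta> n"
    unfolding convergent_def by metis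
  \<comment> \<open>Phrased with finite sums because \<open>\<eta>\<close> is not yet known to lie
    in \<open>l2\<close>; finite sums pass to the coordinatewise limit.\<close>
  have close: "\<exists>K. \<forall>k\<ge>K. \<forall>f\<in>real_states. \<forall>G. finite G \<longrightarrow> (\<Sum>n\<in>G. f (sq (\<xi> k n - \<eta> n))) \<le> e\<^sup>2"
    if e: "0 < e" for e
  proof -
    obtain K where K: "\<And>i j. i \<ge> K \<Longrightarrow> j \<ge> K \<Longrightarrow> l2_norm (\<lambda>n. \<xi> i n - \<xi> j n) < e"
      using Cauchy[OF e] by blast
    have "(\<Sum>n\<in>G. f (sq (\<xi> k n - \<eta> n))) \<le> e\<^sup>2"
      if k: "k \<ge> K" and f: "f \<in> real_states" and G: "finite G" for k f G
    proof (rule tendsto_upperbound)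
      have "(\<lambda>j. f (sq (\<xi> k n - \<xi> j n))) \<longlonglongrightarrow> f (sq (\<xi> k n - \<eta> n))" for n
        unfolding sq_def using bounded_linear_real_state[OF f] bounded_linear_adj lim
        by (intro bounded_linear.tendsto[OF bounded_linear_real_state[OF f]]
            tendsto_mult bounded_linear.tendsto[OF bounded_linear_adj] tendsto_diff tendsto_const lim)
      then show "(\<lambda>j. \<Sum>n\<in>G. f (sq (\<xi> k n - \<xi> j n))) \<longlonglongrightarrow> (\<Sum>n\<in>G. f (sq (\<xi> k n - \<eta> n)))"
        by (intro tendsto_sum)
      have "(\<Sum>n\<in>G. f (sq (\<xi> k n - \<xi> j n))) \<le> e\<^sup>2" if "j \<ge> K" for j
      proof -
        have "(\<Sum>n\<in>G. f (sq (\<xi> k n - \<xi> j n))) \<le> (l2_norm (\<lambda>n. \<xi> k n - \<xi> j n))\<^sup>2"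
          using sum_real_state_sq_le[OF f l2_diff[OF \<xi> \<xi>] G] real_state_inner_self_le_norm[OF f]
          by (rule order_trans)
        also have "\<dots> \<le> e\<^sup>2"
          using K[OF k that] by (intro power_mono) auto
        finally show ?thesis .
      qed
      then show "\<forall>\<^sub>F j in sequentially. (\<Sum>n\<in>G. f (sq (\<xi> k n - \<xi> j n))) \<le> e\<^sup>2"
        by (auto simp: eventually_sequentially)
    qed simp
    then show ?thesis by blast
  qed
  have \<eta>: "\<eta> \<in> l2"
    unfolding l2_iff_summable summable_on_iff_Cauchy
  proof (intro allI impI)
    fix e :: real assume e: "e > 0"
    \<comment> \<open>Each of the two terms of \<open>real_state_sq_add_le\<close> contributes at
      most \<open>2 * (e / 8)\<close>, in total \<open>e / 2\<close>.\<close>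
    define d where "d = sqrt (e / 8)"
    have d: "d > 0" "d\<^sup>2 = e / 8" using e by (auto simp: d_def)
    obtain k where k: "\<And>f G. f \<in> real_states \<Longrightarrow> finite G \<Longrightarrow> (\<Sum>n\<in>G. f (sq (\<xi> k n - \<eta> n))) \<le> d\<^sup>2"
      using close[OF d(1)] by blast
    have d8: "e / 8 > 0" using e by simp
    obtain F where F: "finite F" "\<And>G. finite G \<Longrightarrow> G \<inter> F = {} \<Longrightarrow> norm (\<Sum>n\<in>G. sq (\<xi> k n)) < e / 8"
      using l2_tail[OF \<xi> d8] by blast
    have "norm (\<Sum>n\<in>G. sq (\<eta> n)) < e" if G: "finite G" "G \<inter> F = {}" for G
    proof -
      have "norm (\<Sum>n\<in>G. sq (\<eta> n)) \<le> e / 2"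
      proof (rule norm_sum_sq_le)
        fix f :: "'a \<Rightarrow> real" assume f: "f \<in> real_states"
        have "f (sq (\<eta> n)) \<le> 2 * f (sq (\<xi> k n)) + 2 * f (sq (\<xi> k n - \<eta> n))" for n
          using real_state_sq_add_le[OF f, of "\<xi> k n" "- (\<xi> k n - \<eta> n)"]
          unfolding sq_minus[of "\<xi> k n - \<eta> n"] by simp
        then have "(\<Sum>n\<in>G. f (sq (\<eta> n))) \<le> (\<Sum>n\<in>G. 2 * f (sq (\<xi> k n)) + 2 * f (sq (\<xi> k n - \<eta> n)))"
          by (intro sum_mono)
        also have "\<dots> = 2 * (\<Sum>n\<in>G. f (sq (\<xi> k n))) + 2 * (\<Sum>n\<in>G. f (sq (\<xi> k n - \<eta> n)))"
          by (simp add: sum.distrib sum_distrib_left)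
        also have "\<dots> \<le> e / 2"
          using k[OF f G(1)] d(2) F(2)[OF G] real_state_sum_sq_le[OF f, of "\<xi> k" G] by simp
        finally show "(\<Sum>n\<in>G. f (sq (\<eta> n))) \<le> e / 2" .
      qed
      then show ?thesis using e by simp
    qed
    then show "\<exists>F. finite F \<and> (\<forall>G. finite G \<and> G \<inter> F = {} \<longrightarrow> norm (\<Sum>n\<in>G. sq (\<eta> n)) < e)"
      using F(1) by blast
  qed
  have "(\<lambda>k. l2_norm (\<lambda>n. \<xi> k n - \<eta> n)) \<longlonglongrightarrow> 0"
  proof (rule LIMSEQ_I)
    fix e :: real assume e: "0 < e"
    then obtain K where K: "\<And>k f G. k \<ge> K \<Longrightarrow> f \<in> real_states \<Longrightarrow> finite G \<Longrightarrow> (\<Sum>n\<in>G. f (sq (\<xi> k n - \<eta> n))) \<le> (e/2)\<^sup>2"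
      using close[of "e/2"] by auto
    have "l2_norm (\<lambda>n. \<xi> k n - \<eta> n) \<le> e / 2" if "k \<ge> K" for k
      using K[OF that] e \<xi> \<eta> by (intro l2_norm_leI_finite) auto
    then show "\<exists>K. \<forall>k\<ge>K. norm (l2_norm (\<lambda>n. \<xi> k n - \<eta> n) - 0) < e"
      using e by (intro exI[of _ K]) force
  qed
  with \<eta> show thesis by (rule that)
qed

section \<open>Adjointable operators\<close>

lemma is_adjointD:
  assumes "is_adjoint S T"
  shows "S \<in> l2 \<rightarrow>\<^sub>E l2" "\<xi> \<in> l2 \<Longrightarrow> S \<xi> \<in> l2"
    "\<xi> \<in> l2 \<Longrightarrow> \<eta> \<in> l2 \<Longrightarrow> l2_inner (S \<xi>) \<eta> = l2_inner \<xi> (T \<eta>)"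
  using assms by (auto simp: is_adjoint_def)

lemma is_adjoint_sym:
  assumes "is_adjoint S T" "T \<in> l2 \<rightarrow>\<^sub>E l2"
  shows "is_adjoint T S"
  unfolding is_adjoint_def
proof (intro conjI ballI assms(2))
  fix \<xi> \<eta> :: "int \<Rightarrow> 'a" assume *: "\<xi> \<in> l2" "\<eta> \<in> l2"
  then have "T \<xi> \<in> l2" using assms(2) by auto
  then show "l2_inner (T \<xi>) \<eta> = l2_inner \<xi> (S \<eta>)"
    using l2_inner_adj[of "S \<eta>" \<xi>] l2_inner_adj[of \<eta> "T \<xi>"] is_adjointD[OF assms(1)] * by simp
qed

lemma is_adjoint_unique:
  assumes "is_adjoint S T" "is_adjoint S' T" "T \<in> l2 \<rightarrow>\<^sub>E l2"
  shows "S = S'"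
proof (rule PiE_ext[OF is_adjointD(1)[OF assms(1)] is_adjointD(1)[OF assms(2)]])
  fix \<xi> :: "int \<Rightarrow> 'a" assume \<xi>: "\<xi> \<in> l2"
  note sym = is_adjoint_sym[OF assms(1,3)] is_adjoint_sym[OF assms(2,3)]
  show "S \<xi> = S' \<xi>"
  proof (rule l2_eqI_inner)
    show "l2_inner \<zeta> (S \<xi>) = l2_inner \<zeta> (S' \<xi>)" if "\<zeta> \<in> l2" for \<zeta>
      using is_adjointD(3)[OF sym(1) that \<xi>] is_adjointD(3)[OF sym(2) that \<xi>] by simp
  qed (use assms \<xi> in \<open>auto dest: is_adjointD\<close>)
qed

text \<open>As \<open>l2_inner (S \<xi>) (S \<xi>)\<close> is self-adjoint, states give its norm
  without a factor 2. Moving \<open>S\<close> to the other side and dividing by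
  \<open>l2_norm (S \<xi>)\<close> then keeps the constant \<open>K\<close>.\<close>

lemma is_adjoint_bound:
  assumes S: "is_adjoint S T" and T: "T \<in> l2 \<rightarrow>\<^sub>E l2"
    and K: "\<And>\<xi>. \<xi> \<in> l2 \<Longrightarrow> l2_norm (T \<xi>) \<le> K * l2_norm \<xi>" and \<xi>: "\<xi> \<in> l2"
  shows "l2_norm (S \<xi>) \<le> K * l2_norm \<xi>"
proof -
  have S\<xi>: "S \<xi> \<in> l2" using S \<xi> by (simp add: is_adjointD)
  then have TS: "T (S \<xi>) \<in> l2" using T by auto
  have "norm (l2_inner (S \<xi>) (S \<xi>)) \<le> l2_norm \<xi> * (K * l2_norm (S \<xi>))"
  proof (rule norm_le_of_real_states)
    fix f :: "'a \<Rightarrow> real" assume f: "f \<in> real_states"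
    have "\<bar>f (l2_inner (S \<xi>) (S \<xi>))\<bar> \<le> l2_norm \<xi> * l2_norm (T (S \<xi>))"
      using abs_real_state_inner_le[OF f \<xi> TS] is_adjointD(3)[OF S \<xi> S\<xi>] by simp
    also have "\<dots> \<le> l2_norm \<xi> * (K * l2_norm (S \<xi>))"
      using K[OF S\<xi>] by (simp add: mult_left_mono)
    finally show "\<bar>f (l2_inner (S \<xi>) (S \<xi>))\<bar> \<le> l2_norm \<xi> * (K * l2_norm (S \<xi>))" .
  qed (simp add: l2_inner_adj S\<xi>)
  then have "l2_norm (S \<xi>) * l2_norm (S \<xi>) \<le> (K * l2_norm \<xi>) * l2_norm (S \<xi>)"
    by (simp add: mult_ac flip: l2_norm_square power2_eq_square)
  moreover have "0 \<le> K * l2_norm \<xi>"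
    using K[OF \<xi>] by (rule order_trans[OF l2_norm_nonneg])
  ultimately show ?thesis
    by (cases "l2_norm (S \<xi>) = 0") (auto simp: less_le)
qed

abbreviation ops :: "('b::cstar_algebra) l2_op cstar" where
  "ops \<equiv> adjointable_ops"

lemma opsI:
  assumes "T \<in> l2 \<rightarrow>\<^sub>E l2" "is_adjoint S T" "\<And>\<xi>. \<xi> \<in> l2 \<Longrightarrow> l2_norm (T \<xi>) \<le> K * l2_norm \<xi>"
  shows "T \<in> carrier ops" "star ops T = S"
proof -
  show "T \<in> carrier ops"
    using assms by (auto simp: adjointable_ops_def)
  have "(THE S. is_adjoint S T) = S"
    using assms(2) is_adjoint_unique[OF _ assms(2,1)] by (rule the_equality)
  then show "star ops T = S"
    by (simp add: adjointable_ops_def)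
qed

lemma ops_funcset: "T \<in> carrier ops \<Longrightarrow> T \<in> l2 \<rightarrow>\<^sub>E l2"
  by (simp add: adjointable_ops_def)

lemma ops_l2 [simp]: "T \<in> carrier ops \<Longrightarrow> \<xi> \<in> l2 \<Longrightarrow> T \<xi> \<in> l2"
  by (auto dest: ops_funcset)

lemma ops_eqI:
  "\<lbrakk>S \<in> carrier ops; T \<in> carrier ops; \<And>\<xi>. \<xi> \<in> l2 \<Longrightarrow> S \<xi> = T \<xi>\<rbrakk> \<Longrightarrow> S = T"
  by (meson PiE_ext ops_funcset)

lemma ops_bounded:
  assumes "T \<in> carrier ops"
  obtains K where "K \<ge> 0" "\<And>\<xi>. \<xi> \<in> l2 \<Longrightarrow> l2_norm (T \<xi>) \<le> K * l2_norm \<xi>"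
proof -
  obtain K where K: "\<And>\<xi>. \<xi> \<in> l2 \<Longrightarrow> l2_norm (T \<xi>) \<le> K * l2_norm \<xi>"
    using assms by (auto simp: adjointable_ops_def)
  have "l2_norm (T \<xi>) \<le> \<bar>K\<bar> * l2_norm \<xi>" if "\<xi> \<in> l2" for \<xi>
    using K[OF that] mult_right_mono[OF abs_ge_self, of "l2_norm \<xi>" K] by simp
  then show thesis using that[of "\<bar>K\<bar>"] by simp
qed

lemma is_adjoint_star:
  assumes "T \<in> carrier ops"
  shows "is_adjoint (star ops T) T"
proof -
  obtain S K where *: "is_adjoint S T" "\<And>\<xi>. \<xi> \<in> l2 \<Longrightarrow> l2_norm (T \<xi>) \<le> K * l2_norm \<xi>"
    using assms by (auto simp: adjointable_ops_def)
  then show ?thesis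
    using opsI(2)[OF ops_funcset[OF assms] *] by simp
qed

lemma star_ops:
  assumes "T \<in> carrier ops"
  shows "star ops T \<in> carrier ops" "star ops (star ops T) = T"
proof -
  note a = is_adjoint_star[OF assms] and T = ops_funcset[OF assms]
  obtain K where K: "\<And>\<xi>. \<xi> \<in> l2 \<Longrightarrow> l2_norm (T \<xi>) \<le> K * l2_norm \<xi>"
    using ops_bounded[OF assms] by metis
  note * = opsI[OF is_adjointD(1)[OF a] is_adjoint_sym[OF a T] is_adjoint_bound[OF a T K]]
  show "star ops T \<in> carrier ops" "star ops (star ops T) = T"
    using * by simp_all
qed

declare star_ops [simp]

lemma ops_inner:
  assumes "T \<in> carrier ops" "\<xi> \<in> l2" "\<eta> \<in> l2"
  shows "l2_inner (star ops T \<xi>) \<eta> = l2_inner \<xi> (T \<eta>)" "l2_inner (T \<xi>) \<eta> = l2_inner \<xi> (star ops T \<eta>)"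
  using is_adjointD(3)[OF is_adjoint_star[OF assms(1)] assms(2,3)]
    is_adjointD(3)[OF is_adjoint_star[OF star_ops(1)[OF assms(1)]] assms(2,3)] star_ops(2)[OF assms(1)]
  by simp_all

text \<open>Linearity is not built into \<open>adjointable_ops\<close>; it follows from the
  existence of an adjoint, since inner products separate vectors.\<close>

lemma ops_add_arg:
  assumes T: "T \<in> carrier ops" and "\<xi> \<in> l2" "\<eta> \<in> l2"
  shows "T (\<lambda>n. \<xi> n + \<eta> n) = (\<lambda>n. T \<xi> n + T \<eta> n)"
  by (rule l2_eqI_inner) (use assms star_ops(1)[OF T] in \<open>simp_all add: l2_inner_add_right flip: ops_inner(1)\<close>)

lemma ops_scaleC_arg:
  assumes T: "T \<in> carrier ops" and "\<xi> \<in> l2"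
  shows "T (\<lambda>n. scaleC c (\<xi> n)) = (\<lambda>n. scaleC c (T \<xi> n))"
  by (rule l2_eqI_inner) (use assms star_ops(1)[OF T] in \<open>simp_all add: l2_inner_scaleC_right flip: ops_inner(1)\<close>)

lemma ops_zero_arg: "T \<in> carrier ops \<Longrightarrow> T (\<lambda>n. 0) = (\<lambda>n. 0)"
  using ops_scaleC_arg[of T "\<lambda>n. 0" 0] by simp

lemma nrm_ops: "nrm ops T = (SUP \<xi>\<in>{\<xi>\<in>l2. l2_norm \<xi> \<le> 1}. l2_norm (T \<xi>))"
  by (simp add: adjointable_ops_def)

lemma nrm_ops_leI:
  assumes "C \<ge> 0" "\<And>\<xi>. \<xi> \<in> l2 \<Longrightarrow> l2_norm (T \<xi>) \<le> C * l2_norm \<xi>"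
  shows "nrm ops T \<le> C"
  unfolding nrm_ops
proof (rule cSUP_least)
  show "{\<xi>\<in>l2. l2_norm \<xi> \<le> 1} \<noteq> {}"
    using l2_zero l2_norm_zero by (metis (mono_tags, lifting) empty_iff mem_Collect_eq zero_le_one)
  show "l2_norm (T \<xi>) \<le> C" if "\<xi> \<in> {\<xi>\<in>l2. l2_norm \<xi> \<le> 1}" for \<xi>
    using assms(2)[of \<xi>] mult_left_mono[of "l2_norm \<xi>" 1 C] assms(1) that by simp
qed

lemma l2_norm_op_le:
  assumes T: "T \<in> carrier ops" and \<xi>: "\<xi> \<in> l2"
  shows "l2_norm (T \<xi>) \<le> nrm ops T * l2_norm \<xi>"
proof (cases "l2_norm \<xi> = 0")
  case True
  then show ?thesis
    using l2_norm_eq_zero[OF \<xi>] ops_zero_arg[OF T] by simp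
next
  case False
  then have pos: "l2_norm \<xi> > 0"
    by (simp add: order_less_le)
  obtain K where K: "K \<ge> 0" "\<And>\<xi>. \<xi> \<in> l2 \<Longrightarrow> l2_norm (T \<xi>) \<le> K * l2_norm \<xi>"
    using ops_bounded[OF T] by metis
  have bdd: "bdd_above ((\<lambda>\<xi>. l2_norm (T \<xi>)) ` {\<xi>\<in>l2. l2_norm \<xi> \<le> 1})"
    using K mult_left_mono[OF _ K(1)] by (intro bdd_aboveI[where M = K]) fastforce
  define \<eta> where "\<eta> = (\<lambda>n. scaleC (complex_of_real (1 / l2_norm \<xi>)) (\<xi> n))"
  have \<eta>: "\<eta> \<in> l2" "l2_norm \<eta> = 1"
    using \<xi> pos by (simp_all add: \<eta>_def l2_norm_scaleC norm_divide)
  have "l2_norm (T \<eta>) \<le> nrm ops T"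
    unfolding nrm_ops using \<eta> by (intro cSUP_upper bdd) auto
  moreover have "l2_norm (T \<eta>) = l2_norm (T \<xi>) / l2_norm \<xi>"
    using \<xi> T pos unfolding \<eta>_def by (simp add: ops_scaleC_arg l2_norm_scaleC norm_divide)
  ultimately show ?thesis
    using pos by (simp add: field_simps)
qed

lemma nrm_ops_nonneg:
  assumes "T \<in> carrier ops"
  shows "0 \<le> nrm ops T"
proof -
  \<comment> \<open>A vector of positive norm is required: at the zero vector the operator bound
    would hold with any constant.\<close>
  define \<delta> :: "int \<Rightarrow> 'a" where "\<delta> = (\<lambda>n. if n = 0 then 1 else 0)"
  have "{n. \<delta> n \<noteq> 0} \<subseteq> {0}" by (auto simp: \<delta>_def)
  then have \<delta>: "\<delta> \<in> l2" by (intro l2_finite_support) (auto elim: finite_subset)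
  have "1 \<le> l2_norm \<delta>"
    using norm_component_le[OF \<delta>, of 0] by (simp add: \<delta>_def)
  moreover have "0 \<le> nrm ops T * l2_norm \<delta>"
    using l2_norm_op_le[OF assms \<delta>] by (rule order_trans[OF l2_norm_nonneg])
  ultimately show ?thesis
    by (simp add: zero_le_mult_iff)
qed

lemma ops_record:
  "mult ops S T = compose l2 S T" "one ops = restrict (\<lambda>\<xi>. \<xi>) l2" "zero ops = restrict (\<lambda>\<xi> n. 0) l2"
  "add ops S T = restrict (\<lambda>\<xi> n. S \<xi> n + T \<xi> n) l2"
  "cscale ops c T = restrict (\<lambda>\<xi> n. scaleC c (T \<xi> n)) l2"
  by (simp_all add: adjointable_ops_def)

lemma ops_apply [simp]:
  assumes "\<xi> \<in> l2"
  shows "mult ops S T \<xi> = S (T \<xi>)" "one ops \<xi> = \<xi>" "zero ops \<xi> = (\<lambda>n. 0)"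
    "add ops S T \<xi> = (\<lambda>n. S \<xi> n + T \<xi> n)" "cscale ops c T \<xi> = (\<lambda>n. scaleC c (T \<xi> n))"
  using assms by (simp_all add: ops_record compose_def)

lemma ops_mult:
  assumes S: "S \<in> carrier ops" and T: "T \<in> carrier ops"
  shows "mult ops S T \<in> carrier ops" "star ops (mult ops S T) = mult ops (star ops T) (star ops S)"
proof -
  have fns: "mult ops S T \<in> l2 \<rightarrow>\<^sub>E l2" if "S \<in> carrier ops" "T \<in> carrier ops" for S T :: "'a l2_op"
    using that by (auto simp: ops_record compose_def)
  have adj: "is_adjoint (mult ops (star ops T) (star ops S)) (mult ops S T)"
    unfolding is_adjoint_def using fns[OF star_ops(1)[OF T] star_ops(1)[OF S]] S T by (simp add: ops_inner)
  have "l2_norm (mult ops S T \<xi>) \<le> (nrm ops S * nrm ops T) * l2_norm \<xi>" if "\<xi> \<in> l2" for \<xi>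
    using that S T l2_norm_op_le[OF S, of "T \<xi>"] mult_left_mono[OF l2_norm_op_le[OF T that] nrm_ops_nonneg[OF S]]
    by (simp add: mult.assoc)
  from opsI[OF fns[OF S T] adj this]
  show "mult ops S T \<in> carrier ops" "star ops (mult ops S T) = mult ops (star ops T) (star ops S)"
    by simp_all
qed

lemma ops_add:
  assumes S: "S \<in> carrier ops" and T: "T \<in> carrier ops"
  shows "add ops S T \<in> carrier ops" "star ops (add ops S T) = add ops (star ops S) (star ops T)"
proof -
  have fns: "add ops S T \<in> l2 \<rightarrow>\<^sub>E l2" if "S \<in> carrier ops" "T \<in> carrier ops" for S T :: "'a l2_op"
    using that by (auto simp: ops_record)
  have adj: "is_adjoint (add ops (star ops S) (star ops T)) (add ops S T)"
    unfolding is_adjoint_def using fns[OF star_ops(1)[OF S] star_ops(1)[OF T]] S T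
    by (simp add: ops_inner l2_inner_add_left l2_inner_add_right)
  have "l2_norm (add ops S T \<xi>) \<le> (nrm ops S + nrm ops T) * l2_norm \<xi>" if "\<xi> \<in> l2" for \<xi>
    using l2_norm_triangle[of "S \<xi>" "T \<xi>"] l2_norm_op_le[OF S that] l2_norm_op_le[OF T that] that S T
    by (simp add: distrib_right)
  from opsI[OF fns[OF S T] adj this]
  show "add ops S T \<in> carrier ops" "star ops (add ops S T) = add ops (star ops S) (star ops T)"
    by simp_all
qed

lemma ops_cscale:
  assumes T: "T \<in> carrier ops"
  shows "cscale ops c T \<in> carrier ops" "star ops (cscale ops c T) = cscale ops (cnj c) (star ops T)"
proof -
  have fns: "cscale ops c T \<in> l2 \<rightarrow>\<^sub>E l2" if "T \<in> carrier ops" for T :: "'a l2_op" and c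
    using that by (auto simp: ops_record)
  have adj: "is_adjoint (cscale ops (cnj c) (star ops T)) (cscale ops c T)"
    unfolding is_adjoint_def using fns[OF star_ops(1)[OF T]] T
    by (simp add: ops_inner l2_inner_scaleC_left l2_inner_scaleC_right)
  have "l2_norm (cscale ops c T \<xi>) \<le> (cmod c * nrm ops T) * l2_norm \<xi>" if "\<xi> \<in> l2" for \<xi>
    using l2_norm_op_le[OF T that] that T by (simp add: l2_norm_scaleC mult.assoc mult_left_mono)
  from opsI[OF fns[OF T] adj this]
  show "cscale ops c T \<in> carrier ops" "star ops (cscale ops c T) = cscale ops (cnj c) (star ops T)"
    by simp_all
qed

lemma ops_zero: "zero ops \<in> carrier ops"
proof (rule opsI(1))
  show "is_adjoint (zero ops) (zero ops :: 'a l2_op)"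
    by (auto simp: is_adjoint_def) (auto simp: ops_record l2_inner_def)
  show "l2_norm (zero ops \<xi>) \<le> 0 * l2_norm \<xi>" if "\<xi> \<in> l2" for \<xi> :: "int \<Rightarrow> 'a"
    using that by simp
qed (auto simp: ops_record)

lemma ops_one: "one ops \<in> carrier ops"
proof (rule opsI(1))
  show "is_adjoint (one ops) (one ops :: 'a l2_op)"
    by (auto simp: is_adjoint_def) (auto simp: ops_record)
  show "l2_norm (one ops \<xi>) \<le> 1 * l2_norm \<xi>" if "\<xi> \<in> l2" for \<xi> :: "int \<Rightarrow> 'a"
    using that by simp
qed (auto simp: ops_record)

lemma ring_ops: "Ring.ring (ops :: 'b::cstar_algebra l2_op cstar)"
proof (rule ringI)
  show "abelian_group (ops :: 'b l2_op cstar)"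
  proof (rule abelian_groupI)
    fix S :: "'b l2_op" assume S: "S \<in> carrier ops"
    show "\<exists>T\<in>carrier ops. T \<oplus>\<^bsub>ops\<^esub> S = \<zero>\<^bsub>ops\<^esub>"
      by (intro bexI[of _ "cscale ops (-1) S"] ops_eqI)
        (use S in \<open>simp_all add: ops_add ops_cscale ops_zero scaleC_minus_left\<close>)
  qed (auto intro!: ops_eqI simp: ops_add ops_zero add_ac)
  show "Group.monoid (ops :: 'b l2_op cstar)"
    by (rule Group.monoidI) (auto intro!: ops_eqI simp: ops_mult ops_one)
qed (auto intro!: ops_eqI simp: ops_add ops_mult ops_add_arg)

lemma a_minus_ops:
  assumes "S \<in> carrier ops" "T \<in> carrier ops"
  shows "S \<ominus>\<^bsub>ops\<^esub> T = restrict (\<lambda>\<xi> n. S \<xi> n - T \<xi> n) l2"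
proof -
  interpret Ring.ring "ops :: 'a l2_op cstar" by (rule ring_ops)
  have "cscale ops (-1) T \<oplus>\<^bsub>ops\<^esub> T = \<zero>\<^bsub>ops\<^esub>"
    by (rule ops_eqI) (use assms in \<open>simp_all add: ops_add ops_cscale ops_zero scaleC_minus_left\<close>)
  then have "\<ominus>\<^bsub>ops\<^esub> T = cscale ops (-1) T"
    using assms by (intro minus_equality) (simp_all add: ops_cscale)
  then show ?thesis
    by (auto simp: a_minus_def ops_record scaleC_minus_left)
qed

text \<open>The substantial half of the C*-identity: move one \<open>T\<close> to the other side of
  \<open>l2_inner (T \<xi>) (T \<xi>)\<close> and use Cauchy-Schwarz under each state.\<close>

lemma nrm_ops_star_mult_le:
  assumes T: "T \<in> carrier ops"
  shows "(nrm ops T)\<^sup>2 \<le> nrm ops (mult ops (star ops T) T)"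
proof -
  define k where "k = nrm ops (mult ops (star ops T) T)"
  note TT = ops_mult(1)[OF star_ops(1)[OF T] T]
  have k: "k \<ge> 0" using nrm_ops_nonneg[OF TT] by (simp add: k_def)
  have "nrm ops T \<le> sqrt k"
  proof (rule nrm_ops_leI)
    fix \<xi> :: "int \<Rightarrow> 'a" assume \<xi>: "\<xi> \<in> l2"
    show "l2_norm (T \<xi>) \<le> sqrt k * l2_norm \<xi>"
    proof (rule l2_norm_leI)
      fix f :: "'a \<Rightarrow> real" assume f: "f \<in> real_states"
      have TT\<xi>: "star ops T (T \<xi>) \<in> l2"
        using T \<xi> by simp
      have "f (l2_inner (T \<xi>) (T \<xi>)) = f (l2_inner \<xi> (star ops T (T \<xi>)))"
        using T \<xi> by (simp add: ops_inner)
      also have "\<dots> \<le> l2_norm \<xi> * l2_norm (star ops T (T \<xi>))"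
        using abs_real_state_inner_le[OF f \<xi> TT\<xi>] by simp
      also have "\<dots> \<le> l2_norm \<xi> * (k * l2_norm \<xi>)"
        using l2_norm_op_le[OF TT \<xi>] \<xi> by (intro mult_left_mono) (auto simp: k_def)
      also have "\<dots> = (sqrt k * l2_norm \<xi>)\<^sup>2"
        using k by (simp add: power_mult_distrib power2_eq_square)
      finally show "f (l2_inner (T \<xi>) (T \<xi>)) \<le> (sqrt k * l2_norm \<xi>)\<^sup>2" .
    qed (use T \<xi> k in auto)
  qed (use k in simp)
  then show ?thesis
    using power_mono[of "nrm ops T" "sqrt k" 2] nrm_ops_nonneg[OF T] k by (simp add: k_def)
qed

lemma nrm_ops_mult_le:
  assumes S: "S \<in> carrier ops" and T: "T \<in> carrier ops"
  shows "nrm ops (mult ops S T) \<le> nrm ops S * nrm ops T"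
proof (rule nrm_ops_leI)
  fix \<xi> :: "int \<Rightarrow> 'a" assume \<xi>: "\<xi> \<in> l2"
  show "l2_norm (mult ops S T \<xi>) \<le> nrm ops S * nrm ops T * l2_norm \<xi>"
    using \<xi> S T l2_norm_op_le[OF S, of "T \<xi>"] mult_left_mono[OF l2_norm_op_le[OF T \<xi>] nrm_ops_nonneg[OF S]]
    by (simp add: mult.assoc)
qed (simp add: S T nrm_ops_nonneg)

lemma nrm_ops_star_le:
  assumes T: "T \<in> carrier ops"
  shows "nrm ops (star ops T) \<le> nrm ops T"
  by (rule nrm_ops_leI[OF nrm_ops_nonneg[OF T]])
    (rule is_adjoint_bound[OF is_adjoint_star[OF T] ops_funcset[OF T] l2_norm_op_le[OF T]])

lemma nrm_ops_diff_le:
  assumes S: "S \<in> carrier ops" and T: "T \<in> carrier ops" and \<xi>: "\<xi> \<in> l2"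
  shows "l2_norm (\<lambda>n. S \<xi> n - T \<xi> n) \<le> nrm ops (S \<ominus>\<^bsub>ops\<^esub> T) * l2_norm \<xi>"
proof -
  interpret Ring.ring "ops :: 'a l2_op cstar" by (rule ring_ops)
  show ?thesis
    using l2_norm_op_le[OF minus_closed[OF S T] \<xi>] \<xi> by (simp add: a_minus_ops[OF S T])
qed

text \<open>The limit must be adjointable. The adjoints form a Cauchy sequence as well, and their
  pointwise limit is an adjoint of the pointwise limit of the operators.\<close>

lemma ops_complete:
  assumes T: "\<And>k::nat. T k \<in> carrier ops"
    and Cauchy: "\<And>e. 0 < e \<Longrightarrow> \<exists>K. \<forall>i\<ge>K. \<forall>j\<ge>K. nrm ops (T i \<ominus>\<^bsub>ops\<^esub> T j) < e"
  shows "\<exists>S\<in>carrier ops. (\<lambda>k. nrm ops (T k \<ominus>\<^bsub>ops\<^esub> S)) \<longlonglongrightarrow> 0"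
proof -
  interpret Ring.ring "ops :: 'a l2_op cstar" by (rule ring_ops)
  have pointwise: "\<exists>\<eta>\<in>l2. (\<lambda>k. l2_norm (\<lambda>n. R k \<xi> n - \<eta> n)) \<longlonglongrightarrow> 0"
    if R: "\<And>k::nat. R k \<in> carrier ops" and RC: "\<And>e. 0 < e \<Longrightarrow> \<exists>K. \<forall>i\<ge>K. \<forall>j\<ge>K. nrm ops (R i \<ominus>\<^bsub>ops\<^esub> R j) < e"
      and \<xi>: "\<xi> \<in> l2" for R and \<xi> :: "int \<Rightarrow> 'a"
  proof -
    have C: "\<exists>K. \<forall>i\<ge>K. \<forall>j\<ge>K. l2_norm (\<lambda>n. R i \<xi> n - R j \<xi> n) < e" if e: "0 < e" for e
    proof -
      have "0 < e / (l2_norm \<xi> + 1)"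
        using e l2_norm_nonneg[of \<xi>] by (intro divide_pos_pos) linarith+
      then obtain K where K: "\<And>i j. i \<ge> K \<Longrightarrow> j \<ge> K \<Longrightarrow> nrm ops (R i \<ominus>\<^bsub>ops\<^esub> R j) < e / (l2_norm \<xi> + 1)"
        using RC by blast
      have "l2_norm (\<lambda>n. R i \<xi> n - R j \<xi> n) < e" if "i \<ge> K" "j \<ge> K" for i j
      proof -
        have "l2_norm (\<lambda>n. R i \<xi> n - R j \<xi> n) \<le> nrm ops (R i \<ominus>\<^bsub>ops\<^esub> R j) * l2_norm \<xi>"
          by (rule nrm_ops_diff_le[OF R R \<xi>])
        also have "\<dots> \<le> e / (l2_norm \<xi> + 1) * l2_norm \<xi>"
          using K[OF that] by (intro mult_right_mono) auto
        also have "\<dots> < e / (l2_norm \<xi> + 1) * (l2_norm \<xi> + 1)"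
          using \<open>0 < e / (l2_norm \<xi> + 1)\<close> by (intro mult_strict_left_mono) auto
        also have "\<dots> = e"
          using l2_norm_nonneg[of \<xi>] by (auto simp: add_nonneg_eq_0_iff)
        finally show ?thesis .
      qed
      then show ?thesis by blast
    qed
    obtain \<eta> where "\<eta> \<in> l2" "(\<lambda>k. l2_norm (\<lambda>n. R k \<xi> n - \<eta> n)) \<longlonglongrightarrow> 0"
    proof (rule l2_complete[of "\<lambda>k. R k \<xi>"])
      show "R k \<xi> \<in> l2" for k by (rule ops_l2[OF R \<xi>])
    qed (use C in auto)
    then show ?thesis by blast
  qed
  have starCauchy: "\<exists>K. \<forall>i\<ge>K. \<forall>j\<ge>K. nrm ops (star ops (T i) \<ominus>\<^bsub>ops\<^esub> star ops (T j)) < e" if "0 < e" for e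
  proof -
    have "nrm ops (star ops (T i) \<ominus>\<^bsub>ops\<^esub> star ops (T j)) \<le> nrm ops (T i \<ominus>\<^bsub>ops\<^esub> T j)" for i j
    proof -
      have eq: "star ops (T i \<ominus>\<^bsub>ops\<^esub> T j) = star ops (T i) \<ominus>\<^bsub>ops\<^esub> star ops (T j)"
      proof -
        have m: "A \<ominus>\<^bsub>ops\<^esub> B = A \<oplus>\<^bsub>ops\<^esub> cscale ops (-1) B" if "A \<in> carrier ops" "B \<in> carrier ops" for A B :: "'a l2_op"
          by (rule ops_eqI[OF minus_closed[OF that]])
            (use that in \<open>simp_all add: ops_add ops_cscale a_minus_ops scaleC_minus_left\<close>)
        show ?thesis
          using T star_ops by (simp add: m ops_add ops_cscale)
      qed
      show ?thesis
        unfolding eq[symmetric] by (intro nrm_ops_star_le minus_closed T)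
    qed
    then show ?thesis
      using Cauchy[OF that] by (meson le_less_trans)
  qed
  have "\<exists>\<eta>. \<xi> \<in> l2 \<longrightarrow> \<eta> \<in> l2 \<and> (\<lambda>k. l2_norm (\<lambda>n. T k \<xi> n - \<eta> n)) \<longlonglongrightarrow> 0" for \<xi>
    using pointwise[OF T Cauchy] by blast
  then obtain S where "\<forall>\<xi>. \<xi> \<in> l2 \<longrightarrow> S \<xi> \<in> l2 \<and> (\<lambda>k. l2_norm (\<lambda>n. T k \<xi> n - S \<xi> n)) \<longlonglongrightarrow> 0"
    using choice[of "\<lambda>\<xi> \<eta>. \<xi> \<in> l2 \<longrightarrow> \<eta> \<in> l2 \<and> (\<lambda>k. l2_norm (\<lambda>n. T k \<xi> n - \<eta> n)) \<longlonglongrightarrow> 0"]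
    by blast
  then have S: "\<And>\<xi>. \<xi> \<in> l2 \<Longrightarrow> S \<xi> \<in> l2" "\<And>\<xi>. \<xi> \<in> l2 \<Longrightarrow> (\<lambda>k. l2_norm (\<lambda>n. T k \<xi> n - S \<xi> n)) \<longlonglongrightarrow> 0"
    by auto
  have "\<exists>\<eta>. \<xi> \<in> l2 \<longrightarrow> \<eta> \<in> l2 \<and> (\<lambda>k. l2_norm (\<lambda>n. star ops (T k) \<xi> n - \<eta> n)) \<longlonglongrightarrow> 0" for \<xi>
    using pointwise[of "\<lambda>k. star ops (T k)" \<xi>, OF star_ops(1)[OF T] starCauchy] by blast
  then obtain S' where "\<forall>\<xi>. \<xi> \<in> l2 \<longrightarrow> S' \<xi> \<in> l2 \<and> (\<lambda>k. l2_norm (\<lambda>n. star ops (T k) \<xi> n - S' \<xi> n)) \<longlonglongrightarrow> 0"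
    using choice[of "\<lambda>\<xi> \<eta>. \<xi> \<in> l2 \<longrightarrow> \<eta> \<in> l2 \<and> (\<lambda>k. l2_norm (\<lambda>n. star ops (T k) \<xi> n - \<eta> n)) \<longlonglongrightarrow> 0"]
    by blast
  then have S': "\<And>\<xi>. \<xi> \<in> l2 \<Longrightarrow> S' \<xi> \<in> l2"
      "\<And>\<xi>. \<xi> \<in> l2 \<Longrightarrow> (\<lambda>k. l2_norm (\<lambda>n. star ops (T k) \<xi> n - S' \<xi> n)) \<longlonglongrightarrow> 0"
    by auto
  have inner_lim: "(\<lambda>k. l2_inner \<zeta> (\<xi> k)) \<longlonglongrightarrow> l2_inner \<zeta> \<eta>"
    if "\<zeta> \<in> l2" "\<And>k. \<xi> k \<in> l2" "\<eta> \<in> l2" "(\<lambda>k. l2_norm (\<lambda>n. \<xi> k n - \<eta> n)) \<longlonglongrightarrow> 0"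
    for \<zeta> \<eta> :: "int \<Rightarrow> 'a" and \<xi> :: "nat \<Rightarrow> int \<Rightarrow> 'a"
  proof -
    have "(\<lambda>k. l2_inner \<zeta> (\<xi> k) - l2_inner \<zeta> \<eta>) \<longlonglongrightarrow> 0"
    proof (rule Lim_null_comparison)
      show "\<forall>\<^sub>F k in sequentially. norm (l2_inner \<zeta> (\<xi> k) - l2_inner \<zeta> \<eta>)
          \<le> 2 * (l2_norm \<zeta> * l2_norm (\<lambda>n. \<xi> k n - \<eta> n))"
        using that norm_l2_inner_le[of \<zeta>] by (simp flip: l2_inner_diff_right)
      show "(\<lambda>k. 2 * (l2_norm \<zeta> * l2_norm (\<lambda>n. \<xi> k n - \<eta> n))) \<longlonglongrightarrow> 0"
        using that(4) by (auto intro!: tendsto_eq_intros)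
    qed
    then show ?thesis by (simp add: LIM_zero_iff)
  qed
  have adj: "l2_inner (S' \<xi>) \<eta> = l2_inner \<xi> (S \<eta>)" if \<xi>: "\<xi> \<in> l2" and \<eta>: "\<eta> \<in> l2" for \<xi> \<eta>
  proof (rule LIMSEQ_unique)
    show "(\<lambda>k. l2_inner \<xi> (T k \<eta>)) \<longlonglongrightarrow> l2_inner \<xi> (S \<eta>)"
      using S T \<xi> \<eta> by (intro inner_lim) auto
    have "(\<lambda>k. l2_inner \<eta> (star ops (T k) \<xi>)) \<longlonglongrightarrow> l2_inner \<eta> (S' \<xi>)"
      using S' T \<xi> \<eta> star_ops(1)[OF T] by (intro inner_lim) auto
    then have "(\<lambda>k. adj (l2_inner \<eta> (star ops (T k) \<xi>))) \<longlonglongrightarrow> adj (l2_inner \<eta> (S' \<xi>))"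
      by (rule bounded_linear.tendsto[OF bounded_linear_adj])
    then show "(\<lambda>k. l2_inner \<xi> (T k \<eta>)) \<longlonglongrightarrow> l2_inner (S' \<xi>) \<eta>"
      using \<xi> \<eta> S' T star_ops(1)[OF T] by (simp add: l2_inner_adj ops_inner)
  qed
  \<comment> \<open>Convergence uniform over the vectors, by letting \<open>j\<close> tend to
    infinity in the Cauchy estimate.\<close>
  have close: "\<exists>K. \<forall>k\<ge>K. \<forall>\<xi>\<in>l2. l2_norm (\<lambda>n. T k \<xi> n - S \<xi> n) \<le> e * l2_norm \<xi>" if e: "0 < e" for e
  proof -
    obtain K where K: "\<And>i j. i \<ge> K \<Longrightarrow> j \<ge> K \<Longrightarrow> nrm ops (T i \<ominus>\<^bsub>ops\<^esub> T j) < e"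
      using Cauchy[OF e] by blast
    have "l2_norm (\<lambda>n. T k \<xi> n - S \<xi> n) \<le> e * l2_norm \<xi>" if k: "k \<ge> K" and \<xi>: "\<xi> \<in> l2" for k \<xi>
    proof (rule tendsto_lowerbound)
      show "(\<lambda>j. e * l2_norm \<xi> + l2_norm (\<lambda>n. T j \<xi> n - S \<xi> n)) \<longlonglongrightarrow> e * l2_norm \<xi>"
        using S(2)[OF \<xi>] by (auto intro!: tendsto_eq_intros)
      have "l2_norm (\<lambda>n. T k \<xi> n - S \<xi> n) \<le> e * l2_norm \<xi> + l2_norm (\<lambda>n. T j \<xi> n - S \<xi> n)" if "j \<ge> K" for j
      proof -
        have "l2_norm (\<lambda>n. T k \<xi> n - T j \<xi> n) \<le> e * l2_norm \<xi>"
          using nrm_ops_diff_le[OF T T \<xi>, of k j] K[OF k that] mult_right_mono[of _ e "l2_norm \<xi>"]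
          by (meson l2_norm_nonneg less_imp_le order_trans)
        then show ?thesis
          using l2_norm_diff_triangle[of "T k \<xi>" "T j \<xi>" "S \<xi>"] T S(1) \<xi> by simp
      qed
      then show "\<forall>\<^sub>F j in sequentially. l2_norm (\<lambda>n. T k \<xi> n - S \<xi> n) \<le> e * l2_norm \<xi> + l2_norm (\<lambda>n. T j \<xi> n - S \<xi> n)"
        by (auto simp: eventually_sequentially)
    qed simp
    then show ?thesis by blast
  qed
  define R where "R = restrict S l2"
  obtain k where k: "\<And>\<xi>. \<xi> \<in> l2 \<Longrightarrow> l2_norm (\<lambda>n. T k \<xi> n - S \<xi> n) \<le> 1 * l2_norm \<xi>"
    using close[of 1] by auto
  have R: "R \<in> carrier ops"
  proof (rule opsI(1))
    show "is_adjoint (restrict S' l2) R"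
      using adj S' by (auto simp: is_adjoint_def R_def)
    show "l2_norm (R \<xi>) \<le> (1 + nrm ops (T k)) * l2_norm \<xi>" if \<xi>: "\<xi> \<in> l2" for \<xi>
      using l2_norm_diff_triangle[of "S \<xi>" "T k \<xi>" "\<lambda>n. 0"] l2_norm_diff_commute[of "S \<xi>" "T k \<xi>"]
        k[OF \<xi>] l2_norm_op_le[OF T \<xi>, of k] T S(1) \<xi> by (simp add: R_def distrib_right)
  qed (use S in \<open>auto simp: R_def\<close>)
  have "(\<lambda>k. nrm ops (T k \<ominus>\<^bsub>ops\<^esub> R)) \<longlonglongrightarrow> 0"
  proof (rule LIMSEQ_I)
    fix e :: real assume e: "0 < e"
    then obtain K where K: "\<And>k \<xi>. k \<ge> K \<Longrightarrow> \<xi> \<in> l2 \<Longrightarrow> l2_norm (\<lambda>n. T k \<xi> n - S \<xi> n) \<le> e / 2 * l2_norm \<xi>"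
      using close[of "e/2"] by auto
    have "(T k \<ominus>\<^bsub>ops\<^esub> R) \<xi> = (\<lambda>n. T k \<xi> n - S \<xi> n)" if "\<xi> \<in> l2" for k \<xi>
      unfolding a_minus_ops[OF T R] using that by (simp add: R_def)
    then have "nrm ops (T k \<ominus>\<^bsub>ops\<^esub> R) \<le> e / 2" if "k \<ge> K" for k
      by (intro nrm_ops_leI) (use K[OF that] e in auto)
    then show "\<exists>K. \<forall>k\<ge>K. norm (nrm ops (T k \<ominus>\<^bsub>ops\<^esub> R) - 0) < e"
      using e nrm_ops_nonneg[OF minus_closed[OF T R]] by (intro exI[of _ K]) force
  qed
  then show ?thesis using R by blast
qed

lemma unital_cstar_ops: "unital_cstar (ops :: 'b::cstar_algebra l2_op cstar)"
proof (rule unital_cstar.intro[OF ring_ops], unfold_locales)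
  fix T :: "'b l2_op" assume T: "T \<in> carrier ops"
  show "(nrm ops T = 0) = (T = \<zero>\<^bsub>ops\<^esub>)"
  proof
    assume "nrm ops T = 0"
    then have "T \<xi> = (\<lambda>n. 0)" if "\<xi> \<in> l2" for \<xi>
      using l2_norm_op_le[OF T that] l2_norm_eq_zero[of "T \<xi>"] T that l2_norm_nonneg[of "T \<xi>"] by simp
    then show "T = \<zero>\<^bsub>ops\<^esub>"
      by (intro ops_eqI[OF T ops_zero]) simp
  next
    assume "T = \<zero>\<^bsub>ops\<^esub>"
    then show "nrm ops T = 0"
      using nrm_ops_leI[of 0 T] nrm_ops_nonneg[OF T] by simp
  qed
  fix c
  have le: "nrm ops (cscale ops c S) \<le> cmod c * nrm ops S" if S: "S \<in> carrier ops" for c and S :: "'b l2_op"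
  proof (rule nrm_ops_leI)
    show "l2_norm (cscale ops c S \<xi>) \<le> cmod c * nrm ops S * l2_norm \<xi>" if "\<xi> \<in> l2" for \<xi>
      using l2_norm_op_le[OF S that] that S by (simp add: l2_norm_scaleC mult.assoc mult_left_mono)
  qed (use nrm_ops_nonneg[OF S] in simp)
  show "nrm ops (cscale ops c T) = cmod c * nrm ops T"
  proof (cases "c = 0")
    case True
    then show ?thesis
      using le[OF T, of 0] nrm_ops_nonneg[OF ops_cscale(1)[OF T, of 0]] by simp
  next
    case False
    have "T = cscale ops (1 / c) (cscale ops c T)"
      by (rule ops_eqI) (use T False in \<open>auto simp: ops_cscale scaleC_scaleC\<close>)
    then have "nrm ops T \<le> cmod (1 / c) * nrm ops (cscale ops c T)"
      using le[OF ops_cscale(1)[OF T], of "1/c" c] by simp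
    then show ?thesis
      using le[OF T, of c] False by (simp add: norm_divide field_simps)
  qed
  show "nrm ops (mult ops (star ops T) T) = (nrm ops T)\<^sup>2"
  proof (rule antisym)
    have "nrm ops (mult ops (star ops T) T) \<le> nrm ops (star ops T) * nrm ops T"
      by (rule nrm_ops_mult_le[OF star_ops(1)[OF T] T])
    also have "\<dots> \<le> nrm ops T * nrm ops T"
      using nrm_ops_star_le[OF T] nrm_ops_nonneg[OF T] by (rule mult_right_mono)
    finally show "nrm ops (mult ops (star ops T) T) \<le> (nrm ops T)\<^sup>2"
      by (simp add: power2_eq_square)
  qed (rule nrm_ops_star_mult_le[OF T])
  fix S :: "'b l2_op" assume S: "S \<in> carrier ops"
  show "nrm ops (S \<oplus>\<^bsub>ops\<^esub> T) \<le> nrm ops S + nrm ops T"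
  proof (rule nrm_ops_leI)
    show "l2_norm ((S \<oplus>\<^bsub>ops\<^esub> T) \<xi>) \<le> (nrm ops S + nrm ops T) * l2_norm \<xi>" if "\<xi> \<in> l2" for \<xi>
      using l2_norm_triangle[of "S \<xi>" "T \<xi>"] l2_norm_op_le[OF S that] l2_norm_op_le[OF T that] that S T
      by (simp add: distrib_right)
  qed (simp add: S T nrm_ops_nonneg)
  show "nrm ops (S \<otimes>\<^bsub>ops\<^esub> T) \<le> nrm ops S * nrm ops T"
    by (rule nrm_ops_mult_le[OF S T])
qed (auto intro!: ops_eqI ops_complete simp: ops_cscale ops_add ops_mult star_ops nrm_ops_nonneg scaleC_scaleC
    scaleC_add_left scaleC_add_right ops_scaleC_arg)

section \<open>Closed subalgebras\<close>

context unital_cstar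
begin

text \<open>Sequences are easier to push through the algebraic operations than the epsilon form of
  \<open>norm_closure\<close>.\<close>

lemma norm_closure_iff_limit:
  fixes W
  assumes W: "W \<subseteq> carrier A"
  shows "(a \<in> carrier A \<and> (\<forall>e>0. \<exists>w\<in>W. nrm A (a \<ominus> w) < e)) \<longleftrightarrow> (\<exists>s. (\<forall>n. s n \<in> W) \<and> converges_to s a)"
proof
  assume a: "a \<in> carrier A \<and> (\<forall>e>0. \<exists>w\<in>W. nrm A (a \<ominus> w) < e)"
  then have "\<forall>n. \<exists>w. w \<in> W \<and> nrm A (a \<ominus> w) < inverse (real (Suc n))"
    by (metis inverse_positive_iff_positive of_nat_0_less_iff zero_less_Suc)
  then obtain s where s: "\<And>n. s n \<in> W" "\<And>n. nrm A (a \<ominus> s n) < inverse (real (Suc n))"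
    by metis
  have "converges_to s a"
    by (rule converges_toI[where r = "\<lambda>n. inverse (real (Suc n))"])
      (use a s W LIMSEQ_inverse_real_of_nat nrm_diff_commute in \<open>auto simp: subset_eq less_imp_le\<close>)
  then show "\<exists>s. (\<forall>n. s n \<in> W) \<and> converges_to s a" using s(1) by blast
next
  assume "\<exists>s. (\<forall>n. s n \<in> W) \<and> converges_to s a"
  then obtain s where s: "\<And>n. s n \<in> W" "converges_to s a" by blast
  note c = converges_toD[OF s(2)]
  have "\<exists>w\<in>W. nrm A (a \<ominus> w) < e" if e: "e > 0" for e
  proof -
    obtain n where "norm (nrm A (s n \<ominus> a)) < e"
      using LIMSEQ_D[OF c(3) e] by auto
    then show ?thesis
      using s(1) nrm_diff_commute[OF c(2) c(1), of n] by (intro bexI[of _ "s n"]) auto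
  qed
  then show "a \<in> carrier A \<and> (\<forall>e>0. \<exists>w\<in>W. nrm A (a \<ominus> w) < e)" using c(2) by blast
qed

end

locale unital_star_subalgebra =
  fixes A :: "'a cstar" and W :: "'a set"
  assumes cstar: "unital_cstar A" and W_carrier: "W \<subseteq> carrier A" and W_one: "\<one>\<^bsub>A\<^esub> \<in> W"
    and W_add: "\<And>x y. x \<in> W \<Longrightarrow> y \<in> W \<Longrightarrow> x \<oplus>\<^bsub>A\<^esub> y \<in> W"
    and W_mult: "\<And>x y. x \<in> W \<Longrightarrow> y \<in> W \<Longrightarrow> x \<otimes>\<^bsub>A\<^esub> y \<in> W"
    and W_cscale: "\<And>c x. x \<in> W \<Longrightarrow> cscale A c x \<in> W"
    and W_star: "\<And>x. x \<in> W \<Longrightarrow> star A x \<in> W"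
begin

sublocale unital_cstar A by (rule cstar)

abbreviation C :: "'a cstar" where "C \<equiv> A\<lparr>carrier := norm_closure A W\<rparr>"

lemma closure_iff: "a \<in> norm_closure A W \<longleftrightarrow> (\<exists>s. (\<forall>n. s n \<in> W) \<and> converges_to s a)"
  unfolding norm_closure_def mem_Collect_eq by (rule norm_closure_iff_limit[OF W_carrier])

lemma closure_carrier: "a \<in> norm_closure A W \<Longrightarrow> a \<in> carrier A"
  by (simp add: norm_closure_def)

lemma W_closure: "w \<in> W \<Longrightarrow> w \<in> norm_closure A W"
  unfolding closure_iff using W_carrier by (intro exI[of _ "\<lambda>_. w"]) (auto intro: converges_to_const)

lemma closure_closed:
  "a \<in> norm_closure A W \<Longrightarrow> b \<in> norm_closure A W \<Longrightarrow> a \<oplus>\<^bsub>A\<^esub> b \<in> norm_closure A W"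
  "a \<in> norm_closure A W \<Longrightarrow> b \<in> norm_closure A W \<Longrightarrow> a \<otimes>\<^bsub>A\<^esub> b \<in> norm_closure A W"
  "a \<in> norm_closure A W \<Longrightarrow> cscale A c a \<in> norm_closure A W"
  "a \<in> norm_closure A W \<Longrightarrow> star A a \<in> norm_closure A W"
proof -
  assume "a \<in> norm_closure A W"
  then obtain s where s: "\<And>n. s n \<in> W" "converges_to s a"
    unfolding closure_iff by blast
  show "cscale A c a \<in> norm_closure A W"
    unfolding closure_iff using converges_to_cscale[OF s(2)] W_cscale[OF s(1)]
    by (intro exI[of _ "\<lambda>n. cscale A c (s n)"]) simp
  show "star A a \<in> norm_closure A W"
    unfolding closure_iff using converges_to_star[OF s(2)] W_star[OF s(1)]
    by (intro exI[of _ "\<lambda>n. star A (s n)"]) simp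
  assume "b \<in> norm_closure A W"
  then obtain t where t: "\<And>n. t n \<in> W" "converges_to t b"
    unfolding closure_iff by blast
  show "a \<oplus>\<^bsub>A\<^esub> b \<in> norm_closure A W"
    unfolding closure_iff using converges_to_add[OF s(2) t(2)] W_add[OF s(1) t(1)]
    by (intro exI[of _ "\<lambda>n. s n \<oplus>\<^bsub>A\<^esub> t n"]) simp
  show "a \<otimes>\<^bsub>A\<^esub> b \<in> norm_closure A W"
    unfolding closure_iff using converges_to_mult[OF s(2) t(2)] W_mult[OF s(1) t(1)]
    by (intro exI[of _ "\<lambda>n. s n \<otimes>\<^bsub>A\<^esub> t n"]) simp
qed

lemma zero_closure: "\<zero>\<^bsub>A\<^esub> \<in> norm_closure A W"
  using closure_closed(3)[OF W_closure[OF W_one], of 0] by simp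

lemma ring_closure: "Ring.ring C"
proof (rule ringI)
  show "abelian_group C"
  proof (rule abelian_groupI)
    fix x assume "x \<in> carrier C"
    then have x: "x \<in> norm_closure A W" by simp
    show "\<exists>y\<in>carrier C. y \<oplus>\<^bsub>C\<^esub> x = \<zero>\<^bsub>C\<^esub>"
      using x closure_closed(3)[OF x, of "-1"] closure_carrier[OF x] l_neg[of x]
      by (auto simp: a_inv_eq_cscale)
  qed (auto simp: closure_closed zero_closure closure_carrier a_ac)
  show "Group.monoid C"
    by (rule Group.monoidI) (auto simp: closure_closed W_closure W_one closure_carrier m_assoc)
qed (auto simp: closure_carrier l_distr r_distr)

text \<open>Subtraction in a record is built from inverses within its carrier, so shrinking the
  carrier could change it; uniqueness of additive inverses shows that it does not.\<close>

lemma a_minus_closure: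
  assumes x: "x \<in> norm_closure A W" and y: "y \<in> norm_closure A W"
  shows "x \<ominus>\<^bsub>C\<^esub> y = x \<ominus>\<^bsub>A\<^esub> y"
proof -
  interpret C: Ring.ring C by (rule ring_closure)
  have "\<ominus>\<^bsub>C\<^esub> y = cscale A (-1) y"
    using y closure_closed(3)[OF y, of "-1"] closure_carrier[OF y] l_neg[of y]
    by (intro C.minus_equality) (auto simp: a_inv_eq_cscale)
  then show ?thesis
    using closure_carrier[OF y] by (simp add: a_minus_def a_inv_eq_cscale)
qed

lemma unital_cstar_closure: "unital_cstar C"
proof (rule unital_cstar.intro[OF ring_closure], unfold_locales)
  fix s :: "nat \<Rightarrow> 'a"
  assume s: "\<And>n. s n \<in> carrier C"
    and Cauchy: "\<And>e. 0 < e \<Longrightarrow> \<exists>N. \<forall>m\<ge>N. \<forall>n\<ge>N. nrm C (s m \<ominus>\<^bsub>C\<^esub> s n) < e"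
  have sW: "s n \<in> norm_closure A W" for n using s by simp
  note sA = closure_carrier[OF sW]
  have "\<exists>N. \<forall>m\<ge>N. \<forall>n\<ge>N. nrm A (s m \<ominus>\<^bsub>A\<^esub> s n) < e" if "0 < e" for e
    using Cauchy[OF that] by (simp add: a_minus_closure[OF sW sW])
  then obtain a where a: "a \<in> carrier A" "(\<lambda>n. nrm A (s n \<ominus>\<^bsub>A\<^esub> a)) \<longlonglongrightarrow> 0"
    using nrm_complete[of s, OF sA] by auto
  have "a \<in> norm_closure A W"
    unfolding norm_closure_def
  proof (intro CollectI conjI allI impI a(1))
    fix e :: real assume e: "0 < e"
    then have "0 < e / 2" by simp
    from LIMSEQ_D[OF a(2) this] obtain n where "norm (nrm A (s n \<ominus>\<^bsub>A\<^esub> a) - 0) < e / 2"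
      by blast
    then have n: "nrm A (s n \<ominus>\<^bsub>A\<^esub> a) < e / 2" by simp
    obtain w where w: "w \<in> W" "nrm A (s n \<ominus>\<^bsub>A\<^esub> w) < e / 2"
      using sW[of n] e unfolding norm_closure_def by (auto dest!: spec[of _ "e/2"])
    have "nrm A (a \<ominus>\<^bsub>A\<^esub> w) < e"
      using nrm_diff_triangle[of a "s n" w] nrm_diff_commute[of a "s n"] n w a(1) sA W_carrier by auto
    then show "\<exists>w\<in>W. nrm A (a \<ominus>\<^bsub>A\<^esub> w) < e" using w by blast
  qed
  then show "\<exists>a\<in>carrier C. (\<lambda>n. nrm C (s n \<ominus>\<^bsub>C\<^esub> a)) \<longlonglongrightarrow> 0"
    using a(2) by (intro bexI[of _ a]) (simp_all add: a_minus_closure[OF sW])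
qed (auto simp: closure_carrier closure_closed cscale_one cscale_cscale cscale_add_left cscale_add_right
    mult_cscale_left mult_cscale_right star_star star_add star_cscale star_mult nrm_nonneg nrm_eq_zero
    nrm_triangle nrm_cscale nrm_mult nrm_star_mult)

end

section \<open>The regular representation\<close>

interpretation ops: unital_cstar "ops :: 'b::cstar_algebra l2_op cstar"
  by (rule unital_cstar_ops)

text \<open>\<open>\<parallel>T\<parallel>\<^sup>2 - T\<^sup>* T\<close> has a self-adjoint square root among the adjointable operators.\<close>

lemma real_state_op_le:
  assumes f: "f \<in> real_states" and T: "T \<in> carrier ops" and \<xi>: "\<xi> \<in> l2"
  shows "f (l2_inner (T \<xi>) (T \<xi>)) \<le> (nrm ops T)\<^sup>2 * f (l2_inner \<xi> \<xi>)"
proof -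
  note l = real_stateD(1)[OF f]
  define h where "h = mult ops (star ops T) T"
  have h: "h \<in> carrier ops" "star ops h = h" "nrm ops h \<le> (nrm ops T)\<^sup>2"
    using T by (simp_all add: h_def ops_mult ops.nrm_star_mult)
  obtain S where S: "ops.pos S" "mult ops S S = ops.scal ((nrm ops T)\<^sup>2) \<ominus>\<^bsub>ops\<^esub> h"
    using ops.pos_sqrt[OF ops.pos_scal_diff[OF h]] by metis
  note Sc = ops.posD[OF S(1)]
  have "S (S \<xi>) = (\<lambda>n. (nrm ops T)\<^sup>2 *\<^sub>R \<xi> n - star ops T (T \<xi>) n)"
    using arg_cong[OF S(2), of "\<lambda>R. R \<xi>"] \<xi> h(1)
    by (simp add: a_minus_ops ops.cscale_closed) (simp add: h_def scaleC_of_real flip: of_real_power)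
  moreover have "0 \<le> f (l2_inner (S \<xi>) (S \<xi>))"
    using f Sc \<xi> by (simp add: real_state_inner_self_nonneg)
  moreover have "l2_inner (S \<xi>) (S \<xi>) = l2_inner \<xi> (S (S \<xi>))"
    using ops_inner(1)[OF Sc(1) \<xi>, of "S \<xi>"] Sc \<xi> by simp
  moreover have "(\<lambda>n. (nrm ops T)\<^sup>2 *\<^sub>R \<xi> n) \<in> l2"
    using l2_scaleC[OF \<xi>, of "complex_of_real ((nrm ops T)\<^sup>2)"] unfolding scaleC_of_real .
  moreover have "l2_inner \<xi> (\<lambda>n. (nrm ops T)\<^sup>2 *\<^sub>R \<xi> n) = (nrm ops T)\<^sup>2 *\<^sub>R l2_inner \<xi> \<xi>"
    using l2_inner_scaleC_right[OF \<xi> \<xi>, of "complex_of_real ((nrm ops T)\<^sup>2)"] unfolding scaleC_of_real .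
  moreover have "l2_inner \<xi> (star ops T (T \<xi>)) = l2_inner (T \<xi>) (T \<xi>)"
    using T \<xi> by (simp add: ops_inner)
  ultimately show ?thesis
    using \<xi> T by (simp add: l2_inner_diff_right linear_diff[OF l] linear_scale[OF l])
qed

lemma l2_inner_sum_right:
  "\<xi> \<in> l2 \<Longrightarrow> (\<And>k. k \<in> K \<Longrightarrow> \<eta> k \<in> l2) \<Longrightarrow> l2_inner \<xi> (\<lambda>n. \<Sum>k\<in>K. \<eta> k n) = (\<Sum>k\<in>K. l2_inner \<xi> (\<eta> k))"
  by (induction K rule: infinite_finite_induct) (auto simp: l2_inner_add_right)

lemma l2_inner_sum_left:
  "\<xi> \<in> l2 \<Longrightarrow> (\<And>k. k \<in> K \<Longrightarrow> \<eta> k \<in> l2) \<Longrightarrow> l2_inner (\<lambda>n. \<Sum>k\<in>K. \<eta> k n) \<xi> = (\<Sum>k\<in>K. l2_inner (\<eta> k) \<xi>)"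
  using l2_inner_adj[of \<xi> "\<lambda>n. \<Sum>k\<in>K. \<eta> k n"] l2_inner_sum_right[of \<xi> K \<eta>] l2_inner_adj[of \<xi>]
  by (simp add: adj_sum)

lemma l2_norm_sum_le:
  "(\<And>k. k \<in> K \<Longrightarrow> \<eta> k \<in> l2) \<Longrightarrow> l2_norm (\<lambda>n. \<Sum>k\<in>K. \<eta> k n) \<le> (\<Sum>k\<in>K. l2_norm (\<eta> k))"
proof (induction K rule: infinite_finite_induct)
  case (insert k K)
  then show ?case
    using l2_norm_triangle[of "\<eta> k" "\<lambda>n. \<Sum>k\<in>K. \<eta> k n"] by simp
qed auto

lemma l2_norm_mult_le:
  assumes \<xi>: "\<xi> \<in> l2" and b: "\<And>n. norm (b n) \<le> C"
  shows "l2_norm (\<lambda>n. b n * \<xi> n) \<le> C * l2_norm \<xi>"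
proof (rule l2_norm_leI_finite)
  have C: "C \<ge> 0" using b[of 0] norm_ge_zero order_trans by blast
  then show "0 \<le> C * l2_norm \<xi>" by simp
  fix f :: "'a \<Rightarrow> real" and G :: "int set" assume f: "f \<in> real_states" and G: "finite G"
  have "(\<Sum>n\<in>G. f (sq (b n * \<xi> n))) \<le> (\<Sum>n\<in>G. C\<^sup>2 * f (sq (\<xi> n)))"
  proof (rule sum_mono)
    fix n
    have "(norm (b n))\<^sup>2 * f (sq (\<xi> n)) \<le> C\<^sup>2 * f (sq (\<xi> n))"
      using b[of n] f by (intro mult_right_mono power_mono) auto
    then show "f (sq (b n * \<xi> n)) \<le> C\<^sup>2 * f (sq (\<xi> n))"
      using real_state_sq_mult_le[OF f, of "b n" "\<xi> n"] by simp
  qed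
  also have "\<dots> = C\<^sup>2 * (\<Sum>n\<in>G. f (sq (\<xi> n)))"
    by (simp add: sum_distrib_left)
  also have "\<dots> \<le> C\<^sup>2 * (l2_norm \<xi>)\<^sup>2"
    using sum_real_state_sq_le[OF f \<xi> G] real_state_inner_self_le_norm[OF f, of \<xi>]
    by (intro mult_left_mono) auto
  finally show "(\<Sum>n\<in>G. f (sq (b n * \<xi> n))) \<le> (C * l2_norm \<xi>)\<^sup>2"
    by (simp add: power_mult_distrib)
qed (rule l2_mult_bounded[OF \<xi> b])

lemma l2_norm_shift: "l2_norm (shift n \<xi>) = l2_norm \<xi>"
  using infsum_reindex_bij_betw[OF bij_shift, of "\<lambda>m. adj (\<xi> m) * \<xi> m" n]
  by (simp add: l2_norm_def l2_inner_def shift_def)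

lemma int_iter_zero [simp]: "star_automorphism \<beta> \<Longrightarrow> int_iter \<beta> n 0 = 0"
  using linear_0[OF star_automorphismD(7)[OF star_automorphism_int_iter]] .

lemma norm_int_iter [simp]: "star_automorphism \<beta> \<Longrightarrow> norm (int_iter \<beta> n x) = norm x"
  by (simp add: star_automorphism_int_iter)

lemma coeff_op_l2:
  "star_automorphism \<beta> \<Longrightarrow> \<xi> \<in> l2 \<Longrightarrow> coeff_op \<beta> b \<xi> \<in> l2"
  unfolding coeff_op_def by (rule l2_mult_bounded[of _ _ "norm b"]) auto

lemma l2_norm_coeff_op_le:
  "star_automorphism \<beta> \<Longrightarrow> \<xi> \<in> l2 \<Longrightarrow> l2_norm (coeff_op \<beta> b \<xi>) \<le> norm b * l2_norm \<xi>"
  unfolding coeff_op_def by (rule l2_norm_mult_le) auto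

text \<open>The adjoint of \<open>b U^n\<close> is \<open>U^(-n) adj b\<close>, which covariance
  rewrites as \<open>\<beta>^(-n) (adj b) U^(-n)\<close>.\<close>

lemma coeff_op_adj:
  assumes \<beta>: "star_automorphism \<beta>"
  shows "l2_inner (coeff_op \<beta> (int_iter \<beta> (- n) (adj b)) (shift (- n) \<xi>)) \<eta> = l2_inner \<xi> (coeff_op \<beta> b (shift n \<eta>))"
proof -
  note b = star_automorphismD(1)[OF \<beta>]
  have "adj (coeff_op \<beta> (int_iter \<beta> (- n) (adj b)) (shift (- n) \<xi>) m) * \<eta> m
      = adj (\<xi> (m + n)) * coeff_op \<beta> b (shift n \<eta>) (m + n)" for m
    using star_automorphismD(5)[OF star_automorphism_int_iter[OF \<beta>], of "- m - n" b]
    by (simp add: coeff_op_def shift_def adj_mult adj_adj mult.assoc flip: int_iter_add[OF b])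
  moreover have "bij (\<lambda>m. m + n :: int)"
    by (rule o_bij[of "\<lambda>m. m - n"]) auto
  ultimately show ?thesis
    using infsum_reindex_bij_betw[of "\<lambda>m. m + n" UNIV UNIV "\<lambda>m. adj (\<xi> m) * coeff_op \<beta> b (shift n \<eta>) m"]
    by (simp add: l2_inner_def)
qed

lemma fin_suppD: "x \<in> fin_supp V \<Longrightarrow> finite {n. x n \<noteq> 0}" "x \<in> fin_supp V \<Longrightarrow> x n \<in> V"
  by (auto simp: fin_supp_def)

lemma fin_supp_UNIV: "x \<in> fin_supp V \<Longrightarrow> x \<in> fin_supp UNIV"
  by (simp add: fin_supp_def)

lemma fin_supp_zero_outside:
  assumes "finite F" "\<And>n. n \<notin> F \<Longrightarrow> x n = 0" "\<And>n. x n \<in> V"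
  shows "x \<in> fin_supp V"
  using assms finite_subset[of "{n. x n \<noteq> 0}" F] by (auto simp: fin_supp_def)

lemma coeff_op_zero [simp]: "star_automorphism \<beta> \<Longrightarrow> coeff_op \<beta> 0 \<xi> = (\<lambda>m. 0)"
  by (simp add: coeff_op_def)

text \<open>Any finite set containing the support may carry the sum, so that several elements can be
  expanded over one index set.\<close>

lemma reg_rep_apply:
  assumes \<beta>: "star_automorphism \<beta>" and \<xi>: "\<xi> \<in> l2" and F: "finite F" "\<And>n. n \<notin> F \<Longrightarrow> x n = 0"
  shows "reg_rep \<beta> x \<xi> = (\<lambda>m. \<Sum>n\<in>F. coeff_op \<beta> (x n) (shift n \<xi>) m)"
proof
  fix m
  show "reg_rep \<beta> x \<xi> m = (\<Sum>n\<in>F. coeff_op \<beta> (x n) (shift n \<xi>) m)"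
    using \<xi> F \<beta> by (auto simp: reg_rep_def intro!: sum.mono_neutral_left)
qed

lemma reg_rep_ops:
  fixes x :: "int \<Rightarrow> 'b::cstar_algebra"
  assumes \<beta>: "star_automorphism \<beta>" and F: "finite F" "\<And>n. n \<notin> F \<Longrightarrow> x n = 0"
  shows "reg_rep \<beta> x \<in> carrier ops" "star ops (reg_rep \<beta> x) = reg_rep \<beta> (cp_adj \<beta> x)"
    "nrm ops (reg_rep \<beta> x) \<le> (\<Sum>n\<in>F. norm (x n))"
proof -
  have app: "reg_rep \<beta> x \<xi> = (\<lambda>m. \<Sum>n\<in>F. coeff_op \<beta> (x n) (shift n \<xi>) m)" if "\<xi> \<in> l2" for \<xi>
    by (rule reg_rep_apply[OF \<beta> that F])
  have F': "finite (uminus ` F)" "\<And>n. n \<notin> uminus ` F \<Longrightarrow> cp_adj \<beta> x n = 0"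
    using F by (auto simp: cp_adj_def \<beta>) (metis F(2) \<beta> adj_zero int_iter_zero imageI minus_minus)
  have app': "reg_rep \<beta> (cp_adj \<beta> x) \<xi>
      = (\<lambda>m. \<Sum>n\<in>F. coeff_op \<beta> (int_iter \<beta> (- n) (adj (x n))) (shift (- n) \<xi>) m)" if "\<xi> \<in> l2" for \<xi>
  proof -
    have "reg_rep \<beta> (cp_adj \<beta> x) \<xi> = (\<lambda>m. \<Sum>n\<in>uminus ` F. coeff_op \<beta> (cp_adj \<beta> x n) (shift n \<xi>) m)"
      by (rule reg_rep_apply[OF \<beta> that F'])
    then show ?thesis by (simp add: sum.reindex cp_adj_def)
  qed
  have fns: "reg_rep \<beta> x \<in> l2 \<rightarrow>\<^sub>E l2"
    using app by (auto simp: coeff_op_l2 \<beta>) (auto simp: reg_rep_def)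
  have fns': "reg_rep \<beta> (cp_adj \<beta> x) \<in> l2 \<rightarrow>\<^sub>E l2"
    using app' by (auto simp: coeff_op_l2 \<beta>) (auto simp: reg_rep_def)
  have adj: "is_adjoint (reg_rep \<beta> (cp_adj \<beta> x)) (reg_rep \<beta> x)"
    unfolding is_adjoint_def
    using fns' by (auto simp: app app' l2_inner_sum_left l2_inner_sum_right coeff_op_l2 \<beta> coeff_op_adj)
  have bound: "l2_norm (reg_rep \<beta> x \<xi>) \<le> (\<Sum>n\<in>F. norm (x n)) * l2_norm \<xi>" if \<xi>: "\<xi> \<in> l2" for \<xi>
  proof -
    have "l2_norm (reg_rep \<beta> x \<xi>) \<le> (\<Sum>n\<in>F. l2_norm (coeff_op \<beta> (x n) (shift n \<xi>)))"
      unfolding app[OF \<xi>] using \<xi> by (intro l2_norm_sum_le) (simp add: coeff_op_l2 \<beta>)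
    also have "\<dots> \<le> (\<Sum>n\<in>F. norm (x n) * l2_norm \<xi>)"
      using l2_norm_coeff_op_le[OF \<beta> l2_shift[OF \<xi>]] by (intro sum_mono) (simp add: l2_norm_shift)
    finally show ?thesis by (simp add: sum_distrib_right)
  qed
  show "reg_rep \<beta> x \<in> carrier ops" "star ops (reg_rep \<beta> x) = reg_rep \<beta> (cp_adj \<beta> x)"
    using opsI[OF fns adj bound] by simp_all
  show "nrm ops (reg_rep \<beta> x) \<le> (\<Sum>n\<in>F. norm (x n))"
    by (rule nrm_ops_leI) (use bound in \<open>auto intro: sum_nonneg\<close>)
qed

text \<open>It plays two roles: the coefficient sequence of the unit, and the vector at position 0
  from whose image coefficients are read off.\<close>

definition unit_seq :: "int \<Rightarrow> 'b::cstar_algebra" where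
  "unit_seq n = (if n = 0 then 1 else 0)"

lemma unit_seq_l2: "unit_seq \<in> l2"
  by (rule l2_finite_support) (auto simp: unit_seq_def intro: finite_subset[of _ "{0}"])

lemma l2_norm_unit_seq: "l2_norm (unit_seq :: int \<Rightarrow> 'b::cstar_algebra) = 1"
proof -
  have "l2_inner unit_seq unit_seq = infsum (\<lambda>n. adj (unit_seq n) * unit_seq n :: 'b) {0}"
    unfolding l2_inner_def by (rule infsum_cong_neutral) (auto simp: unit_seq_def)
  then show ?thesis by (simp add: l2_norm_def unit_seq_def)
qed

context
  fixes \<beta> :: "'b::cstar_algebra \<Rightarrow> 'b"
  assumes \<beta>: "star_automorphism \<beta>"
begin

lemma reg_rep_carrier: "x \<in> fin_supp V \<Longrightarrow> reg_rep \<beta> x \<in> carrier ops"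
  by (rule reg_rep_ops(1)[OF \<beta> fin_suppD(1)]) auto

lemma reg_rep_star: "x \<in> fin_supp V \<Longrightarrow> star ops (reg_rep \<beta> x) = reg_rep \<beta> (cp_adj \<beta> x)"
  by (rule reg_rep_ops(2)[OF \<beta> fin_suppD(1)]) auto

lemma reg_rep_add:
  assumes x: "x \<in> fin_supp V" and y: "y \<in> fin_supp V'"
  shows "reg_rep \<beta> (\<lambda>n. x n + y n) = add ops (reg_rep \<beta> x) (reg_rep \<beta> y)"
proof (rule ops_eqI)
  let ?F = "{n. x n \<noteq> 0} \<union> {n. y n \<noteq> 0}"
  have F: "finite ?F" using x y by (auto dest: fin_suppD)
  show "reg_rep \<beta> (\<lambda>n. x n + y n) \<in> carrier ops"
    by (rule reg_rep_ops(1)[OF \<beta> F]) auto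
  show "add ops (reg_rep \<beta> x) (reg_rep \<beta> y) \<in> carrier ops"
    using x y reg_rep_carrier by simp
  fix \<xi> :: "int \<Rightarrow> 'b" assume \<xi>: "\<xi> \<in> l2"
  have "reg_rep \<beta> x \<xi> = (\<lambda>m. \<Sum>n\<in>?F. coeff_op \<beta> (x n) (shift n \<xi>) m)"
    "reg_rep \<beta> y \<xi> = (\<lambda>m. \<Sum>n\<in>?F. coeff_op \<beta> (y n) (shift n \<xi>) m)"
    "reg_rep \<beta> (\<lambda>n. x n + y n) \<xi> = (\<lambda>m. \<Sum>n\<in>?F. coeff_op \<beta> (x n + y n) (shift n \<xi>) m)"
    by (rule reg_rep_apply[OF \<beta> \<xi> F], auto)+
  then show "reg_rep \<beta> (\<lambda>n. x n + y n) \<xi> = add ops (reg_rep \<beta> x) (reg_rep \<beta> y) \<xi>"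
    using \<xi> star_automorphismD(2)[OF star_automorphism_int_iter[OF \<beta>]]
    by (simp add: coeff_op_def distrib_right sum.distrib)
qed

lemma reg_rep_scaleC:
  assumes x: "x \<in> fin_supp V"
  shows "reg_rep \<beta> (\<lambda>n. scaleC c (x n)) = cscale ops c (reg_rep \<beta> x)"
proof (rule ops_eqI)
  let ?F = "{n. x n \<noteq> 0}"
  have F: "finite ?F" using x by (auto dest: fin_suppD)
  have sc0: "scaleC c (0::'b) = 0" using linear_0[OF linear_scaleC] .
  show "reg_rep \<beta> (\<lambda>n. scaleC c (x n)) \<in> carrier ops"
    by (rule reg_rep_ops(1)[OF \<beta> F]) (auto simp: sc0)
  show "cscale ops c (reg_rep \<beta> x) \<in> carrier ops"
    using x reg_rep_carrier by simp
  fix \<xi> :: "int \<Rightarrow> 'b" assume \<xi>: "\<xi> \<in> l2"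
  have "reg_rep \<beta> x \<xi> = (\<lambda>m. \<Sum>n\<in>?F. coeff_op \<beta> (x n) (shift n \<xi>) m)"
    "reg_rep \<beta> (\<lambda>n. scaleC c (x n)) \<xi> = (\<lambda>m. \<Sum>n\<in>?F. coeff_op \<beta> (scaleC c (x n)) (shift n \<xi>) m)"
    by (rule reg_rep_apply[OF \<beta> \<xi> F], auto simp: sc0)+
  then show "reg_rep \<beta> (\<lambda>n. scaleC c (x n)) \<xi> = cscale ops c (reg_rep \<beta> x) \<xi>"
    using \<xi> star_automorphismD(3)[OF star_automorphism_int_iter[OF \<beta>]]
    by (simp add: coeff_op_def mult_scaleC_left linear_sum[OF linear_scaleC])
qed

lemma reg_rep_diff:
  assumes x: "x \<in> fin_supp V" and y: "y \<in> fin_supp V'"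
  shows "reg_rep \<beta> (\<lambda>n. x n - y n) = reg_rep \<beta> x \<ominus>\<^bsub>ops\<^esub> reg_rep \<beta> y"
proof -
  have "(\<lambda>n. scaleC (-1) (y n)) \<in> fin_supp UNIV"
    using y by (auto simp: fin_supp_def scaleC_minus_left)
  from reg_rep_add[OF x this] show ?thesis
    using y reg_rep_carrier by (simp add: scaleC_minus_left reg_rep_scaleC[OF y, of "-1", simplified scaleC_minus_left scaleC_one]
        a_minus_def ops.a_inv_eq_cscale)
qed

lemma reg_rep_one: "reg_rep \<beta> unit_seq = one ops"
proof (rule ops_eqI)
  have F: "finite {0::int}" by simp
  show "reg_rep \<beta> unit_seq \<in> carrier ops"
    by (rule reg_rep_ops(1)[OF \<beta> F]) (auto simp: unit_seq_def)
  fix \<xi> :: "int \<Rightarrow> 'b" assume \<xi>: "\<xi> \<in> l2"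
  have "reg_rep \<beta> unit_seq \<xi> = (\<lambda>m. \<Sum>n\<in>{0}. coeff_op \<beta> (unit_seq n) (shift n \<xi>) m)"
    by (rule reg_rep_apply[OF \<beta> \<xi> F]) (auto simp: unit_seq_def)
  then show "reg_rep \<beta> unit_seq \<xi> = one ops \<xi>"
    using \<xi> star_automorphismD(6)[OF star_automorphism_int_iter[OF \<beta>]]
    by (simp add: unit_seq_def coeff_op_def shift_def)
qed (rule ops_one)

lemma reg_rep_unit_seq_apply:
  assumes x: "x \<in> fin_supp V"
  shows "reg_rep \<beta> x unit_seq m = int_iter \<beta> (- m) (x m)"
proof -
  have "reg_rep \<beta> x unit_seq = (\<lambda>m. \<Sum>n | x n \<noteq> 0. coeff_op \<beta> (x n) (shift n unit_seq) m)"
    by (rule reg_rep_apply[OF \<beta> unit_seq_l2 fin_suppD(1)[OF x]]) auto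
  then have "reg_rep \<beta> x unit_seq m = (\<Sum>n | x n \<noteq> 0. if n = m then int_iter \<beta> (- m) (x m) else 0)"
    by (auto intro!: sum.cong simp: coeff_op_def shift_def unit_seq_def)
  then show ?thesis
    using x \<beta> by (auto simp: fin_supp_def sum.delta)
qed

text \<open>The image of \<open>unit_seq\<close> has the m-th entry
  \<open>\<beta>^(-m) (x m)\<close>, and automorphisms are isometric.\<close>

lemma norm_coeff_le:
  assumes x: "x \<in> fin_supp V"
  shows "norm (x m) \<le> nrm ops (reg_rep \<beta> x)"
proof -
  note T = reg_rep_carrier[OF x]
  have "norm (x m) = norm (reg_rep \<beta> x unit_seq m)"
    by (simp add: reg_rep_unit_seq_apply[OF x] \<beta>)
  also have "\<dots> \<le> l2_norm (reg_rep \<beta> x unit_seq)"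
    by (rule norm_component_le[OF ops_l2[OF T unit_seq_l2]])
  also have "\<dots> \<le> nrm ops (reg_rep \<beta> x)"
    using l2_norm_op_le[OF T unit_seq_l2] by (simp add: l2_norm_unit_seq)
  finally show ?thesis .
qed

lemma reg_rep_mult:
  assumes x: "x \<in> fin_supp UNIV" and y: "y \<in> fin_supp UNIV"
  shows "mult ops (reg_rep \<beta> x) (reg_rep \<beta> y) \<in> reg_rep \<beta> ` fin_supp UNIV"
proof -
  note b = star_automorphismD(1)[OF \<beta>]
  note ii = star_automorphism_int_iter[OF \<beta>]
  let ?F = "{n. x n \<noteq> 0}" and ?G = "{n. y n \<noteq> 0}"
  have F: "finite ?F" and G: "finite ?G" using x y by (auto dest: fin_suppD)
  define H where "H = (\<lambda>(n, k). n + k) ` (?F \<times> ?G)"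
  have H: "finite H" using F G by (simp add: H_def)
  \<comment> \<open>Twisted convolution, from \<open>U^n b = \<beta>^n (b) U^n\<close>.\<close>
  define z where "z j = (\<Sum>n\<in>?F. x n * int_iter \<beta> n (y (j - n)))" for j
  have z0: "z j = 0" if "j \<notin> H" for j
  proof -
    have "x n * int_iter \<beta> n (y (j - n)) = 0" if "n \<in> ?F" for n
    proof (cases "y (j - n) = 0")
      case False
      then have "(n, j - n) \<in> ?F \<times> ?G" using that by simp
      then have "n + (j - n) \<in> H" unfolding H_def by force
      then show ?thesis using \<open>j \<notin> H\<close> by simp
    qed (simp add: \<beta>)
    then show ?thesis by (simp add: z_def)
  qed
  have "mult ops (reg_rep \<beta> x) (reg_rep \<beta> y) = reg_rep \<beta> z"
  proof (rule ops_eqI)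
    show "mult ops (reg_rep \<beta> x) (reg_rep \<beta> y) \<in> carrier ops"
      using reg_rep_carrier x y by simp
    show "reg_rep \<beta> z \<in> carrier ops"
      by (rule reg_rep_ops(1)[OF \<beta> H z0])
    fix \<xi> :: "int \<Rightarrow> 'b" assume \<xi>: "\<xi> \<in> l2"
    have y\<xi>: "reg_rep \<beta> y \<xi> \<in> l2" using reg_rep_carrier[OF y] \<xi> by simp
    have app: "reg_rep \<beta> x (reg_rep \<beta> y \<xi>) = (\<lambda>m. \<Sum>n\<in>?F. coeff_op \<beta> (x n) (shift n (reg_rep \<beta> y \<xi>)) m)"
      "reg_rep \<beta> y \<xi> = (\<lambda>m. \<Sum>k\<in>?G. coeff_op \<beta> (y k) (shift k \<xi>) m)"
      by (rule reg_rep_apply[OF \<beta> y\<xi> F] reg_rep_apply[OF \<beta> \<xi> G]; auto)+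
    show "mult ops (reg_rep \<beta> x) (reg_rep \<beta> y) \<xi> = reg_rep \<beta> z \<xi>"
    proof
      fix m
      have "mult ops (reg_rep \<beta> x) (reg_rep \<beta> y) \<xi> m
          = (\<Sum>n\<in>?F. coeff_op \<beta> (x n) (shift n (reg_rep \<beta> y \<xi>)) m)"
        unfolding ops_apply(1)[OF \<xi>] app(1) ..
      also have "\<dots> = (\<Sum>n\<in>?F. \<Sum>k\<in>?G. int_iter \<beta> (- m) (x n * int_iter \<beta> n (y k)) * \<xi> (m - (n + k)))"
        by (simp add: app(2) coeff_op_def shift_def sum_distrib_left
            star_automorphismD(4)[OF ii] int_iter_add[OF b, symmetric] mult.assoc diff_diff_eq)
      also have "\<dots> = (\<Sum>n\<in>?F. \<Sum>j\<in>H. int_iter \<beta> (- m) (x n * int_iter \<beta> n (y (j - n))) * \<xi> (m - j))"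
      proof (rule sum.cong[OF refl])
        fix n assume n: "n \<in> ?F"
        let ?t = "\<lambda>j. int_iter \<beta> (- m) (x n * int_iter \<beta> n (y (j - n))) * \<xi> (m - j)"
        have "(\<Sum>j\<in>H. ?t j) = (\<Sum>j\<in>(\<lambda>k. n + k) ` ?G. ?t j)"
        proof (rule sum.mono_neutral_right[OF H])
          show "(\<lambda>k. n + k) ` ?G \<subseteq> H" using n by (auto simp: H_def)
          show "\<forall>j\<in>H - (\<lambda>k. n + k) ` ?G. ?t j = 0"
          proof
            fix j assume "j \<in> H - (\<lambda>k. n + k) ` ?G"
            then have "y (j - n) = 0"
              by (auto simp: image_iff dest!: spec[of _ "j - n"])
            then show "?t j = 0" by (simp add: \<beta>)
          qed
        qed
        also have "\<dots> = (\<Sum>k\<in>?G. ?t (n + k))"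
          by (subst sum.reindex) auto
        finally show "(\<Sum>k\<in>?G. int_iter \<beta> (- m) (x n * int_iter \<beta> n (y k)) * \<xi> (m - (n + k))) = (\<Sum>j\<in>H. ?t j)"
          by simp
      qed
      also have "\<dots> = (\<Sum>j\<in>H. \<Sum>n\<in>?F. int_iter \<beta> (- m) (x n * int_iter \<beta> n (y (j - n))) * \<xi> (m - j))"
        by (rule sum.swap)
      also have "\<dots> = (\<Sum>j\<in>H. coeff_op \<beta> (z j) (shift j \<xi>) m)"
        by (simp add: coeff_op_def shift_def z_def linear_sum[OF star_automorphismD(7)[OF ii]] sum_distrib_right)
      also have "\<dots> = reg_rep \<beta> z \<xi> m"
      proof -
        have "reg_rep \<beta> z \<xi> = (\<lambda>m. \<Sum>j\<in>H. coeff_op \<beta> (z j) (shift j \<xi>) m)"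
          by (rule reg_rep_apply[OF \<beta> \<xi> H z0])
        then show ?thesis by simp
      qed
      finally show "mult ops (reg_rep \<beta> x) (reg_rep \<beta> y) \<xi> m = reg_rep \<beta> z \<xi> m" .
    qed
  qed
  moreover have "z \<in> fin_supp UNIV"
    using fin_supp_zero_outside[OF H z0] by simp
  ultimately show ?thesis by blast
qed

lemma cp_adj_fin_supp:
  assumes x: "x \<in> fin_supp V" and V: "0 \<in> V" "\<And>n v. v \<in> V \<Longrightarrow> int_iter \<beta> n (adj v) \<in> V"
  shows "cp_adj \<beta> x \<in> fin_supp V"
proof (rule fin_supp_zero_outside[of "uminus ` {n. x n \<noteq> 0}"])
  show "finite (uminus ` {n. x n \<noteq> 0})"
    using x by (simp add: fin_supp_def)
  show "cp_adj \<beta> x n = 0" if "n \<notin> uminus ` {n. x n \<noteq> 0}" for n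
  proof -
    have "x (- n) = 0" using that by (metis (mono_tags, lifting) imageI mem_Collect_eq minus_minus)
    then show ?thesis by (simp add: cp_adj_def \<beta>)
  qed
  show "cp_adj \<beta> x n \<in> V" for n
    using x V by (simp add: cp_adj_def fin_supp_def)
qed

lemma reg_rep_subalgebra: "unital_star_subalgebra ops (reg_rep \<beta> ` fin_supp UNIV)"
proof
  have unit: "unit_seq \<in> fin_supp (UNIV :: 'b set)"
    by (rule fin_supp_zero_outside[of "{0}"]) (auto simp: unit_seq_def)
  show "one ops \<in> reg_rep \<beta> ` fin_supp UNIV"
    using unit reg_rep_one by (metis imageI)
  fix S T assume S: "S \<in> reg_rep \<beta> ` fin_supp UNIV"
  then obtain x where x: "x \<in> fin_supp UNIV" "S = reg_rep \<beta> x" by blast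
  show "cscale ops c S \<in> reg_rep \<beta> ` fin_supp UNIV" for c
  proof -
    have "(\<lambda>n. scaleC c (x n)) \<in> fin_supp UNIV"
      using x(1) linear_0[OF linear_scaleC, of c]
      by (intro fin_supp_zero_outside[of "{n. x n \<noteq> 0}"]) (auto simp: fin_supp_def)
    then show ?thesis
      unfolding x(2) reg_rep_scaleC[OF x(1), symmetric] by blast
  qed
  show "star ops S \<in> reg_rep \<beta> ` fin_supp UNIV"
    unfolding x(2) reg_rep_star[OF x(1)] using cp_adj_fin_supp[OF x(1)] by blast
  assume "T \<in> reg_rep \<beta> ` fin_supp UNIV"
  then obtain y where y: "y \<in> fin_supp UNIV" "T = reg_rep \<beta> y" by blast
  show "add ops S T \<in> reg_rep \<beta> ` fin_supp UNIV"
  proof -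
    have "(\<lambda>n. x n + y n) \<in> fin_supp UNIV"
      using x(1) y(1) by (intro fin_supp_zero_outside[of "{n. x n \<noteq> 0} \<union> {n. y n \<noteq> 0}"]) (auto simp: fin_supp_def)
    then show ?thesis
      unfolding x(2) y(2) reg_rep_add[OF x(1) y(1), symmetric] by blast
  qed
  show "mult ops S T \<in> reg_rep \<beta> ` fin_supp UNIV"
    unfolding x(2) y(2) by (rule reg_rep_mult[OF x(1) y(1)])
qed (use reg_rep_carrier in auto)

lemma unital_cstar_crossed_product: "unital_cstar (crossed_product \<beta>)"
  unfolding crossed_product_def
  by (rule unital_star_subalgebra.unital_cstar_closure[OF reg_rep_subalgebra])

lemma crossed_product_carrier:
  "carrier (crossed_product \<beta>) = norm_closure ops (reg_rep \<beta> ` fin_supp UNIV)"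
  by (simp add: crossed_product_def)

lemma reg_rep_crossed_product: "x \<in> fin_supp V \<Longrightarrow> reg_rep \<beta> x \<in> carrier (crossed_product \<beta>)"
  unfolding crossed_product_carrier
  by (intro unital_star_subalgebra.W_closure[OF reg_rep_subalgebra] imageI fin_supp_UNIV)

lemma crossed_product_a_minus:
  assumes "S \<in> carrier (crossed_product \<beta>)" "T \<in> carrier (crossed_product \<beta>)"
  shows "S \<ominus>\<^bsub>crossed_product \<beta>\<^esub> T = S \<ominus>\<^bsub>ops\<^esub> T"
  using unital_star_subalgebra.a_minus_closure[OF reg_rep_subalgebra] assms
  by (simp add: crossed_product_def)

end

lemma crossed_product_record [simp]:
  "mult (crossed_product \<beta>) = mult ops" "one (crossed_product \<beta>) = one ops"
  "add (crossed_product \<beta>) = add ops" "zero (crossed_product \<beta>) = zero ops"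
  "cscale (crossed_product \<beta>) = cscale ops" "star (crossed_product \<beta>) = star ops"
  "nrm (crossed_product \<beta>) = nrm ops"
  by (simp_all add: crossed_product_def)

section \<open>Fourier multipliers with square summable symbol\<close>

lemma summable_on_infsum_sum:
  fixes g :: "'k \<Rightarrow> 'i \<Rightarrow> real"
  assumes "\<And>k. k \<in> G \<Longrightarrow> g k summable_on A"
  shows "(\<lambda>l. \<Sum>k\<in>G. g k l) summable_on A \<and> infsum (\<lambda>l. \<Sum>k\<in>G. g k l) A = (\<Sum>k\<in>G. infsum (g k) A)"
  using assms by (induction G rule: infinite_finite_induct) (auto simp: summable_on_add infsum_add)

text \<open>With \<open>\<xi>\<^sub>k(l) = c(k - l) \<xi>(l)\<close>, the operator with coefficients \<open>c(n) y(n)\<close> maps \<open>\<xi>\<close> to a vector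
  whose \<open>k\<close>-th entry is the \<open>k\<close>-th entry of the image of \<open>\<xi>\<^sub>k\<close> under the operator with coefficients \<open>y\<close>.\<close>

lemma nrm_multiplier_le:
  fixes y :: "int \<Rightarrow> 'b::cstar_algebra" and c :: "int \<Rightarrow> real"
  assumes \<beta>: "star_automorphism \<beta>" and y: "y \<in> fin_supp V"
    and S: "\<And>G. finite G \<Longrightarrow> (\<Sum>n\<in>G. (c n)\<^sup>2) \<le> S"
  shows "nrm ops (reg_rep \<beta> (\<lambda>n. c n *\<^sub>R y n)) \<le> sqrt S * nrm ops (reg_rep \<beta> y)"
proof (rule nrm_ops_leI)
  let ?T = "reg_rep \<beta> (\<lambda>n. c n *\<^sub>R y n)" and ?Y = "nrm ops (reg_rep \<beta> y)"
  have S0: "S \<ge> 0" using S[of "{}"] by simp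
  note T = reg_rep_carrier[OF \<beta> y]
  then have Y0: "?Y \<ge> 0" by (rule nrm_ops_nonneg)
  then show "0 \<le> sqrt S * ?Y" using S0 by simp
  have F: "finite {n. y n \<noteq> 0}" using y by (simp add: fin_supp_def)
  have cS: "\<bar>c n\<bar> \<le> sqrt S" for n
    using S[of "{n}"] by (simp add: real_le_rsqrt)
  fix \<xi> :: "int \<Rightarrow> 'b" assume \<xi>: "\<xi> \<in> l2"
  define \<zeta> where "\<zeta> k l = c (k - l) *\<^sub>R \<xi> l" for k l
  have \<zeta>: "\<zeta> k \<in> l2" for k
    using l2_mult_bounded[OF \<xi>, of "\<lambda>l. c (k - l) *\<^sub>R 1" "sqrt S"] cS by (simp add: \<zeta>_def[abs_def])
  have entry: "?T \<xi> k = reg_rep \<beta> y (\<zeta> k) k" for k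
  proof -
    have "?T \<xi> = (\<lambda>m. \<Sum>n | y n \<noteq> 0. coeff_op \<beta> (c n *\<^sub>R y n) (shift n \<xi>) m)"
      by (rule reg_rep_apply[OF \<beta> \<xi> F]) auto
    moreover have "reg_rep \<beta> y (\<zeta> k) = (\<lambda>m. \<Sum>n | y n \<noteq> 0. coeff_op \<beta> (y n) (shift n (\<zeta> k)) m)"
      by (rule reg_rep_apply[OF \<beta> \<zeta> F]) auto
    ultimately show ?thesis
      using linear_scale[OF star_automorphismD(7)[OF star_automorphism_int_iter[OF \<beta>]]]
      by (simp add: coeff_op_def shift_def \<zeta>_def)
  qed
  have Tl2: "?T \<xi> \<in> l2"
    using reg_rep_ops(1)[OF \<beta> F, of "\<lambda>n. c n *\<^sub>R y n"] \<xi> by simp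
  show "l2_norm (?T \<xi>) \<le> sqrt S * ?Y * l2_norm \<xi>"
  proof (rule l2_norm_leI_finite[OF Tl2])
    show "0 \<le> sqrt S * ?Y * l2_norm \<xi>" using S0 Y0 by simp
    fix f :: "'b \<Rightarrow> real" and G :: "int set" assume f: "f \<in> real_states" and G: "finite G"
    note l = real_stateD(1)[OF f]
    define h where "h l = f (sq (\<xi> l))" for l
    have h: "h summable_on UNIV" "infsum h UNIV = f (l2_inner \<xi> \<xi>)" "\<And>l. h l \<ge> 0"
      using real_state_inner[OF f \<xi> \<xi>] f by (simp_all add: h_def[abs_def] sq_def[symmetric])
    have sq\<zeta>: "f (adj (\<zeta> k l) * \<zeta> k l) = (c (k - l))\<^sup>2 * h l" for k l
      by (simp add: \<zeta>_def h_def sq_def adj_scaleR linear_scale[OF l] power2_eq_square)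
    have inner\<zeta>: "(\<lambda>l. (c (k - l))\<^sup>2 * h l) summable_on UNIV"
      "f (l2_inner (\<zeta> k) (\<zeta> k)) = infsum (\<lambda>l. (c (k - l))\<^sup>2 * h l) UNIV" for k
      using real_state_inner[OF f \<zeta>[of k] \<zeta>[of k]] by (simp_all add: sq\<zeta>)
    have "(\<Sum>k\<in>G. f (sq (?T \<xi> k))) \<le> (\<Sum>k\<in>G. ?Y\<^sup>2 * f (l2_inner (\<zeta> k) (\<zeta> k)))"
    proof (rule sum_mono)
      fix k
      have "f (sq (?T \<xi> k)) \<le> f (l2_inner (reg_rep \<beta> y (\<zeta> k)) (reg_rep \<beta> y (\<zeta> k)))"
        using sum_real_state_sq_le[OF f ops_l2[OF T \<zeta>], of "{k}"] by (simp add: entry)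
      also have "\<dots> \<le> ?Y\<^sup>2 * f (l2_inner (\<zeta> k) (\<zeta> k))"
        by (rule real_state_op_le[OF f T \<zeta>])
      finally show "f (sq (?T \<xi> k)) \<le> ?Y\<^sup>2 * f (l2_inner (\<zeta> k) (\<zeta> k))" .
    qed
    also have "\<dots> = ?Y\<^sup>2 * infsum (\<lambda>l. \<Sum>k\<in>G. (c (k - l))\<^sup>2 * h l) UNIV"
      using summable_on_infsum_sum[of G "\<lambda>k l. (c (k - l))\<^sup>2 * h l" UNIV] inner\<zeta>
      by (simp add: sum_distrib_left)
    \<comment> \<open>After the exchange of sums, the weight of \<open>h l\<close> is the sum of the
      squares of \<open>c\<close> over a translate of \<open>G\<close>, at most
      \<open>S\<close>.\<close>
    also have "\<dots> \<le> ?Y\<^sup>2 * infsum (\<lambda>l. S * h l) UNIV"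
    proof (intro mult_left_mono infsum_mono)
      show "(\<lambda>l. \<Sum>k\<in>G. (c (k - l))\<^sup>2 * h l) summable_on UNIV"
        using summable_on_infsum_sum[of G "\<lambda>k l. (c (k - l))\<^sup>2 * h l" UNIV] inner\<zeta> by simp
      show "(\<lambda>l. S * h l) summable_on UNIV"
        using h(1) by (rule summable_on_cmult_right)
      fix l
      have "(\<Sum>k\<in>G. (c (k - l))\<^sup>2) = (\<Sum>n\<in>(\<lambda>k. k - l) ` G. (c n)\<^sup>2)"
        by (subst sum.reindex) (auto simp: inj_on_def)
      also have "\<dots> \<le> S" using G by (intro S) simp
      finally show "(\<Sum>k\<in>G. (c (k - l))\<^sup>2 * h l) \<le> S * h l"
        using h(3)[of l] by (simp add: mult_right_mono flip: sum_distrib_right)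
    qed simp
    also have "\<dots> = ?Y\<^sup>2 * (S * f (l2_inner \<xi> \<xi>))"
      using h by (simp add: infsum_cmult_right)
    also have "\<dots> \<le> ?Y\<^sup>2 * (S * (l2_norm \<xi>)\<^sup>2)"
      using real_state_inner_self_le_norm[OF f, of \<xi>] S0 by (intro mult_left_mono) auto
    also have "\<dots> = (sqrt S * ?Y * l2_norm \<xi>)\<^sup>2"
      using S0 by (simp add: power_mult_distrib)
    finally show "(\<Sum>k\<in>G. f (sq (?T \<xi> k))) \<le> (sqrt S * ?Y * l2_norm \<xi>)\<^sup>2" .
  qed
qed

section \<open>Transfer between crossed products\<close>

text \<open>The transfer map is the composition of the compression of the regular representation to
  \<open>{0..<R}\<close>, a map into \<open>R \<times> R\<close> matrices over \<open>B\<close>, with the unital completely positive map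
  \<open>(b\<^sub>m\<^sub>l) \<mapsto> R\<^sup>-\<^sup>1 \<Sum>m l. U\<^sup>m b\<^sub>m\<^sub>l U\<^sup>-\<^sup>l\<close> from these matrices to the second crossed product.\<close>

definition transfer :: "('b::cstar_algebra \<Rightarrow> 'b) \<Rightarrow> ('b \<Rightarrow> 'b) \<Rightarrow> nat \<Rightarrow> (int \<Rightarrow> 'b) \<Rightarrow> int \<Rightarrow> 'b" where
  "transfer \<beta> \<gamma> R x n = (1 / real R) *\<^sub>R
     (\<Sum>m | m \<in> {0..<int R} \<and> m - n \<in> {0..<int R}. int_iter \<gamma> m (int_iter \<beta> (- m) (x n)))"

lemma real_state_comp_automorphism:
  assumes f: "f \<in> real_states" and \<gamma>: "star_automorphism \<gamma>"
  shows "(\<lambda>x. f (\<gamma> x)) \<in> real_states"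
  using linear_compose[OF star_automorphismD(7)[OF \<gamma>] real_stateD(1)[OF f]] star_automorphismD[OF \<gamma>] real_stateD[OF f]
  by (simp add: real_states_def o_def)

lemma sq_automorphism: "star_automorphism \<gamma> \<Longrightarrow> sq (\<gamma> x) = \<gamma> (sq x)"
  by (simp add: sq_def star_automorphismD)

lemma transfer_zero: "star_automorphism \<beta> \<Longrightarrow> star_automorphism \<gamma> \<Longrightarrow> x n = 0 \<Longrightarrow> transfer \<beta> \<gamma> R x n = 0"
  by (simp add: transfer_def)

text \<open>Each entry of the image of \<open>\<xi>\<close> is an average over \<open>R\<close>
  windows of \<open>\<xi>\<close> to which the first representation is applied. Cauchy-Schwarz turns
  the factor \<open>1 / R^2\<close> into \<open>1 / R\<close>. Every entry of \<open>\<xi>\<close>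
  lies in \<open>R\<close> windows, and this cancels the remaining \<open>1 / R\<close>, so the
  bound is exactly contractive.\<close>

lemma nrm_transfer_le:
  fixes x :: "int \<Rightarrow> 'b::cstar_algebra"
  assumes \<beta>: "star_automorphism \<beta>" and \<gamma>: "star_automorphism \<gamma>" and x: "x \<in> fin_supp V" and R: "R > 0"
  shows "nrm ops (reg_rep \<gamma> (transfer \<beta> \<gamma> R x)) \<le> nrm ops (reg_rep \<beta> x)"
proof (rule nrm_ops_leI)
  let ?T = "reg_rep \<gamma> (transfer \<beta> \<gamma> R x)" and ?X = "nrm ops (reg_rep \<beta> x)" and ?I = "{0..<int R}"
  let ?F = "{n. x n \<noteq> 0}"
  note \<gamma>b = star_automorphismD(1)[OF \<gamma>] and \<gamma>i = star_automorphism_int_iter[OF \<gamma>]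
  note T = reg_rep_carrier[OF \<beta> x]
  show X0: "?X \<ge> 0" using T by (rule nrm_ops_nonneg)
  have F: "finite ?F" using x by (simp add: fin_supp_def)
  have tr0: "transfer \<beta> \<gamma> R x n = 0" if "n \<notin> ?F" for n
    using that transfer_zero[OF \<beta> \<gamma>] by simp
  fix \<xi> :: "int \<Rightarrow> 'b" assume \<xi>: "\<xi> \<in> l2"
  \<comment> \<open>The window of \<open>\<xi>\<close> of length \<open>R\<close> at
    \<open>j\<close>, moved to 0. Its twist by \<open>int_iter \<gamma> j\<close> is cancelled by
    \<open>int_iter \<gamma> (m - i)\<close> in \<open>entry\<close>, where
    \<open>j = i - m\<close>.\<close>
  define \<zeta> where "\<zeta> j l = (if l \<in> ?I then int_iter \<gamma> j (\<xi> (j + l)) else 0)" for j l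
  have \<zeta>: "\<zeta> j \<in> l2" for j
    by (rule l2_finite_support, rule finite_subset[of _ ?I]) (auto simp: \<zeta>_def)
  define \<omega> where "\<omega> j = reg_rep \<beta> x (\<zeta> j)" for j
  have \<omega>: "\<omega> j \<in> l2" for j using T \<zeta> by (simp add: \<omega>_def)
  have Tl2: "?T \<xi> \<in> l2"
    using reg_rep_ops(1)[OF \<gamma> F tr0] \<xi> by simp
  have entry: "?T \<xi> i = (1 / real R) *\<^sub>R (\<Sum>m\<in>?I. int_iter \<gamma> (m - i) (\<omega> (i - m) m))" for i
  proof -
    have "int_iter \<gamma> (m - i) (\<omega> (i - m) m)
        = (\<Sum>n\<in>?F. if m - n \<in> ?I then int_iter \<gamma> (m - i) (int_iter \<beta> (- m) (x n)) * \<xi> (i - n) else 0)" for m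
    proof -
      have \<omega>m: "\<omega> (i - m) m = (\<Sum>n\<in>?F. int_iter \<beta> (- m) (x n) * \<zeta> (i - m) (m - n))"
      proof -
        have "\<omega> (i - m) = (\<lambda>m'. \<Sum>n\<in>?F. coeff_op \<beta> (x n) (shift n (\<zeta> (i - m))) m')"
          unfolding \<omega>_def by (rule reg_rep_apply[OF \<beta> \<zeta> F]) auto
        then show ?thesis by (simp add: coeff_op_def shift_def)
      qed
      have "int_iter \<gamma> (m - i) (\<omega> (i - m) m)
          = (\<Sum>n\<in>?F. int_iter \<gamma> (m - i) (int_iter \<beta> (- m) (x n)) * int_iter \<gamma> (m - i) (\<zeta> (i - m) (m - n)))"
        by (simp only: \<omega>m linear_sum[OF star_automorphismD(7)[OF \<gamma>i]] star_automorphismD(4)[OF \<gamma>i])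
      also have "\<dots> = (\<Sum>n\<in>?F. if m - n \<in> ?I then int_iter \<gamma> (m - i) (int_iter \<beta> (- m) (x n)) * \<xi> (i - n) else 0)"
      proof (rule sum.cong[OF refl])
        fix n
        have "int_iter \<gamma> (m - i) (\<zeta> (i - m) (m - n)) = (if m - n \<in> ?I then \<xi> (i - n) else 0)"
        proof (cases "m - n \<in> ?I")
          case True
          have "int_iter \<gamma> (m - i + (i - m)) (\<xi> (i - n)) = int_iter \<gamma> (m - i) (int_iter \<gamma> (i - m) (\<xi> (i - n)))"
            by (rule int_iter_add[OF \<gamma>b])
          moreover have "i - m + (m - n) = i - n" by simp
          ultimately show ?thesis using True unfolding \<zeta>_def by auto
        qed (auto simp: \<zeta>_def \<gamma>)
        then show "int_iter \<gamma> (m - i) (int_iter \<beta> (- m) (x n)) * int_iter \<gamma> (m - i) (\<zeta> (i - m) (m - n))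
          = (if m - n \<in> ?I then int_iter \<gamma> (m - i) (int_iter \<beta> (- m) (x n)) * \<xi> (i - n) else 0)"
          by simp
      qed
      finally show ?thesis .
    qed
    then have "(\<Sum>m\<in>?I. int_iter \<gamma> (m - i) (\<omega> (i - m) m))
        = (\<Sum>n\<in>?F. \<Sum>m\<in>?I. if m - n \<in> ?I then int_iter \<gamma> (m - i) (int_iter \<beta> (- m) (x n)) * \<xi> (i - n) else 0)"
      by (simp only: sum.swap[of _ ?F])
    also have "\<dots> = (\<Sum>n\<in>?F. \<Sum>m | m \<in> ?I \<and> m - n \<in> ?I. int_iter \<gamma> (m - i) (int_iter \<beta> (- m) (x n)) * \<xi> (i - n))"
      by (intro sum.cong refl sum.inter_filter[symmetric]) simp
    finally have eq: "(\<Sum>m\<in>?I. int_iter \<gamma> (m - i) (\<omega> (i - m) m)) = \<dots>" .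
    have "?T \<xi> i = (\<Sum>n\<in>?F. int_iter \<gamma> (- i) (transfer \<beta> \<gamma> R x n) * \<xi> (i - n))"
    proof -
      have "?T \<xi> = (\<lambda>m. \<Sum>n\<in>?F. coeff_op \<gamma> (transfer \<beta> \<gamma> R x n) (shift n \<xi>) m)"
        by (rule reg_rep_apply[OF \<gamma> \<xi> F tr0])
      then show ?thesis by (simp only: coeff_op_def shift_def)
    qed
    also have "\<dots> = (1 / real R) *\<^sub>R (\<Sum>n\<in>?F. \<Sum>m | m \<in> ?I \<and> m - n \<in> ?I.
        int_iter \<gamma> (m - i) (int_iter \<beta> (- m) (x n)) * \<xi> (i - n))"
    proof -
      have "int_iter \<gamma> (- i) (int_iter \<gamma> m b) = int_iter \<gamma> (m - i) b" for m b
        using int_iter_add[OF \<gamma>b, of "- i" m b] by simp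
      then show ?thesis
        unfolding transfer_def linear_scale[OF star_automorphismD(7)[OF \<gamma>i]]
          linear_sum[OF star_automorphismD(7)[OF \<gamma>i]] scaleR_sum_right mult_scaleR_left sum_distrib_right
        by (simp only:)
    qed
    finally show ?thesis
      unfolding eq .
  qed
  show "l2_norm (?T \<xi>) \<le> ?X * l2_norm \<xi>"
  proof (rule l2_norm_leI_finite[OF Tl2])
    show "0 \<le> ?X * l2_norm \<xi>" using X0 by simp
    fix f :: "'b \<Rightarrow> real" and G :: "int set" assume f: "f \<in> real_states" and G: "finite G"
    note l = real_stateD(1)[OF f]
    \<comment> \<open>Composition with \<open>\<gamma>^(-j)\<close> cancels the twist in
      \<open>\<zeta> j\<close> and yields a real state again.\<close>
    define g where "g j = (\<lambda>a. f (int_iter \<gamma> (- j) a))" for j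
    have g: "g j \<in> real_states" for j
      unfolding g_def by (rule real_state_comp_automorphism[OF f \<gamma>i])
    define J where "J = (\<lambda>(i, m). i - m) ` (G \<times> ?I)"
    have J: "finite J" using G by (simp add: J_def)
    have "f (sq (?T \<xi> i)) \<le> (1 / real R) * (\<Sum>m\<in>?I. g (i - m) (sq (\<omega> (i - m) m)))" for i
    proof -
      have "f (sq (?T \<xi> i)) = (1 / real R)\<^sup>2 * f (sq (\<Sum>m\<in>?I. int_iter \<gamma> (m - i) (\<omega> (i - m) m)))"
        unfolding entry by (simp add: sq_def adj_scaleR linear_scale[OF l] power2_eq_square)
      also have "\<dots> \<le> (1 / real R)\<^sup>2 * (real R * (\<Sum>m\<in>?I. f (sq (int_iter \<gamma> (m - i) (\<omega> (i - m) m)))))"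
        using real_state_sq_sum_le[OF f, of _ ?I] by (intro mult_left_mono) (simp_all del: of_nat_0_le_iff)
      also have "\<dots> = (1 / real R) * (\<Sum>m\<in>?I. g (i - m) (sq (\<omega> (i - m) m)))"
        using R by (simp add: g_def sq_automorphism[OF \<gamma>i] power2_eq_square)
      finally show ?thesis .
    qed
    then have "(\<Sum>i\<in>G. f (sq (?T \<xi> i))) \<le> (\<Sum>i\<in>G. (1 / real R) * (\<Sum>m\<in>?I. g (i - m) (sq (\<omega> (i - m) m))))"
      by (intro sum_mono)
    also have "\<dots> = (1 / real R) * (\<Sum>(i, m)\<in>G \<times> ?I. g (i - m) (sq (\<omega> (i - m) m)))"
      by (simp only: sum.cartesian_product sum_distrib_left[symmetric])
    also have "(\<Sum>(i, m)\<in>G \<times> ?I. g (i - m) (sq (\<omega> (i - m) m)))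
        = (\<Sum>(j, m)\<in>(\<lambda>(i, m). (i - m, m)) ` (G \<times> ?I). g j (sq (\<omega> j m)))"
      by (subst sum.reindex) (auto simp: inj_on_def case_prod_unfold)
    \<comment> \<open>Enlarging the set of pairs \<open>(i - m, m)\<close> to a full product adds
      only nonnegative terms and separates the two sums.\<close>
    also have "(1 / real R) * \<dots> \<le> (1 / real R) * (\<Sum>(j, m)\<in>J \<times> ?I. g j (sq (\<omega> j m)))"
      using J g by (intro mult_left_mono sum_mono2) (force simp: J_def)+
    also have "(\<Sum>(j, m)\<in>J \<times> ?I. g j (sq (\<omega> j m))) = (\<Sum>j\<in>J. \<Sum>m\<in>?I. g j (sq (\<omega> j m)))"
      by (simp add: sum.cartesian_product)
    also have "(1 / real R) * \<dots> \<le> (1 / real R) * (\<Sum>j\<in>J. ?X\<^sup>2 * (\<Sum>l\<in>?I. f (sq (\<xi> (j + l)))))"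
    proof (intro mult_left_mono sum_mono)
      fix j
      have "(\<Sum>m\<in>?I. g j (sq (\<omega> j m))) \<le> g j (l2_inner (\<omega> j) (\<omega> j))"
        by (rule sum_real_state_sq_le[OF g \<omega>]) simp
      also have "\<dots> \<le> ?X\<^sup>2 * g j (l2_inner (\<zeta> j) (\<zeta> j))"
        unfolding \<omega>_def by (rule real_state_op_le[OF g T \<zeta>])
      also have "l2_inner (\<zeta> j) (\<zeta> j) = infsum (\<lambda>l. sq (\<zeta> j l)) ?I"
        unfolding l2_inner_def sq_def by (rule infsum_cong_neutral) (auto simp: \<zeta>_def)
      also have "\<dots> = (\<Sum>l\<in>?I. int_iter \<gamma> j (sq (\<xi> (j + l))))"
        by (simp add: \<zeta>_def sq_automorphism[OF \<gamma>i])
      also have "g j \<dots> = (\<Sum>l\<in>?I. f (sq (\<xi> (j + l))))"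
        unfolding real_state_sum[OF g] by (simp add: g_def \<gamma>b)
      finally show "(\<Sum>m\<in>?I. g j (sq (\<omega> j m))) \<le> ?X\<^sup>2 * (\<Sum>l\<in>?I. f (sq (\<xi> (j + l))))" .
    qed simp
    also have "\<dots> = (1 / real R) * ?X\<^sup>2 * (\<Sum>l\<in>?I. \<Sum>j\<in>J. f (sq (\<xi> (j + l))))"
      by (simp add: sum.swap[of _ ?I] flip: sum_distrib_left)
    also have "\<dots> \<le> (1 / real R) * ?X\<^sup>2 * (\<Sum>l\<in>?I. (l2_norm \<xi>)\<^sup>2)"
    proof (intro mult_left_mono sum_mono)
      fix l
      have "(\<Sum>j\<in>J. f (sq (\<xi> (j + l)))) = (\<Sum>k\<in>(\<lambda>j. j + l) ` J. f (sq (\<xi> k)))"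
        by (subst sum.reindex) (auto simp: inj_on_def)
      also have "\<dots> \<le> f (l2_inner \<xi> \<xi>)"
        using J by (intro sum_real_state_sq_le[OF f \<xi>]) simp
      also have "\<dots> \<le> (l2_norm \<xi>)\<^sup>2"
        by (rule real_state_inner_self_le_norm[OF f])
      finally show "(\<Sum>j\<in>J. f (sq (\<xi> (j + l)))) \<le> (l2_norm \<xi>)\<^sup>2" .
    qed simp
    also have "\<dots> = (?X * l2_norm \<xi>)\<^sup>2"
      using R by (simp add: power_mult_distrib)
    finally show "(\<Sum>i\<in>G. f (sq (?T \<xi> i))) \<le> (?X * l2_norm \<xi>)\<^sup>2" .
  qed
qed

text \<open>The substitution of \<open>m + n\<close> for \<open>m\<close> exchanges the two
  conditions that \<open>m\<close> and \<open>m - n\<close> lie in the window, so averaging respects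
  the adjoint.\<close>

lemma transfer_cp_adj:
  assumes \<beta>: "star_automorphism \<beta>" and \<gamma>: "star_automorphism \<gamma>"
  shows "transfer \<beta> \<gamma> R (cp_adj \<beta> x) = cp_adj \<gamma> (transfer \<beta> \<gamma> R x)"
proof
  fix n
  let ?I = "{0..<int R}"
  note b = star_automorphismD(1)[OF \<beta>] and c = star_automorphismD(1)[OF \<gamma>]
  note bi = star_automorphism_int_iter[OF \<beta>] and ci = star_automorphism_int_iter[OF \<gamma>]
  have "(\<Sum>m | m \<in> ?I \<and> m - n \<in> ?I. int_iter \<gamma> m (int_iter \<beta> (- m) (int_iter \<beta> n (adj (x (- n))))))
     = (\<Sum>m | m \<in> ?I \<and> m + n \<in> ?I. int_iter \<gamma> (n + m) (int_iter \<beta> (- m) (adj (x (- n)))))"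
    by (rule sum.reindex_bij_witness[where i = "\<lambda>m. m + n" and j = "\<lambda>m. m - n"])
      (auto simp: add.commute int_iter_add[OF b, symmetric])
  also have "\<dots> = (\<Sum>m | m \<in> ?I \<and> m - - n \<in> ?I. int_iter \<gamma> n (adj (int_iter \<gamma> m (int_iter \<beta> (- m) (x (- n))))))"
    by (simp add: int_iter_add[OF c] star_automorphismD(5)[OF bi] star_automorphismD(5)[OF ci] del: atLeastLessThan_iff)
  finally show "transfer \<beta> \<gamma> R (cp_adj \<beta> x) n = cp_adj \<gamma> (transfer \<beta> \<gamma> R x) n"
    unfolding transfer_def cp_adj_def
    by (simp only: linear_scale[OF star_automorphismD(7)[OF ci]] adj_scaleR adj_sum
        linear_sum[OF star_automorphismD(7)[OF ci]])
qed

section \<open>Metrization of the weak-star topology\<close>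

text \<open>The premise \<open>net\<close> bounds the distance and fits a weak-star neighbourhood,
  given by the finite set \<open>F\<close>, into a metric ball. The premise \<open>dense\<close>
  controls every evaluation by the distance, which makes evaluations continuous and separates
  points. The value type \<open>'f\<close> covers real and complex states at once.\<close>

lemma metrizesI:
  fixes S :: "('a \<Rightarrow> 'f::real_normed_vector) set"
  assumes VW: "V \<subseteq> W" and ext: "S \<subseteq> extensional W"
    and net: "\<And>e. e > 0 \<Longrightarrow> \<exists>F. finite F \<and> F \<subseteq> W \<and> (\<forall>x\<in>V. L x \<le> 1 \<longrightarrow>
      (\<exists>f\<in>F. \<forall>\<mu>\<in>S. \<forall>\<nu>\<in>S. norm (\<mu> x - \<nu> x) \<le> norm (\<mu> f - \<nu> f) + e))"
    and dense: "\<And>w e. w \<in> W \<Longrightarrow> e > 0 \<Longrightarrow> \<exists>x\<in>V. \<exists>K\<ge>0. L x \<le> 1 \<and>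
      (\<forall>\<mu>\<in>S. \<forall>\<nu>\<in>S. norm (\<mu> w - \<nu> w) \<le> K * norm (\<mu> x - \<nu> x) + e)"
  shows "metrizes (state_dist V L) (weak_star W S)"
proof -
  define d where "d \<mu> \<nu> = enn2real (state_dist V L \<mu> \<nu>)" for \<mu> \<nu> :: "'a \<Rightarrow> 'f"
  have top: "topspace (weak_star W S) = S"
    using ext by (auto simp: weak_star_def PiE_def)
  have fin: "state_dist V L \<mu> \<nu> < \<infinity>" if S: "\<mu> \<in> S" "\<nu> \<in> S" for \<mu> \<nu>
  proof -
    obtain F where F: "finite F" and le: "\<And>x. x \<in> V \<Longrightarrow> L x \<le> 1 \<Longrightarrow> \<exists>f\<in>F. norm (\<mu> x - \<nu> x) \<le> norm (\<mu> f - \<nu> f) + 1"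
      using net[of 1] S by (metis zero_less_one)
    have "norm (\<mu> x - \<nu> x) \<le> (\<Sum>f\<in>F. norm (\<mu> f - \<nu> f)) + 1" if xV: "x \<in> V" "L x \<le> 1" for x
    proof -
      obtain f where f: "f \<in> F" "norm (\<mu> x - \<nu> x) \<le> norm (\<mu> f - \<nu> f) + 1"
        using le[OF xV] by blast
      have "norm (\<mu> f - \<nu> f) \<le> (\<Sum>f\<in>F. norm (\<mu> f - \<nu> f))"
        using F f(1) by (intro member_le_sum) auto
      then show ?thesis using f(2) by simp
    qed
    then have "state_dist V L \<mu> \<nu> \<le> ennreal ((\<Sum>f\<in>F. norm (\<mu> f - \<nu> f)) + 1)"
      unfolding state_dist_def by (intro SUP_least ennreal_leI) auto
    then show ?thesis
      by (rule le_less_trans) simp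
  qed
  have upper: "norm (\<mu> x - \<nu> x) \<le> d \<mu> \<nu>" if S: "\<mu> \<in> S" "\<nu> \<in> S" and x: "x \<in> V" "L x \<le> 1" for \<mu> \<nu> x
  proof -
    have "ennreal (norm (\<mu> x - \<nu> x)) \<le> state_dist V L \<mu> \<nu>"
      unfolding state_dist_def using x by (intro SUP_upper) auto
    also have "\<dots> = ennreal (d \<mu> \<nu>)"
      using fin[OF S] by (simp add: d_def)
    finally show ?thesis by (simp add: d_def)
  qed
  have least: "d \<mu> \<nu> \<le> r" if "r \<ge> 0" "\<And>x. x \<in> V \<Longrightarrow> L x \<le> 1 \<Longrightarrow> norm (\<mu> x - \<nu> x) \<le> r" for \<mu> \<nu> r
  proof -
    have "state_dist V L \<mu> \<nu> \<le> ennreal r"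
      unfolding state_dist_def using that by (intro SUP_least ennreal_leI) auto
    then show ?thesis
      using that(1) enn2real_mono[of "state_dist V L \<mu> \<nu>" "ennreal r"] by (simp add: d_def)
  qed
  have eval: "\<exists>K\<ge>0. \<forall>\<mu>\<in>S. \<forall>\<nu>\<in>S. norm (\<mu> w - \<nu> w) \<le> K * d \<mu> \<nu> + e" if we: "w \<in> W" "e > 0" for w e
  proof -
    obtain x K where x: "x \<in> V" "K \<ge> 0" "L x \<le> 1" and le: "\<And>\<mu> \<nu>. \<mu> \<in> S \<Longrightarrow> \<nu> \<in> S \<Longrightarrow> norm (\<mu> w - \<nu> w) \<le> K * norm (\<mu> x - \<nu> x) + e"
      using dense[OF we] by blast
    have "norm (\<mu> w - \<nu> w) \<le> K * d \<mu> \<nu> + e" if "\<mu> \<in> S" "\<nu> \<in> S" for \<mu> \<nu>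
      using le[OF that] mult_left_mono[OF upper[OF that x(1,3)] x(2)] by simp
    then show ?thesis using x(2) by blast
  qed
  have dnn: "0 \<le> d \<mu> \<nu>" for \<mu> \<nu> by (simp add: d_def)
  have dcomm: "d \<mu> \<nu> = d \<nu> \<mu>" for \<mu> \<nu>
    by (simp add: d_def state_dist_def norm_minus_commute)
  interpret M: Metric_space S d
  proof
    fix \<mu> \<nu> assume S: "\<mu> \<in> S" "\<nu> \<in> S"
    show "d \<mu> \<nu> = 0 \<longleftrightarrow> \<mu> = \<nu>"
    proof
      assume d0: "d \<mu> \<nu> = 0"
      show "\<mu> = \<nu>"
      proof (rule extensionalityI[of _ W])
        fix w assume w: "w \<in> W"
        have "norm (\<mu> w - \<nu> w) \<le> e" if e: "e > 0" for e
        proof -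
          obtain K where "\<forall>\<mu>\<in>S. \<forall>\<nu>\<in>S. norm (\<mu> w - \<nu> w) \<le> K * d \<mu> \<nu> + e"
            using eval[OF w e] by blast
          then have "norm (\<mu> w - \<nu> w) \<le> K * d \<mu> \<nu> + e" using S by blast
          then show ?thesis by (simp add: d0)
        qed
        then show "\<mu> w = \<nu> w"
          by (metis dense_ge norm_le_zero_iff right_minus_eq)
      qed (use S ext in auto)
    next
      assume "\<mu> = \<nu>"
      then show "d \<mu> \<nu> = 0" using least[of 0 \<mu> \<nu>] dnn[of \<mu> \<nu>] by simp
    qed
    fix \<kappa> assume "\<kappa> \<in> S"
    show "d \<mu> \<kappa> \<le> d \<mu> \<nu> + d \<nu> \<kappa>"
    proof (rule least)
      fix x assume x: "x \<in> V" "L x \<le> 1"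
      have "norm (\<mu> x - \<kappa> x) \<le> norm (\<mu> x - \<nu> x) + norm (\<nu> x - \<kappa> x)"
        using norm_triangle_ineq[of "\<mu> x - \<nu> x" "\<nu> x - \<kappa> x"] by simp
      then show "norm (\<mu> x - \<kappa> x) \<le> d \<mu> \<nu> + d \<nu> \<kappa>"
        using upper[OF S x] upper[OF S(2) \<open>\<kappa> \<in> S\<close> x] by linarith
    qed (simp add: dnn)
  qed (auto simp: dnn dcomm)
  have "M.mtopology = weak_star W S"
    unfolding topology_eq
  proof (intro allI iffI)
    fix U assume U: "openin (weak_star W S) U"
    have ev: "continuous_map M.mtopology euclidean (\<lambda>\<mu>. \<mu> w)" if w: "w \<in> W" for w
      unfolding continuous_map
    proof (intro conjI allI impI)
      fix O' :: "'f set" assume "openin euclidean O'"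
      then have O': "open O'" by simp
      show "openin M.mtopology {\<mu> \<in> topspace M.mtopology. \<mu> w \<in> O'}"
        unfolding M.openin_mtopology M.topspace_mtopology
      proof (intro conjI allI impI)
        fix \<mu> assume "\<mu> \<in> {\<mu> \<in> S. \<mu> w \<in> O'}"
        then have \<mu>: "\<mu> \<in> S" "\<mu> w \<in> O'" by auto
        obtain e where e: "e > 0" "ball (\<mu> w) e \<subseteq> O'"
          using O' \<mu>(2) openE by blast
        have e2: "e / 2 > 0" using e(1) by simp
        obtain K where K: "K \<ge> 0" "\<And>\<mu> \<nu>. \<mu> \<in> S \<Longrightarrow> \<nu> \<in> S \<Longrightarrow> norm (\<mu> w - \<nu> w) \<le> K * d \<mu> \<nu> + e / 2"
          using eval[OF w e2] by blast
        \<comment> \<open>Dividing by \<open>K + 1\<close> rather than \<open>K\<close> covers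
          \<open>K = 0\<close>.\<close>
        have "M.mball \<mu> (e / (2 * (K + 1))) \<subseteq> {\<mu> \<in> S. \<mu> w \<in> O'}"
        proof
          fix \<nu> assume "\<nu> \<in> M.mball \<mu> (e / (2 * (K + 1)))"
          then have \<nu>: "\<nu> \<in> S" "d \<mu> \<nu> < e / (2 * (K + 1))" by auto
          have "K * d \<mu> \<nu> \<le> (K + 1) * d \<mu> \<nu>" using dnn[of \<mu> \<nu>] by (simp add: algebra_simps)
          also have "\<dots> < (K + 1) * (e / (2 * (K + 1)))"
            using \<nu>(2) K(1) by (intro mult_strict_left_mono) auto
          also have "\<dots> = e / 2" using K(1) by (simp add: field_simps)
          finally have "norm (\<mu> w - \<nu> w) < e"
            using K(2)[OF \<mu>(1) \<nu>(1)] by simp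
          then show "\<nu> \<in> {\<mu> \<in> S. \<mu> w \<in> O'}"
            using e(2) \<nu>(1) by (auto simp: subset_eq dist_norm)
        qed
        moreover have "e / (2 * (K + 1)) > 0" using e(1) K(1) by simp
        ultimately show "\<exists>r>0. M.mball \<mu> r \<subseteq> {\<mu> \<in> S. \<mu> w \<in> O'}" by blast
      qed auto
    qed simp
    have "continuous_map M.mtopology (weak_star W S) (\<lambda>\<mu>. \<mu>)"
      unfolding weak_star_def continuous_map_in_subtopology continuous_map_componentwise
      using ext ev by auto
    from openin_continuous_map_preimage[OF this U] show "openin M.mtopology U"
      using openin_subset[OF U] by (simp add: top Collect_conj_eq inf.absorb2)
  next
    fix U assume U: "openin M.mtopology U"
    show "openin (weak_star W S) U"
    proof (subst openin_subopen, intro ballI)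
      fix \<mu> assume \<mu>: "\<mu> \<in> U"
      then obtain r where r: "r > 0" "M.mball \<mu> r \<subseteq> U" and \<mu>S: "\<mu> \<in> S"
        using U unfolding M.openin_mtopology by blast
      \<comment> \<open>One \<open>e\<close> is lost to the net and one to the coordinates, and
        \<open>2 * e < r\<close>.\<close>
      define e where "e = r / 3"
      have e: "e > 0" using r(1) by (simp add: e_def)
      obtain F where F: "finite F" "F \<subseteq> W" and le: "\<And>x. x \<in> V \<Longrightarrow> L x \<le> 1 \<Longrightarrow>
          \<exists>f\<in>F. \<forall>\<mu>\<in>S. \<forall>\<nu>\<in>S. norm (\<mu> x - \<nu> x) \<le> norm (\<mu> f - \<nu> f) + e"
        using net[OF e] by blast
      define T where "T = S \<inter> \<Inter> ((\<lambda>f. {\<nu> \<in> S. \<nu> f \<in> ball (\<mu> f) e}) ` F)"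
      have "openin (weak_star W S) {\<nu> \<in> topspace (weak_star W S). \<nu> f \<in> ball (\<mu> f) e}" if "f \<in> F" for f
      proof (rule openin_continuous_map_preimage[of _ euclidean])
        show "continuous_map (weak_star W S) euclidean (\<lambda>\<nu>. \<nu> f)"
          unfolding weak_star_def using that F(2)
          by (intro continuous_map_from_subtopology continuous_map_product_projection) auto
      qed auto
      then have "openin (weak_star W S) ((\<Inter>f\<in>F. {\<nu> \<in> S. \<nu> f \<in> ball (\<mu> f) e}) \<inter> topspace (weak_star W S))"
        unfolding top by (intro openin_INT[OF F(1), of "weak_star W S", unfolded top])
      then have "openin (weak_star W S) T"
        by (simp only: T_def top Int_commute)
      moreover have "\<mu> \<in> T" using \<mu>S e by (simp add: T_def)
      moreover have "T \<subseteq> M.mball \<mu> r"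
      proof
        fix \<nu> assume \<nu>: "\<nu> \<in> T"
        then have \<nu>S: "\<nu> \<in> S" by (simp add: T_def)
        have "d \<mu> \<nu> \<le> 2 * e"
        proof (rule least)
          fix x assume "x \<in> V" "L x \<le> 1"
          then obtain f where f: "f \<in> F" "norm (\<mu> x - \<nu> x) \<le> norm (\<mu> f - \<nu> f) + e"
            using le \<mu>S \<nu>S by meson
          have "norm (\<mu> f - \<nu> f) < e"
            using \<nu> f(1) by (simp add: T_def dist_norm)
          then show "norm (\<mu> x - \<nu> x) \<le> 2 * e" using f(2) by simp
        qed (use e in simp)
        then show "\<nu> \<in> M.mball \<mu> r"
          using \<mu>S \<nu>S e by (simp add: e_def)
      qed
      ultimately show "\<exists>T. openin (weak_star W S) T \<and> \<mu> \<in> T \<and> T \<subseteq> U"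
        using r(2) by blast
    qed
  qed
  then show ?thesis
    unfolding metrizes_def top using fin M.Metric_space_axioms by (simp add: d_def[abs_def])
qed

section \<open>States\<close>

lemma unital_star_subspaceD:
  assumes "unital_star_subspace A V"
  shows "V \<subseteq> carrier A" "\<one>\<^bsub>A\<^esub> \<in> V" "x \<in> V \<Longrightarrow> y \<in> V \<Longrightarrow> x \<oplus>\<^bsub>A\<^esub> y \<in> V"
    "x \<in> V \<Longrightarrow> cscale A c x \<in> V" "x \<in> V \<Longrightarrow> star A x \<in> V"
  using assms by (auto simp: unital_star_subspace_def)

locale star_subspace =
  fixes A :: "'a cstar" and V :: "'a set"
  assumes cstar: "unital_cstar A" and sub: "unital_star_subspace A V"
begin

sublocale unital_cstar A by (rule cstar)

abbreviation Vsa :: "'a set" where "Vsa \<equiv> sa_part A V"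

lemma V_closed [simp]:
  "\<one>\<^bsub>A\<^esub> \<in> V" "x \<in> V \<Longrightarrow> y \<in> V \<Longrightarrow> x \<oplus>\<^bsub>A\<^esub> y \<in> V" "x \<in> V \<Longrightarrow> cscale A c x \<in> V" "x \<in> V \<Longrightarrow> star A x \<in> V"
  using unital_star_subspaceD[OF sub] by auto

lemma V_carrier [simp]: "x \<in> V \<Longrightarrow> x \<in> carrier A"
  using unital_star_subspaceD(1)[OF sub] by auto

lemma diff_eq: "x \<in> carrier A \<Longrightarrow> y \<in> carrier A \<Longrightarrow> x \<ominus>\<^bsub>A\<^esub> y = x \<oplus>\<^bsub>A\<^esub> cscale A (-1) y"
  by (simp add: minus_eq a_inv_eq_cscale)

lemma V_diff [simp]: "x \<in> V \<Longrightarrow> y \<in> V \<Longrightarrow> x \<ominus>\<^bsub>A\<^esub> y \<in> V"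
  by (simp add: diff_eq)

lemma VsaD: "x \<in> Vsa \<Longrightarrow> x \<in> V" "x \<in> Vsa \<Longrightarrow> star A x = x" "x \<in> Vsa \<Longrightarrow> x \<in> carrier A"
  by (auto simp: sa_part_def)

lemma Vsa_closed [simp]:
  "\<one>\<^bsub>A\<^esub> \<in> Vsa" "x \<in> Vsa \<Longrightarrow> y \<in> Vsa \<Longrightarrow> x \<oplus>\<^bsub>A\<^esub> y \<in> Vsa"
  "x \<in> Vsa \<Longrightarrow> cscale A (complex_of_real r) x \<in> Vsa" "x \<in> Vsa \<Longrightarrow> y \<in> Vsa \<Longrightarrow> x \<ominus>\<^bsub>A\<^esub> y \<in> Vsa"
  by (auto simp: sa_part_def star_add star_cscale star_diff)

lemma ou_stateD:
  assumes "\<mu> \<in> ou_states A V"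
  shows "\<mu> \<in> extensional Vsa" "\<mu> \<one>\<^bsub>A\<^esub> = 1" "x \<in> Vsa \<Longrightarrow> y \<in> Vsa \<Longrightarrow> \<mu> (x \<oplus>\<^bsub>A\<^esub> y) = \<mu> x + \<mu> y"
    "x \<in> Vsa \<Longrightarrow> \<mu> (cscale A (complex_of_real r) x) = r * \<mu> x"
    "x \<in> Vsa \<Longrightarrow> y \<in> Vsa \<Longrightarrow> \<mu> (x \<ominus>\<^bsub>A\<^esub> y) = \<mu> x - \<mu> y"
proof -
  show *: "\<mu> \<in> extensional Vsa" "\<mu> \<one>\<^bsub>A\<^esub> = 1" "\<And>x y. x \<in> Vsa \<Longrightarrow> y \<in> Vsa \<Longrightarrow> \<mu> (x \<oplus>\<^bsub>A\<^esub> y) = \<mu> x + \<mu> y"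
    "\<And>x r. x \<in> Vsa \<Longrightarrow> \<mu> (cscale A (complex_of_real r) x) = r * \<mu> x"
    using assms by (auto simp: ou_states_def)
  show "x \<in> Vsa \<Longrightarrow> y \<in> Vsa \<Longrightarrow> \<mu> (x \<ominus>\<^bsub>A\<^esub> y) = \<mu> x - \<mu> y"
    using *(3)[of x "cscale A (-1) y"] *(4)[of y "-1"] Vsa_closed(3)[of y "-1"]
    by (simp add: diff_eq VsaD)
qed

text \<open>Positivity of \<open>\<mu>\<close> is applied to the scalar \<open>nrm A x\<close> minus
  and plus \<open>x\<close>.\<close>

lemma abs_ou_state_le:
  assumes \<mu>: "\<mu> \<in> ou_states A V" and x: "x \<in> Vsa"
  shows "\<bar>\<mu> x\<bar> \<le> nrm A x"
proof -
  have *: "\<mu> y \<le> nrm A x" if y: "y \<in> Vsa" "nrm A y = nrm A x" for y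
  proof -
    have "positive A (scal (nrm A x) \<ominus>\<^bsub>A\<^esub> y)"
      using pos_scal_diff[of y "nrm A x"] y by (simp add: positive_iff_pos[OF cstar] VsaD)
    then have "0 \<le> \<mu> (scal (nrm A x) \<ominus>\<^bsub>A\<^esub> y)"
      using \<mu> y by (auto simp: ou_states_def)
    then show ?thesis
      using ou_stateD[OF \<mu>] y by simp
  qed
  have "nrm A (cscale A (complex_of_real (-1)) x) = nrm A x"
    using x by (simp add: nrm_cscale VsaD)
  from *[OF Vsa_closed(3)[OF x] this] *[OF x] show ?thesis
    using ou_stateD(4)[OF \<mu> x, of "-1"] by simp
qed

text \<open>Contractive unital functionals are positive: \<open>\<parallel>r - x\<parallel> \<le> r\<close> for positive \<open>x\<close> and large \<open>r\<close>.\<close>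

lemma ou_stateI:
  assumes "\<mu> \<in> extensional Vsa" "\<mu> \<one>\<^bsub>A\<^esub> = 1" and add: "\<And>x y. x \<in> Vsa \<Longrightarrow> y \<in> Vsa \<Longrightarrow> \<mu> (x \<oplus>\<^bsub>A\<^esub> y) = \<mu> x + \<mu> y"
    and scale: "\<And>x r. x \<in> Vsa \<Longrightarrow> \<mu> (cscale A (complex_of_real r) x) = r * \<mu> x"
    and le: "\<And>x. x \<in> Vsa \<Longrightarrow> \<bar>\<mu> x\<bar> \<le> nrm A x"
  shows "\<mu> \<in> ou_states A V"
proof -
  have "0 \<le> \<mu> x" if x: "x \<in> Vsa" "positive A x" for x
  proof -
    obtain r where r: "r > 0" "nrm A (scal r \<ominus>\<^bsub>A\<^esub> x) \<le> r"
      using x(2) posE by (auto simp: positive_iff_pos[OF cstar])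
    have "scal r \<oplus>\<^bsub>A\<^esub> cscale A (complex_of_real (-1)) x = scal r \<ominus>\<^bsub>A\<^esub> x"
      using x by (simp add: diff_eq VsaD)
    then have "\<mu> (scal r \<ominus>\<^bsub>A\<^esub> x) = r - \<mu> x"
      using add[of "scal r" "cscale A (complex_of_real (-1)) x"] scale[of x "-1"] scale[of "\<one>\<^bsub>A\<^esub>" r] assms(2)
        Vsa_closed(3)[OF x(1), of "-1"] x by simp
    then show ?thesis
      using le[of "scal r \<ominus>\<^bsub>A\<^esub> x"] r x by auto
  qed
  then show ?thesis
    using assms by (auto simp: ou_states_def)
qed

lemma stateD:
  assumes "\<mu> \<in> states A"
  shows "\<mu> \<in> extensional (carrier A)" "\<mu> \<one>\<^bsub>A\<^esub> = 1"
    "x \<in> carrier A \<Longrightarrow> y \<in> carrier A \<Longrightarrow> \<mu> (x \<oplus>\<^bsub>A\<^esub> y) = \<mu> x + \<mu> y"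
    "x \<in> carrier A \<Longrightarrow> \<mu> (cscale A c x) = c * \<mu> x"
    "x \<in> carrier A \<Longrightarrow> y \<in> carrier A \<Longrightarrow> \<mu> (x \<ominus>\<^bsub>A\<^esub> y) = \<mu> x - \<mu> y"
proof -
  show *: "\<mu> \<in> extensional (carrier A)" "\<mu> \<one>\<^bsub>A\<^esub> = 1"
    "\<And>x y. x \<in> carrier A \<Longrightarrow> y \<in> carrier A \<Longrightarrow> \<mu> (x \<oplus>\<^bsub>A\<^esub> y) = \<mu> x + \<mu> y"
    "\<And>c x. x \<in> carrier A \<Longrightarrow> \<mu> (cscale A c x) = c * \<mu> x"
    using assms by (auto simp: states_def)
  show "x \<in> carrier A \<Longrightarrow> y \<in> carrier A \<Longrightarrow> \<mu> (x \<ominus>\<^bsub>A\<^esub> y) = \<mu> x - \<mu> y"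
    using *(3)[of x "cscale A (-1) y"] *(4)[of y "-1"] by (simp add: diff_eq)
qed

text \<open>States are contractive on self-adjoint elements; splitting into real and imaginary part
  costs the factor 2.\<close>

lemma norm_state_le:
  assumes \<mu>: "\<mu> \<in> states A" and x: "x \<in> carrier A"
  shows "cmod (\<mu> x) \<le> 2 * nrm A x"
proof -
  have sa: "cmod (\<mu> y) \<le> nrm A y" if y: "y \<in> carrier A" "star A y = y" for y
  proof -
    let ?m = "cscale A (-1) y"
    have m: "?m \<in> carrier A" "star A ?m = ?m" "nrm A ?m = nrm A y"
      using y by (simp_all add: star_cscale nrm_cscale)
    have "\<mu> (scal (nrm A y) \<ominus>\<^bsub>A\<^esub> z) \<in> \<real>\<^sub>\<ge>\<^sub>0" if "z \<in> carrier A" "star A z = z" "nrm A z = nrm A y" for z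
      using \<mu> that pos_scal_diff[of z "nrm A y"] by (auto simp: states_def positive_iff_pos[OF cstar])
    from this[OF y refl] this[OF m] have "complex_of_real (nrm A y) - \<mu> y \<in> \<real>\<^sub>\<ge>\<^sub>0" "complex_of_real (nrm A y) + \<mu> y \<in> \<real>\<^sub>\<ge>\<^sub>0"
      using stateD[OF \<mu>] y m by simp_all
    then show ?thesis
      by (auto simp: complex_nonneg_Reals_iff cmod_eq_Re)
  qed
  obtain a b where ab: "a \<in> carrier A" "star A a = a" "nrm A a \<le> nrm A x"
    "b \<in> carrier A" "star A b = b" "nrm A b \<le> nrm A x" "x = a \<oplus>\<^bsub>A\<^esub> cscale A \<i> b"
    using Re_Im_decomposition[OF x] by metis
  have "cmod (\<mu> x) \<le> cmod (\<mu> a) + cmod (\<mu> b)"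
    using norm_triangle_ineq[of "\<mu> a" "\<i> * \<mu> b"] ab stateD[OF \<mu>] by (simp add: norm_mult)
  then show ?thesis
    using sa[OF ab(1,2)] sa[OF ab(4,5)] ab(3,6) by simp
qed

text \<open>Rieffel's criterion: the Lipschitz ball is totally bounded modulo scalars. The ball
  itself contains all scalars when \<open>L\<close> vanishes on them, but differences of states do
  not see scalars.\<close>

definition net_mod_scalars :: "('a \<Rightarrow> real) \<Rightarrow> bool" where
  "net_mod_scalars L \<longleftrightarrow> (\<forall>e>0. \<exists>F. finite F \<and> F \<subseteq> V \<and>
     (\<forall>x\<in>V. L x \<le> 1 \<longrightarrow> (\<exists>f\<in>F. \<exists>c. nrm A (x \<ominus>\<^bsub>A\<^esub> (f \<oplus>\<^bsub>A\<^esub> cscale A c \<one>\<^bsub>A\<^esub>)) < e)))"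

definition sa_net_mod_scalars :: "('a \<Rightarrow> real) \<Rightarrow> bool" where
  "sa_net_mod_scalars L \<longleftrightarrow> (\<forall>e>0. \<exists>F. finite F \<and> F \<subseteq> Vsa \<and>
     (\<forall>x\<in>Vsa. L x \<le> 1 \<longrightarrow> (\<exists>f\<in>F. \<exists>r. nrm A (x \<ominus>\<^bsub>A\<^esub> (f \<oplus>\<^bsub>A\<^esub> scal r)) < e)))"

text \<open>Taking real parts fixes a self-adjoint \<open>x\<close> and is contractive, so the real
  parts of a net for the whole ball form a net for its self-adjoint part.\<close>

lemma sa_net_of_net:
  assumes "net_mod_scalars L"
  shows "sa_net_mod_scalars L"
  unfolding sa_net_mod_scalars_def
proof (intro allI impI)
  fix e :: real assume e: "e > 0"
  obtain F where F: "finite F" "F \<subseteq> V"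
    and net: "\<And>x. x \<in> V \<Longrightarrow> L x \<le> 1 \<Longrightarrow> \<exists>f\<in>F. \<exists>c. nrm A (x \<ominus>\<^bsub>A\<^esub> (f \<oplus>\<^bsub>A\<^esub> cscale A c \<one>\<^bsub>A\<^esub>)) < e"
    using assms e unfolding net_mod_scalars_def by meson
  define re where "re f = cscale A (1/2) (f \<oplus>\<^bsub>A\<^esub> star A f)" for f
  have re: "re f \<in> Vsa" if "f \<in> V" for f
    using that by (auto simp: re_def sa_part_def star_cscale star_add star_star a_comm)
  have "\<exists>f\<in>re ` F. \<exists>r. nrm A (x \<ominus>\<^bsub>A\<^esub> (f \<oplus>\<^bsub>A\<^esub> scal r)) < e" if x: "x \<in> Vsa" "L x \<le> 1" for x
  proof -
    obtain f c where f: "f \<in> F" "nrm A (x \<ominus>\<^bsub>A\<^esub> (f \<oplus>\<^bsub>A\<^esub> cscale A c \<one>\<^bsub>A\<^esub>)) < e"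
      using net[OF VsaD(1)[OF x(1)] x(2)] by blast
    define y where "y = x \<ominus>\<^bsub>A\<^esub> (f \<oplus>\<^bsub>A\<^esub> cscale A c \<one>\<^bsub>A\<^esub>)"
    have fc: "f \<in> carrier A" "x \<in> carrier A" using f(1) F(2) x by (auto simp: VsaD)
    then have y: "y \<in> carrier A" by (simp add: y_def)
    have half: "cscale A (1/2) x \<oplus>\<^bsub>A\<^esub> cscale A (1/2) x = x"
      using cscale_add_left[of x "1/2" "1/2"] fc by (simp add: cscale_one)
    have "c / 2 + cnj c / 2 = complex_of_real (Re c)"
      by (simp add: complex_eq_iff)
    then have c_eq: "cscale A (c / 2) \<one>\<^bsub>A\<^esub> \<oplus>\<^bsub>A\<^esub> cscale A (cnj c / 2) \<one>\<^bsub>A\<^esub> = scal (Re c)"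
      using cscale_add_left[of "\<one>\<^bsub>A\<^esub>" "c/2" "cnj c / 2"] by simp
    define h a b u v where "h = cscale A (1/2) x" and "a = cscale A (1/2) f" and "b = cscale A (1/2) (star A f)"
      and "u = cscale A (c / 2) \<one>\<^bsub>A\<^esub>" and "v = cscale A (cnj c / 2) \<one>\<^bsub>A\<^esub>"
    have hc: "h \<in> carrier A" "a \<in> carrier A" "b \<in> carrier A" "u \<in> carrier A" "v \<in> carrier A"
      using fc by (auto simp: h_def a_def b_def u_def v_def)
    have "cscale A (1/2) y = h \<ominus>\<^bsub>A\<^esub> (a \<oplus>\<^bsub>A\<^esub> u)" "cscale A (1/2) (star A y) = h \<ominus>\<^bsub>A\<^esub> (b \<oplus>\<^bsub>A\<^esub> v)"
      using fc VsaD(2)[OF x(1)]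
      by (simp_all add: y_def h_def a_def b_def u_def v_def star_diff star_add star_cscale cscale_diff
          cscale_add_right cscale_cscale)
    then have "cscale A (1/2) (y \<oplus>\<^bsub>A\<^esub> star A y) = (h \<ominus>\<^bsub>A\<^esub> (a \<oplus>\<^bsub>A\<^esub> u)) \<oplus>\<^bsub>A\<^esub> (h \<ominus>\<^bsub>A\<^esub> (b \<oplus>\<^bsub>A\<^esub> v))"
      using y by (simp add: cscale_add_right)
    also have "\<dots> = (h \<oplus>\<^bsub>A\<^esub> h) \<ominus>\<^bsub>A\<^esub> ((a \<oplus>\<^bsub>A\<^esub> b) \<oplus>\<^bsub>A\<^esub> (u \<oplus>\<^bsub>A\<^esub> v))"
      using hc by algebra
    also have "\<dots> = x \<ominus>\<^bsub>A\<^esub> (re f \<oplus>\<^bsub>A\<^esub> scal (Re c))"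
      using half c_eq fc by (simp add: h_def a_def b_def u_def v_def re_def cscale_add_right)
    finally have eq: "cscale A (1/2) (y \<oplus>\<^bsub>A\<^esub> star A y) = x \<ominus>\<^bsub>A\<^esub> (re f \<oplus>\<^bsub>A\<^esub> scal (Re c))" .
    have "nrm A (x \<ominus>\<^bsub>A\<^esub> (re f \<oplus>\<^bsub>A\<^esub> scal (Re c))) \<le> nrm A y"
      using nrm_triangle[of y "star A y"] y unfolding eq[symmetric] by (simp add: nrm_cscale)
    also have "\<dots> < e" using f(2) by (simp add: y_def)
    finally show ?thesis using f(1) by blast
  qed
  then show "\<exists>F. finite F \<and> F \<subseteq> Vsa \<and>
     (\<forall>x\<in>Vsa. L x \<le> 1 \<longrightarrow> (\<exists>f\<in>F. \<exists>r. nrm A (x \<ominus>\<^bsub>A\<^esub> (f \<oplus>\<^bsub>A\<^esub> scal r)) < e))"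
    using F re by (intro exI[of _ "re ` F"]) auto
qed

text \<open>Scalars cancel in \<open>\<mu> x - \<nu> x\<close>, so a net modulo scalars yields the
  finite test sets of \<open>metrizesI\<close>; scaling \<open>w\<close> into the Lipschitz ball
  yields its other premise.\<close>

lemma ou_cqms_of_net:
  assumes semi: "seminorm_over \<real> A Vsa L" and L1: "L \<one>\<^bsub>A\<^esub> = 0" and net: "sa_net_mod_scalars L"
  shows "ou_cqms A V L"
proof -
  have "metrizes (state_dist Vsa L) (weak_star Vsa (ou_states A V))"
  proof (rule metrizesI)
    show "ou_states A V \<subseteq> extensional Vsa" by (auto simp: ou_states_def)
    show "\<exists>F. finite F \<and> F \<subseteq> Vsa \<and> (\<forall>x\<in>Vsa. L x \<le> 1 \<longrightarrow>
      (\<exists>f\<in>F. \<forall>\<mu>\<in>ou_states A V. \<forall>\<nu>\<in>ou_states A V. norm (\<mu> x - \<nu> x) \<le> norm (\<mu> f - \<nu> f) + e))" if e: "e > 0" for e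
    proof -
      have e2: "e / 2 > 0" using e by simp
      obtain F where F: "finite F" "F \<subseteq> Vsa"
        and close: "\<And>x. x \<in> Vsa \<Longrightarrow> L x \<le> 1 \<Longrightarrow> \<exists>f\<in>F. \<exists>r. nrm A (x \<ominus>\<^bsub>A\<^esub> (f \<oplus>\<^bsub>A\<^esub> scal r)) < e / 2"
        using net e2 unfolding sa_net_mod_scalars_def by meson
      have "\<exists>f\<in>F. \<forall>\<mu>\<in>ou_states A V. \<forall>\<nu>\<in>ou_states A V. norm (\<mu> x - \<nu> x) \<le> norm (\<mu> f - \<nu> f) + e"
        if x: "x \<in> Vsa" "L x \<le> 1" for x
      proof -
        obtain f r where f: "f \<in> F" "nrm A (x \<ominus>\<^bsub>A\<^esub> (f \<oplus>\<^bsub>A\<^esub> scal r)) < e / 2"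
          using close[OF x] by blast
        have fV: "f \<in> Vsa" using f F by auto
        have *: "\<bar>\<mu> x - (\<mu> f + r)\<bar> < e / 2" if \<mu>: "\<mu> \<in> ou_states A V" for \<mu>
          using abs_ou_state_le[OF \<mu>, of "x \<ominus>\<^bsub>A\<^esub> (f \<oplus>\<^bsub>A\<^esub> scal r)"] f fV x
          by (simp add: ou_stateD[OF \<mu>])
        have "norm (\<mu> x - \<nu> x) \<le> norm (\<mu> f - \<nu> f) + e" if "\<mu> \<in> ou_states A V" "\<nu> \<in> ou_states A V" for \<mu> \<nu>
          using *[OF that(1)] *[OF that(2)] unfolding real_norm_def by linarith
        then show ?thesis using f by blast
      qed
      then show ?thesis using F by blast
    qed
    fix w and e :: real assume w: "w \<in> Vsa" and e: "e > 0"
    have Lw: "0 \<le> L w" using semi w by (simp add: seminorm_over_def)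
    \<comment> \<open>Dividing by \<open>L w + 1\<close> also covers \<open>L w = 0\<close>.\<close>
    define x where "x = cscale A (complex_of_real (1 / (L w + 1))) w"
    have "L x = cmod (complex_of_real (1 / (L w + 1))) * L w"
      using semi w unfolding seminorm_over_def x_def by (metis Reals_of_real)
    also have "\<dots> = L w / (L w + 1)"
      using Lw by (simp add: norm_divide del: of_real_add)
    also have "\<dots> \<le> 1"
      using Lw by simp
    finally have "L x \<le> 1" .
    moreover have "norm (\<mu> w - \<nu> w) \<le> (L w + 1) * norm (\<mu> x - \<nu> x) + e"
      if "\<mu> \<in> ou_states A V" "\<nu> \<in> ou_states A V" for \<mu> \<nu>
    proof -
      have "\<mu> x - \<nu> x = (\<mu> w - \<nu> w) / (L w + 1)"
        using ou_stateD(4)[OF that(1) w] ou_stateD(4)[OF that(2) w] by (simp add: x_def diff_divide_distrib del: of_real_divide of_real_add)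
      then show ?thesis using Lw e by (simp add: abs_mult)
    qed
    ultimately show "\<exists>x\<in>Vsa. \<exists>K\<ge>0. L x \<le> 1 \<and>
      (\<forall>\<mu>\<in>ou_states A V. \<forall>\<nu>\<in>ou_states A V. norm (\<mu> w - \<nu> w) \<le> K * norm (\<mu> x - \<nu> x) + e)"
      using w Lw by (intro bexI[of _ x] exI[of _ "L w + 1"]) (auto simp: x_def simp del: of_real_divide of_real_add)
  qed simp
  then show ?thesis
    using cstar sub semi L1 by (simp add: ou_cqms_def)
qed

lemma cqms_of_net:
  assumes dense: "norm_closure A V = carrier A" and semi: "seminorm_over UNIV A V L" and L1: "L \<one>\<^bsub>A\<^esub> = 0"
    and Lstar: "\<And>x. x \<in> V \<Longrightarrow> L (star A x) = L x" and net: "net_mod_scalars L"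
  shows "cqms A V L"
proof -
  have "metrizes (state_dist V L) (weak_star (carrier A) (states A))"
  proof (rule metrizesI)
    show "states A \<subseteq> extensional (carrier A)" by (auto simp: states_def)
    show "V \<subseteq> carrier A" by auto
    show "\<exists>F. finite F \<and> F \<subseteq> carrier A \<and> (\<forall>x\<in>V. L x \<le> 1 \<longrightarrow>
      (\<exists>f\<in>F. \<forall>\<mu>\<in>states A. \<forall>\<nu>\<in>states A. norm (\<mu> x - \<nu> x) \<le> norm (\<mu> f - \<nu> f) + e))" if e: "e > 0" for e
    proof -
      \<comment> \<open>The bound of \<open>norm_state_le\<close> has a factor 2, and two states are
        compared.\<close>
      have e2: "e / 4 > 0" using e by simp
      obtain F where F: "finite F" "F \<subseteq> V"
        and close: "\<And>x. x \<in> V \<Longrightarrow> L x \<le> 1 \<Longrightarrow> \<exists>f\<in>F. \<exists>c. nrm A (x \<ominus>\<^bsub>A\<^esub> (f \<oplus>\<^bsub>A\<^esub> cscale A c \<one>\<^bsub>A\<^esub>)) < e / 4"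
        using net e2 unfolding net_mod_scalars_def by meson
      have "\<exists>f\<in>F. \<forall>\<mu>\<in>states A. \<forall>\<nu>\<in>states A. norm (\<mu> x - \<nu> x) \<le> norm (\<mu> f - \<nu> f) + e"
        if x: "x \<in> V" "L x \<le> 1" for x
      proof -
        obtain f c where f: "f \<in> F" "nrm A (x \<ominus>\<^bsub>A\<^esub> (f \<oplus>\<^bsub>A\<^esub> cscale A c \<one>\<^bsub>A\<^esub>)) < e / 4"
          using close[OF x] by blast
        have fV: "f \<in> carrier A" using f F by auto
        have *: "cmod (\<mu> x - (\<mu> f + c)) \<le> e / 2" if \<mu>: "\<mu> \<in> states A" for \<mu>
          using norm_state_le[OF \<mu>, of "x \<ominus>\<^bsub>A\<^esub> (f \<oplus>\<^bsub>A\<^esub> cscale A c \<one>\<^bsub>A\<^esub>)"] f fV x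
          by (simp add: stateD[OF \<mu>])
        have "norm (\<mu> x - \<nu> x) \<le> norm (\<mu> f - \<nu> f) + e" if \<mu>: "\<mu> \<in> states A" and \<nu>: "\<nu> \<in> states A" for \<mu> \<nu>
        proof -
          have "\<mu> x - \<nu> x = (\<mu> f - \<nu> f) + ((\<mu> x - (\<mu> f + c)) - (\<nu> x - (\<nu> f + c)))" by simp
          then have "norm (\<mu> x - \<nu> x) \<le> norm (\<mu> f - \<nu> f) + norm ((\<mu> x - (\<mu> f + c)) - (\<nu> x - (\<nu> f + c)))"
            by (metis norm_triangle_ineq)
          also have "norm ((\<mu> x - (\<mu> f + c)) - (\<nu> x - (\<nu> f + c))) \<le> e / 2 + e / 2"
            by (rule order_trans[OF norm_triangle_ineq4 add_mono[OF *[OF \<mu>] *[OF \<nu>]]])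
          finally show ?thesis by simp
        qed
        then show ?thesis using f by blast
      qed
      then show ?thesis using F by (intro exI[of _ F]) auto
    qed
    fix w and e :: real assume w: "w \<in> carrier A" and e: "e > 0"
    \<comment> \<open>The states live on all of \<open>A\<close>, whereas \<open>L\<close> is
      considered on \<open>V\<close>; density replaces \<open>w\<close> by a nearby
      \<open>y\<close>.\<close>
    have "e / 4 > 0" using e by simp
    then obtain y where y: "y \<in> V" "nrm A (w \<ominus>\<^bsub>A\<^esub> y) < e / 4"
      using w dense unfolding norm_closure_def by blast
    have Ly: "0 \<le> L y" using semi y by (simp add: seminorm_over_def)
    define x where "x = cscale A (complex_of_real (1 / (L y + 1))) y"
    have "L x = cmod (complex_of_real (1 / (L y + 1))) * L y"
      using semi y unfolding seminorm_over_def x_def by blast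
    also have "\<dots> = L y / (L y + 1)"
      using Ly by (simp add: norm_divide del: of_real_add)
    also have "\<dots> \<le> 1"
      using Ly by simp
    finally have "L x \<le> 1" .
    moreover have "norm (\<mu> w - \<nu> w) \<le> (L y + 1) * norm (\<mu> x - \<nu> x) + e"
      if \<mu>: "\<mu> \<in> states A" and \<nu>: "\<nu> \<in> states A" for \<mu> \<nu>
    proof -
      have "\<mu> x - \<nu> x = complex_of_real (1 / (L y + 1)) * (\<mu> y - \<nu> y)"
        using stateD(4)[OF \<mu>, of y] stateD(4)[OF \<nu>, of y] y by (simp add: x_def right_diff_distrib del: of_real_divide of_real_add)
      then have 1: "norm (\<mu> y - \<nu> y) = (L y + 1) * norm (\<mu> x - \<nu> x)"
        using Ly by (simp add: norm_mult norm_divide del: of_real_add)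
      have *: "cmod (\<kappa> w - \<kappa> y) \<le> e / 2" if \<kappa>: "\<kappa> \<in> states A" for \<kappa>
        using norm_state_le[OF \<kappa>, of "w \<ominus>\<^bsub>A\<^esub> y"] w y by (simp add: stateD[OF \<kappa>])
      have "\<mu> w - \<nu> w = (\<mu> y - \<nu> y) + ((\<mu> w - \<mu> y) - (\<nu> w - \<nu> y))" by simp
      then have "norm (\<mu> w - \<nu> w) \<le> norm (\<mu> y - \<nu> y) + norm ((\<mu> w - \<mu> y) - (\<nu> w - \<nu> y))"
        by (metis norm_triangle_ineq)
      also have "norm ((\<mu> w - \<mu> y) - (\<nu> w - \<nu> y)) \<le> e / 2 + e / 2"
        by (rule order_trans[OF norm_triangle_ineq4 add_mono[OF *[OF \<mu>] *[OF \<nu>]]])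
      finally show ?thesis using 1 by simp
    qed
    ultimately show "\<exists>x\<in>V. \<exists>K\<ge>0. L x \<le> 1 \<and>
      (\<forall>\<mu>\<in>states A. \<forall>\<nu>\<in>states A. norm (\<mu> w - \<nu> w) \<le> K * norm (\<mu> x - \<nu> x) + e)"
      using y Ly by (intro bexI[of _ x] exI[of _ "L y + 1"]) (auto simp: x_def simp del: of_real_divide of_real_add)
  qed
  then show ?thesis
    using cstar sub dense semi L1 Lstar by (simp add: cqms_def)
qed

end

section \<open>Total boundedness of the Lipschitz ball of the coefficient algebra\<close>

lemma states_cstar_of_type:
  "states cstar_of_type = {\<mu> :: 'b::cstar_algebra \<Rightarrow> complex. (\<forall>x y. \<mu> (x + y) = \<mu> x + \<mu> y) \<and>
     (\<forall>c x. \<mu> (scaleC c x) = c * \<mu> x) \<and> (\<forall>x. psd x \<longrightarrow> \<mu> x \<in> \<real>\<^sub>\<ge>\<^sub>0) \<and> \<mu> 1 = 1}"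
proof -
  have "positive cstar_of_type x \<longleftrightarrow> psd x" for x :: 'b
    by (simp add: positive_iff_pos[OF unital_cstar_of_type] psd_iff_pos)
  then show ?thesis
    by (simp add: states_def) (simp add: cstar_of_type_def)
qed

text \<open>The complexification of \<open>f\<close>. On a positive \<open>x\<close> it is real,
  because \<open>f\<close> is invariant under \<open>adj\<close>, which changes the sign of
  \<open>- i x\<close>.\<close>

lemma state_of_real_state:
  assumes f: "f \<in> real_states"
  shows "(\<lambda>x. Complex (f x) (f (scaleC (-\<i>) x))) \<in> states cstar_of_type"
proof -
  note l = real_stateD(1)[OF f]
  have sc: "scaleC c x = Re c *\<^sub>R x + Im c *\<^sub>R scaleC \<i> x" for c and x :: 'a
    by (metis complex_eq mult.commute scaleC_add_left scaleC_of_real scaleC_scaleC)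
  have re: "f (scaleC c x) = Re c * f x - Im c * f (scaleC (-\<i>) x)" for c x
    unfolding sc[of c] by (simp add: linear_add[OF l] linear_scale[OF l] scaleC_minus_left linear_neg[OF l])
  have im: "f (scaleC (-\<i>) (scaleC c x)) = Re c * f (scaleC (-\<i>) x) + Im c * f x" for c x
    using re[of "- \<i> * c" x] by (simp add: scaleC_scaleC)
  have zero: "f (scaleC (-\<i>) x) = 0" if "psd x" for x
    using real_stateD(4)[OF f, of "scaleC (-\<i>) x"] psd_adj[OF that]
    by (simp add: adj_scaleC adj_minus scaleC_minus_left linear_neg[OF l])
  have one: "psd (1 :: 'a)"
    using psd_star_mult[of "1 :: 'a"] by simp
  show ?thesis
    unfolding states_cstar_of_type mem_Collect_eq
  proof (intro conjI allI impI)
    show "Complex (f (x + y)) (f (scaleC (-\<i>) (x + y)))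
        = Complex (f x) (f (scaleC (-\<i>) x)) + Complex (f y) (f (scaleC (-\<i>) y))" for x y
      by (simp add: complex_eq_iff linear_add[OF l] scaleC_add_right)
    show "Complex (f (scaleC c x)) (f (scaleC (-\<i>) (scaleC c x))) = c * Complex (f x) (f (scaleC (-\<i>) x))" for c x
      by (simp only: complex_eq_iff re[of c x] im[of c x]) simp
    show "Complex (f x) (f (scaleC (-\<i>) x)) \<in> \<real>\<^sub>\<ge>\<^sub>0" if "psd x" for x
      using zero[OF that] real_state_psd[OF f that] by (simp add: complex_nonneg_Reals_iff)
    show "Complex (f 1) (f (scaleC (-\<i>) 1)) = 1"
      using zero[OF one] real_stateD(2)[OF f] by (simp add: complex_eq_iff)
  qed
qed

lemma norm_le_of_states:
  assumes "\<And>\<mu>. \<mu> \<in> states cstar_of_type \<Longrightarrow> cmod (\<mu> a) \<le> r"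
  shows "norm (a :: 'b::cstar_algebra) \<le> 2 * r"
proof (rule norm_le_2_of_real_states)
  fix f :: "'b \<Rightarrow> real" assume "f \<in> real_states"
  then have *: "cmod (Complex (f a) (f (scaleC (-\<i>) a))) \<le> r"
    using assms state_of_real_state by blast
  show "\<bar>f a\<bar> \<le> r" "\<bar>f (scaleC (-\<i>) a)\<bar> \<le> r"
    using abs_Re_le_cmod[of "Complex (f a) (f (scaleC (-\<i>) a))"] abs_Im_le_cmod[of "Complex (f a) (f (scaleC (-\<i>) a))"] *
    by simp_all
qed

lemma states_nonempty: "states (cstar_of_type :: 'b::cstar_algebra cstar) \<noteq> {}"
proof -
  obtain f :: "'b \<Rightarrow> real" where "f \<in> real_states"
    by (rule norming_real_state[OF adj_one])
  then show ?thesis using state_of_real_state by blast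
qed

text \<open>Banach-Alaoglu: the defining conditions are closed under pointwise limits, and by
  \<open>norm_state_le\<close> all states lie in a product of discs, which is compact by
  Tychonoff.\<close>

lemma compact_space_states: "compact_space (weak_star UNIV (states (cstar_of_type :: 'b::cstar_algebra cstar)))"
proof -
  let ?S = "states (cstar_of_type :: 'b cstar)"
  have coord: "continuous_on UNIV (\<lambda>\<mu> :: 'b \<Rightarrow> complex. \<mu> x)" for x
    by (rule continuous_on_product_coordinates)
  have "closed {\<mu> :: 'b \<Rightarrow> complex. \<mu> x \<in> \<real>\<^sub>\<ge>\<^sub>0}" for x
    using closed_vimage[OF closed_nonneg_Reals_complex coord[of x]] by (simp add: vimage_def)
  then have "closed ?S"
    unfolding states_cstar_of_type
    by (intro closed_Collect_conj closed_Collect_all closed_Collect_eq closed_Collect_imp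
        continuous_on_add continuous_on_mult continuous_on_const coord open_Collect_const)
  then have closed: "closedin (product_topology (\<lambda>_. euclidean) UNIV) ?S"
    by (simp add: euclidean_product_topology)
  interpret star_subspace "cstar_of_type :: 'b cstar" UNIV
    by unfold_locales (simp_all add: unital_star_subspace_def cstar_of_type_def)
  have "\<mu> x \<in> cball 0 (2 * norm x)" if "\<mu> \<in> ?S" for \<mu> and x :: 'b
    using norm_state_le[OF that, of x] by (simp add: cstar_of_type_def)
  then have subset: "?S \<subseteq> PiE UNIV (\<lambda>x. cball 0 (2 * norm x))"
    by auto
  have "compactin (product_topology (\<lambda>_. euclidean) UNIV) (PiE UNIV (\<lambda>x::'b. cball (0::complex) (2 * norm x)))"
    by (simp add: compactin_PiE)
  then have "compactin (product_topology (\<lambda>_. euclidean) UNIV) ?S"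
    using subset closed by (rule closed_compactin)
  then show ?thesis
    unfolding weak_star_def by (rule compact_space_subtopology)
qed

text \<open>Arzela-Ascoli: the elements of the Lipschitz ball are 1-Lipschitz functions on the compact
  metric space of states. An element is classified by the approximate values of \<open>\<mu> - \<mu>\<^sub>0\<close> on it, for
  \<open>\<mu>\<close> in a finite net of states.\<close>

lemma cqms_imp_net:
  fixes VB :: "'b::cstar_algebra set"
  assumes cq: "cqms cstar_of_type VB LB" and e: "e > 0"
  obtains F where "finite F" "F \<subseteq> VB"
    "\<And>b. b \<in> VB \<Longrightarrow> LB b \<le> 1 \<Longrightarrow> \<exists>f\<in>F. \<exists>c. norm (b - f - scaleC c 1) < e"
proof -
  let ?S = "states (cstar_of_type :: 'b cstar)"
  let ?X = "weak_star UNIV ?S"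
  define d where "d \<mu> \<nu> = enn2real (state_dist VB LB \<mu> \<nu>)" for \<mu> \<nu> :: "'b \<Rightarrow> complex"
  have carrier: "carrier (cstar_of_type :: 'b cstar) = UNIV" by (simp add: cstar_of_type_def)
  have top: "topspace ?X = ?S"
    by (auto simp: weak_star_def)
  have met: "metrizes (state_dist VB LB) ?X"
    using cq by (simp add: cqms_def carrier)
  interpret M: Metric_space ?S d
    using met unfolding metrizes_def top d_def[abs_def] by simp
  have "M.mtopology = ?X"
    using met unfolding metrizes_def top d_def[abs_def] by simp
  then have "compact_space M.mtopology"
    using compact_space_states by metis
  then have tb: "M.mtotally_bounded ?S"
    unfolding M.compact_space_eq_mcomplete_mtotally_bounded by blast
  have lip: "cmod (\<mu> b - \<nu> b) \<le> d \<mu> \<nu>" if "\<mu> \<in> ?S" "\<nu> \<in> ?S" "b \<in> VB" "LB b \<le> 1" for \<mu> \<nu> b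
  proof -
    have "ennreal (cmod (\<mu> b - \<nu> b)) \<le> state_dist VB LB \<mu> \<nu>"
      unfolding state_dist_def using that by (intro SUP_upper) auto
    also have "\<dots> = ennreal (d \<mu> \<nu>)"
      using met that unfolding metrizes_def top d_def by simp
    finally show ?thesis by (simp add: d_def)
  qed
  \<comment> \<open>Each state will give \<open>4 * \<delta>\<close>, which
    \<open>norm_le_of_states\<close> doubles, and \<open>8 * \<delta> < e\<close>.\<close>
  define \<delta> where "\<delta> = e / 9"
  have \<delta>: "\<delta> > 0" using e by (simp add: \<delta>_def)
  obtain K where K: "finite K" "K \<subseteq> ?S" "?S \<subseteq> (\<Union>x\<in>K. M.mball x \<delta>)"
    using tb[unfolded M.mtotally_bounded_def, rule_format, OF \<delta>] by blast
  obtain \<mu>0 where \<mu>0: "\<mu>0 \<in> ?S" using states_nonempty by blast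
  \<comment> \<open>A common bound for all \<open>k b - \<mu>0 b\<close> with \<open>b\<close> in
    the Lipschitz ball, so that finitely many discs of radius \<open>\<delta>\<close> cover these
    values.\<close>
  define D where "D = (\<Sum>k\<in>K. d k \<mu>0)"
  have D: "d k \<mu>0 \<le> D" if "k \<in> K" for k
    unfolding D_def using K(1) that by (intro member_le_sum) auto
  have "\<exists>P. finite P \<and> P \<subseteq> cball 0 D \<and> cball (0::complex) D \<subseteq> (\<Union>x\<in>P. ball x \<delta>)"
    using seq_compact_imp_totally_bounded[of "cball (0::complex) D"] \<delta> by (simp add: compact_imp_seq_compact)
  then obtain P :: "complex set" where P: "finite P" "cball 0 D \<subseteq> (\<Union>x\<in>P. ball x \<delta>)"
    by blast
  define B where "B = {b \<in> VB. LB b \<le> 1}"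
  have ex: "\<exists>p\<in>P. dist p (k b - \<mu>0 b) < \<delta>" if "b \<in> B" "k \<in> K" for b k
  proof -
    have "cmod (k b - \<mu>0 b) \<le> D"
      using lip[of k \<mu>0 b] D[OF that(2)] that K \<mu>0 by (force simp: B_def)
    then show ?thesis using P(2) by (force simp: subset_eq)
  qed
  define cl where "cl b = (\<lambda>k\<in>K. SOME p. p \<in> P \<and> dist p (k b - \<mu>0 b) < \<delta>)" for b
  have cl: "cl b k \<in> P" "dist (cl b k) (k b - \<mu>0 b) < \<delta>" if "b \<in> B" "k \<in> K" for b k
  proof -
    have "\<exists>p. p \<in> P \<and> dist p (k b - \<mu>0 b) < \<delta>" using ex[OF that] by blast
    from someI_ex[OF this] show "cl b k \<in> P" "dist (cl b k) (k b - \<mu>0 b) < \<delta>"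
      using that(2) by (simp_all add: cl_def)
  qed
  have "cl b \<in> extensional K" for b
    by (simp add: cl_def)
  then have "cl ` B \<subseteq> PiE K (\<lambda>_. P)"
    using cl(1) by (auto simp: PiE_def)
  then have fin: "finite (cl ` B)"
    using K(1) P(1) by (meson finite_PiE finite_subset)
  define rep where "rep q = (SOME b. b \<in> B \<and> cl b = q)" for q
  have rep: "rep (cl b) \<in> B" "cl (rep (cl b)) = cl b" if "b \<in> B" for b
    using someI_ex[of "\<lambda>b'. b' \<in> B \<and> cl b' = cl b"] that unfolding rep_def by blast+
  show thesis
  proof (rule that[of "rep ` cl ` B"])
    show "finite (rep ` cl ` B)" using fin by simp
    show "rep ` cl ` B \<subseteq> VB" using rep(1) by (auto simp: B_def)
    fix b assume "b \<in> VB" "LB b \<le> 1"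
    then have b: "b \<in> B" by (simp add: B_def)
    define f where "f = rep (cl b)"
    have f: "f \<in> B" "cl f = cl b" using rep[OF b] by (simp_all add: f_def)
    \<comment> \<open>The scalar by which \<open>b\<close> and its representative differ is read off
      at the base state.\<close>
    define c where "c = \<mu>0 b - \<mu>0 f"
    have "norm (b - f - scaleC c 1) \<le> 2 * (4 * \<delta>)"
    proof (rule norm_le_of_states)
      fix \<mu> assume \<mu>: "\<mu> \<in> ?S"
      then obtain k where k: "k \<in> K" "d k \<mu> < \<delta>" using K(3) by auto
      have kS: "k \<in> ?S" using k K(2) by auto
      have "\<mu> (b - f - scaleC c 1) = \<mu> b - \<mu> f - c"
      proof -
        have lin: "\<mu> (x + y) = \<mu> x + \<mu> y" "\<mu> (scaleC z x) = z * \<mu> x" "\<mu> 1 = 1" for x y z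
          using \<mu> by (auto simp: states_cstar_of_type)
        have "b - f - scaleC c 1 = b + (scaleC (-1) f + scaleC (-c) 1)"
          by (simp add: scaleC_minus_left)
        then show ?thesis by (simp only: lin) simp
      qed
      also have "\<dots> = (\<mu> b - k b) + (k f - \<mu> f) + (((k b - \<mu>0 b) - cl b k) + (cl f k - (k f - \<mu>0 f)))"
        by (simp add: c_def f(2))
      also have "cmod \<dots> \<le> (\<delta> + \<delta>) + (\<delta> + \<delta>)"
      proof (intro norm_triangle_le add_mono)
        show "cmod (\<mu> b - k b) \<le> \<delta>"
          using lip[OF kS \<mu>, of b] b k(2) by (simp add: B_def norm_minus_commute)
        show "cmod (k f - \<mu> f) \<le> \<delta>"
          using lip[OF kS \<mu>, of f] f k(2) by (simp add: B_def)
        show "cmod (k b - \<mu>0 b - cl b k) \<le> \<delta>" "cmod (cl f k - (k f - \<mu>0 f)) \<le> \<delta>"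
          using cl(2)[OF b k(1)] cl(2)[OF f(1) k(1)] by (simp_all add: dist_norm norm_minus_commute)
      qed
      finally show "cmod (\<mu> (b - f - scaleC c 1)) \<le> 4 * \<delta>" by simp
    qed
    also have "\<dots> < e" using e by (simp add: \<delta>_def)
    finally show "\<exists>f\<in>rep ` cl ` B. \<exists>c. norm (b - f - scaleC c 1) < e"
      using b by (auto simp: f_def)
  qed
qed

section \<open>Direct sums and the quantum Gromov-Hausdorff distance\<close>

lemma dsum_record [simp]:
  "carrier (dsum A B) = carrier A \<times> carrier B"
  "mult (dsum A B) x y = (fst x \<otimes>\<^bsub>A\<^esub> fst y, snd x \<otimes>\<^bsub>B\<^esub> snd y)"
  "one (dsum A B) = (\<one>\<^bsub>A\<^esub>, \<one>\<^bsub>B\<^esub>)" "zero (dsum A B) = (\<zero>\<^bsub>A\<^esub>, \<zero>\<^bsub>B\<^esub>)"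
  "add (dsum A B) x y = (fst x \<oplus>\<^bsub>A\<^esub> fst y, snd x \<oplus>\<^bsub>B\<^esub> snd y)"
  "cscale (dsum A B) c x = (cscale A c (fst x), cscale B c (snd x))"
  "star (dsum A B) x = (star A (fst x), star B (snd x))"
  "nrm (dsum A B) x = max (nrm A (fst x)) (nrm B (snd x))"
  by (simp_all add: dsum_def)

context
  fixes A :: "'a cstar" and B :: "'b cstar"
  assumes A: "unital_cstar A" and B: "unital_cstar B"
begin

interpretation A: unital_cstar A by (rule A)
interpretation B: unital_cstar B by (rule B)

lemma ring_dsum: "Ring.ring (dsum A B)"
proof (rule ringI)
  show "abelian_group (dsum A B)"
  proof (rule abelian_groupI)
    fix x assume "x \<in> carrier (dsum A B)"
    then show "\<exists>y\<in>carrier (dsum A B). y \<oplus>\<^bsub>dsum A B\<^esub> x = \<zero>\<^bsub>dsum A B\<^esub>"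
      by (intro bexI[of _ "(\<ominus>\<^bsub>A\<^esub> fst x, \<ominus>\<^bsub>B\<^esub> snd x)"]) (auto simp: A.l_neg B.l_neg)
  qed (auto simp: A.a_ac B.a_ac)
  show "Group.monoid (dsum A B)"
    by (rule Group.monoidI) (auto simp: A.m_assoc B.m_assoc)
qed (auto simp: A.l_distr A.r_distr B.l_distr B.r_distr)

lemma a_minus_dsum:
  assumes "x \<in> carrier (dsum A B)" "y \<in> carrier (dsum A B)"
  shows "x \<ominus>\<^bsub>dsum A B\<^esub> y = (fst x \<ominus>\<^bsub>A\<^esub> fst y, snd x \<ominus>\<^bsub>B\<^esub> snd y)"
proof -
  interpret D: Ring.ring "dsum A B" by (rule ring_dsum)
  have "\<ominus>\<^bsub>dsum A B\<^esub> y = (\<ominus>\<^bsub>A\<^esub> fst y, \<ominus>\<^bsub>B\<^esub> snd y)"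
    using assms by (intro D.minus_equality) (auto simp: A.l_neg B.l_neg)
  then show ?thesis by (simp add: a_minus_def)
qed

lemma unital_cstar_dsum: "unital_cstar (dsum A B)"
proof (rule unital_cstar.intro[OF ring_dsum], unfold_locales)
  fix x assume "x \<in> carrier (dsum A B)"
  then have x: "fst x \<in> carrier A" "snd x \<in> carrier B" by auto
  show "(nrm (dsum A B) x = 0) = (x = \<zero>\<^bsub>dsum A B\<^esub>)"
    using A.nrm_eq_zero[OF x(1)] B.nrm_eq_zero[OF x(2)] A.nrm_nonneg[OF x(1)] B.nrm_nonneg[OF x(2)]
    by (auto simp: max_def prod_eq_iff)
  show "nrm (dsum A B) (star (dsum A B) x \<otimes>\<^bsub>dsum A B\<^esub> x) = (nrm (dsum A B) x)\<^sup>2"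
    using A.nrm_nonneg[OF x(1)] B.nrm_nonneg[OF x(2)] x
    by (auto simp: A.nrm_star_mult B.nrm_star_mult max_def power_mono intro!: antisym dest: power2_le_imp_le)
  show "nrm (dsum A B) (cscale (dsum A B) c x) = cmod c * nrm (dsum A B) x" for c
    using x by (simp add: A.nrm_cscale B.nrm_cscale max_mult_distrib_left)
  show "0 \<le> nrm (dsum A B) x"
    using A.nrm_nonneg[OF x(1)] by simp
  fix y assume "y \<in> carrier (dsum A B)"
  then have y: "fst y \<in> carrier A" "snd y \<in> carrier B" by auto
  show "nrm (dsum A B) (x \<oplus>\<^bsub>dsum A B\<^esub> y) \<le> nrm (dsum A B) x + nrm (dsum A B) y"
    using A.nrm_triangle[OF x(1) y(1)] B.nrm_triangle[OF x(2) y(2)] by auto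
  have "nrm A (fst x) * nrm A (fst y) \<le> nrm (dsum A B) x * nrm (dsum A B) y"
    "nrm B (snd x) * nrm B (snd y) \<le> nrm (dsum A B) x * nrm (dsum A B) y"
    using x y A.nrm_nonneg B.nrm_nonneg by (auto intro!: mult_mono simp: le_max_iff_disj)
  then show "nrm (dsum A B) (x \<otimes>\<^bsub>dsum A B\<^esub> y) \<le> nrm (dsum A B) x * nrm (dsum A B) y"
    using A.nrm_mult[OF x(1) y(1)] B.nrm_mult[OF x(2) y(2)] by simp
next
  fix s :: "nat \<Rightarrow> 'a \<times> 'b"
  assume s: "\<And>n. s n \<in> carrier (dsum A B)"
    and Cauchy: "\<And>e. 0 < e \<Longrightarrow> \<exists>N. \<forall>m\<ge>N. \<forall>n\<ge>N. nrm (dsum A B) (s m \<ominus>\<^bsub>dsum A B\<^esub> s n) < e"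
  have c: "fst (s n) \<in> carrier A" "snd (s n) \<in> carrier B" for n using s[of n] by auto
  have "\<exists>N. \<forall>m\<ge>N. \<forall>n\<ge>N. nrm A (fst (s m) \<ominus>\<^bsub>A\<^esub> fst (s n)) < e"
    "\<exists>N. \<forall>m\<ge>N. \<forall>n\<ge>N. nrm B (snd (s m) \<ominus>\<^bsub>B\<^esub> snd (s n)) < e" if e: "0 < e" for e
    using Cauchy[OF e] by (auto simp: a_minus_dsum[OF s s])
  then obtain a b where a: "a \<in> carrier A" "(\<lambda>n. nrm A (fst (s n) \<ominus>\<^bsub>A\<^esub> a)) \<longlonglongrightarrow> 0"
    and b: "b \<in> carrier B" "(\<lambda>n. nrm B (snd (s n) \<ominus>\<^bsub>B\<^esub> b)) \<longlonglongrightarrow> 0"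
    using A.nrm_complete[of "\<lambda>n. fst (s n)", OF c(1)] B.nrm_complete[of "\<lambda>n. snd (s n)", OF c(2)] by blast
  have ab: "(a, b) \<in> carrier (dsum A B)" using a b by simp
  have "(\<lambda>n. nrm (dsum A B) (s n \<ominus>\<^bsub>dsum A B\<^esub> (a, b))) \<longlonglongrightarrow> max 0 0"
    unfolding a_minus_dsum[OF s ab] using tendsto_max[OF a(2) b(2)] by simp
  then show "\<exists>a\<in>carrier (dsum A B). (\<lambda>n. nrm (dsum A B) (s n \<ominus>\<^bsub>dsum A B\<^esub> a)) \<longlonglongrightarrow> 0"
    using ab by auto
qed (auto simp: A.cscale_one B.cscale_one A.cscale_cscale B.cscale_cscale A.cscale_add_left B.cscale_add_left
    A.cscale_add_right B.cscale_add_right A.mult_cscale_left B.mult_cscale_left A.mult_cscale_right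
    B.mult_cscale_right A.star_star B.star_star A.star_add B.star_add A.star_cscale B.star_cscale
    A.star_mult B.star_mult)

end

text \<open>Unital contractivity is what \<open>ou_stateI\<close> asks for, so states pull back
  along such maps; the last condition keeps Lipschitz balls inside Lipschitz balls.\<close>

definition lip_map ::
  "'a cstar \<Rightarrow> 'a set \<Rightarrow> ('a \<Rightarrow> real) \<Rightarrow> 'b cstar \<Rightarrow> 'b set \<Rightarrow> ('b \<Rightarrow> real) \<Rightarrow> ('a \<Rightarrow> 'b) \<Rightarrow> bool" where
  "lip_map A V L B W M \<Phi> \<longleftrightarrow> (\<forall>x\<in>sa_part A V. \<Phi> x \<in> sa_part B W) \<and> \<Phi> \<one>\<^bsub>A\<^esub> = \<one>\<^bsub>B\<^esub> \<and>
     (\<forall>x\<in>sa_part A V. \<forall>y\<in>sa_part A V. \<Phi> (x \<oplus>\<^bsub>A\<^esub> y) = \<Phi> x \<oplus>\<^bsub>B\<^esub> \<Phi> y) \<and>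
     (\<forall>r. \<forall>x\<in>sa_part A V. \<Phi> (cscale A (complex_of_real r) x) = cscale B (complex_of_real r) (\<Phi> x)) \<and>
     (\<forall>x\<in>sa_part A V. nrm B (\<Phi> x) \<le> nrm A x \<and> M (\<Phi> x) \<le> L x)"

lemma lip_mapD:
  assumes "lip_map A V L B W M \<Phi>"
  shows "x \<in> sa_part A V \<Longrightarrow> \<Phi> x \<in> sa_part B W" "\<Phi> \<one>\<^bsub>A\<^esub> = \<one>\<^bsub>B\<^esub>"
    "x \<in> sa_part A V \<Longrightarrow> y \<in> sa_part A V \<Longrightarrow> \<Phi> (x \<oplus>\<^bsub>A\<^esub> y) = \<Phi> x \<oplus>\<^bsub>B\<^esub> \<Phi> y"
    "x \<in> sa_part A V \<Longrightarrow> \<Phi> (cscale A (complex_of_real r) x) = cscale B (complex_of_real r) (\<Phi> x)"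
    "x \<in> sa_part A V \<Longrightarrow> nrm B (\<Phi> x) \<le> nrm A x" "x \<in> sa_part A V \<Longrightarrow> M (\<Phi> x) \<le> L x"
  using assms by (auto simp: lip_map_def)

lemma lip_map_diff:
  assumes "star_subspace A V" "star_subspace B W" "lip_map A V L B W M \<Phi>" "x \<in> sa_part A V" "y \<in> sa_part A V"
  shows "\<Phi> (x \<ominus>\<^bsub>A\<^esub> y) = \<Phi> x \<ominus>\<^bsub>B\<^esub> \<Phi> y"
proof -
  interpret A: star_subspace A V by fact
  interpret B: star_subspace B W by fact
  note d = lip_mapD[OF assms(3)]
  have "x \<ominus>\<^bsub>A\<^esub> y = x \<oplus>\<^bsub>A\<^esub> cscale A (complex_of_real (-1)) y"
    using assms by (simp add: A.diff_eq A.VsaD)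
  also have "\<Phi> \<dots> = \<Phi> x \<oplus>\<^bsub>B\<^esub> cscale B (complex_of_real (-1)) (\<Phi> y)"
    using d(3)[OF assms(4) A.Vsa_closed(3)[OF assms(5)], of "-1"] d(4)[OF assms(5), of "-1"] by simp
  also have "\<dots> = \<Phi> x \<ominus>\<^bsub>B\<^esub> \<Phi> y"
    using d(1)[OF assms(4)] d(1)[OF assms(5)] by (simp add: B.diff_eq B.VsaD)
  finally show ?thesis .
qed

lemma lip_map_state:
  assumes "star_subspace A V" "star_subspace B W" and \<Phi>: "lip_map A V L B W M \<Phi>" and \<mu>: "\<mu> \<in> ou_states B W"
  shows "restrict (\<mu> \<circ> \<Phi>) (sa_part A V) \<in> ou_states A V"
proof -
  interpret A: star_subspace A V by fact
  interpret B: star_subspace B W by fact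
  note d = lip_mapD[OF \<Phi>]
  show ?thesis
  proof (rule A.ou_stateI)
    fix x assume x: "x \<in> A.Vsa"
    show "\<bar>restrict (\<mu> \<circ> \<Phi>) A.Vsa x\<bar> \<le> nrm A x"
      using B.abs_ou_state_le[OF \<mu> d(1)[OF x]] d(5)[OF x] x by simp
  qed (use d B.ou_stateD[OF \<mu>] in auto)
qed

text \<open>Formulated for \<open>heine_borel\<close> types, as it is applied to real and to complex
  scalars.\<close>

lemma scalar_net:
  fixes R \<delta> :: real
  assumes "\<delta> > 0"
  obtains P :: "'c::heine_borel set" where "finite P" "\<And>t. dist a t \<le> R \<Longrightarrow> \<exists>p\<in>P. dist p t < \<delta>"
proof -
  have "\<exists>P. finite P \<and> P \<subseteq> cball a R \<and> cball (a::'c) R \<subseteq> (\<Union>x\<in>P. ball x \<delta>)"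
    using seq_compact_imp_totally_bounded[of "cball a R"] assms by (simp add: compact_imp_seq_compact)
  then show thesis
    using that by (force simp: subset_eq)
qed

lemma max3_add_mono:
  fixes a b c :: real
  shows "\<lbrakk>a \<le> a1 + a2; b \<le> b1 + b2; c \<le> c1 + c2\<rbrakk>
    \<Longrightarrow> max a (max b c) \<le> max a1 (max b1 c1) + max a2 (max b2 c2)"
  by (auto simp: max_def)

lemma max3_mult: "0 \<le> k \<Longrightarrow> max (k * a) (max (k * b) (k * c)) = k * max a (max b (c::real))"
  by (simp add: max_mult_distrib_left)

text \<open>The bridge semi-norm is \<open>max (L1 x) (max (L2 y) (\<parallel>y - \<Phi> x\<parallel> / e))\<close>.\<close>

lemma dist_q_le:
  assumes X1: "star_subspace A1 V1" and X2: "star_subspace A2 V2" and one: "nrm A2 \<one>\<^bsub>A2\<^esub> = 1"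
    and s1: "seminorm_over \<real> A1 (sa_part A1 V1) L1" and s2: "seminorm_over \<real> A2 (sa_part A2 V2) L2"
    and L1_one: "L1 \<one>\<^bsub>A1\<^esub> = 0" and L2_one: "L2 \<one>\<^bsub>A2\<^esub> = 0"
    and net1: "star_subspace.sa_net_mod_scalars A1 V1 L1" and net2: "star_subspace.sa_net_mod_scalars A2 V2 L2"
    and \<Phi>: "lip_map A1 V1 L1 A2 V2 L2 \<Phi>" and \<Psi>: "lip_map A2 V2 L2 A1 V1 L1 \<Psi>" and e: "e > 0"
    and close1: "\<And>x. x \<in> sa_part A1 V1 \<Longrightarrow> L1 x \<le> 1 \<Longrightarrow> nrm A1 (x \<ominus>\<^bsub>A1\<^esub> \<Psi> (\<Phi> x)) \<le> e"
    and close2: "\<And>y. y \<in> sa_part A2 V2 \<Longrightarrow> L2 y \<le> 1 \<Longrightarrow> nrm A2 (y \<ominus>\<^bsub>A2\<^esub> \<Phi> (\<Psi> y)) \<le> e"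
  shows "dist_q A1 V1 L1 A2 V2 L2 \<le> ennreal (2 * e)"
proof -
  interpret X1: star_subspace A1 V1 by fact
  interpret X2: star_subspace A2 V2 by fact
  let ?D = "dsum A1 A2"
  let ?W = "sa_part ?D (V1 \<times> V2)"
  interpret D: star_subspace ?D "V1 \<times> V2"
    by (rule star_subspace.intro[OF unital_cstar_dsum[OF X1.cstar X2.cstar]])
      (auto simp: unital_star_subspace_def)
  have W: "?W = X1.Vsa \<times> X2.Vsa"
    by (auto simp: sa_part_def)
  note \<Phi>d = lip_mapD[OF \<Phi>] and \<Psi>d = lip_mapD[OF \<Psi>]
  define L where "L = (\<lambda>(x, y). max (L1 x) (max (L2 y) (nrm A2 (y \<ominus>\<^bsub>A2\<^esub> \<Phi> x) / e)))"
  have L1nn: "0 \<le> L1 x" if "x \<in> X1.Vsa" for x using s1 that by (simp add: seminorm_over_def)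
  have L2nn: "0 \<le> L2 y" if "y \<in> X2.Vsa" for y using s2 that by (simp add: seminorm_over_def)
  have \<Phi>c: "\<Phi> x \<in> carrier A2" "\<Phi> x \<in> X2.Vsa" if "x \<in> X1.Vsa" for x using \<Phi>d(1)[OF that] by (auto simp: X2.VsaD)
  have \<Psi>c: "\<Psi> y \<in> carrier A1" "\<Psi> y \<in> X1.Vsa" if "y \<in> X2.Vsa" for y using \<Psi>d(1)[OF that] by (auto simp: X1.VsaD)
  note c = X1.VsaD(3) X2.VsaD(3)
  have semi: "seminorm_over \<real> ?D ?W L"
    unfolding seminorm_over_def W
  proof (intro conjI ballI)
    fix p assume "p \<in> X1.Vsa \<times> X2.Vsa"
    then obtain x y where p: "p = (x, y)" and xy: "x \<in> X1.Vsa" "y \<in> X2.Vsa" by blast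
    show "0 \<le> L p" using L1nn[OF xy(1)] by (simp add: p L_def)
    fix q assume "q \<in> X1.Vsa \<times> X2.Vsa"
    then obtain x' y' where q: "q = (x', y')" and xy': "x' \<in> X1.Vsa" "y' \<in> X2.Vsa" by blast
    have "(y \<oplus>\<^bsub>A2\<^esub> y') \<ominus>\<^bsub>A2\<^esub> \<Phi> (x \<oplus>\<^bsub>A1\<^esub> x') = (y \<ominus>\<^bsub>A2\<^esub> \<Phi> x) \<oplus>\<^bsub>A2\<^esub> (y' \<ominus>\<^bsub>A2\<^esub> \<Phi> x')"
      unfolding \<Phi>d(3)[OF xy(1) xy'(1)] using c(2)[OF xy(2)] c(2)[OF xy'(2)] \<Phi>c(1)[OF xy(1)] \<Phi>c(1)[OF xy'(1)]
      by (simp add: X2.minus_eq X2.minus_add X2.a_ac)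
    then have "nrm A2 ((y \<oplus>\<^bsub>A2\<^esub> y') \<ominus>\<^bsub>A2\<^esub> \<Phi> (x \<oplus>\<^bsub>A1\<^esub> x')) \<le> nrm A2 (y \<ominus>\<^bsub>A2\<^esub> \<Phi> x) + nrm A2 (y' \<ominus>\<^bsub>A2\<^esub> \<Phi> x')"
      using X2.nrm_triangle[of "y \<ominus>\<^bsub>A2\<^esub> \<Phi> x" "y' \<ominus>\<^bsub>A2\<^esub> \<Phi> x'"] c(2)[OF xy(2)] c(2)[OF xy'(2)] \<Phi>c(1)[OF xy(1)] \<Phi>c(1)[OF xy'(1)]
      by simp
    then have "nrm A2 ((y \<oplus>\<^bsub>A2\<^esub> y') \<ominus>\<^bsub>A2\<^esub> \<Phi> (x \<oplus>\<^bsub>A1\<^esub> x')) / e \<le> nrm A2 (y \<ominus>\<^bsub>A2\<^esub> \<Phi> x) / e + nrm A2 (y' \<ominus>\<^bsub>A2\<^esub> \<Phi> x') / e"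
      using e by (simp add: divide_right_mono flip: add_divide_distrib)
    moreover have "L1 (x \<oplus>\<^bsub>A1\<^esub> x') \<le> L1 x + L1 x'" "L2 (y \<oplus>\<^bsub>A2\<^esub> y') \<le> L2 y + L2 y'"
      using s1 s2 xy xy' by (auto simp: seminorm_over_def)
    ultimately show "L (p \<oplus>\<^bsub>?D\<^esub> q) \<le> L p + L q"
      unfolding p q L_def dsum_record fst_conv snd_conv prod.case by (intro max3_add_mono)
  next
    fix r :: complex and p assume r: "r \<in> \<real>" and "p \<in> X1.Vsa \<times> X2.Vsa"
    then obtain x y t where p: "p = (x, y)" and xy: "x \<in> X1.Vsa" "y \<in> X2.Vsa" and t: "r = complex_of_real t"
      by (auto elim: Reals_cases)
    have "cscale A2 r y \<ominus>\<^bsub>A2\<^esub> \<Phi> (cscale A1 r x) = cscale A2 r (y \<ominus>\<^bsub>A2\<^esub> \<Phi> x)"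
      unfolding t \<Phi>d(4)[OF xy(1)] using c(2)[OF xy(2)] \<Phi>c(1)[OF xy(1)] by (simp add: X2.cscale_diff)
    then have "nrm A2 (cscale A2 r y \<ominus>\<^bsub>A2\<^esub> \<Phi> (cscale A1 r x)) / e = cmod r * (nrm A2 (y \<ominus>\<^bsub>A2\<^esub> \<Phi> x) / e)"
      using c(2)[OF xy(2)] \<Phi>c(1)[OF xy(1)] by (simp add: X2.nrm_cscale)
    moreover have "L1 (cscale A1 r x) = cmod r * L1 x" "L2 (cscale A2 r y) = cmod r * L2 y"
      using s1 s2 xy r by (auto simp: seminorm_over_def)
    ultimately show "L (cscale ?D r p) = cmod r * L p"
      unfolding p L_def dsum_record fst_conv snd_conv prod.case by (simp only: max3_mult[OF norm_ge_zero])
  qed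
  have L_one: "L \<one>\<^bsub>?D\<^esub> = 0"
    by (simp add: L_def L1_one L2_one \<Phi>d(2) X2.minus_eq X2.r_neg)
  have net: "D.sa_net_mod_scalars L"
    unfolding D.sa_net_mod_scalars_def
  proof (intro allI impI)
    fix \<epsilon> :: real assume \<epsilon>: "\<epsilon> > 0"
    define \<delta> where "\<delta> = \<epsilon> / 2"
    have \<delta>: "\<delta> > 0" using \<epsilon> by (simp add: \<delta>_def)
    obtain F1 where F1: "finite F1" "F1 \<subseteq> X1.Vsa"
      and n1: "\<And>x. x \<in> X1.Vsa \<Longrightarrow> L1 x \<le> 1 \<Longrightarrow> \<exists>f\<in>F1. \<exists>r. nrm A1 (x \<ominus>\<^bsub>A1\<^esub> (f \<oplus>\<^bsub>A1\<^esub> X1.scal r)) < \<delta>"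
      using net1 \<delta> unfolding X1.sa_net_mod_scalars_def by meson
    obtain F2 where F2: "finite F2" "F2 \<subseteq> X2.Vsa"
      and n2: "\<And>y. y \<in> X2.Vsa \<Longrightarrow> L2 y \<le> 1 \<Longrightarrow> \<exists>f\<in>F2. \<exists>r. nrm A2 (y \<ominus>\<^bsub>A2\<^esub> (f \<oplus>\<^bsub>A2\<^esub> X2.scal r)) < \<delta>"
      using net2 \<delta> unfolding X2.sa_net_mod_scalars_def by meson
    \<comment> \<open>A pair in the ball is close to \<open>(f1 + r1, f2 + r2)\<close>, but only one
      common scalar may be removed. Since \<open>y\<close> is within \<open>e\<close> of
      \<open>\<Phi> x\<close>, the difference \<open>r2 - r1\<close> is at most \<open>R\<close> in
      absolute value, so it can be taken from the finite set \<open>P\<close>.\<close>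
    define R where "R = (\<Sum>f\<in>F1. nrm A1 f) + (\<Sum>f\<in>F2. nrm A2 f) + e + 2 * \<delta>"
    obtain P :: "real set" where P: "finite P" "\<And>t. dist 0 t \<le> R \<Longrightarrow> \<exists>p\<in>P. dist p t < \<delta>"
      using scalar_net[OF \<delta>] by blast
    define F where "F = (\<lambda>(f1, f2, p). (f1, f2 \<oplus>\<^bsub>A2\<^esub> X2.scal p)) ` (F1 \<times> F2 \<times> P)"
    have "\<exists>f\<in>F. \<exists>r. nrm ?D (z \<ominus>\<^bsub>?D\<^esub> (f \<oplus>\<^bsub>?D\<^esub> D.scal r)) < \<epsilon>" if z: "z \<in> ?W" "L z \<le> 1" for z
    proof -
      obtain x y where z_eq: "z = (x, y)" and xy: "x \<in> X1.Vsa" "y \<in> X2.Vsa" using z(1) W by blast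
      have Lz: "L1 x \<le> 1" "L2 y \<le> 1" "nrm A2 (y \<ominus>\<^bsub>A2\<^esub> \<Phi> x) \<le> e"
        using z(2) e by (auto simp: z_eq L_def)
      obtain f1 r1 where f1: "f1 \<in> F1" "nrm A1 (x \<ominus>\<^bsub>A1\<^esub> (f1 \<oplus>\<^bsub>A1\<^esub> X1.scal r1)) < \<delta>"
        using n1[OF xy(1) Lz(1)] by blast
      obtain f2 r2 where f2: "f2 \<in> F2" "nrm A2 (y \<ominus>\<^bsub>A2\<^esub> (f2 \<oplus>\<^bsub>A2\<^esub> X2.scal r2)) < \<delta>"
        using n2[OF xy(2) Lz(2)] by blast
      have fV: "f1 \<in> X1.Vsa" "f2 \<in> X2.Vsa" using f1 f2 F1 F2 by auto
      note cc = c(1)[OF xy(1)] c(2)[OF xy(2)] c(1)[OF fV(1)] c(2)[OF fV(2)] \<Phi>c(1)[OF xy(1)] \<Phi>c(1)[OF fV(1)]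
      have sc: "X2.scal r \<in> carrier A2" "X1.scal r \<in> carrier A1" for r by auto
      define u v w where "u = y \<ominus>\<^bsub>A2\<^esub> (f2 \<oplus>\<^bsub>A2\<^esub> X2.scal r2)" and "v = y \<ominus>\<^bsub>A2\<^esub> \<Phi> x"
        and "w = \<Phi> x \<ominus>\<^bsub>A2\<^esub> (\<Phi> f1 \<oplus>\<^bsub>A2\<^esub> X2.scal r1)"
      have uvw: "u \<in> carrier A2" "v \<in> carrier A2" "w \<in> carrier A2"
        using cc sc by (auto simp: u_def v_def w_def)
      have "w = \<Phi> (x \<ominus>\<^bsub>A1\<^esub> (f1 \<oplus>\<^bsub>A1\<^esub> X1.scal r1))"
        using lip_map_diff[OF X1 X2 \<Phi> xy(1), of "f1 \<oplus>\<^bsub>A1\<^esub> X1.scal r1"] \<Phi>d(3)[OF fV(1), of "X1.scal r1"]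
          \<Phi>d(4)[of "\<one>\<^bsub>A1\<^esub>" r1] \<Phi>d(2) fV(1) by (simp add: w_def)
      then have w: "nrm A2 w < \<delta>"
        using \<Phi>d(5)[of "x \<ominus>\<^bsub>A1\<^esub> (f1 \<oplus>\<^bsub>A1\<^esub> X1.scal r1)"] f1(2) xy(1) fV(1) by simp
      have "X2.scal r2 \<ominus>\<^bsub>A2\<^esub> X2.scal r1 = ((v \<oplus>\<^bsub>A2\<^esub> w) \<ominus>\<^bsub>A2\<^esub> u) \<oplus>\<^bsub>A2\<^esub> (\<Phi> f1 \<ominus>\<^bsub>A2\<^esub> f2)"
        unfolding u_def v_def w_def using cc(2,4,5,6) sc(1)[of r1] sc(1)[of r2] by algebra
      moreover have "X2.scal (r2 - r1) = X2.scal r2 \<ominus>\<^bsub>A2\<^esub> X2.scal r1"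
        using X2.cscale_add_left[of "\<one>\<^bsub>A2\<^esub>" "complex_of_real r2" "- complex_of_real r1"]
        by (simp add: X2.minus_eq X2.cscale_minus)
      ultimately have "nrm A2 (X2.scal (r2 - r1)) \<le> ((nrm A2 v + nrm A2 w) + nrm A2 u) + (nrm A2 (\<Phi> f1) + nrm A2 f2)"
        using X2.nrm_triangle[of "(v \<oplus>\<^bsub>A2\<^esub> w) \<ominus>\<^bsub>A2\<^esub> u" "\<Phi> f1 \<ominus>\<^bsub>A2\<^esub> f2"] X2.nrm_diff_le[of "v \<oplus>\<^bsub>A2\<^esub> w" u]
          X2.nrm_triangle[of v w] X2.nrm_diff_le[of "\<Phi> f1" f2] uvw cc by simp
      moreover have "nrm A2 (X2.scal (r2 - r1)) = \<bar>r2 - r1\<bar>"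
        by (simp only: X2.nrm_cscale[OF X2.one_closed] one norm_of_real mult_1_right)
      moreover have "nrm A2 (\<Phi> f1) \<le> (\<Sum>f\<in>F1. nrm A1 f)"
      proof (rule order_trans[OF \<Phi>d(5)[OF fV(1)] member_le_sum[where f = "nrm A1", OF f1(1) _ F1(1)]])
        show "0 \<le> nrm A1 f" if "f \<in> F1 - {f1}" for f
          using that F1(2) by (intro X1.nrm_nonneg c(1)) auto
      qed
      moreover have "nrm A2 f2 \<le> (\<Sum>f\<in>F2. nrm A2 f)"
      proof (rule member_le_sum[where f = "nrm A2", OF f2(1) _ F2(1)])
        show "0 \<le> nrm A2 f" if "f \<in> F2 - {f2}" for f
          using that F2(2) by (intro X2.nrm_nonneg c(2)) auto
      qed
      ultimately have "dist 0 (r2 - r1) \<le> R"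
        using w f2(2) Lz(3) by (simp add: R_def u_def v_def)
      then obtain p where p: "p \<in> P" "dist p (r2 - r1) < \<delta>" using P(2) by blast
      have "nrm A2 (y \<ominus>\<^bsub>A2\<^esub> ((f2 \<oplus>\<^bsub>A2\<^esub> X2.scal p) \<oplus>\<^bsub>A2\<^esub> X2.scal r1)) < \<epsilon>"
      proof -
        have "X2.scal (r2 - r1 - p) = X2.scal r2 \<ominus>\<^bsub>A2\<^esub> (X2.scal p \<oplus>\<^bsub>A2\<^esub> X2.scal r1)"
          using X2.cscale_add_left[of "\<one>\<^bsub>A2\<^esub>" "complex_of_real r2" "- complex_of_real (p + r1)"] X2.scal_add[of p r1]
            X2.cscale_minus[of "\<one>\<^bsub>A2\<^esub>" "complex_of_real (p + r1)"]
          by (simp add: X2.minus_eq algebra_simps)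
        then have "y \<ominus>\<^bsub>A2\<^esub> ((f2 \<oplus>\<^bsub>A2\<^esub> X2.scal p) \<oplus>\<^bsub>A2\<^esub> X2.scal r1) = u \<oplus>\<^bsub>A2\<^esub> X2.scal (r2 - r1 - p)"
          unfolding u_def using cc(2,4) sc(1)[of r1] sc(1)[of r2] sc(1)[of p] by algebra
        then have "nrm A2 (y \<ominus>\<^bsub>A2\<^esub> ((f2 \<oplus>\<^bsub>A2\<^esub> X2.scal p) \<oplus>\<^bsub>A2\<^esub> X2.scal r1)) \<le> nrm A2 u + cmod (complex_of_real (r2 - r1 - p))"
          using X2.nrm_triangle[of u "X2.scal (r2 - r1 - p)"] X2.nrm_cscale_one_le[of "complex_of_real (r2 - r1 - p)"] uvw
          by (simp del: of_real_diff norm_of_real)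
        also have "\<dots> < \<delta> + \<delta>"
          using f2(2) p(2) unfolding norm_of_real by (intro add_strict_mono) (auto simp: u_def dist_real_def)
        finally show ?thesis by (simp add: \<delta>_def)
      qed
      moreover have "nrm A1 (x \<ominus>\<^bsub>A1\<^esub> (f1 \<oplus>\<^bsub>A1\<^esub> X1.scal r1)) < \<epsilon>"
        using f1(2) \<epsilon> by (simp add: \<delta>_def)
      ultimately have "nrm ?D (z \<ominus>\<^bsub>?D\<^esub> ((f1, f2 \<oplus>\<^bsub>A2\<^esub> X2.scal p) \<oplus>\<^bsub>?D\<^esub> D.scal r1)) < \<epsilon>"
        using cc by (simp add: z_eq a_minus_dsum[OF X1.cstar X2.cstar])
      then show ?thesis
        using f1(1) f2(1) p(1) by (auto simp: F_def intro!: bexI[of _ "(f1, f2, p)"] exI[of _ r1])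
    qed
    moreover have "finite F" using F1(1) F2(1) P(1) by (simp add: F_def)
    moreover have "F \<subseteq> ?W"
      unfolding W using F1(2) F2(2) by (auto simp: F_def)
    ultimately show "\<exists>F. finite F \<and> F \<subseteq> ?W \<and>
        (\<forall>x\<in>?W. L x \<le> 1 \<longrightarrow> (\<exists>f\<in>F. \<exists>r. nrm ?D (x \<ominus>\<^bsub>?D\<^esub> (f \<oplus>\<^bsub>?D\<^esub> D.scal r)) < \<epsilon>))"
      by blast
  qed
  \<comment> \<open>By homogeneity from \<open>close2\<close>; scaling with \<open>q > L2 y\<close>
    instead of \<open>L2 y\<close> avoids a division by 0.\<close>
  have close2': "nrm A2 (y \<ominus>\<^bsub>A2\<^esub> \<Phi> (\<Psi> y)) \<le> e * L2 y" if y: "y \<in> X2.Vsa" for y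
  proof -
    have "nrm A2 (y \<ominus>\<^bsub>A2\<^esub> \<Phi> (\<Psi> y)) / e \<le> q" if q: "L2 y < q" for q
    proof -
      have q0: "q > 0" using L2nn[OF y] q by simp
      define s where "s = complex_of_real (1 / q)"
      have s: "s \<in> \<real>" "cmod s = 1 / q" using q0 by (auto simp: s_def norm_divide)
      have sy: "cscale A2 s y \<in> X2.Vsa" using y by (simp add: s_def del: of_real_divide)
      have "L2 (cscale A2 s y) = 1 / q * L2 y"
        using s2 y s unfolding seminorm_over_def by metis
      then have "L2 (cscale A2 s y) \<le> 1" using q q0 by simp
      from close2[OF sy this] have "nrm A2 (cscale A2 s y \<ominus>\<^bsub>A2\<^esub> \<Phi> (\<Psi> (cscale A2 s y))) \<le> e" .
      moreover have "\<Phi> (\<Psi> (cscale A2 s y)) = cscale A2 s (\<Phi> (\<Psi> y))"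
        unfolding s_def \<Psi>d(4)[OF y] \<Phi>d(4)[OF \<Psi>c(2)[OF y]] ..
      ultimately have "nrm A2 (cscale A2 s (y \<ominus>\<^bsub>A2\<^esub> \<Phi> (\<Psi> y))) \<le> e"
        using c(2)[OF y] \<Phi>c(1)[OF \<Psi>c(2)[OF y]] by (simp add: X2.cscale_diff)
      then show ?thesis
        using c(2)[OF y] \<Phi>c(1)[OF \<Psi>c(2)[OF y]] s(2) q0 e by (simp add: X2.nrm_cscale field_simps)
    qed
    then have "nrm A2 (y \<ominus>\<^bsub>A2\<^esub> \<Phi> (\<Psi> y)) / e \<le> L2 y" by (rule dense_ge)
    then show ?thesis using e by (simp add: field_simps)
  qed
  \<comment> \<open>Both infima are attained: for fixed \<open>x\<close> at \<open>\<Phi> x\<close>,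
    where the third term vanishes, and for fixed \<open>y\<close> at \<open>\<Psi> y\<close>, where
    \<open>close2'\<close> bounds the third term by \<open>L2 y\<close>.\<close>
  have "admissible A1 V1 L1 A2 V2 L2 L"
    unfolding admissible_def
  proof (intro conjI ballI)
    show "ou_cqms ?D (V1 \<times> V2) L"
      by (rule D.ou_cqms_of_net[OF semi L_one net])
    fix x assume x: "x \<in> X1.Vsa"
    have "L (x, \<Phi> x) = L1 x"
      using \<Phi>d(6)[OF x] L1nn[OF x] \<Phi>c(1)[OF x] by (simp add: L_def X2.minus_eq X2.r_neg)
    moreover have "L1 x \<le> L (x, y)" for y by (simp add: L_def)
    ultimately show "L1 x = (INF y\<in>X2.Vsa. L (x, y))"
      using \<Phi>c(2)[OF x] by (intro cInf_eq_minimum[symmetric]) (auto intro!: image_eqI[of _ _ "\<Phi> x"])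
  next
    fix y assume y: "y \<in> X2.Vsa"
    have "L (\<Psi> y, y) = L2 y"
      using \<Psi>d(6)[OF y] close2'[OF y] e by (simp add: L_def field_simps)
    moreover have "L2 y \<le> L (x, y)" for x by (simp add: L_def)
    ultimately show "L2 y = (INF x\<in>X1.Vsa. L (x, y))"
      using \<Psi>c(2)[OF y] by (intro cInf_eq_minimum[symmetric]) (auto intro!: image_eqI[of _ _ "\<Psi> y"])
  qed
  then have "dist_q A1 V1 L1 A2 V2 L2 \<le> hausdorff_dist (state_dist ?W L)
      ((\<lambda>\<mu>. restrict (\<mu> \<circ> fst) ?W) ` ou_states A1 V1) ((\<lambda>\<mu>. restrict (\<mu> \<circ> snd) ?W) ` ou_states A2 V2)"
    unfolding dist_q_def Let_def by (intro INF_lower) simp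
  also have "\<dots> \<le> ennreal (2 * e)"
    unfolding hausdorff_dist_def
  proof (rule max.boundedI)
    have bound: "state_dist ?W L (restrict (\<mu> \<circ> fst) ?W) (restrict (\<nu> \<circ> snd) ?W) \<le> ennreal (2 * e)"
      if "\<And>x y. x \<in> X1.Vsa \<Longrightarrow> y \<in> X2.Vsa \<Longrightarrow> L1 x \<le> 1 \<Longrightarrow> nrm A2 (y \<ominus>\<^bsub>A2\<^esub> \<Phi> x) \<le> e \<Longrightarrow> \<bar>\<mu> x - \<nu> y\<bar> \<le> 2 * e"
      for \<mu> \<nu>
      unfolding state_dist_def using that e by (intro SUP_least ennreal_leI) (auto simp: W L_def)
    show "(SUP x\<in>(\<lambda>\<mu>. restrict (\<mu> \<circ> fst) ?W) ` ou_states A1 V1.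
        INF y\<in>(\<lambda>\<mu>. restrict (\<mu> \<circ> snd) ?W) ` ou_states A2 V2. state_dist ?W L x y) \<le> ennreal (2 * e)"
    proof (rule SUP_least)
      fix \<mu>' assume "\<mu>' \<in> (\<lambda>\<mu>. restrict (\<mu> \<circ> fst) ?W) ` ou_states A1 V1"
      then obtain \<mu> where \<mu>: "\<mu> \<in> ou_states A1 V1" "\<mu>' = restrict (\<mu> \<circ> fst) ?W" by blast
      \<comment> \<open>Here \<open>\<mu> x - \<nu> y = \<mu> (x - \<Psi> y)\<close>, and
        \<open>x - \<Psi> y\<close> is the sum of \<open>x - \<Psi> (\<Phi> x)\<close> and
        \<open>\<Psi> (\<Phi> x - y)\<close>, each of norm at most \<open>e\<close>.\<close>
      define \<nu> where "\<nu> = restrict (\<mu> \<circ> \<Psi>) X2.Vsa"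
      have \<nu>: "\<nu> \<in> ou_states A2 V2"
        unfolding \<nu>_def by (rule lip_map_state[OF X2 X1 \<Psi> \<mu>(1)])
      have "state_dist ?W L \<mu>' (restrict (\<nu> \<circ> snd) ?W) \<le> ennreal (2 * e)"
        unfolding \<mu>(2)
      proof (rule bound)
        fix x y assume xy: "x \<in> X1.Vsa" "y \<in> X2.Vsa" and Lx: "L1 x \<le> 1" and le: "nrm A2 (y \<ominus>\<^bsub>A2\<^esub> \<Phi> x) \<le> e"
        have "nrm A1 (\<Psi> (\<Phi> x) \<ominus>\<^bsub>A1\<^esub> \<Psi> y) = nrm A1 (\<Psi> (\<Phi> x \<ominus>\<^bsub>A2\<^esub> y))"
          by (simp add: lip_map_diff[OF X2 X1 \<Psi> \<Phi>c(2)[OF xy(1)] xy(2)])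
        also have "\<dots> \<le> nrm A2 (\<Phi> x \<ominus>\<^bsub>A2\<^esub> y)"
          using \<Phi>c(2)[OF xy(1)] xy(2) by (intro \<Psi>d(5)) simp
        also have "\<dots> \<le> e"
          using le X2.nrm_diff_commute[OF \<Phi>c(1)[OF xy(1)] c(2)[OF xy(2)]] by simp
        finally have "nrm A1 (x \<ominus>\<^bsub>A1\<^esub> \<Psi> y) \<le> 2 * e"
          using X1.nrm_diff_triangle[OF c(1)[OF xy(1)] \<Psi>c(1)[OF \<Phi>c(2)[OF xy(1)]] \<Psi>c(1)[OF xy(2)]]
            close1[OF xy(1) Lx] by simp
        moreover have "\<bar>\<mu> (x \<ominus>\<^bsub>A1\<^esub> \<Psi> y)\<bar> \<le> nrm A1 (x \<ominus>\<^bsub>A1\<^esub> \<Psi> y)"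
          using xy(1) \<Psi>c(2)[OF xy(2)] by (intro X1.abs_ou_state_le[OF \<mu>(1)]) simp
        ultimately show "\<bar>\<mu> x - \<nu> y\<bar> \<le> 2 * e"
          using X1.ou_stateD(5)[OF \<mu>(1) xy(1) \<Psi>c(2)[OF xy(2)]] xy(2) by (simp add: \<nu>_def)
      qed
      then show "(INF y\<in>(\<lambda>\<mu>. restrict (\<mu> \<circ> snd) ?W) ` ou_states A2 V2. state_dist ?W L \<mu>' y) \<le> ennreal (2 * e)"
        using \<nu> by (intro INF_lower2[of "restrict (\<nu> \<circ> snd) ?W"]) auto
    qed
    show "(SUP y\<in>(\<lambda>\<mu>. restrict (\<mu> \<circ> snd) ?W) ` ou_states A2 V2.
        INF x\<in>(\<lambda>\<mu>. restrict (\<mu> \<circ> fst) ?W) ` ou_states A1 V1. state_dist ?W L x y) \<le> ennreal (2 * e)"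
    proof (rule SUP_least)
      fix \<nu>' assume "\<nu>' \<in> (\<lambda>\<mu>. restrict (\<mu> \<circ> snd) ?W) ` ou_states A2 V2"
      then obtain \<nu> where \<nu>: "\<nu> \<in> ou_states A2 V2" "\<nu>' = restrict (\<nu> \<circ> snd) ?W" by blast
      \<comment> \<open>This direction costs only \<open>e\<close>, because
        \<open>\<nu> y - \<mu> x = \<nu> (y - \<Phi> x)\<close>.\<close>
      define \<mu> where "\<mu> = restrict (\<nu> \<circ> \<Phi>) X1.Vsa"
      have \<mu>: "\<mu> \<in> ou_states A1 V1"
        unfolding \<mu>_def by (rule lip_map_state[OF X1 X2 \<Phi> \<nu>(1)])
      have "state_dist ?W L (restrict (\<mu> \<circ> fst) ?W) \<nu>' \<le> ennreal (2 * e)"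
        unfolding \<nu>(2)
      proof (rule bound)
        fix x y assume xy: "x \<in> X1.Vsa" "y \<in> X2.Vsa" and le: "nrm A2 (y \<ominus>\<^bsub>A2\<^esub> \<Phi> x) \<le> e"
        have "\<bar>\<nu> (y \<ominus>\<^bsub>A2\<^esub> \<Phi> x)\<bar> \<le> nrm A2 (y \<ominus>\<^bsub>A2\<^esub> \<Phi> x)"
          using xy(2) \<Phi>c(2)[OF xy(1)] by (intro X2.abs_ou_state_le[OF \<nu>(1)]) simp
        then show "\<bar>\<mu> x - \<nu> y\<bar> \<le> 2 * e"
          using X2.ou_stateD(5)[OF \<nu>(1) xy(2) \<Phi>c(2)[OF xy(1)]] xy(1) le e by (simp add: \<mu>_def)
      qed
      then show "(INF x\<in>(\<lambda>\<mu>. restrict (\<mu> \<circ> fst) ?W) ` ou_states A1 V1. state_dist ?W L x \<nu>') \<le> ennreal (2 * e)"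
        using \<mu> by (intro INF_lower2[of "restrict (\<mu> \<circ> fst) ?W"]) auto
    qed
  qed
  finally show ?thesis .
qed

section \<open>The Lipschitz semi-norms of the crossed products\<close>

lemma of_int_mult_scaleR: "of_int n * x = real_of_int n *\<^sub>R (x :: 'b::cstar_algebra)"
  by (metis of_real_of_int_eq scaleR_conv_of_real)

text \<open>Telescoping with \<open>2 / (k + 1)^2 \<le> 2 / k - 2 / (k + 1)\<close>; the numerator 2
  accounts for both signs of \<open>n\<close>.\<close>

lemma inverse_square_tail:
  assumes M: "M \<ge> (1::nat)" and G: "finite G"
  shows "(\<Sum>n\<in>G. (if \<bar>n\<bar> > int M then 1 / real_of_int n else 0)\<^sup>2) \<le> 2 / real M"
proof -
  let ?g = "\<lambda>n. (if \<bar>n\<bar> > int M then 1 / real_of_int n else 0)\<^sup>2"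
  have step: "(\<Sum>n\<in>{- int (M + k)..int (M + k)}. ?g n) \<le> 2 / real M - 2 / real (M + k)" for k
  proof (induction k)
    case 0
    have "(\<Sum>n\<in>{- int M..int M}. ?g n) = 0" by (intro sum.neutral) auto
    then show ?case by simp
  next
    case (Suc k)
    let ?K = "M + k"
    have "{- int (M + Suc k)..int (M + Suc k)} = insert (int ?K + 1) (insert (- (int ?K + 1)) {- int ?K..int ?K})"
      by auto
    then have "(\<Sum>n\<in>{- int (M + Suc k)..int (M + Suc k)}. ?g n)
        = 2 / (real ?K + 1)\<^sup>2 + (\<Sum>n\<in>{- int ?K..int ?K}. ?g n)"
      by (simp add: power_divide power2_eq_square) (simp add: field_simps)
    moreover have "2 / (real ?K + 1)\<^sup>2 \<le> 2 / real ?K - 2 / (real ?K + 1)"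
    proof -
      have K: "real ?K > 0" using M by simp
      then have "2 / real ?K - 2 / (real ?K + 1) = 2 / (real ?K * (real ?K + 1))"
        by (simp add: field_simps del: of_nat_add)
      moreover have "2 / (real ?K + 1)\<^sup>2 \<le> 2 / (real ?K * (real ?K + 1))"
        using K unfolding power2_eq_square by (intro divide_left_mono mult_right_mono mult_pos_pos) auto
      ultimately show ?thesis by linarith
    qed
    ultimately show ?case using Suc by (simp add: add.commute add.left_commute)
  qed
  obtain K where K: "\<And>n. n \<in> G \<Longrightarrow> \<bar>n\<bar> \<le> int K"
  proof -
    have "\<exists>k. \<forall>n\<in>G. \<bar>n\<bar> \<le> int k"
    proof (intro exI[of _ "nat (\<Sum>n\<in>G. \<bar>n\<bar>)"] ballI)
      fix n assume "n \<in> G"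
      then have "\<bar>n\<bar> \<le> (\<Sum>n\<in>G. \<bar>n\<bar>)" using G by (intro member_le_sum) auto
      then show "\<bar>n\<bar> \<le> int (nat (\<Sum>n\<in>G. \<bar>n\<bar>))" by simp
    qed
    then show thesis using that by blast
  qed
  have "(\<Sum>n\<in>G. ?g n) \<le> (\<Sum>n\<in>{- int (M + K)..int (M + K)}. ?g n)"
    using K by (intro sum_mono2) (force simp: abs_le_iff)+
  also have "\<dots> \<le> 2 / real M"
    using step[of K] by (smt (verit) divide_nonneg_nonneg of_nat_0_le_iff)
  finally show ?thesis .
qed

text \<open>Low coefficients are estimated by the triangle inequality, high ones by the multiplier
  \<open>1 / n\<close> applied to \<open>y\<close>. The relation between \<open>y\<close> and
  \<open>u\<close> concerns only indices beyond \<open>M\<close>, so \<open>y\<close> can be the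
  derivation of some \<open>x\<close> while \<open>u\<close> is \<open>x\<close> minus an element of
  a net.\<close>

lemma nrm_reg_rep_split_le:
  fixes u y :: "int \<Rightarrow> 'b::cstar_algebra"
  assumes \<beta>: "star_automorphism \<beta>" and u: "u \<in> fin_supp UNIV" and y: "y \<in> fin_supp UNIV" and M: "M \<ge> (1::nat)"
    and high: "\<And>n. \<bar>n\<bar> > int M \<Longrightarrow> of_int n * u n = y n"
  shows "nrm ops (reg_rep \<beta> u) \<le> (\<Sum>n\<in>{- int M..int M}. norm (u n)) + sqrt (2 / real M) * nrm ops (reg_rep \<beta> y)"
proof -
  define lo where "lo n = (if \<bar>n\<bar> \<le> int M then u n else 0)" for n
  define c where "c n = (if \<bar>n\<bar> > int M then 1 / real_of_int n else 0)" for n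
  have lo0: "lo n = 0" if "n \<notin> {- int M..int M}" for n using that by (auto simp: lo_def)
  have "u n = lo n + c n *\<^sub>R y n" for n
    using high[of n] by (auto simp: lo_def c_def of_int_mult_scaleR simp flip: high)
  then have u_eq: "u = (\<lambda>n. lo n + c n *\<^sub>R y n)" by blast
  have lo: "lo \<in> fin_supp UNIV"
    by (rule fin_supp_zero_outside[of "{- int M..int M}"]) (auto intro: lo0)
  have hi: "(\<lambda>n. c n *\<^sub>R y n) \<in> fin_supp UNIV"
    using y by (intro fin_supp_zero_outside[of "{n. y n \<noteq> 0}"]) (auto simp: fin_supp_def)
  have "nrm ops (reg_rep \<beta> u) \<le> nrm ops (reg_rep \<beta> lo) + nrm ops (reg_rep \<beta> (\<lambda>n. c n *\<^sub>R y n))"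
    unfolding u_eq reg_rep_add[OF \<beta> lo hi]
    by (intro ops.nrm_triangle reg_rep_carrier[OF \<beta> lo] reg_rep_carrier[OF \<beta> hi])
  moreover have "nrm ops (reg_rep \<beta> lo) \<le> (\<Sum>n\<in>{- int M..int M}. norm (lo n))"
    by (rule reg_rep_ops(3)[OF \<beta> _ lo0]) auto
  moreover have "(\<Sum>n\<in>{- int M..int M}. norm (lo n)) = (\<Sum>n\<in>{- int M..int M}. norm (u n))"
    by (intro sum.cong) (auto simp: lo_def)
  moreover have "nrm ops (reg_rep \<beta> (\<lambda>n. c n *\<^sub>R y n)) \<le> sqrt (2 / real M) * nrm ops (reg_rep \<beta> y)"
    using inverse_square_tail[OF M] by (intro nrm_multiplier_le[OF \<beta> y]) (simp add: c_def)
  ultimately show ?thesis by simp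
qed

text \<open>The cardinality is the maximum of 0 and \<open>R - |n|\<close>, a Fejer weight before
  normalisation.\<close>

lemma card_transfer_range:
  "real (card {m. m \<in> {0..<int R} \<and> m - n \<in> {0..<int R}}) \<le> real R"
  "real R - \<bar>real_of_int n\<bar> \<le> real (card {m. m \<in> {0..<int R} \<and> m - n \<in> {0..<int R}})"
proof -
  have eq: "{m. m \<in> {0..<int R} \<and> m - n \<in> {0..<int R}} = {max 0 n..<min (int R) (int R + n)}"
    by auto
  show "real (card {m. m \<in> {0..<int R} \<and> m - n \<in> {0..<int R}}) \<le> real R"
    "real R - \<bar>real_of_int n\<bar> \<le> real (card {m. m \<in> {0..<int R} \<and> m - n \<in> {0..<int R}})"
    unfolding eq by (auto simp: max_def min_def)
qed

text \<open>One error arises because the automorphisms \<open>\<gamma>^m \<beta>^(-m)\<close> move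
  \<open>x n\<close>, the other because the average has fewer than \<open>R\<close> terms. As
  \<open>\<gamma>^m\<close> is isometric, the first is measured by comparing backward
  powers.\<close>

lemma norm_transfer_diff_le:
  fixes x :: "int \<Rightarrow> 'b::cstar_algebra"
  assumes \<gamma>: "star_automorphism \<gamma>" and R: "R > 0"
    and close: "\<And>m. m \<in> {0..<int R} \<Longrightarrow> norm (int_iter \<beta> (- m) (x n) - int_iter \<gamma> (- m) (x n)) \<le> e"
  shows "norm (transfer \<beta> \<gamma> R x n - x n) \<le> e + \<bar>real_of_int n\<bar> / real R * norm (x n)"
proof -
  let ?S = "{m. m \<in> {0..<int R} \<and> m - n \<in> {0..<int R}}"
  note \<gamma>i = star_automorphism_int_iter[OF \<gamma>] and \<gamma>b = star_automorphismD(1)[OF \<gamma>]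
  have fin: "finite ?S" by (rule finite_subset[of _ "{0..<int R}"]) auto
  have e: "e \<ge> 0" using close[of 0] R by (auto intro: order_trans[OF norm_ge_zero])
  have "transfer \<beta> \<gamma> R x n - x n = (1 / real R) *\<^sub>R (\<Sum>m\<in>?S. int_iter \<gamma> m (int_iter \<beta> (- m) (x n)) - x n)
      - (1 - real (card ?S) / real R) *\<^sub>R x n"
    using R by (simp add: transfer_def sum_subtractf sum_constant_scaleR scaleR_diff_right scaleR_diff_left
        del: sum_constant)
  then have "norm (transfer \<beta> \<gamma> R x n - x n)
      \<le> norm ((1 / real R) *\<^sub>R (\<Sum>m\<in>?S. int_iter \<gamma> m (int_iter \<beta> (- m) (x n)) - x n))
        + norm ((1 - real (card ?S) / real R) *\<^sub>R x n)"
    by (simp only: norm_triangle_ineq4)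
  also have "norm ((1 / real R) *\<^sub>R (\<Sum>m\<in>?S. int_iter \<gamma> m (int_iter \<beta> (- m) (x n)) - x n)) \<le> e"
  proof -
    have "norm (int_iter \<gamma> m (int_iter \<beta> (- m) (x n)) - x n) \<le> e" if "m \<in> ?S" for m
    proof -
      have "int_iter \<gamma> m (int_iter \<beta> (- m) (x n)) - x n = int_iter \<gamma> m (int_iter \<beta> (- m) (x n) - int_iter \<gamma> (- m) (x n))"
        using \<gamma>b by (simp add: linear_diff[OF star_automorphismD(7)[OF \<gamma>i]])
      then show ?thesis using close[of m] that \<gamma> by simp
    qed
    then have "norm (\<Sum>m\<in>?S. int_iter \<gamma> m (int_iter \<beta> (- m) (x n)) - x n) \<le> real (card ?S) * e"
      by (rule sum_norm_bound)
    also have "\<dots> \<le> real R * e"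
      using card_transfer_range(1) e by (rule mult_right_mono)
    finally show ?thesis using R by (simp add: field_simps)
  qed
  also have "norm ((1 - real (card ?S) / real R) *\<^sub>R x n) \<le> \<bar>real_of_int n\<bar> / real R * norm (x n)"
  proof -
    have "\<bar>1 - real (card ?S) / real R\<bar> \<le> \<bar>real_of_int n\<bar> / real R"
    proof -
      have "(real R - real (card ?S)) / real R \<le> \<bar>real_of_int n\<bar> / real R"
        using card_transfer_range(2)[of R n] by (intro divide_right_mono) auto
      moreover have "1 - real (card ?S) / real R = (real R - real (card ?S)) / real R" "real (card ?S) / real R \<le> 1"
        using R card_transfer_range(1)[of R n] by (simp_all add: diff_divide_distrib)
      ultimately show ?thesis by simp
    qed
    then show ?thesis unfolding norm_scaleR by (rule mult_right_mono) simp
  qed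
  finally show ?thesis by simp
qed

lemma cp_adj_add: "star_automorphism \<beta> \<Longrightarrow> cp_adj \<beta> (\<lambda>n. x n + y n) = (\<lambda>n. cp_adj \<beta> x n + cp_adj \<beta> y n)"
  by (simp add: cp_adj_def adj_add star_automorphismD(2)[OF star_automorphism_int_iter])

lemma cp_adj_scaleC:
  "star_automorphism \<beta> \<Longrightarrow> cp_adj \<beta> (\<lambda>n. scaleC c (x n)) = (\<lambda>n. scaleC (cnj c) (cp_adj \<beta> x n))"
  by (simp add: cp_adj_def adj_scaleC star_automorphismD(3)[OF star_automorphism_int_iter])

lemma cp_adj_cp_adj: "star_automorphism \<beta> \<Longrightarrow> cp_adj \<beta> (cp_adj \<beta> x) = x"
  using int_iter_cancel(1)[OF star_automorphismD(1), of \<beta>]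
  by (simp add: cp_adj_def adj_adj flip: star_automorphismD(5)[OF star_automorphism_int_iter])

lemma cp_adj_unit_seq: "star_automorphism \<beta> \<Longrightarrow> cp_adj \<beta> unit_seq = unit_seq"
  by (auto simp: cp_adj_def unit_seq_def fun_eq_iff)

lemma cp_adj_of_int_mult:
  "star_automorphism \<beta> \<Longrightarrow> cp_adj \<beta> (\<lambda>n. of_int n * x n) = (\<lambda>n. - (of_int n * cp_adj \<beta> x n))"
  by (simp add: cp_adj_def of_int_mult_scaleR adj_scaleR adj_minus
      linear_scale[OF star_automorphismD(7)[OF star_automorphism_int_iter]]
      linear_neg[OF star_automorphismD(7)[OF star_automorphism_int_iter]])

lemma transfer_add:
  assumes "star_automorphism \<beta>" "star_automorphism \<gamma>"
  shows "transfer \<beta> \<gamma> R (\<lambda>n. x n + y n) = (\<lambda>n. transfer \<beta> \<gamma> R x n + transfer \<beta> \<gamma> R y n)"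
  by (rule ext) (simp add: transfer_def sum.distrib scaleR_add_right
      star_automorphismD(2)[OF star_automorphism_int_iter[OF assms(1)]]
      star_automorphismD(2)[OF star_automorphism_int_iter[OF assms(2)]])

lemma transfer_scaleC:
  assumes "star_automorphism \<beta>" "star_automorphism \<gamma>"
  shows "transfer \<beta> \<gamma> R (\<lambda>n. scaleC c (x n)) = (\<lambda>n. scaleC c (transfer \<beta> \<gamma> R x n))"
  by (rule ext) (simp add: transfer_def linear_scale[OF linear_scaleC] linear_sum[OF linear_scaleC]
      star_automorphismD(3)[OF star_automorphism_int_iter[OF assms(1)]]
      star_automorphismD(3)[OF star_automorphism_int_iter[OF assms(2)]])

lemma transfer_of_int_mult:
  assumes "star_automorphism \<beta>" "star_automorphism \<gamma>"
  shows "transfer \<beta> \<gamma> R (\<lambda>n. of_int n * x n) = (\<lambda>n. of_int n * transfer \<beta> \<gamma> R x n)"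
  by (rule ext) (simp add: transfer_def of_int_mult_scaleR scaleR_sum_right mult.commute
      linear_scale[OF star_automorphismD(7)[OF star_automorphism_int_iter[OF assms(1)]]]
      linear_scale[OF star_automorphismD(7)[OF star_automorphism_int_iter[OF assms(2)]]])

lemma transfer_unit_seq:
  assumes "star_automorphism \<beta>" "star_automorphism \<gamma>" "R > 0"
  shows "transfer \<beta> \<gamma> R unit_seq = unit_seq"
proof
  fix n
  have "{m. 0 \<le> m \<and> m < int R \<and> 0 \<le> m \<and> m < int R} = {0..<int R}" by auto
  then show "transfer \<beta> \<gamma> R unit_seq n = unit_seq n"
    using assms by (simp add: transfer_def unit_seq_def sum_constant_scaleR
        star_automorphismD(6)[OF star_automorphism_int_iter] del: sum_constant)
qed

section \<open>The coefficient algebra and the order preserving norm\<close>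

locale lip_coefficients =
  fixes VB :: "'b::cstar_algebra set" and LB :: "'b \<Rightarrow> real" and N :: "(int \<Rightarrow> complex) \<Rightarrow> real"
  assumes cq: "cqms cstar_of_type VB LB" and N: "order_preserving_norm N"
begin

lemma VB [simp]:
  "1 \<in> VB" "a \<in> VB \<Longrightarrow> b \<in> VB \<Longrightarrow> a + b \<in> VB" "a \<in> VB \<Longrightarrow> scaleC c a \<in> VB" "a \<in> VB \<Longrightarrow> adj a \<in> VB"
  using cq by (auto simp: cqms_def unital_star_subspace_def cstar_of_type_def)

lemma VB_zero [simp]: "0 \<in> VB"
  using VB(3)[OF VB(1), of 0] by simp

lemma VB_scaleR [simp]: "a \<in> VB \<Longrightarrow> r *\<^sub>R a \<in> VB"
  using VB(3)[of a "complex_of_real r"] by (simp add: scaleC_of_real)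

lemma VB_sum [simp]: "(\<And>k. k \<in> K \<Longrightarrow> v k \<in> VB) \<Longrightarrow> (\<Sum>k\<in>K. v k) \<in> VB"
  by (induction K rule: infinite_finite_induct) auto

lemma LB:
  "a \<in> VB \<Longrightarrow> 0 \<le> LB a" "a \<in> VB \<Longrightarrow> b \<in> VB \<Longrightarrow> LB (a + b) \<le> LB a + LB b"
  "a \<in> VB \<Longrightarrow> LB (scaleC c a) = cmod c * LB a" "LB 1 = 0" "a \<in> VB \<Longrightarrow> LB (adj a) = LB a"
  using cq by (auto simp: cqms_def seminorm_over_def cstar_of_type_def)

lemma LB_zero [simp]: "LB 0 = 0"
  using LB(3)[OF VB(1), of 0] by simp

lemma LB_scaleR: "a \<in> VB \<Longrightarrow> LB (r *\<^sub>R a) = \<bar>r\<bar> * LB a"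
  using LB(3)[of a "complex_of_real r"] by (simp add: scaleC_of_real)

lemma LB_sum: "(\<And>k. k \<in> K \<Longrightarrow> v k \<in> VB) \<Longrightarrow> LB (\<Sum>k\<in>K. v k) \<le> (\<Sum>k\<in>K. LB (v k))"
proof (induction K rule: infinite_finite_induct)
  case (insert k K)
  then show ?case using LB(2)[of "v k" "\<Sum>k\<in>K. v k"] by simp
qed auto

lemma VB_dense: "e > 0 \<Longrightarrow> \<exists>v\<in>VB. norm (a - v) < e"
proof -
  assume e: "e > 0"
  have "norm_closure cstar_of_type VB = carrier cstar_of_type"
    using cq by (simp only: cqms_def)
  then have "a \<in> norm_closure cstar_of_type VB"
    by (simp add: cstar_of_type_def)
  then show ?thesis
    using e unfolding norm_closure_def a_minus_cstar_of_type by (auto simp: cstar_of_type_def)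
qed

definition Nr :: "(int \<Rightarrow> real) \<Rightarrow> real" where
  "Nr h = N (\<lambda>n. complex_of_real (h n))"

lemma fin_supp_of_real: "finite {n. h n \<noteq> 0} \<Longrightarrow> (\<lambda>n. complex_of_real (h n)) \<in> fin_supp UNIV"
  by (simp add: fin_supp_def)

lemma N_nonneg: "h \<in> fin_supp UNIV \<Longrightarrow> 0 \<le> N h"
  and N_eq_zero_iff: "h \<in> fin_supp UNIV \<Longrightarrow> N h = 0 \<longleftrightarrow> h = (\<lambda>n. 0)"
  and N_add: "h \<in> fin_supp UNIV \<Longrightarrow> k \<in> fin_supp UNIV \<Longrightarrow> N (\<lambda>n. h n + k n) \<le> N h + N k"
  and N_scale: "h \<in> fin_supp UNIV \<Longrightarrow> N (\<lambda>n. c * h n) = cmod c * N h"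
  and N_mono: "f \<in> fin_supp UNIV \<Longrightarrow> g \<in> fin_supp UNIV \<Longrightarrow> (\<And>n. 0 \<le> f n \<and> f n \<le> g n) \<Longrightarrow>
    N (\<lambda>n. complex_of_real (f n)) \<le> N (\<lambda>n. complex_of_real (g n))"
  using N unfolding order_preserving_norm_def by simp_all

lemma Nr_nonneg: "finite {n. h n \<noteq> 0} \<Longrightarrow> 0 \<le> Nr h"
  unfolding Nr_def by (rule N_nonneg[OF fin_supp_of_real])

lemma Nr_add: "finite {n. h n \<noteq> 0} \<Longrightarrow> finite {n. k n \<noteq> 0} \<Longrightarrow> Nr (\<lambda>n. h n + k n) \<le> Nr h + Nr k"
  unfolding Nr_def of_real_add by (rule N_add[OF fin_supp_of_real fin_supp_of_real])

lemma Nr_scale: "finite {n. h n \<noteq> 0} \<Longrightarrow> Nr (\<lambda>n. r * h n) = \<bar>r\<bar> * Nr h"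
  unfolding Nr_def of_real_mult using N_scale[OF fin_supp_of_real, of h "complex_of_real r"] by simp

lemma Nr_mono:
  assumes "finite {n. k n \<noteq> 0}" "\<And>n. 0 \<le> h n" "\<And>n. h n \<le> k n"
  shows "Nr h \<le> Nr k"
proof -
  have "{n. h n \<noteq> 0} \<subseteq> {n. k n \<noteq> 0}"
    using assms(2,3) by (metis (mono_tags, lifting) Collect_mono order_antisym)
  then have "finite {n. h n \<noteq> 0}" using assms(1) finite_subset by blast
  then have "h \<in> fin_supp UNIV" "k \<in> fin_supp UNIV"
    using assms(1) by (auto simp: fin_supp_def)
  then show ?thesis
    unfolding Nr_def using assms(2,3) by (intro N_mono) auto
qed

lemma Nr_zero: "Nr (\<lambda>n. 0) = 0"
  using Nr_scale[of "\<lambda>n. 0" 0] by simp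

text \<open>The norm of the n-th unit sequence. As \<open>N\<close> is order preserving,
  \<open>LB (x n)\<close> is at most the norm of the sequence of all \<open>LB (x k)\<close> divided
  by \<open>weight n\<close>, so the semi-norm controls each single coefficient, though not
  uniformly in \<open>n\<close>.\<close>

definition weight :: "int \<Rightarrow> real" where
  "weight n = Nr (\<lambda>k. if k = n then 1 else 0)"

lemma weight_pos: "0 < weight n"
proof -
  let ?h = "\<lambda>k. complex_of_real (if k = n then 1 else 0)"
  have "?h \<in> fin_supp UNIV"
    by (rule fin_supp_of_real) simp
  moreover have "?h \<noteq> (\<lambda>k. 0)" by (auto simp: fun_eq_iff intro!: exI[of _ n])
  ultimately have "0 \<le> N ?h" "N ?h \<noteq> 0"
    by (auto simp: N_nonneg N_eq_zero_iff)
  then show ?thesis by (simp add: weight_def Nr_def)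
qed

lemma fin_supp_LB: "x \<in> fin_supp VB \<Longrightarrow> finite {n. LB (x n) \<noteq> 0}"
  by (rule finite_subset[of _ "{n. x n \<noteq> 0}"]) (auto simp: fin_supp_def)

lemma LB_coeff_le:
  assumes x: "x \<in> fin_supp VB"
  shows "LB (x n) \<le> Nr (\<lambda>k. LB (x k)) / weight n"
proof -
  have nn: "0 \<le> LB (x k)" for k using x by (auto intro: LB simp: fin_supp_def)
  have "Nr (\<lambda>k. LB (x n) * (if k = n then 1 else 0)) \<le> Nr (\<lambda>k. LB (x k))"
    using nn fin_supp_LB[OF x] by (intro Nr_mono) auto
  then have "LB (x n) * weight n \<le> Nr (\<lambda>k. LB (x k))"
    using nn[of n] by (subst (asm) Nr_scale) (auto simp: weight_def)
  then show ?thesis using weight_pos[of n] by (simp add: field_simps)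
qed

lemma fin_supp_VB_add: "x \<in> fin_supp VB \<Longrightarrow> y \<in> fin_supp VB \<Longrightarrow> (\<lambda>n. x n + y n) \<in> fin_supp VB"
  by (rule fin_supp_zero_outside[of "{n. x n \<noteq> 0} \<union> {n. y n \<noteq> 0}"]) (auto simp: fin_supp_def)

lemma fin_supp_VB_scaleC: "x \<in> fin_supp VB \<Longrightarrow> (\<lambda>n. scaleC c (x n)) \<in> fin_supp VB"
  using linear_0[OF linear_scaleC, of c]
  by (intro fin_supp_zero_outside[of "{n. x n \<noteq> 0}"]) (auto simp: fin_supp_def)

lemma fin_supp_of_int_mult: "x \<in> fin_supp V \<Longrightarrow> (\<lambda>n. of_int n * x n) \<in> fin_supp UNIV"
  by (rule fin_supp_zero_outside[of "{n. x n \<noteq> 0}"]) (auto simp: fin_supp_def)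

lemma unit_seq_fin_supp: "unit_seq \<in> fin_supp VB"
  by (rule fin_supp_zero_outside[of "{0}"]) (auto simp: unit_seq_def)

lemma coefficient_net:
  assumes C: "C > 0" and e: "e > 0"
  obtains F where "finite F" "F \<subseteq> VB" "\<And>b. b \<in> VB \<Longrightarrow> LB b \<le> C \<Longrightarrow> \<exists>f\<in>F. \<exists>c. norm (b - f - scaleC c 1) < e"
proof -
  have eC: "e / C > 0" using C e by simp
  obtain F where F: "finite F" "F \<subseteq> VB" "\<And>b. b \<in> VB \<Longrightarrow> LB b \<le> 1 \<Longrightarrow> \<exists>f\<in>F. \<exists>c. norm (b - f - scaleC c 1) < e / C"
    using cqms_imp_net[OF cq eC] by metis
  show thesis
  proof (rule that[of "(\<lambda>f. C *\<^sub>R f) ` F"])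
    fix b assume b: "b \<in> VB" "LB b \<le> C"
    have "(1 / C) *\<^sub>R b \<in> VB" "LB ((1 / C) *\<^sub>R b) \<le> 1"
      using b C by (simp_all add: LB_scaleR)
    then obtain f c where f: "f \<in> F" "norm ((1 / C) *\<^sub>R b - f - scaleC c 1) < e / C"
      using F(3) by blast
    have "b - C *\<^sub>R f - scaleC (complex_of_real C * c) 1 = C *\<^sub>R ((1 / C) *\<^sub>R b - f - scaleC c 1)"
      using C by (simp add: algebra_simps) (simp add: scaleC_scaleC mult.commute flip: scaleC_of_real)
    then have "norm (b - C *\<^sub>R f - scaleC (complex_of_real C * c) 1) < e"
      using f(2) C by (simp only: norm_scaleR) (simp add: pos_less_divide_eq mult.commute)
    then show "\<exists>f\<in>(\<lambda>f. C *\<^sub>R f) ` F. \<exists>c. norm (b - f - scaleC c 1) < e"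
      using f(1) by blast
  qed (use F in auto)
qed

text \<open>Under a norm bound the scalars in \<open>coefficient_net\<close> stay in a disc, which
  has a finite net. This version serves the coefficients with n \<noteq> 0, from which no scalar may
  be removed.\<close>

lemma bounded_coefficient_net:
  assumes C: "C > 0" and e: "e > 0"
  obtains F where "finite F" "F \<subseteq> VB" "\<And>b. b \<in> VB \<Longrightarrow> LB b \<le> C \<Longrightarrow> norm b \<le> 1 \<Longrightarrow> \<exists>f\<in>F. norm (b - f) < e"
proof -
  have e2: "e / 2 > 0" using e by simp
  obtain F where F: "finite F" "F \<subseteq> VB" "\<And>b. b \<in> VB \<Longrightarrow> LB b \<le> C \<Longrightarrow> \<exists>f\<in>F. \<exists>c. norm (b - f - scaleC c 1) < e / 2"
    using coefficient_net[OF C e2] by metis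
  define R where "R = 1 + (\<Sum>f\<in>F. norm f) + e / 2"
  obtain P :: "complex set" where P: "finite P" "\<And>t. dist 0 t \<le> R \<Longrightarrow> \<exists>p\<in>P. dist p t < e / 2"
    using scalar_net[OF e2] by blast
  show thesis
  proof (rule that[of "(\<lambda>(f, p). f + scaleC p 1) ` (F \<times> P)"])
    fix b assume b: "b \<in> VB" "LB b \<le> C" "norm b \<le> 1"
    obtain f c where f: "f \<in> F" "norm (b - f - scaleC c 1) < e / 2"
      using F(3)[OF b(1,2)] by blast
    have "norm f \<le> (\<Sum>f\<in>F. norm f)"
      using F(1) f(1) by (intro member_le_sum) auto
    moreover have "norm (scaleC c (1::'b)) \<le> norm b + norm f + norm (b - f - scaleC c 1)"
    proof -
      have "scaleC c 1 = (b - f) - (b - f - scaleC c 1)" by simp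
      then show ?thesis
        using norm_triangle_ineq4[of "b - f" "b - f - scaleC c 1"] norm_triangle_ineq4[of b f] by simp
    qed
    ultimately have "dist 0 c \<le> R"
      using b(3) f(2) by (simp add: R_def norm_scaleC)
    then obtain p where p: "p \<in> P" "dist p c < e / 2" using P(2) by blast
    have split: "scaleC c (1::'b) = scaleC (c - p) 1 + scaleC p 1"
      using scaleC_add_left[of "c - p" p "1::'b"] by simp
    have "b - (f + scaleC p 1) = (b - f - scaleC c 1) + scaleC (c - p) 1"
      by (simp add: split)
    then have "norm (b - (f + scaleC p 1)) \<le> norm (b - f - scaleC c 1) + cmod (c - p)"
      using norm_triangle_ineq[of "b - f - scaleC c 1" "scaleC (c - p) 1"] by (simp only: norm_scaleC) simp
    also have "\<dots> < e"
      using f(2) p(2) by (simp add: dist_norm norm_minus_commute)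
    finally show "\<exists>f\<in>(\<lambda>(f, p). f + scaleC p 1) ` (F \<times> P). norm (b - f) < e"
      using f(1) p(1) by force
  qed (use F P in auto)
qed

definition lip_automorphism :: "('b \<Rightarrow> 'b) \<Rightarrow> bool" where
  "lip_automorphism \<beta> \<longleftrightarrow> star_automorphism \<beta> \<and> \<beta> ` VB = VB \<and> (\<forall>b\<in>VB. LB (\<beta> b) = LB b)"

lemma lip_automorphism_int_iter:
  assumes \<beta>: "lip_automorphism \<beta>" and b: "b \<in> VB"
  shows "int_iter \<beta> n b \<in> VB \<and> LB (int_iter \<beta> n b) = LB b"
proof -
  have star: "star_automorphism \<beta>" and im: "\<beta> ` VB = VB" and iso: "\<And>b. b \<in> VB \<Longrightarrow> LB (\<beta> b) = LB b"
    using \<beta> by (auto simp: lip_automorphism_def)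
  note bij = star_automorphismD(1)[OF star]
  \<comment> \<open>As \<open>\<beta>\<close> maps \<open>VB\<close> onto itself, the claims before
    and after one step are equivalent, so a single induction covers positive and negative
    powers.\<close>
  have "int_iter \<beta> (n + 1) b \<in> VB \<and> LB (int_iter \<beta> (n + 1) b) = LB b
      \<longleftrightarrow> int_iter \<beta> n b \<in> VB \<and> LB (int_iter \<beta> n b) = LB b" for n
  proof -
    have "\<beta> a \<in> VB \<longleftrightarrow> a \<in> VB" for a
      using im bij_is_inj[OF bij] by (metis inj_image_mem_iff)
    then show ?thesis
      using iso unfolding int_iter_Suc[OF bij] by metis
  qed
  then show ?thesis
    using b by (induction n rule: int_induct[of _ 0]) (simp_all, metis diff_add_cancel)
qed

section \<open>The compact quantum metric structure of one crossed product\<close>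

context
  fixes \<beta> :: "'b \<Rightarrow> 'b"
  assumes lip: "lip_automorphism \<beta>"
begin

lemma star_aut: "star_automorphism \<beta>"
  using lip by (simp add: lip_automorphism_def)

lemma cp_adj_VB: "x \<in> fin_supp VB \<Longrightarrow> cp_adj \<beta> x \<in> fin_supp VB"
  using lip_automorphism_int_iter[OF lip] by (intro cp_adj_fin_supp[OF star_aut]) auto

abbreviation "P \<equiv> crossed_product \<beta>"
abbreviation "W \<equiv> cp_domain VB \<beta>"
abbreviation "L \<equiv> cp_seminorm VB LB N \<beta>"

lemma L_reg_rep:
  assumes "x \<in> fin_supp VB"
  shows "L (reg_rep \<beta> x) = max (nrm ops (reg_rep \<beta> (\<lambda>n. of_int n * x n)))
    (max (Nr (\<lambda>n. LB (x n))) (Nr (\<lambda>n. LB (cp_adj \<beta> x n))))"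
  unfolding cp_seminorm_def the_inv_into_f_f[OF inj_on_reg_rep[OF star_aut] assms]
  by (simp add: cp_seminorm_coeff_def Nr_def)

lemma W_cases:
  assumes "T \<in> W"
  obtains x where "x \<in> fin_supp VB" "T = reg_rep \<beta> x"
  using assms by (auto simp: cp_domain_def)

lemma star_subspace_W: "star_subspace P W"
proof (rule star_subspace.intro[OF unital_cstar_crossed_product[OF star_aut]])
  show "unital_star_subspace P W"
    unfolding unital_star_subspace_def crossed_product_record
  proof (intro conjI ballI allI)
    show "W \<subseteq> carrier P"
      by (auto simp: cp_domain_def intro: reg_rep_crossed_product[OF star_aut])
    show "one ops \<in> W"
      unfolding cp_domain_def reg_rep_one[OF star_aut, symmetric] using unit_seq_fin_supp by blast
    fix S assume "S \<in> W"
    then obtain x where x: "x \<in> fin_supp VB" "S = reg_rep \<beta> x" by (rule W_cases)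
    show "cscale ops c S \<in> W" for c
      unfolding x(2) reg_rep_scaleC[OF star_aut x(1), symmetric] cp_domain_def
      using fin_supp_VB_scaleC[OF x(1)] by blast
    show "star ops S \<in> W"
      unfolding x(2) reg_rep_star[OF star_aut x(1)] cp_domain_def using cp_adj_VB[OF x(1)] by blast
    fix T assume "T \<in> W"
    then obtain y where y: "y \<in> fin_supp VB" "T = reg_rep \<beta> y" by (rule W_cases)
    show "add ops S T \<in> W"
      unfolding x(2) y(2) reg_rep_add[OF star_aut x(1) y(1), symmetric] cp_domain_def
      using fin_supp_VB_add[OF x(1) y(1)] by blast
  qed
qed

text \<open>The operator norm is at most the sum of the norms of the coefficients, so a finitely
  supported element is approximated coefficient by coefficient.\<close>

lemma norm_closure_W: "norm_closure P W = carrier P"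
proof
  show "norm_closure P W \<subseteq> carrier P" by (auto simp: norm_closure_def)
  interpret P: star_subspace P W by (rule star_subspace_W)
  show "carrier P \<subseteq> norm_closure P W"
  proof
    fix a assume a: "a \<in> carrier P"
    have "\<exists>w\<in>W. nrm P (a \<ominus>\<^bsub>P\<^esub> w) < e" if e: "e > 0" for e
    proof -
      have "e / 2 > 0" using e by simp
      then obtain x where x: "x \<in> fin_supp UNIV" "nrm ops (a \<ominus>\<^bsub>ops\<^esub> reg_rep \<beta> x) < e / 2"
        using a unfolding crossed_product_carrier[OF star_aut] norm_closure_def by blast
      let ?F = "{n. x n \<noteq> 0}"
      have F: "finite ?F" using x(1) by (simp add: fin_supp_def)
      \<comment> \<open>The added 1 covers an empty support and makes the final estimate
        strict.\<close>
      define \<delta> where "\<delta> = e / (2 * (real (card ?F) + 1))"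
      have \<delta>: "\<delta> > 0" using e by (simp add: \<delta>_def)
      obtain v where v: "\<And>n. v n \<in> VB" "\<And>n. norm (x n - v n) < \<delta>"
      proof -
        have "\<forall>n. \<exists>v. v \<in> VB \<and> norm (x n - v) < \<delta>" using VB_dense[OF \<delta>] by blast
        then show thesis using that by metis
      qed
      define y where "y n = (if n \<in> ?F then v n else 0)" for n
      have y: "y \<in> fin_supp VB"
        by (rule fin_supp_zero_outside[OF F]) (auto simp: y_def v)
      have Tx: "reg_rep \<beta> x \<in> carrier P" "reg_rep \<beta> y \<in> carrier P"
        by (rule reg_rep_crossed_product[OF star_aut x(1)], rule reg_rep_crossed_product[OF star_aut y])
      have "nrm ops (reg_rep \<beta> (\<lambda>n. x n - y n)) \<le> (\<Sum>n\<in>?F. norm (x n - y n))"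
        by (rule reg_rep_ops(3)[OF star_aut F]) (auto simp: y_def)
      also have "\<dots> \<le> real (card ?F) * \<delta>"
        using v(2) by (intro sum_bounded_above) (auto simp: y_def less_imp_le)
      also have "\<dots> < (real (card ?F) + 1) * \<delta>" using \<delta> by simp
      also have "\<dots> = e / 2" by (simp add: \<delta>_def field_simps)
      finally have "nrm P (reg_rep \<beta> x \<ominus>\<^bsub>P\<^esub> reg_rep \<beta> y) < e / 2"
        by (simp add: crossed_product_a_minus[OF star_aut Tx] reg_rep_diff[OF star_aut x(1) y])
      moreover have "nrm P (a \<ominus>\<^bsub>P\<^esub> reg_rep \<beta> x) < e / 2"
        using x(2) by (simp add: crossed_product_a_minus[OF star_aut a Tx(1)])
      ultimately have "nrm P (a \<ominus>\<^bsub>P\<^esub> reg_rep \<beta> y) < e"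
        using P.nrm_diff_triangle[OF a Tx] by linarith
      then show ?thesis
        using y by (auto simp: cp_domain_def)
    qed
    then show "a \<in> norm_closure P W"
      using a by (simp add: norm_closure_def)
  qed
qed

lemma seminorm_L: "seminorm_over UNIV P W L"
  unfolding seminorm_over_def crossed_product_record
proof (intro conjI ballI)
  fix S assume "S \<in> W"
  then obtain x where x: "x \<in> fin_supp VB" "S = reg_rep \<beta> x" by (rule W_cases)
  note xa = cp_adj_VB[OF x(1)]
  note Dx = fin_supp_of_int_mult[OF x(1)]
  show "0 \<le> L S"
    unfolding x(2) L_reg_rep[OF x(1)] using Nr_nonneg[OF fin_supp_LB[OF x(1)]] by simp
  show "L (cscale ops c S) = cmod c * L S" for c
  proof -
    have "(\<lambda>n. of_int n * scaleC c (x n)) = (\<lambda>n. scaleC c (of_int n * x n))"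
      by (simp add: mult_scaleC_right)
    moreover have "(\<lambda>n. LB (scaleC c (x n))) = (\<lambda>n. cmod c * LB (x n))"
      using x(1) by (auto simp: LB(3) fin_supp_def)
    moreover have "(\<lambda>n. LB (scaleC (cnj c) (cp_adj \<beta> x n))) = (\<lambda>n. cmod c * LB (cp_adj \<beta> x n))"
      using xa by (auto simp: LB(3) fin_supp_def)
    ultimately show ?thesis
      unfolding x(2) reg_rep_scaleC[OF star_aut x(1), symmetric] L_reg_rep[OF x(1)]
        L_reg_rep[OF fin_supp_VB_scaleC[OF x(1)]]
      by (simp add: cp_adj_scaleC[OF star_aut] reg_rep_scaleC[OF star_aut Dx] Nr_scale fin_supp_LB x(1) xa
          ops.nrm_cscale reg_rep_carrier[OF star_aut Dx] max_mult_distrib_left)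
  qed
  fix T assume "T \<in> W"
  then obtain y where y: "y \<in> fin_supp VB" "T = reg_rep \<beta> y" by (rule W_cases)
  note ya = cp_adj_VB[OF y(1)]
  note Dy = fin_supp_of_int_mult[OF y(1)]
  have Nr_le: "Nr (\<lambda>n. LB (x n + y n)) \<le> Nr (\<lambda>n. LB (x n)) + Nr (\<lambda>n. LB (y n))"
    if "x \<in> fin_supp VB" "y \<in> fin_supp VB" for x y
  proof -
    have "Nr (\<lambda>n. LB (x n + y n)) \<le> Nr (\<lambda>n. LB (x n) + LB (y n))"
    proof (rule Nr_mono)
      show "finite {n. LB (x n) + LB (y n) \<noteq> 0}"
        using fin_supp_LB[OF that(1)] fin_supp_LB[OF that(2)]
        by (rule finite_subset[rotated, OF finite_UnI]) auto
    qed (use that in \<open>auto simp: fin_supp_def intro!: LB\<close>)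
    also have "\<dots> \<le> Nr (\<lambda>n. LB (x n)) + Nr (\<lambda>n. LB (y n))"
      by (rule Nr_add[OF fin_supp_LB[OF that(1)] fin_supp_LB[OF that(2)]])
    finally show ?thesis .
  qed
  show "L (add ops S T) \<le> L S + L T"
    unfolding x(2) y(2) reg_rep_add[OF star_aut x(1) y(1), symmetric] L_reg_rep[OF x(1)] L_reg_rep[OF y(1)]
      L_reg_rep[OF fin_supp_VB_add[OF x(1) y(1)]] cp_adj_add[OF star_aut] distrib_left
      reg_rep_add[OF star_aut Dx Dy]
    by (intro max3_add_mono Nr_le ops.nrm_triangle reg_rep_carrier[OF star_aut Dx]
        reg_rep_carrier[OF star_aut Dy] x(1) y(1) xa ya)
qed

lemma L_one: "L (one P) = 0"
proof -
  have "(\<lambda>n. of_int n * unit_seq n :: 'b) = (\<lambda>n. scaleC 0 (unit_seq n))"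
    by (auto simp: unit_seq_def)
  moreover have "nrm ops (reg_rep \<beta> (\<lambda>n. scaleC 0 (unit_seq n))) = 0"
    unfolding reg_rep_scaleC[OF star_aut unit_seq_fin_supp]
    using reg_rep_carrier[OF star_aut unit_seq_fin_supp] by simp
  moreover have "(\<lambda>n. LB (unit_seq n)) = (\<lambda>n. 0)"
    by (auto simp: unit_seq_def LB(4))
  ultimately show ?thesis
    using L_reg_rep[OF unit_seq_fin_supp]
    by (simp only: crossed_product_record reg_rep_one[OF star_aut] cp_adj_unit_seq[OF star_aut] Nr_zero)
qed

text \<open>The derivation of the adjoint is minus the adjoint of the derivation, so the first term
  keeps its value, while the other two are exchanged.\<close>

lemma L_star:
  assumes "S \<in> W"
  shows "L (star P S) = L S"
proof -
  obtain x where x: "x \<in> fin_supp VB" "S = reg_rep \<beta> x" using assms by (rule W_cases)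
  note Dx = fin_supp_of_int_mult[OF x(1)]
  have "reg_rep \<beta> (\<lambda>n. of_int n * cp_adj \<beta> x n) = cscale ops (-1) (star ops (reg_rep \<beta> (\<lambda>n. of_int n * x n)))"
    using reg_rep_scaleC[OF star_aut cp_adj_fin_supp[OF star_aut Dx], of "-1"]
    by (simp add: reg_rep_star[OF star_aut Dx] cp_adj_of_int_mult[OF star_aut] scaleC_minus_left)
  then have "nrm ops (reg_rep \<beta> (\<lambda>n. of_int n * cp_adj \<beta> x n)) = nrm ops (reg_rep \<beta> (\<lambda>n. of_int n * x n))"
    using reg_rep_carrier[OF star_aut Dx] by (simp add: ops.nrm_cscale)
  then show ?thesis
    unfolding x(2) crossed_product_record reg_rep_star[OF star_aut x(1)] L_reg_rep[OF x(1)]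
      L_reg_rep[OF cp_adj_VB[OF x(1)]] cp_adj_cp_adj[OF star_aut]
    by (simp add: max.commute)
qed

lemma coeff_bounds:
  assumes x: "x \<in> fin_supp VB" and L: "L (reg_rep \<beta> x) \<le> 1"
  shows "nrm ops (reg_rep \<beta> (\<lambda>n. of_int n * x n)) \<le> 1" "\<bar>real_of_int n\<bar> * norm (x n) \<le> 1"
    "LB (x n) \<le> 1 / weight n"
proof -
  note Dx = fin_supp_of_int_mult[OF x]
  show 1: "nrm ops (reg_rep \<beta> (\<lambda>n. of_int n * x n)) \<le> 1"
    using L unfolding L_reg_rep[OF x] by simp
  show "\<bar>real_of_int n\<bar> * norm (x n) \<le> 1"
    using norm_coeff_le[OF star_aut Dx, of n] 1 by (simp add: of_int_mult_scaleR)
  have "Nr (\<lambda>k. LB (x k)) / weight n \<le> 1 / weight n"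
    using L weight_pos[of n] unfolding L_reg_rep[OF x] by (intro divide_right_mono) auto
  then show "LB (x n) \<le> 1 / weight n"
    using LB_coeff_le[OF x, of n] by simp
qed

text \<open>The derivation bounds \<open>x n\<close> for n \<noteq> 0 but says nothing about
  \<open>x 0\<close>. Hence coefficient 0 is approximated modulo scalars, by \<open>F1\<close>, and
  the scalars of the crossed product absorb the defect; all other low coefficients are approximated
  in norm, by \<open>F2\<close>.\<close>

lemma net_L: "star_subspace.net_mod_scalars P W L"
proof -
  interpret P: star_subspace P W by (rule star_subspace_W)
  show ?thesis
    unfolding P.net_mod_scalars_def
  proof (intro allI impI)
    fix e :: real assume e: "e > 0"
    have "(\<lambda>M. sqrt (2 / real M)) \<longlonglongrightarrow> 0"
      by real_asymp
    then have "\<forall>\<^sub>F M in sequentially. sqrt (2 / real M) < e / 2 \<and> M \<ge> 1"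
      using e by (intro eventually_conj order_tendstoD(2)[of _ 0] eventually_ge_at_top) auto
    then obtain M where M: "sqrt (2 / real M) < e / 2" "M \<ge> 1"
      by (auto simp: eventually_sequentially)
    let ?I = "{- int M..int M}"
    define \<delta> where "\<delta> = e / (2 * real (card ?I))"
    have I: "card ?I > 0" by simp
    then have \<delta>: "\<delta> > 0" using e by (simp add: \<delta>_def)
    \<comment> \<open>The sum is a convenient common bound for the Lipschitz constants of the
      coefficients in \<open>?I\<close>.\<close>
    define C where "C = (\<Sum>n\<in>?I. 1 / weight n)"
    have Cn: "1 / weight n \<le> C" if "n \<in> ?I" for n
      unfolding C_def using that weight_pos by (intro member_le_sum) (auto simp: less_imp_le)
    have "0 < 1 / weight 0" using weight_pos[of 0] by simp
    also have "\<dots> \<le> C" by (rule Cn) simp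
    finally have C: "C > 0" .
    obtain F1 where F1: "finite F1" "F1 \<subseteq> VB"
      "\<And>b. b \<in> VB \<Longrightarrow> LB b \<le> C \<Longrightarrow> \<exists>f\<in>F1. \<exists>c. norm (b - f - scaleC c 1) < \<delta>"
      using coefficient_net[OF C \<delta>] by metis
    obtain F2 where F2: "finite F2" "F2 \<subseteq> VB"
      "\<And>b. b \<in> VB \<Longrightarrow> LB b \<le> C \<Longrightarrow> norm b \<le> 1 \<Longrightarrow> \<exists>f\<in>F2. norm (b - f) < \<delta>"
      using bounded_coefficient_net[OF C \<delta>] by metis
    define Q where "Q = PiE ?I (\<lambda>n. if n = 0 then F1 else F2)"
    have Q: "finite Q" unfolding Q_def using F1(1) F2(1) by (intro finite_PiE) auto
    define g where "g q n = (if n \<in> ?I then q n else (0::'b))" for q n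
    have g: "g q \<in> fin_supp VB" if "q \<in> Q" for q
    proof (rule fin_supp_zero_outside[of ?I])
      have "q n \<in> F1 \<union> F2" if "n \<in> ?I" for n
        using PiE_mem[OF \<open>q \<in> Q\<close>[unfolded Q_def] that] by (auto split: if_splits)
      then show "g q n \<in> VB" for n
        using F1(2) F2(2) by (auto simp: g_def)
    qed (auto simp: g_def)
    have "\<exists>f\<in>(\<lambda>q. reg_rep \<beta> (g q)) ` Q. \<exists>c. nrm P (S \<ominus>\<^bsub>P\<^esub> (f \<oplus>\<^bsub>P\<^esub> cscale P c \<one>\<^bsub>P\<^esub>)) < e"
      if S: "S \<in> W" "L S \<le> 1" for S
    proof -
      obtain x where x: "x \<in> fin_supp VB" "S = reg_rep \<beta> x" using S(1) by (rule W_cases)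
      note b = coeff_bounds[OF x(1) S(2)[unfolded x(2)]]
      have xV: "x n \<in> VB" for n using x(1) by (simp add: fin_supp_def)
      have LBx: "LB (x n) \<le> C" if "n \<in> ?I" for n
        using b(3)[of n] Cn[OF that] by simp
      obtain f0 c where f0: "f0 \<in> F1" "norm (x 0 - f0 - scaleC c 1) < \<delta>"
        using F1(3)[OF xV LBx, of 0] by auto
      have "\<exists>f. f \<in> F2 \<and> norm (x n - f) < \<delta>" if "n \<in> ?I - {0}" for n
      proof -
        have "1 * norm (x n) \<le> \<bar>real_of_int n\<bar> * norm (x n)"
          using that by (intro mult_right_mono) auto
        then have "norm (x n) \<le> 1" using b(2)[of n] by simp
        then show ?thesis using F2(3)[OF xV LBx] that by blast
      qed
      then obtain f where f: "\<And>n. n \<in> ?I - {0} \<Longrightarrow> f n \<in> F2 \<and> norm (x n - f n) < \<delta>"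
        by metis
      define q where "q = (\<lambda>n\<in>?I. if n = 0 then f0 else f n)"
      have q: "q \<in> Q" using f0(1) f by (auto simp: q_def Q_def)
      note gq = g[OF q]
      \<comment> \<open>Beyond \<open>M\<close> this agrees with \<open>x\<close>, so the derivation
        of \<open>x\<close> controls its high part.\<close>
      define u where "u = (\<lambda>n. x n - (g q n + scaleC c (unit_seq n)))"
      have gc: "(\<lambda>n. g q n + scaleC c (unit_seq n)) \<in> fin_supp VB"
        by (intro fin_supp_VB_add fin_supp_VB_scaleC gq unit_seq_fin_supp)
      have u: "u \<in> fin_supp UNIV"
        unfolding u_def using x(1) gc
        by (intro fin_supp_zero_outside[of "{n. x n \<noteq> 0} \<union> {n. g q n + scaleC c (unit_seq n) \<noteq> 0}"])
          (auto simp: fin_supp_def)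
      have small: "norm (u n) \<le> \<delta>" if "n \<in> ?I" for n
        using f[of n] f0(2) that by (cases "n = 0") (auto simp: u_def g_def q_def unit_seq_def diff_diff_eq linear_0[OF linear_scaleC])
      have "nrm ops (reg_rep \<beta> u) \<le> (\<Sum>n\<in>?I. norm (u n)) + sqrt (2 / real M) * nrm ops (reg_rep \<beta> (\<lambda>n. of_int n * x n))"
        by (rule nrm_reg_rep_split_le[OF star_aut u fin_supp_of_int_mult[OF x(1)] M(2)])
          (auto simp: u_def g_def unit_seq_def linear_0[OF linear_scaleC])
      also have "\<dots> \<le> real (card ?I) * \<delta> + sqrt (2 / real M) * 1"
        using small b(1) by (intro add_mono sum_bounded_above mult_left_mono) auto
      also have "real (card ?I) * \<delta> = e / 2" using I by (simp add: \<delta>_def field_simps del: card_atLeastAtMost_int)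
      also have "e / 2 + sqrt (2 / real M) * 1 < e / 2 + e / 2" using M(1) by simp
      finally have ue: "nrm ops (reg_rep \<beta> u) < e" by simp
      have Tq: "reg_rep \<beta> (g q) \<oplus>\<^bsub>P\<^esub> cscale P c \<one>\<^bsub>P\<^esub> = reg_rep \<beta> (\<lambda>n. g q n + scaleC c (unit_seq n))"
        by (simp add: reg_rep_add[OF star_aut gq fin_supp_VB_scaleC[OF unit_seq_fin_supp]]
            reg_rep_scaleC[OF star_aut unit_seq_fin_supp] reg_rep_one[OF star_aut])
      have "S \<ominus>\<^bsub>P\<^esub> (reg_rep \<beta> (g q) \<oplus>\<^bsub>P\<^esub> cscale P c \<one>\<^bsub>P\<^esub>) = reg_rep \<beta> u"
        unfolding Tq x(2) u_def reg_rep_diff[OF star_aut x(1) gc]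
        by (intro crossed_product_a_minus[OF star_aut] reg_rep_crossed_product[OF star_aut x(1)]
            reg_rep_crossed_product[OF star_aut gc])
      then have "nrm P (S \<ominus>\<^bsub>P\<^esub> (reg_rep \<beta> (g q) \<oplus>\<^bsub>P\<^esub> cscale P c \<one>\<^bsub>P\<^esub>)) < e"
        using ue by simp
      then show ?thesis
        using q by blast
    qed
    moreover have "(\<lambda>q. reg_rep \<beta> (g q)) ` Q \<subseteq> W"
      using g by (auto simp: cp_domain_def)
    ultimately show "\<exists>F. finite F \<and> F \<subseteq> W \<and>
       (\<forall>S\<in>W. L S \<le> 1 \<longrightarrow> (\<exists>f\<in>F. \<exists>c. nrm P (S \<ominus>\<^bsub>P\<^esub> (f \<oplus>\<^bsub>P\<^esub> cscale P c \<one>\<^bsub>P\<^esub>)) < e))"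
      using Q by blast
  qed
qed

theorem cqms_crossed_product: "cqms P W L"
  by (rule star_subspace.cqms_of_net[OF star_subspace_W norm_closure_W seminorm_L L_one L_star net_L])

text \<open>The exact value lets \<open>dist_q_le\<close> read off the size of a scalar from the
  norm of its multiple of the unit.\<close>

lemma nrm_one_P: "nrm P \<one>\<^bsub>P\<^esub> = 1"
proof -
  have u: "unit_seq \<in> (l2 :: (int \<Rightarrow> 'b) set)" by (rule unit_seq_l2)
  have "1 \<le> nrm ops (one ops :: 'b l2_op)"
    using l2_norm_op_le[OF ops_one u] u by (simp add: l2_norm_unit_seq)
  moreover have "nrm ops (one ops :: 'b l2_op) \<le> 1" by (rule ops.nrm_one_le)
  ultimately show ?thesis by simp
qed

lemma seminorm_L_sa: "seminorm_over \<real> P (sa_part P W) L"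
  using seminorm_L by (auto simp: seminorm_over_def sa_part_def)

end

section \<open>The transfer operator on Lipschitz elements\<close>

definition transfer_op :: "('b \<Rightarrow> 'b) \<Rightarrow> ('b \<Rightarrow> 'b) \<Rightarrow> nat \<Rightarrow> 'b l2_op \<Rightarrow> 'b l2_op" where
  "transfer_op \<beta> \<gamma> R T = reg_rep \<gamma> (transfer \<beta> \<gamma> R (the_inv_into (fin_supp VB) (reg_rep \<beta>) T))"

context
  fixes \<beta> \<gamma> :: "'b \<Rightarrow> 'b" and R :: nat
  assumes \<beta>: "lip_automorphism \<beta>" and \<gamma>: "lip_automorphism \<gamma>" and R: "R > 0"
begin

lemma transfer_op_reg_rep:
  "x \<in> fin_supp VB \<Longrightarrow> transfer_op \<beta> \<gamma> R (reg_rep \<beta> x) = reg_rep \<gamma> (transfer \<beta> \<gamma> R x)"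
  by (simp add: transfer_op_def the_inv_into_f_f[OF inj_on_reg_rep[OF star_aut[OF \<beta>]]])

text \<open>Each summand has the norm and the Lipschitz constant of \<open>x n\<close>, and the sum
  divided by \<open>R\<close> has at most \<open>R\<close> terms.\<close>

lemma transfer_VB:
  assumes x: "x \<in> fin_supp VB"
  shows "transfer \<beta> \<gamma> R x \<in> fin_supp VB" "LB (transfer \<beta> \<gamma> R x n) \<le> LB (x n)"
    "norm (transfer \<beta> \<gamma> R x n) \<le> norm (x n)"
proof -
  let ?S = "\<lambda>n. {m. m \<in> {0..<int R} \<and> m - n \<in> {0..<int R}}"
  have xV: "x n \<in> VB" for n using x by (simp add: fin_supp_def)
  have it: "int_iter \<gamma> m (int_iter \<beta> (- m) b) \<in> VB" "LB (int_iter \<gamma> m (int_iter \<beta> (- m) b)) = LB b" if "b \<in> VB" for m b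
    using lip_automorphism_int_iter[OF \<beta> that] lip_automorphism_int_iter[OF \<gamma>] by auto
  show "transfer \<beta> \<gamma> R x \<in> fin_supp VB"
    using x transfer_zero[OF star_aut[OF \<beta>] star_aut[OF \<gamma>]] xV it
    by (intro fin_supp_zero_outside[of "{n. x n \<noteq> 0}"]) (auto simp: fin_supp_def transfer_def)
  have card: "real (card (?S n)) / real R \<le> 1"
    using card_transfer_range(1)[of R n] R by simp
  have "LB (transfer \<beta> \<gamma> R x n) = (1 / real R) * LB (\<Sum>m\<in>?S n. int_iter \<gamma> m (int_iter \<beta> (- m) (x n)))"
    unfolding transfer_def using xV it by (subst LB_scaleR) auto
  also have "\<dots> \<le> (1 / real R) * (\<Sum>m\<in>?S n. LB (x n))"
    using LB_sum[of "?S n" "\<lambda>m. int_iter \<gamma> m (int_iter \<beta> (- m) (x n))"] xV it by (intro mult_left_mono) auto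
  also have "\<dots> = real (card (?S n)) / real R * LB (x n)" by simp
  also have "\<dots> \<le> 1 * LB (x n)"
    using card LB(1)[OF xV] by (rule mult_right_mono)
  finally show "LB (transfer \<beta> \<gamma> R x n) \<le> LB (x n)" by simp
  have "norm (\<Sum>m\<in>?S n. int_iter \<gamma> m (int_iter \<beta> (- m) (x n))) \<le> real (card (?S n)) * norm (x n)"
    using star_aut[OF \<beta>] star_aut[OF \<gamma>] by (intro sum_norm_bound) simp
  then have "norm (transfer \<beta> \<gamma> R x n) \<le> (1 / real R) * (real (card (?S n)) * norm (x n))"
    unfolding transfer_def norm_scaleR by (intro mult_mono) auto
  also have "\<dots> = real (card (?S n)) / real R * norm (x n)" by simp
  also have "\<dots> \<le> 1 * norm (x n)"
    using card norm_ge_zero by (rule mult_right_mono)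
  finally show "norm (transfer \<beta> \<gamma> R x n) \<le> norm (x n)" by simp
qed

text \<open>The three terms are compared one by one: the derivation term by contractivity, the other
  two by order preservation of \<open>N\<close>, after moving the transfer map through derivation
  and adjoint.\<close>

lemma L_transfer_le:
  assumes x: "x \<in> fin_supp VB"
  shows "cp_seminorm VB LB N \<gamma> (reg_rep \<gamma> (transfer \<beta> \<gamma> R x)) \<le> cp_seminorm VB LB N \<beta> (reg_rep \<beta> x)"
proof -
  note sb = star_aut[OF \<beta>] and sg = star_aut[OF \<gamma>]
  have Nr: "Nr (\<lambda>n. LB (transfer \<beta> \<gamma> R y n)) \<le> Nr (\<lambda>n. LB (y n))" if y: "y \<in> fin_supp VB" for y
    using transfer_VB[OF y] fin_supp_LB[OF y] by (intro Nr_mono) (auto intro: LB simp: fin_supp_def)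
  show ?thesis
    unfolding L_reg_rep[OF \<beta> x] L_reg_rep[OF \<gamma> transfer_VB(1)[OF x]] transfer_of_int_mult[OF sb sg, symmetric]
      transfer_cp_adj[OF sb sg, symmetric]
    by (intro max.mono nrm_transfer_le[OF sb sg fin_supp_of_int_mult[OF x] R] Nr x cp_adj_VB[OF \<beta>])
qed

lemma lip_map_transfer_op:
  "lip_map (crossed_product \<beta>) (cp_domain VB \<beta>) (cp_seminorm VB LB N \<beta>)
     (crossed_product \<gamma>) (cp_domain VB \<gamma>) (cp_seminorm VB LB N \<gamma>) (transfer_op \<beta> \<gamma> R)"
  unfolding lip_map_def crossed_product_record
proof (intro conjI ballI allI)
  note sb = star_aut[OF \<beta>] and sg = star_aut[OF \<gamma>]
  show "transfer_op \<beta> \<gamma> R (one ops) = one ops"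
    using transfer_op_reg_rep[OF unit_seq_fin_supp] by (simp add: reg_rep_one[OF sb] reg_rep_one[OF sg] transfer_unit_seq[OF sb sg R])
  fix S assume "S \<in> sa_part (crossed_product \<beta>) (cp_domain VB \<beta>)"
  then have S: "S \<in> cp_domain VB \<beta>" "star ops S = S" by (auto simp: sa_part_def)
  then obtain x where x: "x \<in> fin_supp VB" "S = reg_rep \<beta> x" using W_cases[OF \<beta>] by blast
  have "cp_adj \<beta> x = x"
    using S(2) inj_onD[OF inj_on_reg_rep[OF sb] _ cp_adj_VB[OF \<beta> x(1)] x(1)] by (simp add: x(2) reg_rep_star[OF sb x(1)])
  then have "star ops (reg_rep \<gamma> (transfer \<beta> \<gamma> R x)) = reg_rep \<gamma> (transfer \<beta> \<gamma> R x)"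
    by (simp add: reg_rep_star[OF sg transfer_VB(1)[OF x(1)]] flip: transfer_cp_adj[OF sb sg])
  then show "transfer_op \<beta> \<gamma> R S \<in> sa_part (crossed_product \<gamma>) (cp_domain VB \<gamma>)"
    unfolding x(2) transfer_op_reg_rep[OF x(1)] using transfer_VB(1)[OF x(1)] by (simp add: sa_part_def cp_domain_def)
  show "nrm ops (transfer_op \<beta> \<gamma> R S) \<le> nrm ops S"
    unfolding x(2) transfer_op_reg_rep[OF x(1)] by (rule nrm_transfer_le[OF sb sg x(1) R])
  show "cp_seminorm VB LB N \<gamma> (transfer_op \<beta> \<gamma> R S) \<le> cp_seminorm VB LB N \<beta> S"
    unfolding x(2) transfer_op_reg_rep[OF x(1)] by (rule L_transfer_le[OF x(1)])
  show "transfer_op \<beta> \<gamma> R (cscale ops (complex_of_real r) S) = cscale ops (complex_of_real r) (transfer_op \<beta> \<gamma> R S)" for r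
    unfolding x(2) transfer_op_reg_rep[OF x(1)] reg_rep_scaleC[OF sb x(1), symmetric]
      reg_rep_scaleC[OF sg transfer_VB(1)[OF x(1)], symmetric] transfer_op_reg_rep[OF fin_supp_VB_scaleC[OF x(1)]]
      transfer_scaleC[OF sb sg] ..
  fix T assume "T \<in> sa_part (crossed_product \<beta>) (cp_domain VB \<beta>)"
  then have "T \<in> cp_domain VB \<beta>" by (auto simp: sa_part_def)
  then obtain y where y: "y \<in> fin_supp VB" "T = reg_rep \<beta> y" using W_cases[OF \<beta>] by blast
  show "transfer_op \<beta> \<gamma> R (add ops S T) = add ops (transfer_op \<beta> \<gamma> R S) (transfer_op \<beta> \<gamma> R T)"
    unfolding x(2) y(2) transfer_op_reg_rep[OF x(1)] transfer_op_reg_rep[OF y(1)]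
      reg_rep_add[OF sb x(1) y(1), symmetric] transfer_op_reg_rep[OF fin_supp_VB_add[OF x(1) y(1)]]
      transfer_add[OF sb sg] reg_rep_add[OF sg transfer_VB(1)[OF x(1)] transfer_VB(1)[OF y(1)]] ..
qed

end

section \<open>Comparison of two crossed products and continuity in the parameter\<close>

text \<open>On a low coefficient, going there and back costs twice the error
  \<open>d + 1 / R\<close> of \<open>norm_transfer_diff_le\<close>, because
  \<open>|n| * norm (x n) \<le> 1\<close>. For the high part, the derivations of \<open>x\<close>
  and of its double transfer \<open>z\<close> both have norm at most 1, whence the factor 2 in front
  of \<open>sqrt (2 / M)\<close>.\<close>

lemma transfer_transfer_close:
  assumes \<beta>: "lip_automorphism \<beta>" and \<gamma>: "lip_automorphism \<gamma>" and R: "R > 0" and M: "M \<ge> 1"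
    and C: "\<And>n. n \<in> {- int M..int M} \<Longrightarrow> 1 / weight n \<le> C"
    and close: "\<And>b m. b \<in> VB \<Longrightarrow> LB b \<le> C \<Longrightarrow> m \<in> {0..<int R} \<Longrightarrow>
      norm (int_iter \<beta> (- m) b - int_iter \<gamma> (- m) b) \<le> d"
    and S: "S \<in> sa_part (crossed_product \<beta>) (cp_domain VB \<beta>)" and L: "cp_seminorm VB LB N \<beta> S \<le> 1"
  shows "nrm (crossed_product \<beta>) (S \<ominus>\<^bsub>crossed_product \<beta>\<^esub> transfer_op \<gamma> \<beta> R (transfer_op \<beta> \<gamma> R S))
    \<le> (2 * real M + 1) * (2 * d + 2 / real R) + 2 * sqrt (2 / real M)"
proof -
  note sb = star_aut[OF \<beta>] and sg = star_aut[OF \<gamma>]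
  let ?I = "{- int M..int M}"
  have "S \<in> cp_domain VB \<beta>" using S by (auto simp: sa_part_def)
  then obtain x where x: "x \<in> fin_supp VB" "S = reg_rep \<beta> x" using W_cases[OF \<beta>] by blast
  define y where "y = transfer \<beta> \<gamma> R x"
  define z where "z = transfer \<gamma> \<beta> R y"
  note y = transfer_VB[OF \<beta> \<gamma> R x(1), folded y_def]
  note z = transfer_VB[OF \<gamma> \<beta> R y(1), folded z_def]
  have Lz: "cp_seminorm VB LB N \<beta> (reg_rep \<beta> z) \<le> 1"
    using L_transfer_le[OF \<gamma> \<beta> R y(1)] L_transfer_le[OF \<beta> \<gamma> R x(1)] L unfolding x(2) y_def z_def by linarith
  note bx = coeff_bounds[OF \<beta> x(1) L[unfolded x(2)]] and bz = coeff_bounds[OF \<beta> z(1) Lz]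
  have xV: "x n \<in> VB" and yV: "y n \<in> VB" for n using x(1) y(1) by (auto simp: fin_supp_def)
  have small: "norm (x n - z n) \<le> 2 * d + 2 / real R" if n: "n \<in> ?I" for n
  proof -
    have LBx: "LB (x n) \<le> C" using bx(3)[of n] C[OF n] by simp
    then have LBy: "LB (y n) \<le> C" using y(2)[of n] by simp
    have "norm (y n - x n) \<le> d + \<bar>real_of_int n\<bar> / real R * norm (x n)"
      unfolding y_def by (rule norm_transfer_diff_le[OF sg R]) (rule close[OF xV LBx])
    moreover have "norm (z n - y n) \<le> d + \<bar>real_of_int n\<bar> / real R * norm (y n)"
      unfolding z_def using close[OF yV LBy] by (intro norm_transfer_diff_le[OF sb R]) (simp add: norm_minus_commute)
    moreover have "\<bar>real_of_int n\<bar> / real R * norm (y n) \<le> \<bar>real_of_int n\<bar> / real R * norm (x n)"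
      using y(3)[of n] by (intro mult_left_mono) auto
    moreover have "\<bar>real_of_int n\<bar> / real R * norm (x n) \<le> 1 / real R"
      using bx(2)[of n] R by (simp add: field_simps)
    moreover have "norm (x n - z n) \<le> norm (y n - x n) + norm (z n - y n)"
      using norm_triangle_ineq[of "y n - x n" "z n - y n"] by (simp add: norm_minus_commute)
    ultimately show ?thesis by simp
  qed
  note Dx = fin_supp_of_int_mult[OF x(1)] and Dz = fin_supp_of_int_mult[OF z(1)]
  have diff: "(\<lambda>n. v n - w n) \<in> fin_supp UNIV" if "v \<in> fin_supp V" "w \<in> fin_supp V'" for v w :: "int \<Rightarrow> 'b" and V V'
    using that by (intro fin_supp_zero_outside[of "{n. v n \<noteq> 0} \<union> {n. w n \<noteq> 0}"]) (auto simp: fin_supp_def)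
  let ?Y = "\<lambda>n. of_int n * x n - of_int n * z n"
  have "nrm ops (reg_rep \<beta> (\<lambda>n. x n - z n)) \<le> (\<Sum>n\<in>?I. norm (x n - z n)) + sqrt (2 / real M) * nrm ops (reg_rep \<beta> ?Y)"
    by (rule nrm_reg_rep_split_le[OF sb diff[OF x(1) z(1)] diff[OF Dx Dz] M]) (simp add: right_diff_distrib)
  also have "\<dots> \<le> real (card ?I) * (2 * d + 2 / real R) + sqrt (2 / real M) * 2"
  proof (intro add_mono sum_bounded_above mult_left_mono small)
    have "nrm ops (reg_rep \<beta> ?Y) \<le> nrm ops (reg_rep \<beta> (\<lambda>n. of_int n * x n)) + nrm ops (reg_rep \<beta> (\<lambda>n. of_int n * z n))"
      unfolding reg_rep_diff[OF sb Dx Dz]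
      by (intro ops.nrm_diff_le reg_rep_carrier[OF sb Dx] reg_rep_carrier[OF sb Dz])
    then show "nrm ops (reg_rep \<beta> ?Y) \<le> 2" using bx(1) bz(1) by linarith
  qed auto
  also have "real (card ?I) = 2 * real M + 1" by simp
  finally have le: "nrm ops (reg_rep \<beta> (\<lambda>n. x n - z n)) \<le> (2 * real M + 1) * (2 * d + 2 / real R) + 2 * sqrt (2 / real M)"
    by (simp add: mult.commute)
  have "transfer_op \<gamma> \<beta> R (transfer_op \<beta> \<gamma> R S) = reg_rep \<beta> z"
    unfolding x(2) transfer_op_reg_rep[OF \<beta> \<gamma> R x(1)] y_def[symmetric] transfer_op_reg_rep[OF \<gamma> \<beta> R y(1)] z_def ..
  then show ?thesis
    using le unfolding x(2) reg_rep_diff[OF sb x(1) z(1)]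
    by (simp add: crossed_product_a_minus[OF sb reg_rep_crossed_product[OF sb x(1)] reg_rep_crossed_product[OF sb z(1)]])
qed

text \<open>The constants do not depend on the automorphisms. First \<open>M\<close> makes the tail
  small; it determines \<open>C\<close> and \<open>d\<close>, and then \<open>R\<close> is chosen
  large compared with \<open>M\<close>. About the pair only the closeness of finitely many backward
  powers on a Lipschitz ball has to be known.\<close>

lemma dist_q_crossed_product_le:
  assumes e: "e > 0"
  obtains R C d where "C > 0" "d > 0" "\<And>\<beta> \<gamma>. lip_automorphism \<beta> \<Longrightarrow> lip_automorphism \<gamma> \<Longrightarrow>
    (\<And>b m. b \<in> VB \<Longrightarrow> LB b \<le> C \<Longrightarrow> m \<in> {0..<int R} \<Longrightarrow> norm (int_iter \<beta> (- m) b - int_iter \<gamma> (- m) b) \<le> d) \<Longrightarrow>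
    dist_q (crossed_product \<beta>) (cp_domain VB \<beta>) (cp_seminorm VB LB N \<beta>)
      (crossed_product \<gamma>) (cp_domain VB \<gamma>) (cp_seminorm VB LB N \<gamma>) \<le> ennreal (2 * e)"
proof -
  have "(\<lambda>M. 2 * sqrt (2 / real M)) \<longlonglongrightarrow> 0"
    by real_asymp
  then have "\<forall>\<^sub>F M in sequentially. 2 * sqrt (2 / real M) < e / 3 \<and> M \<ge> 1"
    using e by (intro eventually_conj order_tendstoD(2)[of _ 0] eventually_ge_at_top) auto
  then obtain M where M: "2 * sqrt (2 / real M) < e / 3" "M \<ge> 1"
    by (auto simp: eventually_sequentially)
  let ?I = "{- int M..int M}"
  define C where "C = (\<Sum>n\<in>?I. 1 / weight n)"
  have Cn: "1 / weight n \<le> C" if "n \<in> ?I" for n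
    unfolding C_def using that weight_pos by (intro member_le_sum) (auto simp: less_imp_le)
  have "0 < 1 / weight 0" using weight_pos[of 0] by simp
  also have "\<dots> \<le> C" by (rule Cn) simp
  finally have C: "C > 0" .
  \<comment> \<open>This gives \<open>(2 M + 1) * 2 d = e / 3\<close>; the terms with
    \<open>R\<close> and with the tail get the other two thirds.\<close>
  define d where "d = e / (6 * (2 * real M + 1))"
  have d: "d > 0" using e by (simp add: d_def)
  have "(\<lambda>R. 2 / real R) \<longlonglongrightarrow> 0"
    by real_asymp
  then have "\<forall>\<^sub>F R in sequentially. 2 / real R < e / (3 * (2 * real M + 1)) \<and> R \<ge> 1"
    using e by (intro eventually_conj order_tendstoD(2)[of _ 0] eventually_ge_at_top) auto
  then obtain R where R: "2 / real R < e / (3 * (2 * real M + 1))" "R \<ge> 1"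
    by (auto simp: eventually_sequentially)
  then have R0: "R > 0" by simp
  have "(2 * real M + 1) * (2 * d + 2 / real R) + 2 * sqrt (2 / real M)
      \<le> (2 * real M + 1) * (2 * d + e / (3 * (2 * real M + 1))) + e / 3"
    using R(1) M(1) by (intro add_mono mult_left_mono) auto
  also have "\<dots> = e"
  proof -
    define k where "k = 2 * real M + 1"
    have "k > 0" by (simp add: k_def)
    then show ?thesis unfolding d_def k_def[symmetric] by (simp add: field_simps)
  qed
  finally have total: "(2 * real M + 1) * (2 * d + 2 / real R) + 2 * sqrt (2 / real M) \<le> e" .
  show thesis
  proof (rule that[OF C d])
    fix \<beta> \<gamma> assume \<beta>: "lip_automorphism \<beta>" and \<gamma>: "lip_automorphism \<gamma>"
      and close: "\<And>b m. b \<in> VB \<Longrightarrow> LB b \<le> C \<Longrightarrow> m \<in> {0..<int R} \<Longrightarrow> norm (int_iter \<beta> (- m) b - int_iter \<gamma> (- m) b) \<le> d"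
    have close': "norm (int_iter \<gamma> (- m) b - int_iter \<beta> (- m) b) \<le> d" if "b \<in> VB" "LB b \<le> C" "m \<in> {0..<int R}" for b m
      using close[OF that] by (simp add: norm_minus_commute)
    show "dist_q (crossed_product \<beta>) (cp_domain VB \<beta>) (cp_seminorm VB LB N \<beta>)
      (crossed_product \<gamma>) (cp_domain VB \<gamma>) (cp_seminorm VB LB N \<gamma>) \<le> ennreal (2 * e)"
    proof (rule dist_q_le[OF star_subspace_W[OF \<beta>] star_subspace_W[OF \<gamma>] nrm_one_P[OF \<gamma>] seminorm_L_sa[OF \<beta>]
          seminorm_L_sa[OF \<gamma>] L_one[OF \<beta>] L_one[OF \<gamma>]
          star_subspace.sa_net_of_net[OF star_subspace_W[OF \<beta>] net_L[OF \<beta>]]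
          star_subspace.sa_net_of_net[OF star_subspace_W[OF \<gamma>] net_L[OF \<gamma>]]
          lip_map_transfer_op[OF \<beta> \<gamma> R0] lip_map_transfer_op[OF \<gamma> \<beta> R0] e])
      show "nrm (crossed_product \<beta>) (S \<ominus>\<^bsub>crossed_product \<beta>\<^esub> transfer_op \<gamma> \<beta> R (transfer_op \<beta> \<gamma> R S)) \<le> e"
        if "S \<in> sa_part (crossed_product \<beta>) (cp_domain VB \<beta>)" "cp_seminorm VB LB N \<beta> S \<le> 1" for S
        using transfer_transfer_close[OF \<beta> \<gamma> R0 M(2) Cn close that] total by linarith
      show "nrm (crossed_product \<gamma>) (S \<ominus>\<^bsub>crossed_product \<gamma>\<^esub> transfer_op \<beta> \<gamma> R (transfer_op \<gamma> \<beta> R S)) \<le> e"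
        if "S \<in> sa_part (crossed_product \<gamma>) (cp_domain VB \<gamma>)" "cp_seminorm VB LB N \<gamma> S \<le> 1" for S
        using transfer_transfer_close[OF \<gamma> \<beta> R0 M(2) Cn close' that] total by linarith
    qed
  qed
qed

text \<open>Only finitely many powers occur, and each converges pointwise. Uniformity on the
  Lipschitz ball comes from a finite net modulo scalars: automorphisms fix scalars and are isometric
  on the remainder.\<close>

lemma eventually_close:
  assumes ev: "\<forall>\<^sub>F t in F. lip_automorphism (\<beta> t)" and \<gamma>: "lip_automorphism \<gamma>"
    and lim: "\<And>b. ((\<lambda>t. \<beta> t b) \<longlongrightarrow> \<gamma> b) F" and C: "C > 0" and d: "d > 0"
  shows "\<forall>\<^sub>F t in F. \<forall>b\<in>VB. LB b \<le> C \<longrightarrow> (\<forall>m\<in>{0..<int R}. norm (int_iter (\<beta> t) (- m) b - int_iter \<gamma> (- m) b) \<le> d)"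
proof -
  note sg = star_aut[OF \<gamma>]
  have lim_iter: "((\<lambda>t. int_iter (\<beta> t) (- int m) b) \<longlongrightarrow> int_iter \<gamma> (- int m) b) F" for m b
  proof (induction m)
    case 0
    then show ?case by simp
  next
    case (Suc m)
    define u where "u = int_iter \<gamma> (- int m) b"
    define v where "v = int_iter \<gamma> (- int (Suc m)) b"
    have \<gamma>v: "\<gamma> v = u"
      using int_iter_Suc[OF star_automorphismD(1)[OF sg], of "- int (Suc m)" b] by (simp add: u_def v_def)
    \<comment> \<open>Applying the isometry \<open>\<beta> t\<close> turns the backward iterate into
      the previous one and leaves the error \<open>\<beta> t v - \<gamma> v\<close>, so convergence
      of inverses needs no separate argument.\<close>
    have "((\<lambda>t. int_iter (\<beta> t) (- int (Suc m)) b - v) \<longlongrightarrow> 0) F"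
    proof (rule Lim_null_comparison)
      show "\<forall>\<^sub>F t in F. norm (int_iter (\<beta> t) (- int (Suc m)) b - v)
          \<le> norm (int_iter (\<beta> t) (- int m) b - u) + norm (\<beta> t v - \<gamma> v)"
        using ev
      proof eventually_elim
        case (elim t)
        note st = star_aut[OF elim]
        have "norm (int_iter (\<beta> t) (- int (Suc m)) b - v) = norm (\<beta> t (int_iter (\<beta> t) (- int (Suc m)) b - v))"
          using st by simp
        also have "\<beta> t (int_iter (\<beta> t) (- int (Suc m)) b - v) = (int_iter (\<beta> t) (- int m) b - u) - (\<beta> t v - \<gamma> v)"
          using int_iter_Suc[OF star_automorphismD(1)[OF st], of "- int (Suc m)" b]
          by (simp add: linear_diff[OF star_automorphismD(7)[OF st]] \<gamma>v)
        also have "norm \<dots> \<le> norm (int_iter (\<beta> t) (- int m) b - u) + norm (\<beta> t v - \<gamma> v)"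
          by (rule norm_triangle_ineq4)
        finally show ?case .
      qed
      have "((\<lambda>t. norm (int_iter (\<beta> t) (- int m) b - u) + norm (\<beta> t v - \<gamma> v)) \<longlongrightarrow> 0 + 0) F"
        using Suc lim[of v] unfolding u_def by (intro tendsto_add tendsto_norm_zero LIM_zero)
      then show "((\<lambda>t. norm (int_iter (\<beta> t) (- int m) b - u) + norm (\<beta> t v - \<gamma> v)) \<longlongrightarrow> 0) F"
        by simp
    qed
    then show ?case unfolding v_def by (rule LIM_zero_cancel)
  qed
  \<comment> \<open>Two thirds are for the remainder under the two automorphisms, one third is for
    the net element.\<close>
  have d3: "d / 3 > 0" using d by simp
  obtain G where G: "finite G" "G \<subseteq> VB" "\<And>b. b \<in> VB \<Longrightarrow> LB b \<le> C \<Longrightarrow> \<exists>f\<in>G. \<exists>c. norm (b - f - scaleC c 1) < d / 3"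
    using coefficient_net[OF C d3] by metis
  have "\<forall>\<^sub>F t in F. norm (int_iter (\<beta> t) (- m) f - int_iter \<gamma> (- m) f) < d / 3" if "m \<in> {0..<int R}" for f m
  proof -
    have "((\<lambda>t. int_iter (\<beta> t) (- m) f) \<longlongrightarrow> int_iter \<gamma> (- m) f) F"
      using lim_iter[of "nat m" f] that by simp
    from tendstoD[OF this d3] show ?thesis by (simp add: dist_norm)
  qed
  then have "\<forall>\<^sub>F t in F. \<forall>f\<in>G. \<forall>m\<in>{0..<int R}. norm (int_iter (\<beta> t) (- m) f - int_iter \<gamma> (- m) f) < d / 3"
    using G(1) by (intro eventually_ball_finite ballI) auto
  with ev show ?thesis
  proof eventually_elim
    case (elim t)
    note st = star_aut[OF elim(1)]
    show ?case
    proof (intro ballI impI)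
      fix b m assume b: "b \<in> VB" "LB b \<le> C" and m: "m \<in> {0..<int R}"
      obtain f c where f: "f \<in> G" "norm (b - f - scaleC c 1) < d / 3" using G(3)[OF b] by blast
      define r where "r = b - f - scaleC c 1"
      have b_eq: "b = r + f + scaleC c 1" by (simp add: r_def)
      have split: "int_iter \<alpha> (- m) b = int_iter \<alpha> (- m) r + int_iter \<alpha> (- m) f + scaleC c 1" if "star_automorphism \<alpha>" for \<alpha>
        unfolding b_eq by (simp add: star_automorphismD(2,3,6)[OF star_automorphism_int_iter[OF that]])
      have "int_iter (\<beta> t) (- m) b - int_iter \<gamma> (- m) b
          = (int_iter (\<beta> t) (- m) r - int_iter \<gamma> (- m) r) + (int_iter (\<beta> t) (- m) f - int_iter \<gamma> (- m) f)"
        unfolding split[OF st] split[OF sg] by simp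
      also have "norm \<dots> \<le> (norm r + norm r) + d / 3"
      proof (intro norm_triangle_le add_mono)
        show "norm (int_iter (\<beta> t) (- m) r - int_iter \<gamma> (- m) r) \<le> norm r + norm r"
          using norm_triangle_ineq4[of "int_iter (\<beta> t) (- m) r" "int_iter \<gamma> (- m) r"] st sg by simp
        show "norm (int_iter (\<beta> t) (- m) f - int_iter \<gamma> (- m) f) \<le> d / 3"
          using elim(2) f(1) m by (simp add: less_imp_le)
      qed
      also have "\<dots> \<le> d" using f(2) by (simp add: r_def)
      finally show "norm (int_iter (\<beta> t) (- m) b - int_iter \<gamma> (- m) b) \<le> d" .
    qed
  qed
qed

lemma dist_q_tendsto_zero:
  assumes ev: "\<forall>\<^sub>F t in F. lip_automorphism (\<beta> t)" and \<gamma>: "lip_automorphism \<gamma>"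
    and lim: "\<And>b. ((\<lambda>t. \<beta> t b) \<longlongrightarrow> \<gamma> b) F"
  shows "((\<lambda>t. dist_q (crossed_product (\<beta> t)) (cp_domain VB (\<beta> t)) (cp_seminorm VB LB N (\<beta> t))
    (crossed_product \<gamma>) (cp_domain VB \<gamma>) (cp_seminorm VB LB N \<gamma>)) \<longlongrightarrow> 0) F"
proof (rule order_tendstoI)
  fix a :: ennreal assume "0 < a"
  \<comment> \<open>The bound \<open>a\<close> may be infinite; an intermediate \<open>b\<close> is
    positive and finite.\<close>
  then obtain b where b: "0 < b" "b < a" using dense by blast
  define e where "e = enn2real b / 2"
  have "b < \<infinity>" using b(2) order.strict_trans2[OF b(2) top_greatest] by simp
  then have e: "e > 0" "ennreal (2 * e) < a"
    using b by (auto simp: e_def enn2real_positive_iff)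
  obtain R C d where C: "C > 0" "d > 0" and le: "\<And>\<beta> \<gamma>. lip_automorphism \<beta> \<Longrightarrow> lip_automorphism \<gamma> \<Longrightarrow>
    (\<And>b m. b \<in> VB \<Longrightarrow> LB b \<le> C \<Longrightarrow> m \<in> {0..<int R} \<Longrightarrow> norm (int_iter \<beta> (- m) b - int_iter \<gamma> (- m) b) \<le> d) \<Longrightarrow>
    dist_q (crossed_product \<beta>) (cp_domain VB \<beta>) (cp_seminorm VB LB N \<beta>)
      (crossed_product \<gamma>) (cp_domain VB \<gamma>) (cp_seminorm VB LB N \<gamma>) \<le> ennreal (2 * e)"
    using dist_q_crossed_product_le[OF e(1)] by metis
  show "\<forall>\<^sub>F t in F. dist_q (crossed_product (\<beta> t)) (cp_domain VB (\<beta> t)) (cp_seminorm VB LB N (\<beta> t))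
    (crossed_product \<gamma>) (cp_domain VB \<gamma>) (cp_seminorm VB LB N \<gamma>) < a"
    using ev eventually_close[OF ev \<gamma> lim C, of R]
  proof eventually_elim
    case (elim t)
    then show ?case using le_less_trans[OF le[OF elim(1) \<gamma>] e(2)] by blast
  qed
qed simp

end

theorem theoremC:
  fixes VB :: "'b::cstar_algebra set" and LB :: "'b \<Rightarrow> real"
    and T :: "'t topology" and \<beta> :: "'t \<Rightarrow> 'b \<Rightarrow> 'b"
    and N :: "(int \<Rightarrow> complex) \<Rightarrow> real"
  assumes "cqms cstar_of_type VB LB"
    and "lower_semicontinuous_on VB LB"
    and "compact_space T" and "Hausdorff_space T"
    and "\<And>t. t \<in> topspace T \<Longrightarrow> star_automorphism (\<beta> t)"
    and "\<And>b. continuous_map T euclidean (\<lambda>t. \<beta> t b)"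
    and "\<And>t. t \<in> topspace T \<Longrightarrow> \<beta> t ` VB = VB"
    and "\<And>t b. t \<in> topspace T \<Longrightarrow> b \<in> VB \<Longrightarrow> LB (\<beta> t b) = LB b"
    and "order_preserving_norm N"
  shows "(\<forall>t\<in>topspace T.
            cqms (crossed_product (\<beta> t)) (cp_domain VB (\<beta> t)) (cp_seminorm VB LB N (\<beta> t))) \<and>
         (\<forall>t0\<in>topspace T.
            ((\<lambda>t. dist_q
                 (crossed_product (\<beta> t)) (cp_domain VB (\<beta> t)) (cp_seminorm VB LB N (\<beta> t))
                 (crossed_product (\<beta> t0)) (cp_domain VB (\<beta> t0)) (cp_seminorm VB LB N (\<beta> t0)))
             \<longlongrightarrow> 0) (atin T t0))"
proof -
  interpret lip_coefficients VB LB N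
    using assms(1,9) by unfold_locales
  have lip: "lip_automorphism (\<beta> t)" if "t \<in> topspace T" for t
    using assms(5,7,8) that by (simp add: lip_automorphism_def)
  show ?thesis
  proof (intro conjI ballI)
    show "cqms (crossed_product (\<beta> t)) (cp_domain VB (\<beta> t)) (cp_seminorm VB LB N (\<beta> t))" if "t \<in> topspace T" for t
      by (rule cqms_crossed_product[OF lip[OF that]])
    fix t0 assume t0: "t0 \<in> topspace T"
    show "((\<lambda>t. dist_q
                 (crossed_product (\<beta> t)) (cp_domain VB (\<beta> t)) (cp_seminorm VB LB N (\<beta> t))
                 (crossed_product (\<beta> t0)) (cp_domain VB (\<beta> t0)) (cp_seminorm VB LB N (\<beta> t0)))
             \<longlongrightarrow> 0) (atin T t0)"
    proof (rule dist_q_tendsto_zero[OF _ lip[OF t0]])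
      have "\<forall>\<^sub>F t in atin T t0. t \<in> topspace T"
        using t0 unfolding eventually_atin by (auto dest: openin_subset intro!: exI[of _ "topspace T"])
      then show "\<forall>\<^sub>F t in atin T t0. lip_automorphism (\<beta> t)"
        by (rule eventually_mono) (rule lip)
      show "((\<lambda>t. \<beta> t b) \<longlongrightarrow> \<beta> t0 b) (atin T t0)" for b
        using assms(6)[of b] t0 unfolding continuous_map_atin by simp
    qed
  qed
qed

end
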